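(* Let $\mathcal F$ be a finite set of graphs and let $\mathcal G$ be the class of all $\mathcal F$-free graphs. Then the following are equivalent: (i) $\mathcal G$ has bounded $\mathrm{tree}\text{-}\alpha$; (ii) $\mathcal G$ is $(\mathrm{tw},\omega)$-bounded; (iii) there exist a complete bipartite graph $H_1$, a forest $H_2$ each of whose components has at most three leaves, and a forest $H_3$ each of whose components has at most three leaves, such that $\mathcal G$ excludes $H_1$, $H_2$, and the line graph of $H_3$.
   Context: $\mathbb N$ is the set of positive integers. Graphs are finite, with no loops or parallel edges, and classes of graphs are considered up to isomorphism. $G$ is $H$-free if no induced subgraph of $G$ is isomorphic to $H$, and $\mathcal F$-free if it is $F$-free for every $F\in\mathcal F$. A class $\mathcal G$ excludes $H$ if every graph in $\mathcal G$ is $H$-free (for a hereditary, i.e. induced-subgraph-closed, class this means $H\notin\mathcal G$). $\omega(G)$ is the maximum size of a clique in $G$ and $\mathrm{tw}(G)$ is the treewidth of $G$. The tree independence number $\mathrm{tree}\text{-}\alpha(G)$ is the minimum $c\in\mathbb N$ such that $G$ admits a tree decomposition each of whose bags induces a subgraph with no stable set (set of pairwise nonadjacent vertices) on $c+1$ vertices. A class $\mathcal G$ has bounded $\mathrm{tree}\text{-}\alpha$ if there is $c\in\mathbb N$ with $\mathrm{tree}\text{-}\alpha(G)\le c$ for all $G\in\mathcal G$. A class $\mathcal G$ is $(\mathrm{tw},\omega)$-bounded if there is a function $f:\mathbb N\to\mathbb N$ such that $\mathrm{tw}(G)\le f(\omega(G))$ for every $G\in\mathcal G$ (equivalently, for every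 $t\in\mathbb N$, the class of all $K_t$-free graphs in $\mathcal G$ has bounded treewidth). *)

theory Defs
  imports "Graph_Theory.Graph_Theory"
begin

text \<open>
  A finite simple graph is a \<^locale>\<open>pair_graph\<close>, an edge between \<open>u\<close> and \<open>v\<close> being the pair of
  arcs \<open>(u, v)\<close>, \<open>(v, u)\<close>. The null graph is allowed.
  Classes of graphs up to isomorphism are represented by sets of graphs with vertices in
  \<open>nat\<close>; every finite graph has an isomorphic copy there.
\<close>

definition induced_free :: "'b pair_pre_digraph \<Rightarrow> 'a pair_pre_digraph \<Rightarrow> bool" where
  "induced_free H G \<longleftrightarrow>
     \<not> (\<exists>K. induced_subgraph K (with_proj G) \<and> digraph_iso (with_proj H) K)"

definition free_class :: "nat pair_pre_digraph set \<Rightarrow> nat pair_pre_digraph set" where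
  "free_class \<F> = {G. pair_graph G \<and> (\<forall>F\<in>\<F>. induced_free F G)}"

definition class_excludes :: "nat pair_pre_digraph set \<Rightarrow> 'b pair_pre_digraph \<Rightarrow> bool" where
  "class_excludes \<G> H \<longleftrightarrow> (\<forall>G\<in>\<G>. induced_free H G)"

definition clique :: "'a pair_pre_digraph \<Rightarrow> 'a set \<Rightarrow> bool" where
  "clique G K \<longleftrightarrow> K \<subseteq> pverts G \<and> (\<forall>u\<in>K. \<forall>v\<in>K. u \<noteq> v \<longrightarrow> (u, v) \<in> parcs G)"

definition clique_number :: "'a pair_pre_digraph \<Rightarrow> nat" where
  "clique_number G = Max (card ` {K. clique G K})"

definition stable_set :: "'a pair_pre_digraph \<Rightarrow> 'a set \<Rightarrow> bool" where
  "stable_set G S \<longleftrightarrow> S \<subseteq> pverts G \<and> (\<forall>u\<in>S. \<forall>v\<in>S. (u, v) \<notin> parcs G)"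

text \<open>
  The library's \<^const>\<open>forest\<close> and \<^const>\<open>tree\<close> are directed notions: they count an edge traversed
  back and forth as a cycle of length 2. The cycles of an undirected simple graph are the ones of
  length at least 3.
\<close>

definition undirected_forest :: "'a pair_pre_digraph \<Rightarrow> bool" where
  "undirected_forest G \<longleftrightarrow>
     pair_graph G \<and> \<not> (\<exists>p. pre_digraph.cycle (with_proj G) p \<and> 3 \<le> length p)"

definition undirected_tree :: "'a pair_pre_digraph \<Rightarrow> bool" where
  "undirected_tree G \<longleftrightarrow> undirected_forest G \<and> connected (with_proj G)"

text \<open>
  In a symmetric digraph, the strongly connected components are the components of the
  undirected graph, and out-degree is degree.
\<close>

definition leaves :: "('a, 'b) pre_digraph \<Rightarrow> 'a set" where
  "leaves C = {v \<in> verts C. out_degree C v = 1}"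

definition forest_with_three_leaf_components :: "'a pair_pre_digraph \<Rightarrow> bool" where
  "forest_with_three_leaf_components G \<longleftrightarrow>
     undirected_forest G \<and> (\<forall>C \<in> pre_digraph.sccs (with_proj G). card (leaves C) \<le> 3)"

definition line_graph :: "'a pair_pre_digraph \<Rightarrow> 'a set pair_pre_digraph" where
  "line_graph G =
     (let E = {{u, v} | u v. (u, v) \<in> parcs G}
      in \<lparr> pverts = E, parcs = {(e, f). e \<in> E \<and> f \<in> E \<and> e \<noteq> f \<and> e \<inter> f \<noteq> {}} \<rparr>)"

definition complete_bipartite :: "'a pair_pre_digraph \<Rightarrow> bool" where
  "complete_bipartite G \<longleftrightarrow>
     pair_graph G \<and> (\<exists>m\<ge>1. \<exists>n\<ge>1. complete_bipartite_digraph m n (with_proj G))"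

text \<open>
  The index tree has nodes in \<open>nat\<close>, which loses no generality since it is finite. Only the values
  of \<open>B\<close> on the nodes of \<open>T\<close> matter.
\<close>

definition tree_decomposition ::
  "'a pair_pre_digraph \<Rightarrow> nat pair_pre_digraph \<Rightarrow> (nat \<Rightarrow> 'a set) \<Rightarrow> bool" where
  "tree_decomposition G T B \<longleftrightarrow>
     undirected_tree T \<and>
     (\<forall>t\<in>pverts T. B t \<subseteq> pverts G) \<and>
     (\<forall>v\<in>pverts G. \<exists>t\<in>pverts T. v \<in> B t) \<and>
     (\<forall>(u, v)\<in>parcs G. \<exists>t\<in>pverts T. u \<in> B t \<and> v \<in> B t) \<and>
     (\<forall>v\<in>pverts G. connected (with_proj T \<restriction> {t \<in> pverts T. v \<in> B t}))"

text \<open>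
  By truncated subtraction, the null graph has treewidth 0 rather than -1.
\<close>

definition decomposition_width :: "nat pair_pre_digraph \<Rightarrow> (nat \<Rightarrow> 'a set) \<Rightarrow> nat" where
  "decomposition_width T B = (MAX t\<in>pverts T. card (B t)) - 1"

definition treewidth :: "'a pair_pre_digraph \<Rightarrow> nat" where
  "treewidth G = (LEAST w. \<exists>T B. tree_decomposition G T B \<and> decomposition_width T B = w)"

definition tree_independence_number :: "'a pair_pre_digraph \<Rightarrow> nat" where
  "tree_independence_number G =
     (LEAST c. 1 \<le> c \<and>
        (\<exists>T B. tree_decomposition G T B \<and>
           (\<forall>t\<in>pverts T. \<not> (\<exists>S\<subseteq>B t. stable_set G S \<and> card S = c + 1))))"

definition bounded_tree_independence_number :: "nat pair_pre_digraph set \<Rightarrow> bool" where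
  "bounded_tree_independence_number \<G> \<longleftrightarrow>
     (\<exists>c\<ge>1. \<forall>G\<in>\<G>. tree_independence_number G \<le> c)"

text \<open>
  The bounding function is a function on the positive integers; its value at 0, which is the clique
  number of the null graph only, is unrestricted.
\<close>

definition tw_omega_bounded :: "nat pair_pre_digraph set \<Rightarrow> bool" where
  "tw_omega_bounded \<G> \<longleftrightarrow>
     (\<exists>f :: nat \<Rightarrow> nat. (\<forall>n\<ge>1. 1 \<le> f n) \<and> (\<forall>G\<in>\<G>. treewidth G \<le> f (clique_number G)))"

lemma pair_graph_line_graph:
  assumes "pair_graph G"
  shows "pair_graph (line_graph G)"
proof -
  interpret pair_graph G by (rule assms)
  let ?E = "{{u, v} | u v. (u, v) \<in> parcs G}"
  have "?E = (\<lambda>(u, v). {u, v}) ` parcs G" by auto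
  then have fin: "finite ?E" using pair_finite_arcs by simp
  have "finite (parcs (line_graph G))"
    by (rule finite_subset[of _ "?E \<times> ?E"]) (use fin in \<open>auto simp: line_graph_def Let_def\<close>)
  then show ?thesis using fin
    by unfold_locales (auto simp: line_graph_def Let_def symmetric_def sym_def)
qed

text \<open>The minima defining the two width parameters range over nonempty sets.\<close>

lemma tree_decomposition_trivial:
  "tree_decomposition G \<lparr> pverts = {0}, parcs = {} \<rparr> (\<lambda>_. pverts G)"
  if "pair_graph G"
proof -
  interpret G: pair_graph G by (rule that)
  let ?T = "\<lparr> pverts = {0::nat}, parcs = {} \<rparr>"
  have pg: "pair_graph ?T"
    by unfold_locales (auto simp: symmetric_def sym_def)
  have cyc: "\<not> pre_digraph.cycle (with_proj ?T) p" for p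
    by (auto simp: pre_digraph.cycle_def pre_digraph.awalk_def)
  have con: "connected (with_proj ?T)" "connected (with_proj ?T \<restriction> {0})"
    by (auto simp: connected_def strongly_connected_def mk_symmetric_def reachable_def
        intro: rtrancl_on.intros)
  show ?thesis
    using pg cyc con
    by (auto simp: tree_decomposition_def undirected_tree_def undirected_forest_def
        dest: G.in_arcsD1 G.in_arcsD2)
qed

end

(*
  Idea. (i) implies (ii) by Ramsey's theorem applied to the bags, and (ii) implies (iii) because
  large bicliques, long subdivisions of walls and the line graphs of the latter have bounded clique
  number but large treewidth, while a small induced subgraph of a long subdivided wall is a forest
  whose components have at most three leaves.

  For (iii) implies (i), measure separators by their independence number. If there is no haven of
  large order in this sense, the recursion of Robertson and Seymour yields a tree decomposition
  with bags of small independence number. A haven in a graph without large bicliques, on the other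
  hand, yields many pairwise anticomplete long claws, or many pairwise anticomplete line graphs of
  long claws, and these contain the forest or the line graph that should be excluded. The tool is
  an Erdos-Posa theorem: a family of sets of bounded size has many pairwise anticomplete members or
  a hitting set of small independence number. Applied to the claws and their line graphs
  themselves, it allows us to assume that there are none. A connected set with three anticomplete
  legs (long induced paths sticking out of it) contains a claw or its line graph; so the legs at any
  connected set X are hit by a set of small independence number. If every vertex is separated from
  the haven by a set of small independence number, then Gyarfas' path argument extends this from
  single vertices to connected sets, up to all of the haven, which is absurd. The vertices that are
  not separated from the haven have small independence number, so that they can be deleted:
  otherwise many stable ones are joined pairwise through the haven by short anticomplete
  connectors, and these form a long claw.
*)

theory Submission
  imports Defs "HOL-Library.Ramsey" "HOL-Library.Nat_Bijection"
begin

text \<open>A set of small independence number may have arbitrarily many vertices, so the usual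
  greedy proofs of Erdos-Posa statements, which collect or delete vertices one by one, do not apply.
  The packing theorem is therefore proved fractionally: all sets of small independence number carry
  weights at the same time, and multiplicative weights produce a sequence of members that is spread
  out with respect to every one of them. Most pairs of terms are then disjoint and nonadjacent,
  because a positive density of adjacent pairs would yield an induced biclique by pigeonhole.
  Excluding bicliques is used once more, to bound the independence number of the set of vertices
  with many neighbours in a fixed stable set. All constants are fixed before the graph.

  The number of connected components of bounds would grow with the graph if separators were simply
  united; the leg-hitting set gives a separator of fixed independence number for a connected set of
  any size. Finiteness of the family enters through the subdivision length of the walls. Rows and
  columns of a wall cross both in the wall and, as sets of edges, in its line graph, so that one
  bramble serves for both.\<close>

section \<open>Stable sets, independence number and induced bicliques\<close>

definition sgraph :: "'a set \<Rightarrow> 'a rel \<Rightarrow> bool" where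
  "sgraph V E \<longleftrightarrow> finite V \<and> E \<subseteq> V \<times> V \<and> sym E \<and> irrefl E"

definition stab :: "'a rel \<Rightarrow> 'a set \<Rightarrow> bool" where
  "stab E S \<longleftrightarrow> (\<forall>u\<in>S. \<forall>v\<in>S. (u, v) \<notin> E)"

definition alpha_le :: "'a rel \<Rightarrow> 'a set \<Rightarrow> nat \<Rightarrow> bool" where
  "alpha_le E Y k \<longleftrightarrow> (\<forall>S\<subseteq>Y. finite S \<longrightarrow> stab E S \<longrightarrow> card S \<le> k)"

definition anticomplete :: "'a rel \<Rightarrow> 'a set \<Rightarrow> 'a set \<Rightarrow> bool" where
  "anticomplete E A B \<longleftrightarrow> A \<inter> B = {} \<and> (\<forall>a\<in>A. \<forall>b\<in>B. (a, b) \<notin> E)"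

text \<open>Both sides are stable, so what is excluded is an induced biclique. Cliques remain
  possible.\<close>

definition biclique_free :: "'a set \<Rightarrow> 'a rel \<Rightarrow> nat \<Rightarrow> bool" where
  "biclique_free V E t \<longleftrightarrow> \<not> (\<exists>A B. A \<subseteq> V \<and> B \<subseteq> V \<and> finite A \<and> finite B \<and> card A = t \<and> card B = t \<and>
     stab E A \<and> stab E B \<and> A \<times> B \<subseteq> E)"

lemma sgraphD:
  assumes "sgraph V E"
  shows "finite V" "E \<subseteq> V \<times> V" "sym E" "irrefl E"
    and "(u, v) \<in> E \<Longrightarrow> (v, u) \<in> E" "(u, u) \<notin> E" "(u, v) \<in> E \<Longrightarrow> u \<in> V \<and> v \<in> V"
  using assms by (auto simp: sgraph_def sym_def irrefl_def)

lemma biclique_free_pos: "biclique_free V E t \<Longrightarrow> t \<ge> 1"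
proof (cases "t = 0")
  case True
  have "{} \<subseteq> V \<and> {} \<subseteq> V \<and> finite {} \<and> finite {} \<and> card {} = t \<and> card {} = t \<and>
     stab E {} \<and> stab E {} \<and> {} \<times> {} \<subseteq> E" using True by (simp add: stab_def)
  then show "biclique_free V E t \<Longrightarrow> t \<ge> 1" unfolding biclique_free_def by blast
qed simp

lemma biclique_freeD:
  assumes "biclique_free V E t" "A \<subseteq> V" "B \<subseteq> V" "finite A" "finite B" "card A = t" "card B = t"
    "stab E A" "stab E B" "A \<times> B \<subseteq> E"
  shows False
proof -
  have "\<exists>A B. A \<subseteq> V \<and> B \<subseteq> V \<and> finite A \<and> finite B \<and> card A = t \<and> card B = t \<and>
     stab E A \<and> stab E B \<and> A \<times> B \<subseteq> E"
    using assms(2-) by (intro exI[of _ A] exI[of _ B] conjI)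
  then show False using assms(1) by (simp only: biclique_free_def not_True_eq_False)
qed

lemma biclique_free_subset:
  assumes "biclique_free V E t" "U \<subseteq> V"
  shows "biclique_free U E t"
  unfolding biclique_free_def
proof (intro notI, elim exE conjE)
  fix A B assume "A \<subseteq> U" "B \<subseteq> U" "finite A" "finite B" "card A = t" "card B = t"
    "stab E A" "stab E B" "A \<times> B \<subseteq> E"
  then show False using assms by (intro biclique_freeD[of V E t A B]) auto
qed

lemma stab_subset: "stab E S \<Longrightarrow> T \<subseteq> S \<Longrightarrow> stab E T"
  by (auto simp: stab_def)

lemma alpha_le_mono: "alpha_le E Y k \<Longrightarrow> Y' \<subseteq> Y \<Longrightarrow> k \<le> k' \<Longrightarrow> alpha_le E Y' k'"
  unfolding alpha_le_def by (meson order_trans)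

lemma alpha_le_card: "finite Y \<Longrightarrow> card Y \<le> k \<Longrightarrow> alpha_le E Y k"
  unfolding alpha_le_def by (meson card_mono order_trans)

lemma alpha_le_Un:
  assumes "alpha_le E Y k" "alpha_le E Z l"
  shows "alpha_le E (Y \<union> Z) (k + l)"
  unfolding alpha_le_def
proof (intro allI impI)
  fix S assume S: "S \<subseteq> Y \<union> Z" "finite S" "stab E S"
  have "card (S \<inter> Y) \<le> k" "card (S \<inter> Z) \<le> l"
    using assms S by (auto simp: alpha_le_def stab_def)
  moreover have "S = (S \<inter> Y) \<union> (S \<inter> Z)" using S by auto
  ultimately show "card S \<le> k + l"
    by (metis add_mono card_Un_le order_trans)
qed

lemma alpha_le_UN:
  assumes "finite I" "\<And>i. i \<in> I \<Longrightarrow> alpha_le E (Y i) k"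
  shows "alpha_le E (\<Union>i\<in>I. Y i) (card I * k)"
  using assms
proof (induction I)
  case (insert i I)
  then show ?case using alpha_le_Un[of E "Y i" k "\<Union>i\<in>I. Y i" "card I * k"] by simp
qed (simp add: alpha_le_def)

lemma not_alpha_leE:
  assumes "\<not> alpha_le E Y k" "n \<le> Suc k"
  obtains S where "S \<subseteq> Y" "finite S" "stab E S" "card S = n"
proof -
  obtain S where S: "S \<subseteq> Y" "finite S" "stab E S" "card S > k"
    using assms unfolding alpha_le_def by (meson not_le)
  then have "n \<le> card S" using assms by simp
  then obtain T where "T \<subseteq> S" "card T = n" by (meson obtain_subset_with_card_n)
  then show thesis using S that[of T] stab_subset finite_subset by blast
qed

subsection \<open>Packing and hitting\<close>

text \<open>Call a vertex heavy if the sets \<open>Y\<close> through it carry at least a fraction \<open>1 / (r d)\<close> of the total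
  weight \<open>2 ^ h Y\<close>. A stable set of heavy vertices has at most \<open>s r d\<close> elements, as each \<open>Y\<close> contains
  at most \<open>s\<close> of them; hence some member of the family consists of light vertices.\<close>

lemma multiplicative_weights_step:
  fixes h :: "'a set \<Rightarrow> nat"
  assumes V: "finite V" and R: "\<And>R. R \<in> \<R> \<Longrightarrow> R \<subseteq> V \<and> card R \<le> r" and d: "d \<ge> 1" and r: "r \<ge> 1"
    and nohit: "\<And>Z. Z \<subseteq> V \<Longrightarrow> alpha_le E Z (s * r * d) \<Longrightarrow> \<exists>R\<in>\<R>. R \<inter> Z = {}"
  defines "\<Y> \<equiv> {Y. Y \<subseteq> V \<and> alpha_le E Y s}"
  shows "\<exists>R\<in>\<R>. d * (\<Sum>Y | Y \<in> \<Y> \<and> R \<inter> Y \<noteq> {}. 2 ^ h Y) \<le> (\<Sum>Y\<in>\<Y>. 2 ^ h Y)"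
proof -
  define \<Phi> :: nat where "\<Phi> = (\<Sum>Y\<in>\<Y>. 2 ^ h Y)"
  define w :: "'a \<Rightarrow> nat" where "w v = (\<Sum>Y | Y \<in> \<Y> \<and> v \<in> Y. 2 ^ h Y)" for v
  define Z where "Z = {v \<in> V. \<Phi> \<le> r * d * w v}"
  have fin: "finite \<Y>" unfolding \<Y>_def using V by simp
  have "{} \<in> \<Y>" by (simp add: \<Y>_def alpha_le_def)
  then have pos: "\<Phi> > 0" unfolding \<Phi>_def using fin
    by (intro sum_pos) auto
  \<comment> \<open>Double counting of the pairs of a vertex of S and a set Y through it. If S is
    stable, each Y is counted at most s times.\<close>
  have w_swap: "(\<Sum>v\<in>S. w v) = (\<Sum>Y\<in>\<Y>. card (S \<inter> Y) * 2 ^ h Y)" if S: "finite S" for S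
  proof -
    have "(\<Sum>v\<in>S. w v) = (\<Sum>v\<in>S. \<Sum>Y\<in>\<Y>. if v \<in> Y then 2 ^ h Y else 0)"
      unfolding w_def by (intro sum.cong refl sum.inter_filter fin)
    also have "\<dots> = (\<Sum>Y\<in>\<Y>. \<Sum>v\<in>S. if v \<in> Y then 2 ^ h Y else 0)" by (rule sum.swap)
    also have "\<dots> = (\<Sum>Y\<in>\<Y>. card (S \<inter> Y) * 2 ^ h Y)"
      using S by (intro sum.cong refl) (simp add: sum.If_cases)
    finally show ?thesis .
  qed
  have "alpha_le E Z (s * r * d)"
    unfolding alpha_le_def
  proof (intro allI impI)
    fix S assume S: "S \<subseteq> Z" "finite S" "stab E S"
    have "card S * \<Phi> = (\<Sum>v\<in>S. \<Phi>)" by simp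
    also have "\<dots> \<le> (\<Sum>v\<in>S. r * d * w v)"
      using S by (intro sum_mono) (auto simp: Z_def)
    also have "\<dots> = r * d * (\<Sum>v\<in>S. w v)" by (simp add: sum_distrib_left)
    also have "(\<Sum>v\<in>S. w v) = (\<Sum>Y\<in>\<Y>. card (S \<inter> Y) * 2 ^ h Y)" using S(2) by (rule w_swap)
    also have "r * d * \<dots> \<le> r * d * (\<Sum>Y\<in>\<Y>. s * 2 ^ h Y)"
    proof (intro mult_left_mono sum_mono mult_right_mono)
      fix Y assume "Y \<in> \<Y>"
      then show "card (S \<inter> Y) \<le> s" using S stab_subset[of E S "S \<inter> Y"]
        by (auto simp: \<Y>_def alpha_le_def)
    qed auto
    also have "\<dots> = r * d * (s * \<Phi>)" by (simp add: \<Phi>_def sum_distrib_left)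
    finally have "card S * \<Phi> \<le> (s * r * d) * \<Phi>" by (simp add: mult.assoc mult.left_commute)
    then show "card S \<le> s * r * d" using pos by simp
  qed
  then obtain R0 where R0: "R0 \<in> \<R>" "R0 \<inter> Z = {}"
    using nohit[of Z] by (auto simp: Z_def)
  have finR: "finite R0" using R R0 V finite_subset by blast
  have "r * d * (\<Sum>Y | Y \<in> \<Y> \<and> R0 \<inter> Y \<noteq> {}. 2 ^ h Y) \<le> r * d * (\<Sum>v\<in>R0. w v)"
  proof (intro mult_left_mono)
    have "(\<Sum>Y | Y \<in> \<Y> \<and> R0 \<inter> Y \<noteq> {}. (2::nat) ^ h Y) = (\<Sum>Y\<in>\<Y>. if R0 \<inter> Y \<noteq> {} then 2 ^ h Y else 0)"
      by (rule sum.inter_filter[OF fin])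
    also have "\<dots> \<le> (\<Sum>Y\<in>\<Y>. card (R0 \<inter> Y) * 2 ^ h Y)"
      using finR by (intro sum_mono) (auto simp: Suc_le_eq card_gt_0_iff)
    also have "\<dots> = (\<Sum>v\<in>R0. w v)"
      by (simp add: w_swap finR)
    finally show "(\<Sum>Y | Y \<in> \<Y> \<and> R0 \<inter> Y \<noteq> {}. 2 ^ h Y) \<le> (\<Sum>v\<in>R0. w v)" .
  qed auto
  also have "\<dots> = (\<Sum>v\<in>R0. r * d * w v)" by (simp add: sum_distrib_left)
  also have "\<dots> \<le> (\<Sum>v\<in>R0. \<Phi>)"
    using R0 R[OF R0(1)] by (intro sum_mono) (force simp: Z_def)
  also have "\<dots> \<le> r * \<Phi>" using R[OF R0(1)] by simp
  finally have "d * (\<Sum>Y | Y \<in> \<Y> \<and> R0 \<inter> Y \<noteq> {}. 2 ^ h Y) \<le> \<Phi>"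
    using r by (simp add: mult.assoc)
  then show ?thesis using R0 unfolding \<Phi>_def by blast
qed

text \<open>A new term doubles the weight of exactly those Y that it meets. By the previous lemma
  these can be made to carry at most 1/d of the total, so each round multiplies the total weight by
  at most 1 + 1/d. The inequality is this bound after M rounds with the denominators
  cleared.\<close>

lemma multiplicative_weights:
  assumes V: "finite V" and R: "\<And>R. R \<in> \<R> \<Longrightarrow> R \<subseteq> V \<and> card R \<le> r" and d: "d \<ge> 1" and r: "r \<ge> 1"
    and nohit: "\<And>Z. Z \<subseteq> V \<Longrightarrow> alpha_le E Z (s * r * d) \<Longrightarrow> \<exists>R\<in>\<R>. R \<inter> Z = {}"
  defines "\<Y> \<equiv> {Y. Y \<subseteq> V \<and> alpha_le E Y s}"
  shows "\<exists>R. (\<forall>i<M. R i \<in> \<R>) \<and>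
    d ^ M * (\<Sum>Y\<in>\<Y>. 2 ^ card {i. i < M \<and> R i \<inter> Y \<noteq> {}}) \<le> (d + 1) ^ M * card \<Y>"
proof (induction M)
  case (Suc M)
  then obtain R where R': "\<forall>i<M. R i \<in> \<R>" and
    le: "d ^ M * (\<Sum>Y\<in>\<Y>. 2 ^ card {i. i < M \<and> R i \<inter> Y \<noteq> {}}) \<le> (d + 1) ^ M * card \<Y>" by blast
  define h where "h Y = card {i. i < M \<and> R i \<inter> Y \<noteq> {}}" for Y
  have fin: "finite \<Y>" unfolding \<Y>_def using V by simp
  obtain R0 where R0: "R0 \<in> \<R>"
    and le0: "d * (\<Sum>Y | Y \<in> \<Y> \<and> R0 \<inter> Y \<noteq> {}. 2 ^ h Y) \<le> (\<Sum>Y\<in>\<Y>. 2 ^ h Y)"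
    using multiplicative_weights_step[OF V R d r nohit, where h = h] unfolding \<Y>_def by blast
  define R1 where "R1 = R(M := R0)"
  have card_eq: "card {i. i < Suc M \<and> R1 i \<inter> Y \<noteq> {}} = h Y + (if R0 \<inter> Y \<noteq> {} then 1 else 0)" for Y
  proof -
    have "{i. i < Suc M \<and> R1 i \<inter> Y \<noteq> {}} =
      {i. i < M \<and> R i \<inter> Y \<noteq> {}} \<union> (if R0 \<inter> Y \<noteq> {} then {M} else {})"
      by (auto simp: R1_def less_Suc_eq)
    then show ?thesis by (auto simp: h_def)
  qed
  have "(\<Sum>Y\<in>\<Y>. (2::nat) ^ card {i. i < Suc M \<and> R1 i \<inter> Y \<noteq> {}}) =
    (\<Sum>Y\<in>\<Y>. 2 ^ h Y + (if R0 \<inter> Y \<noteq> {} then 2 ^ h Y else 0))"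
    unfolding card_eq by (intro sum.cong) auto
  also have "\<dots> = (\<Sum>Y\<in>\<Y>. 2 ^ h Y) + (\<Sum>Y | Y \<in> \<Y> \<and> R0 \<inter> Y \<noteq> {}. 2 ^ h Y)"
    by (simp add: sum.distrib sum.inter_filter[OF fin])
  finally have eq: "(\<Sum>Y\<in>\<Y>. (2::nat) ^ card {i. i < Suc M \<and> R1 i \<inter> Y \<noteq> {}}) =
    (\<Sum>Y\<in>\<Y>. 2 ^ h Y) + (\<Sum>Y | Y \<in> \<Y> \<and> R0 \<inter> Y \<noteq> {}. 2 ^ h Y)" .
  have "d ^ Suc M * (\<Sum>Y\<in>\<Y>. 2 ^ card {i. i < Suc M \<and> R1 i \<inter> Y \<noteq> {}}) =
    d ^ M * (d * (\<Sum>Y\<in>\<Y>. 2 ^ h Y) + d * (\<Sum>Y | Y \<in> \<Y> \<and> R0 \<inter> Y \<noteq> {}. 2 ^ h Y))"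
    unfolding eq by (simp add: algebra_simps)
  also have "\<dots> \<le> d ^ M * (d * (\<Sum>Y\<in>\<Y>. 2 ^ h Y) + (\<Sum>Y\<in>\<Y>. 2 ^ h Y))"
    using le0 by (intro mult_left_mono) auto
  also have "\<dots> = (d + 1) * (d ^ M * (\<Sum>Y\<in>\<Y>. 2 ^ h Y))" by (simp add: algebra_simps)
  also have "\<dots> \<le> (d + 1) * ((d + 1) ^ M * card \<Y>)"
    using le unfolding h_def by (intro mult_left_mono) auto
  finally have "d ^ Suc M * (\<Sum>Y\<in>\<Y>. 2 ^ card {i. i < Suc M \<and> R1 i \<inter> Y \<noteq> {}}) \<le> (d + 1) ^ Suc M * card \<Y>"
    by (simp only: power_Suc mult.assoc)
  moreover have "\<forall>i<Suc M. R1 i \<in> \<R>" using R' R0 by (auto simp: R1_def)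
  ultimately show ?case by blast
qed simp

text \<open>This is (1 + 1/d)^d <= e < 4; the constant 4 is taken because it is a power of
  2.\<close>

lemma Suc_power_le: "d \<ge> 1 \<Longrightarrow> (d + 1) ^ d \<le> 4 * d ^ (d::nat)"
proof -
  assume d: "d \<ge> 1"
  have "(1 + 1 / real d) ^ d \<le> exp (1 / real d) ^ d"
    using d by (intro power_mono) auto
  also have "\<dots> = exp 1" using d by (simp flip: exp_of_nat_mult)
  also have "\<dots> \<le> 3" by (rule exp_le)
  finally have "(1 + 1 / real d) ^ d \<le> 4" by simp
  then have "(1 + 1 / real d) ^ d * real d ^ d \<le> 4 * real d ^ d"
    by (intro mult_right_mono) auto
  moreover have "(1 + 1 / real d) ^ d * real d ^ d = (real d + 1) ^ d"
    using d by (simp add: power_mult_distrib[symmetric] field_simps)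
  ultimately have "(real d + 1) ^ d \<le> 4 * real d ^ d" by simp
  then have "real ((d + 1) ^ d) \<le> real (4 * d ^ d)" by (simp add: add.commute)
  then show ?thesis by (simp only: of_nat_le_iff)
qed

text \<open>If no set of small independence number hits the whole family, then some sequence of members is
  spread out: every \<open>Y\<close> of independence number at most \<open>s\<close> meets at most \<open>1 / q\<close> of its terms.\<close>

lemma diffuse_sequence:
  assumes V: "finite V" and R: "\<And>R. R \<in> \<R> \<Longrightarrow> R \<subseteq> V \<and> card R \<le> r" and q: "q \<ge> 1" and r: "r \<ge> 1"
    and nohit: "\<And>Z. Z \<subseteq> V \<Longrightarrow> alpha_le E Z (s * r * (3 * q)) \<Longrightarrow> \<exists>R\<in>\<R>. R \<inter> Z = {}"
  shows "\<exists>M\<ge>1. \<exists>R. (\<forall>i<M. R i \<in> \<R>) \<and>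
    (\<forall>Y. Y \<subseteq> V \<longrightarrow> alpha_le E Y s \<longrightarrow> q * card {i. i < M \<and> R i \<inter> Y \<noteq> {}} \<le> M)"
proof -
  define \<Y> where "\<Y> = {Y. Y \<subseteq> V \<and> alpha_le E Y s}"
  define m where "m = card \<Y>"
  \<comment> \<open>After d m rounds the total weight is at most (1 + 1/d)^(d m) m <= 4^m 2^m = 2^(3
    m), so each Y is met at most 3 m times. Among d m terms this is the fraction 1/q if d = 3
    q.\<close>
  define d where "d = 3 * q"
  have fin: "finite \<Y>" unfolding \<Y>_def using V by simp
  have "{} \<in> \<Y>" by (simp add: \<Y>_def alpha_le_def)
  then have m: "m \<ge> 1" unfolding m_def using fin by (metis One_nat_def Suc_leI card_gt_0_iff empty_iff)
  have d: "d \<ge> 1" using q by (simp add: d_def)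
  obtain R where R': "\<forall>i<d*m. R i \<in> \<R>" and
    le: "d ^ (d*m) * (\<Sum>Y\<in>\<Y>. 2 ^ card {i. i < d*m \<and> R i \<inter> Y \<noteq> {}}) \<le> (d + 1) ^ (d*m) * card \<Y>"
    using multiplicative_weights[of V \<R> r d E s "d*m", OF V R d r] nohit
    unfolding d_def \<Y>_def by blast
  have "q * card {i. i < d*m \<and> R i \<inter> Y \<noteq> {}} \<le> d*m" if Y: "Y \<subseteq> V" "alpha_le E Y s" for Y
  proof -
    let ?h = "\<lambda>Y. card {i. i < d*m \<and> R i \<inter> Y \<noteq> {}}"
    have "(2::nat) ^ ?h Y \<le> (\<Sum>Y\<in>\<Y>. 2 ^ ?h Y)"
      using fin Y by (intro member_le_sum[of Y \<Y> "\<lambda>Y. 2 ^ ?h Y"]) (auto simp: \<Y>_def)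
    then have "d ^ (d*m) * 2 ^ ?h Y \<le> d ^ (d*m) * (\<Sum>Y\<in>\<Y>. 2 ^ ?h Y)"
      by (intro mult_left_mono) auto
    also have "\<dots> \<le> ((d + 1) ^ d) ^ m * m" using le by (simp add: m_def power_mult)
    also have "\<dots> \<le> (4 * d ^ d) ^ m * 2 ^ m"
      using Suc_power_le[OF d] by (intro mult_mono power_mono) (auto intro: less_imp_le)
    also have "\<dots> = d ^ (d*m) * 2 ^ (3 * m)"
    proof -
      have "(2::nat) ^ (3 * m) = 4 ^ m * 2 ^ m" by (simp add: power_mult flip: power_mult_distrib)
      then show ?thesis by (simp add: power_mult_distrib power_mult)
    qed
    finally have "(2::nat) ^ ?h Y \<le> 2 ^ (3 * m)" using d by simp
    then have "?h Y \<le> 3 * m" by simp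
    then have "q * ?h Y \<le> q * (3 * m)" by (rule mult_left_mono) simp
    then show ?thesis by (simp add: d_def mult_ac)
  qed
  moreover have "d * m \<ge> 1" using d m by simp
  ultimately show ?thesis using R' by blast
qed

text \<open>If the claim failed, the \<open>f i\<close> with many neighbours among the
  \<open>g j\<close> would contain a stable set S of 2 t p + 1 vertices, since f is spread out. By
  double counting at least M / (2 p) of the \<open>g j\<close> have t neighbours in S, and by
  pigeonhole the same t neighbours T0 for so many j that these \<open>g j\<close> contain a stable
  set of size t, now because g is spread out. Together with T0 this is an induced biclique.\<close>

lemma dense_imp_biclique:
  assumes bf: "biclique_free V E t" and V: "finite V" and M: "M \<ge> 1"
    and fV: "\<And>i. i < M \<Longrightarrow> f i \<in> V" and gV: "\<And>i. i < M \<Longrightarrow> g i \<in> V"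
    and df: "\<And>Y. Y \<subseteq> V \<Longrightarrow> alpha_le E Y (2 * t * p) \<Longrightarrow> q * card {i. i < M \<and> f i \<in> Y} \<le> M"
    and dg: "\<And>Y. Y \<subseteq> V \<Longrightarrow> alpha_le E Y (2 * t * p) \<Longrightarrow> q * card {i. i < M \<and> g i \<in> Y} \<le> M"
    and p: "p \<ge> 1" and q: "q > 2 * p * 2 ^ Suc (2 * t * p)"
  shows "q * card {i. i < M \<and> M \<le> p * card {j. j < M \<and> (f i, g j) \<in> E}} \<le> M"
proof (rule ccontr)
  define L where "L = {i. i < M \<and> M \<le> p * card {j. j < M \<and> (f i, g j) \<in> E}}"
  assume "\<not> ?thesis"
  then have "M < q * card L" by (simp add: L_def)
  also have "\<dots> \<le> q * card {i. i < M \<and> f i \<in> f ` L}"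
    by (intro mult_left_mono card_mono) (auto simp: L_def)
  finally have "\<not> alpha_le E (f ` L) (2 * t * p)"
    using df[of "f ` L"] fV by (force simp: L_def)
  then obtain S where S: "S \<subseteq> f ` L" "finite S" "stab E S" "card S = Suc (2 * t * p)"
    using not_alpha_leE[of E "f ` L" "2 * t * p" "Suc (2 * t * p)"] by auto
  have SV: "S \<subseteq> V" using S fV by (auto simp: L_def)
  define c where "c j = card {v \<in> S. (v, g j) \<in> E}" for j
  have "card S * M = (\<Sum>v\<in>S. M)" by simp
  also have "\<dots> \<le> (\<Sum>v\<in>S. p * card {j. j < M \<and> (v, g j) \<in> E})"
    using S by (intro sum_mono) (auto simp: L_def)
  also have "\<dots> = p * (\<Sum>v\<in>S. \<Sum>j<M. if (v, g j) \<in> E then 1 else 0)"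
    by (simp add: sum_distrib_left sum.If_cases Int_def)
  also have "\<dots> = p * (\<Sum>j<M. c j)"
    by (subst sum.swap) (simp add: c_def sum.If_cases S(2) Int_def)
  finally have 1: "card S * M \<le> p * (\<Sum>j<M. c j)" .
  define J where "J = {j. j < M \<and> t \<le> c j}"
  have "(\<Sum>j<M. c j) \<le> (\<Sum>j<M. t + (if t \<le> c j then card S else 0))"
    using S(2) by (intro sum_mono) (auto simp: c_def intro!: trans_le_add2 card_mono)
  also have "\<dots> = t * M + card S * card J"
    by (simp add: sum.distrib sum.If_cases J_def Int_def)
  finally have "card S * M \<le> p * (t * M + card S * card J)"
    using 1 by (meson le_trans mult_le_mono2)
  \<comment> \<open>As S has more than 2 t p elements, the indices j with fewer than t neighbours in
    S account for at most half of the pairs.\<close>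
  moreover have "2 * (p * (t * M)) \<le> card S * M" unfolding S(4) by (simp add: algebra_simps)
  ultimately have "card S * M \<le> 2 * (p * (card S * card J))" by (simp only: distrib_left)
  then have "card S * M \<le> card S * (2 * p * card J)" by (simp only: mult_ac)
  then have MJ: "M \<le> 2 * p * card J" using S(4) by (simp only: mult_le_cancel1)
  have "\<exists>T. T \<subseteq> S \<and> card T = t \<and> (\<forall>v\<in>T. (v, g j) \<in> E)" if "j \<in> J" for j
  proof -
    have "t \<le> card {v \<in> S. (v, g j) \<in> E}" using that by (simp add: J_def c_def)
    then obtain T where "T \<subseteq> {v \<in> S. (v, g j) \<in> E}" "card T = t"
      by (rule obtain_subset_with_card_n)
    then show ?thesis by auto
  qed
  then obtain T where T: "\<And>j. j \<in> J \<Longrightarrow> T j \<subseteq> S \<and> card (T j) = t \<and> (\<forall>v\<in>T j. (v, g j) \<in> E)" by metis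
  have finJ: "finite J" by (simp add: J_def)
  \<comment> \<open>Pigeonhole over the subsets of S; their number is the exponential factor in the
    lower bound on q.\<close>
  have "\<exists>T0. card J \<le> 2 ^ card S * card {j \<in> J. T j = T0}"
  proof (rule ccontr)
    assume "\<not> ?thesis"
    then have *: "2 ^ card S * card {j \<in> J. T j = T0} < card J" for T0 by (simp add: not_le)
    have "2 ^ card S * card J \<le> 2 ^ card S * (\<Sum>T0\<in>Pow S. card {j \<in> J. T j = T0})"
    proof (intro mult_left_mono)
      have "J \<subseteq> (\<Union>T0\<in>Pow S. {j \<in> J. T j = T0})" using T by auto
      then have "card J \<le> card (\<Union>T0\<in>Pow S. {j \<in> J. T j = T0})"
        using finJ S(2) by (intro card_mono) auto
      also have "\<dots> \<le> (\<Sum>T0\<in>Pow S. card {j \<in> J. T j = T0})"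
        using S(2) by (intro card_UN_le) auto
      finally show "card J \<le> (\<Sum>T0\<in>Pow S. card {j \<in> J. T j = T0})" .
    qed auto
    also have "\<dots> = (\<Sum>T0\<in>Pow S. 2 ^ card S * card {j \<in> J. T j = T0})" by (simp add: sum_distrib_left)
    also have "\<dots> < (\<Sum>T0\<in>Pow S. card J)"
      using * S(2) by (intro sum_strict_mono) auto
    also have "\<dots> = 2 ^ card S * card J" using S(2) by (simp add: card_Pow)
    finally show False by simp
  qed
  then obtain T0 where T0: "card J \<le> 2 ^ card S * card {j \<in> J. T j = T0}" by blast
  define J0 where "J0 = {j \<in> J. T j = T0}"
  have "M \<le> 2 * p * (2 ^ card S * card J0)"
    unfolding J0_def using MJ mult_le_mono2[OF T0] by (rule order_trans)
  then have "M \<le> 2 * p * 2 ^ card S * card J0" by (simp only: mult.assoc)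
  moreover have "J0 \<noteq> {}" using calculation M by (intro notI) simp
  then have "card J0 > 0" using finJ by (simp add: J0_def card_gt_0_iff)
  then have "2 * p * 2 ^ card S * card J0 < q * card J0" using q S(4) by simp
  ultimately have "M < q * card J0" by linarith
  also have "\<dots> \<le> q * card {i. i < M \<and> g i \<in> g ` J0}"
    by (intro mult_left_mono card_mono) (auto simp: J0_def J_def)
  finally have "\<not> alpha_le E (g ` J0) (2 * t * p)"
    using dg[of "g ` J0"] gV by (force simp: J0_def J_def)
  moreover have "t \<le> Suc (2 * t * p)" using p by (cases p) auto
  ultimately obtain B where B: "B \<subseteq> g ` J0" "finite B" "stab E B" "card B = t"
    using not_alpha_leE by metis
  obtain j0 where "j0 \<in> J0" using \<open>J0 \<noteq> {}\<close> by blast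
  then have T0': "T0 \<subseteq> S" "card T0 = t" using T by (auto simp: J0_def)
  have "T0 \<times> B \<subseteq> E" using B T by (auto simp: J0_def)
  moreover have "B \<subseteq> V" using B gV by (auto simp: J0_def J_def)
  moreover have "finite T0" "stab E T0" "T0 \<subseteq> V"
    using T0' S SV stab_subset finite_subset by auto
  ultimately show False using bf B T0' by (intro biclique_freeD[of V E t T0 B])
qed

text \<open>Without a hitting set there is a spread out sequence of members. By
  \<open>dense_imp_biclique\<close>, applied to each pair of coordinates, only few indices
  \<open>Hi\<close> have a member that is adjacent to a considerable fraction of the others. Any
  other member conflicts with few terms, so N members can be picked greedily outside
  \<open>Hi\<close>.\<close>

lemma packing_or_hitting_set:
  "\<exists>C. \<forall>(V::'a set) E \<R>. finite V \<longrightarrow> sym E \<longrightarrow> biclique_free V E t \<longrightarrow>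
     (\<forall>R\<in>\<R>. R \<subseteq> V \<and> R \<noteq> {} \<and> card R \<le> r) \<longrightarrow>
     (\<exists>\<S>\<subseteq>\<R>. finite \<S> \<and> card \<S> = N \<and> pairwise (anticomplete E) \<S>) \<or>
     (\<exists>Z\<subseteq>V. alpha_le E Z C \<and> (\<forall>R\<in>\<R>. R \<inter> Z \<noteq> {}))"
proof -
  \<comment> \<open>The successor keeps the number of coordinates positive even if r = 0.\<close>
  define r' where "r' = Suc r"
  \<comment> \<open>Each pair of coordinates contributes conflicts of density below 1/p, and the
    number of pairs is the square of \<open>r'\<close>. So \<open>Hi\<close> takes up at most M / (4
    (N + 1)) indices and every other index conflicts with at most M / (2 (N + 1)), which leaves room
    for N greedy choices.\<close>
  define p where "p = 4 * (N + 1) * r'\<^sup>2"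
  define s where "s = 2 * t * p"
  define q where "q = 2 * p * 2 ^ Suc s + p"
  have r': "r' \<ge> 1" and p: "p \<ge> 1" by (auto simp: r'_def p_def)
  then have q: "q \<ge> 1" "q > 2 * p * 2 ^ Suc s" "q \<ge> p" by (auto simp: q_def)
  have main: "(\<exists>\<S>\<subseteq>\<R>. finite \<S> \<and> card \<S> = N \<and> pairwise (anticomplete E) \<S>)"
    if V: "finite (V::'a set)" and E: "sym E" and bf: "biclique_free V E t"
      and R: "\<forall>R\<in>\<R>. R \<subseteq> V \<and> R \<noteq> {} \<and> card R \<le> r"
      and nohit: "\<not> (\<exists>Z\<subseteq>V. alpha_le E Z (s * r' * (3 * q)) \<and> (\<forall>R\<in>\<R>. R \<inter> Z \<noteq> {}))"
    for V E \<R>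
  proof -
    have t: "t \<ge> 1" using bf by (rule biclique_free_pos)
    have s: "s \<ge> 1" using t p by (simp add: s_def)
    have "\<exists>M\<ge>1. \<exists>R. (\<forall>i<M. R i \<in> \<R>) \<and>
      (\<forall>Y. Y \<subseteq> V \<longrightarrow> alpha_le E Y s \<longrightarrow> q * card {i. i < M \<and> R i \<inter> Y \<noteq> {}} \<le> M)"
      by (rule diffuse_sequence[OF V _ q(1) r']) (use R nohit in \<open>auto simp: r'_def le_SucI\<close>)
    then obtain M Rs where M: "M \<ge> 1" and Rs: "\<And>i. i < M \<Longrightarrow> Rs i \<in> \<R>"
      and diff: "\<And>Y. Y \<subseteq> V \<Longrightarrow> alpha_le E Y s \<Longrightarrow> q * card {i. i < M \<and> Rs i \<inter> Y \<noteq> {}} \<le> M"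
      by auto
    \<comment> \<open>Every member is listed with exactly \<open>r'\<close> coordinates, repeating
      one element if it is smaller, so that each coordinate is a sequence of vertices.\<close>
    have "\<exists>e. e ` {..<r'} = Rs i" if "i < M" for i
    proof -
      have fin: "finite (Rs i)" and ne: "Rs i \<noteq> {}" and c: "card (Rs i) \<le> r'"
        using R Rs[OF that] V finite_subset by (auto simp: r'_def)
      obtain h where h: "bij_betw h {..<card (Rs i)} (Rs i)"
        using ex_bij_betw_nat_finite[OF fin] by (auto simp: atLeast0LessThan)
      have c0: "card (Rs i) > 0" using fin ne by (simp add: card_gt_0_iff)
      have "(\<lambda>a. if a < card (Rs i) then a else 0) ` {..<r'} = {..<card (Rs i)}"
        using c c0 by (auto simp: image_iff)
      then have "(\<lambda>a. h (if a < card (Rs i) then a else 0)) ` {..<r'} = h ` {..<card (Rs i)}"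
        by (metis image_image)
      also have "\<dots> = Rs i" using h by (simp add: bij_betw_def)
      finally show ?thesis by (rule exI[of _ "\<lambda>a. h (if a < card (Rs i) then a else 0)"])
    qed
    then obtain e where e: "\<And>i. i < M \<Longrightarrow> e i ` {..<r'} = Rs i" by metis
    have eV: "e i a \<in> V" if "i < M" "a < r'" for i a
    proof -
      have "Rs i \<subseteq> V" using R Rs[OF that(1)] by blast
      moreover have "e i a \<in> e i ` {..<r'}" using that(2) by simp
      ultimately show ?thesis unfolding e[OF that(1)] by (rule subsetD)
    qed
    have ediff: "q * card {i. i < M \<and> e i a \<in> Y} \<le> M" if "Y \<subseteq> V" "alpha_le E Y s" "a < r'" for Y a
    proof -
      have "card {i. i < M \<and> e i a \<in> Y} \<le> card {i. i < M \<and> Rs i \<inter> Y \<noteq> {}}"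
        using e that by (intro card_mono) auto
      then show ?thesis using diff[OF that(1,2)] by (meson le_trans mult_le_mono2)
    qed
    define H where "H a b = {i. i < M \<and> M \<le> p * card {j. j < M \<and> (e i a, e j b) \<in> E}}" for a b
    have H: "q * card (H a b) \<le> M" if "a < r'" "b < r'" for a b
      unfolding H_def
      by (rule dense_imp_biclique[OF bf V M _ _ _ _ p]) (use that eV ediff q in \<open>auto simp: s_def\<close>)
    define Hi where "Hi = (\<Union>(a, b)\<in>{..<r'} \<times> {..<r'}. H a b)"
    have "q * card Hi \<le> q * (\<Sum>(a,b)\<in>{..<r'} \<times> {..<r'}. card (H a b))"
      unfolding Hi_def by (intro mult_left_mono order_trans[OF card_UN_le]) (auto simp: case_prod_beta)
    also have "\<dots> \<le> (\<Sum>(a,b)\<in>{..<r'} \<times> {..<r'}. M)"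
      unfolding sum_distrib_left using H by (intro sum_mono) auto
    also have "\<dots> = r'\<^sup>2 * M" by (simp add: power2_eq_square)
    finally have "q * card Hi \<le> r'\<^sup>2 * M" .
    then have "p * card Hi \<le> r'\<^sup>2 * M" using q(3) by (meson le_trans mult_le_mono1)
    then have "r'\<^sup>2 * (4 * (N + 1) * card Hi) \<le> r'\<^sup>2 * M" by (simp add: p_def mult_ac)
    then have cHi: "4 * (N + 1) * card Hi \<le> M" using r' by simp
    define Cf where "Cf i = {j. j < M \<and> \<not> anticomplete E (Rs i) (Rs j)}" for i
    have cCf: "2 * (N + 1) * card (Cf i) \<le> M" if i: "i < M" "i \<notin> Hi" for i
    proof -
      let ?A = "\<lambda>a b. {j. j < M \<and> (e i a, e j b) \<in> E}" and ?B = "\<lambda>a. {j. j < M \<and> Rs j \<inter> {e i a} \<noteq> {}}"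
      have "Cf i \<subseteq> (\<Union>(a,b)\<in>{..<r'} \<times> {..<r'}. ?A a b) \<union> (\<Union>a<r'. ?B a)"
      proof
        fix j assume "j \<in> Cf i"
        then have j: "j < M" and na: "\<not> anticomplete E (Rs i) (Rs j)" by (auto simp: Cf_def)
        show "j \<in> (\<Union>(a,b)\<in>{..<r'} \<times> {..<r'}. ?A a b) \<union> (\<Union>a<r'. ?B a)"
        proof (cases "Rs i \<inter> Rs j = {}")
          case True
          then obtain x y where "x \<in> Rs i" "y \<in> Rs j" "(x, y) \<in> E" using na by (auto simp: anticomplete_def)
          moreover have "x \<in> e i ` {..<r'}" "y \<in> e j ` {..<r'}" using calculation e[OF i(1)] e[OF j] by auto
          ultimately obtain a b where "a < r'" "b < r'" "(e i a, e j b) \<in> E" by auto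
          then show ?thesis using j by blast
        next
          case False
          then obtain x where "x \<in> e i ` {..<r'}" "x \<in> Rs j" using e[OF i(1)] by auto
          then obtain a where "a < r'" "e i a \<in> Rs j" by auto
          then show ?thesis using j by blast
        qed
      qed
      then have "card (Cf i) \<le> card ((\<Union>(a,b)\<in>{..<r'} \<times> {..<r'}. ?A a b) \<union> (\<Union>a<r'. ?B a))"
        by (intro card_mono) auto
      also have "\<dots> \<le> (\<Sum>(a,b)\<in>{..<r'} \<times> {..<r'}. card (?A a b)) + (\<Sum>a<r'. card (?B a))"
        by (intro order_trans[OF card_Un_le] add_mono order_trans[OF card_UN_le]) (auto simp: case_prod_beta)
      finally have "p * card (Cf i) \<le> p * (\<Sum>(a,b)\<in>{..<r'} \<times> {..<r'}. card (?A a b)) + p * (\<Sum>a<r'. card (?B a))"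
        by (subst distrib_left[symmetric]) (rule mult_le_mono2)
      also have "\<dots> \<le> (\<Sum>(a,b)\<in>{..<r'} \<times> {..<r'}. M) + (\<Sum>a<r'. M)"
        unfolding sum_distrib_left
      proof (intro add_mono sum_mono)
        fix ab assume "ab \<in> {..<r'} \<times> {..<r'}"
        then show "p * (case ab of (a, b) \<Rightarrow> card (?A a b)) \<le> (case ab of (a, b) \<Rightarrow> M)"
          using i by (auto simp: Hi_def H_def not_le intro: less_imp_le)
      next
        fix a assume "a \<in> {..<r'}"
        then have "q * card (?B a) \<le> M"
          using eV[OF i(1), of a] s alpha_le_card[of "{e i a}" s E] by (intro diff) auto
        then show "p * card (?B a) \<le> M" using q(3) by (meson le_trans mult_le_mono1)
      qed
      also have "\<dots> \<le> 2 * r'\<^sup>2 * M" using r' by (simp add: power2_eq_square algebra_simps)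
      finally have "r'\<^sup>2 * (4 * (N + 1) * card (Cf i)) \<le> r'\<^sup>2 * (2 * M)" by (simp only: p_def mult_ac)
      then have "4 * (N + 1) * card (Cf i) \<le> 2 * M" using r' by (subst (asm) nat_mult_le_cancel1) auto
      then show ?thesis by (simp add: algebra_simps)
    qed
    have "\<exists>I. I \<subseteq> {..<M} - Hi \<and> card I = n \<and> pairwise (\<lambda>i j. anticomplete E (Rs i) (Rs j)) I" if "n \<le> N" for n
      using that
    proof (induction n)
      case 0
      then show ?case by (intro exI[of _ "{}"]) auto
    next
      case (Suc n)
      then obtain I where I: "I \<subseteq> {..<M} - Hi" "card I = n"
        "pairwise (\<lambda>i j. anticomplete E (Rs i) (Rs j)) I" by auto
      have finI: "finite I" using I finite_subset by blast
      have "card (Hi \<union> (\<Union>i\<in>I. Cf i)) \<le> card Hi + (\<Sum>i\<in>I. card (Cf i))"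
        using finI by (intro order_trans[OF card_Un_le] add_mono card_UN_le) auto
      then have "4 * (N + 1) * card (Hi \<union> (\<Union>i\<in>I. Cf i)) \<le> 4 * (N + 1) * (card Hi + (\<Sum>i\<in>I. card (Cf i)))"
        by (rule mult_le_mono2)
      also have "\<dots> = 4 * (N + 1) * card Hi + 2 * (\<Sum>i\<in>I. 2 * (N + 1) * card (Cf i))"
        unfolding sum_distrib_left[symmetric] by (simp add: algebra_simps)
      also have "(\<Sum>i\<in>I. 2 * (N + 1) * card (Cf i)) \<le> (\<Sum>i\<in>I. M)"
        using cCf I by (intro sum_mono) auto
      then have "4 * (N + 1) * card Hi + 2 * (\<Sum>i\<in>I. 2 * (N + 1) * card (Cf i)) \<le> M + 2 * (n * M)"
        using cHi I(2) by auto
      also have "\<dots> < 4 * (N + 1) * M" 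
      proof -
        have "n * M \<le> N * M" using Suc.prems by simp
        then have "M + 2 * (n * M) < 4 * (N * M) + 4 * M" using M by linarith
        also have "\<dots> = 4 * (N + 1) * M" by (simp add: algebra_simps)
        finally show ?thesis .
      qed
      finally have "card (Hi \<union> (\<Union>i\<in>I. Cf i)) < card {..<M}" by simp
      then have "\<not> {..<M} \<subseteq> Hi \<union> (\<Union>i\<in>I. Cf i)"
        using card_mono[of "Hi \<union> (\<Union>i\<in>I. Cf i)" "{..<M}"] finI
        by (auto simp: Hi_def H_def Cf_def not_less[symmetric])
      then obtain j where j: "j < M" "j \<notin> Hi" "\<And>i. i \<in> I \<Longrightarrow> j \<notin> Cf i" by auto
      \<comment> \<open>A nonempty set is not anticomplete to itself, so avoiding conflicts already
        makes the index new.\<close>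
      have "j \<notin> I"
      proof
        assume "j \<in> I"
        then have "anticomplete E (Rs j) (Rs j)" using j by (auto simp: Cf_def)
        then show False using R Rs[OF j(1)] by (auto simp: anticomplete_def)
      qed
      moreover have "anticomplete E (Rs i) (Rs j)" "anticomplete E (Rs j) (Rs i)" if "i \<in> I" for i
        using j(1) j(3)[OF that] by (auto simp: Cf_def anticomplete_def dest: symD[OF E])
      ultimately show ?case using I finI j
        by (intro exI[of _ "insert j I"]) (auto simp: pairwise_insert)
    qed
    from this[of N] obtain I where I: "I \<subseteq> {..<M} - Hi" "card I = N"
      "pairwise (\<lambda>i j. anticomplete E (Rs i) (Rs j)) I" by auto
    have "inj_on Rs I"
    proof (rule inj_onI, rule ccontr)
      fix i j assume ij: "i \<in> I" "j \<in> I" "Rs i = Rs j" "i \<noteq> j"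
      then have "Rs i \<inter> Rs j = {}" using I(3) by (auto simp: pairwise_def anticomplete_def)
      moreover have "Rs i \<noteq> {}" using I(1) ij R Rs by auto
      ultimately show False using ij by auto
    qed
    then have "card (Rs ` I) = N" using I by (simp add: card_image)
    moreover have "finite (Rs ` I)" using I finite_subset by blast
    moreover have "Rs ` I \<subseteq> \<R>" using I Rs by auto
    moreover have "pairwise (anticomplete E) (Rs ` I)" using I(3) by (auto simp: pairwise_def)
    ultimately show ?thesis by blast
  qed
  show ?thesis
  proof (intro exI[of _ "s * r' * (3 * q)"] allI impI, goal_cases)
    case (1 V E \<R>)
    show ?case
    proof (cases "\<exists>Z\<subseteq>V. alpha_le E Z (s * r' * (3 * q)) \<and> (\<forall>R\<in>\<R>. R \<inter> Z \<noteq> {})")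
      case True
      then show ?thesis by (rule disjI2)
    next
      case False
      then show ?thesis by (intro disjI1) (rule main[OF 1 False])
    qed
  qed
qed

text \<open>Elimination form: the constant is obtained before the graph and may enter the
  definitions of later constants.\<close>

lemma packing_or_hitting_setE:
  fixes t r N :: nat
  obtains C where "\<And>(V::'a set) E \<R>. finite V \<Longrightarrow> sym E \<Longrightarrow> biclique_free V E t \<Longrightarrow>
     (\<And>R. R \<in> \<R> \<Longrightarrow> R \<subseteq> V \<and> R \<noteq> {} \<and> card R \<le> r) \<Longrightarrow>
     (\<exists>\<S>\<subseteq>\<R>. finite \<S> \<and> card \<S> = N \<and> pairwise (anticomplete E) \<S>) \<or>
     (\<exists>Z\<subseteq>V. alpha_le E Z C \<and> (\<forall>R\<in>\<R>. R \<inter> Z \<noteq> {}))"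
proof -
  obtain C where C: "\<forall>(V::'a set) E \<R>. finite V \<longrightarrow> sym E \<longrightarrow> biclique_free V E t \<longrightarrow>
     (\<forall>R\<in>\<R>. R \<subseteq> V \<and> R \<noteq> {} \<and> card R \<le> r) \<longrightarrow>
     (\<exists>\<S>\<subseteq>\<R>. finite \<S> \<and> card \<S> = N \<and> pairwise (anticomplete E) \<S>) \<or>
     (\<exists>Z\<subseteq>V. alpha_le E Z C \<and> (\<forall>R\<in>\<R>. R \<inter> Z \<noteq> {}))"
    using packing_or_hitting_set[of t r N] by (rule exE)
  show thesis
  proof (rule that[of C])
    fix V :: "'a set" and E \<R>
    assume "finite V" "sym E" "biclique_free V E t" and R: "\<And>R. R \<in> \<R> \<Longrightarrow> R \<subseteq> V \<and> R \<noteq> {} \<and> card R \<le> r"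
    moreover have "\<forall>R\<in>\<R>. R \<subseteq> V \<and> R \<noteq> {} \<and> card R \<le> r" using R by blast
    ultimately show "(\<exists>\<S>\<subseteq>\<R>. finite \<S> \<and> card \<S> = N \<and> pairwise (anticomplete E) \<S>) \<or>
     (\<exists>Z\<subseteq>V. alpha_le E Z C \<and> (\<forall>R\<in>\<R>. R \<inter> Z \<noteq> {}))"
      using C by (elim allE[of _ V] allE[of _ E] allE[of _ \<R>] impE) simp_all
  qed
qed

section \<open>Connected sets and induced paths\<close>

text \<open>The empty set counts as connected, in contrast to \<open>connected\<close> of the
  library.\<close>

definition conn :: "'a rel \<Rightarrow> 'a set \<Rightarrow> bool" where
  "conn E X \<longleftrightarrow> (\<forall>x\<in>X. \<forall>y\<in>X. (x, y) \<in> (E \<inter> X \<times> X)\<^sup>*)"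

definition ipath :: "'a rel \<Rightarrow> 'a list \<Rightarrow> bool" where
  "ipath E xs \<longleftrightarrow> distinct xs \<and>
     (\<forall>i<length xs. \<forall>j<length xs. (xs ! i, xs ! j) \<in> E \<longleftrightarrow> j = Suc i \<or> i = Suc j)"

lemma anticomplete_subset: "anticomplete E A B \<Longrightarrow> A' \<subseteq> A \<Longrightarrow> B' \<subseteq> B \<Longrightarrow> anticomplete E A' B'"
  unfolding anticomplete_def by blast

lemma ipath_append:
  assumes E: "sym E" and xs: "ipath E xs" "xs \<noteq> []" and ys: "ipath E ys" "ys \<noteq> []"
    and disj: "set xs \<inter> set ys = {}"
    and adj: "\<And>x y. x \<in> set xs \<Longrightarrow> y \<in> set ys \<Longrightarrow> (x, y) \<in> E \<longleftrightarrow> x = last xs \<and> y = hd ys"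
  shows "ipath E (xs @ ys)"
  unfolding ipath_def
proof (intro conjI allI impI)
  have dx: "distinct xs" "distinct ys" using xs ys by (auto simp: ipath_def)
  then show "distinct (xs @ ys)" using disj by simp
  have cross: "(xs ! i, ys ! j) \<in> E \<longleftrightarrow> Suc i = length xs \<and> j = 0" if "i < length xs" "j < length ys" for i j
  proof -
    have "xs ! i = last xs \<longleftrightarrow> Suc i = length xs"
      using that(1) xs dx nth_eq_iff_index_eq[OF dx(1), of i "length xs - 1"] by (auto simp: last_conv_nth)
    moreover have "ys ! j = hd ys \<longleftrightarrow> j = 0"
      using that(2) ys dx nth_eq_iff_index_eq[OF dx(2), of j 0] by (auto simp: hd_conv_nth)
    ultimately show ?thesis using adj[of "xs ! i" "ys ! j"] that by simp
  qed
  have cross': "(ys ! j, xs ! i) \<in> E \<longleftrightarrow> Suc i = length xs \<and> j = 0" if "i < length xs" "j < length ys" for i j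
    using cross[OF that] E unfolding sym_def by metis
  fix i j assume ij: "i < length (xs @ ys)" "j < length (xs @ ys)"
  show "((xs @ ys) ! i, (xs @ ys) ! j) \<in> E \<longleftrightarrow> j = Suc i \<or> i = Suc j"
  proof (cases "i < length xs"; cases "j < length xs")
    assume "i < length xs" "j < length xs"
    then show ?thesis using xs by (simp add: nth_append ipath_def)
  next
    assume a: "i < length xs" "\<not> j < length xs"
    then have "(xs ! i, ys ! (j - length xs)) \<in> E \<longleftrightarrow> Suc i = length xs \<and> j - length xs = 0"
      using ij by (intro cross) auto
    then show ?thesis using a by (auto simp: nth_append)
  next
    assume a: "\<not> i < length xs" "j < length xs"
    then have "(ys ! (i - length xs), xs ! j) \<in> E \<longleftrightarrow> Suc j = length xs \<and> i - length xs = 0"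
      using ij by (intro cross') auto
    then show ?thesis using a by (auto simp: nth_append)
  next
    assume a: "\<not> i < length xs" "\<not> j < length xs"
    then obtain i' j' where [simp]: "i = length xs + i'" "j = length xs + j'"
      by (metis le_iff_add not_less)
    have "(ys ! i', ys ! j') \<in> E \<longleftrightarrow> j' = Suc i' \<or> i' = Suc j'"
      using ij ys by (simp add: ipath_def)
    then show ?thesis by (simp add: nth_append)
  qed
qed

lemma ipath_rev: "ipath E (rev xs) \<longleftrightarrow> ipath E xs"
proof -
  have *: "ipath E (rev xs)" if "ipath E xs" for xs :: "'a list"
    unfolding ipath_def
  proof (intro conjI allI impI)
    show "distinct (rev xs)" using that by (simp add: ipath_def)
    fix i j assume ij: "i < length (rev xs)" "j < length (rev xs)"
    then have "(xs ! (length xs - Suc i), xs ! (length xs - Suc j)) \<in> E \<longleftrightarrow>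
      length xs - Suc j = Suc (length xs - Suc i) \<or> length xs - Suc i = Suc (length xs - Suc j)"
      using that by (simp add: ipath_def)
    moreover have "length xs - Suc j = Suc (length xs - Suc i) \<longleftrightarrow> i = Suc j"
      "length xs - Suc i = Suc (length xs - Suc j) \<longleftrightarrow> j = Suc i" using ij by (simp_all, arith+)
    ultimately show "(rev xs ! i, rev xs ! j) \<in> E \<longleftrightarrow> j = Suc i \<or> i = Suc j"
      using ij by (simp add: rev_nth) blast
  qed
  show ?thesis
  proof
    assume "ipath E (rev xs)"
    then have "ipath E (rev (rev xs))" by (rule *)
    then show "ipath E xs" by simp
  qed (rule *)
qed

lemma ipath_tl: "ipath E xs \<Longrightarrow> ipath E (tl xs)"
  unfolding ipath_def by (auto simp: nth_tl distinct_tl)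

text \<open>The path is a shortest walk inside U from x to a vertex satisfying P. A chord, a
  repetition or an earlier vertex satisfying P would shorten it.\<close>

lemma shortest_ipath:
  assumes E: "sym E" "irrefl E" and x: "x \<in> U" and xy: "(x, y) \<in> (E \<inter> U \<times> U)\<^sup>*" and P: "P y"
  obtains xs where "ipath E xs" "xs \<noteq> []" "hd xs = x" "set xs \<subseteq> U" "P (last xs)"
    "\<And>z. z \<in> set (butlast xs) \<Longrightarrow> \<not> P z"
proof -
  define R where "R = E \<inter> U \<times> U"
  define n where "n = (LEAST n. \<exists>z. P z \<and> (x, z) \<in> R ^^ n)"
  have "\<exists>n z. P z \<and> (x, z) \<in> R ^^ n" using xy P by (auto simp: R_def rtrancl_power)
  then have "\<exists>z. P z \<and> (x, z) \<in> R ^^ n" unfolding n_def by (rule LeastI_ex)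
  then obtain z where z: "P z" "(x, z) \<in> R ^^ n" by blast
  have least: "n \<le> m" if "P z'" "(x, z') \<in> R ^^ m" for m z'
    unfolding n_def using that by (intro Least_le) blast
  obtain f where f: "f 0 = x" "f n = z" "\<And>i. i < n \<Longrightarrow> (f i, f (Suc i)) \<in> R"
    using z(2) by (auto simp: relpow_fun_conv)
  have step: "(f i, f (i + k)) \<in> R ^^ k" if "i + k \<le> n" for i k
    using that
  proof (induction k)
    case (Suc k)
    then have "(f i, f (i + k)) \<in> R ^^ k" "(f (i + k), f (Suc (i + k))) \<in> R" using f by auto
    then show ?case using relpow_Suc_I by fastforce
  qed simp
  \<comment> \<open>A shorter walk to \<open>f i\<close>, continued along the rest of f, would reach
    z too early.\<close>
  have dist: "i \<le> m" if "i \<le> n" "(x, f i) \<in> R ^^ m" for i m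
  proof -
    have "(f i, f n) \<in> R ^^ (n - i)" using step[of i "n - i"] that by simp
    then have "(x, z) \<in> R ^^ m O R ^^ (n - i)" using that f by auto
    then have "(x, z) \<in> R ^^ (m + (n - i))" by (simp only: relpow_add)
    then show ?thesis using least[OF z(1)] that by fastforce
  qed
  have reach: "(x, f i) \<in> R ^^ i" if "i \<le> n" for i using step[of 0 i] that f by simp
  have fU: "f i \<in> U" if "i \<le> n" for i
    using that x f by (cases i) (auto simp: R_def Suc_le_eq)
  have adj_le: "j \<le> Suc i" if "i \<le> n" "j \<le> n" "(f i, f j) \<in> E" for i j
  proof -
    have "(f i, f j) \<in> R" using that fU by (auto simp: R_def)
    then have "(x, f j) \<in> R ^^ Suc i" using reach[OF that(1)] by auto
    then show ?thesis using dist that by blast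
  qed
  have inj: "i = j" if "i \<le> n" "j \<le> n" "f i = f j" for i j
  proof (rule antisym)
    show "i \<le> j" using dist[of i j] reach[of j] that by simp
    show "j \<le> i" using dist[of j i] reach[of i] that by simp
  qed
  define xs where "xs = map f [0..<Suc n]"
  have len: "length xs = Suc n" by (simp add: xs_def)
  have nth: "xs ! i = f i" if "i \<le> n" for i
    unfolding xs_def using that by (subst nth_map) (simp_all del: upt_Suc)
  show thesis
  proof (rule that[of xs])
    show "ipath E xs" unfolding ipath_def
    proof (intro conjI allI impI)
      show "distinct xs" unfolding xs_def distinct_map
        using inj by (auto intro!: inj_onI simp: less_Suc_eq_le simp del: upt_Suc)
      fix i j assume ij: "i < length xs" "j < length xs"
      have fE: "(f k, f (Suc k)) \<in> E" "(f (Suc k), f k) \<in> E" if "k < n" for k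
        using f(3)[OF that] symD[OF E(1)] unfolding R_def by blast+
      have "(f i, f j) \<in> E \<longleftrightarrow> j = Suc i \<or> i = Suc j"
      proof
        assume a: "(f i, f j) \<in> E"
        then have "(f j, f i) \<in> E" by (rule symD[OF E(1)])
        moreover have "i \<le> n" "j \<le> n" using ij len by auto
        ultimately have "j \<le> Suc i" "i \<le> Suc j" using adj_le[of i j] adj_le[of j i] a by blast+
        moreover have "i \<noteq> j" using a E(2) by (metis irrefl_def)
        ultimately show "j = Suc i \<or> i = Suc j" by linarith
      next
        assume "j = Suc i \<or> i = Suc j"
        then show "(f i, f j) \<in> E" using fE ij len by auto
      qed
      then show "(xs ! i, xs ! j) \<in> E \<longleftrightarrow> j = Suc i \<or> i = Suc j"
        using nth ij len by simp
    qed
    show "xs \<noteq> []" using len by auto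
    then show "hd xs = x" using nth[of 0] f by (simp add: hd_conv_nth)
    show "set xs \<subseteq> U" using fU by (auto simp: xs_def less_Suc_eq_le simp del: upt_Suc)
    show "P (last xs)" using z f by (simp add: xs_def)
    fix w assume "w \<in> set (butlast xs)"
    then obtain i where i: "i < n" "w = f i" by (auto simp: xs_def butlast_append)
    show "\<not> P w" using least[of w i] reach[of i] i by auto
  qed
qed

lemma connD: "conn E X \<Longrightarrow> x \<in> X \<Longrightarrow> y \<in> X \<Longrightarrow> (x, y) \<in> (E \<inter> X \<times> X)\<^sup>*"
  by (auto simp: conn_def)

lemma rtrancl_restrict_mono: "(x, y) \<in> (E \<inter> X \<times> X)\<^sup>* \<Longrightarrow> X \<subseteq> Y \<Longrightarrow> (x, y) \<in> (E \<inter> Y \<times> Y)\<^sup>*"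
  using rtrancl_mono[of "E \<inter> X \<times> X" "E \<inter> Y \<times> Y"] by blast

lemma rtrancl_restrict_sym: "sym E \<Longrightarrow> (x, y) \<in> (E \<inter> X \<times> X)\<^sup>* \<Longrightarrow> (y, x) \<in> (E \<inter> X \<times> X)\<^sup>*"
  by (metis sym_Int sym_def sym_rtrancl mem_Sigma_iff)

lemma conn_insert:
  assumes "sym E" "conn E X" "x \<in> X" "(x, y) \<in> E"
  shows "conn E (insert y X)"
proof -
  have a: "(z, x) \<in> (E \<inter> insert y X \<times> insert y X)\<^sup>*" if "z \<in> insert y X" for z
  proof (cases "z = y")
    case True
    then have "(z, x) \<in> E \<inter> insert y X \<times> insert y X" using assms by (auto dest: symD)
    then show ?thesis by blast
  next
    case False
    then show ?thesis using that connD[OF assms(2), of z x] assms(3) rtrancl_restrict_mono[of z x E X "insert y X"] by auto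
  qed
  show ?thesis unfolding conn_def
    using a rtrancl_restrict_sym[OF assms(1)] by (meson rtrancl_trans)
qed

lemma conn_Un:
  assumes "sym E" "conn E X" "conn E Y" "x \<in> X" "y \<in> Y" "(x, y) \<in> E \<or> x = y"
  shows "conn E (X \<union> Y)"
proof -
  let ?R = "(E \<inter> (X \<union> Y) \<times> (X \<union> Y))\<^sup>*"
  have xy: "(y, x) \<in> ?R"
    using assms by (auto dest: symD)
  have a: "(z, x) \<in> ?R" if "z \<in> X \<union> Y" for z
  proof (cases "z \<in> X")
    case True
    then show ?thesis using connD[OF assms(2), of z x] assms(4) rtrancl_restrict_mono[of z x E X "X \<union> Y"] by auto
  next
    case False
    then have "(z, y) \<in> ?R" 
      using that connD[OF assms(3), of z y] assms(5) rtrancl_restrict_mono[of z y E Y "X \<union> Y"] by auto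
    then show ?thesis using xy by (rule rtrancl_trans)
  qed
  show ?thesis unfolding conn_def
    using a rtrancl_restrict_sym[OF assms(1)] by (meson rtrancl_trans)
qed

subsection \<open>Claws and their line graphs\<close>

text \<open>The subdivided claw has centre \<open>(0, 0)\<close>, and \<open>(i, j)\<close> is the \<open>j\<close>-th vertex of its leg \<open>i\<close>. Its line
  graph consists of the triangle \<open>(0, 1)\<close>, \<open>(1, 1)\<close>, \<open>(2, 1)\<close> with a path attached to each vertex.\<close>

definition claw_dom :: "nat \<Rightarrow> (nat \<times> nat) set" where
  "claw_dom t = insert (0, 0) ({..<3} \<times> {1..t})"

definition claw_adj :: "nat \<times> nat \<Rightarrow> nat \<times> nat \<Rightarrow> bool" where
  "claw_adj p q \<longleftrightarrow> (fst p = fst q \<and> (snd p = Suc (snd q) \<or> snd q = Suc (snd p))) \<or>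
     (snd p = 0 \<and> snd q = 1) \<or> (snd p = 1 \<and> snd q = 0)"

definition tri_dom :: "nat \<Rightarrow> (nat \<times> nat) set" where
  "tri_dom t = {..<3} \<times> {1..t}"

definition tri_adj :: "nat \<times> nat \<Rightarrow> nat \<times> nat \<Rightarrow> bool" where
  "tri_adj p q \<longleftrightarrow> (fst p = fst q \<and> (snd p = Suc (snd q) \<or> snd q = Suc (snd p))) \<or>
     (snd p = 1 \<and> snd q = 1 \<and> fst p \<noteq> fst q)"

definition claw_set :: "'a rel \<Rightarrow> nat \<Rightarrow> 'a set \<Rightarrow> bool" where
  "claw_set E t R \<longleftrightarrow> (\<exists>f. inj_on f (claw_dom t) \<and> R = f ` claw_dom t \<and>
     (\<forall>p\<in>claw_dom t. \<forall>q\<in>claw_dom t. (f p, f q) \<in> E \<longleftrightarrow> claw_adj p q))"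

definition tri_set :: "'a rel \<Rightarrow> nat \<Rightarrow> 'a set \<Rightarrow> bool" where
  "tri_set E t R \<longleftrightarrow> (\<exists>f. inj_on f (tri_dom t) \<and> R = f ` tri_dom t \<and>
     (\<forall>p\<in>tri_dom t. \<forall>q\<in>tri_dom t. (f p, f q) \<in> E \<longleftrightarrow> tri_adj p q))"

text \<open>The vertices of a leg are counted from 0 here, so \<open>L i k\<close> becomes the point
  \<open>(i, Suc k)\<close>. Pairs of legs need to be checked in one order only.\<close>

lemma claw_setI:
  fixes L :: "nat \<Rightarrow> nat \<Rightarrow> 'a"
  assumes E: "sym E" "irrefl E"
    and leg: "\<And>i k l. i < 3 \<Longrightarrow> k < t \<Longrightarrow> l < t \<Longrightarrow> (L i k, L i l) \<in> E \<longleftrightarrow> k = Suc l \<or> l = Suc k"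
    and inj: "\<And>i k l. i < 3 \<Longrightarrow> k < t \<Longrightarrow> l < t \<Longrightarrow> L i k = L i l \<Longrightarrow> k = l"
    and cross: "\<And>i i' k l. i < i' \<Longrightarrow> i' < 3 \<Longrightarrow> k < t \<Longrightarrow> l < t \<Longrightarrow> (L i k, L i' l) \<notin> E \<and> L i k \<noteq> L i' l"
    and cen: "\<And>i k. i < 3 \<Longrightarrow> k < t \<Longrightarrow> c \<noteq> L i k \<and> ((c, L i k) \<in> E \<longleftrightarrow> k = 0)"
  shows "claw_set E t (insert c (\<Union>i<3. L i ` {..<t}))"
proof -
  define f where "f p = (if snd p = 0 then c else L (fst p) (snd p - 1))" for p :: "nat \<times> nat"
  have cross': "(L i k, L i' l) \<notin> E \<and> L i k \<noteq> L i' l" if "i \<noteq> i'" "i < 3" "i' < 3" "k < t" "l < t" for i i' k l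
  proof (cases "i < i'")
    case True then show ?thesis using cross that by blast
  next
    case False
    then show ?thesis using cross[of i' i l k] that E(1) by (auto dest: symD)
  qed
  have cen': "(L i k, c) \<in> E \<longleftrightarrow> k = 0" if "i < 3" "k < t" for i k
    using cen[OF that] E(1) by (auto dest: symD)
  have cc: "(c, c) \<notin> E" using E(2) by (auto simp: irrefl_def)
  have "inj_on f (claw_dom t)"
  proof (rule inj_onI)
    fix p q assume pq: "p \<in> claw_dom t" "q \<in> claw_dom t" "f p = f q"
    obtain i k i' k' where [simp]: "p = (i, k)" "q = (i', k')" by (cases p, cases q)
    show "p = q"
    proof (cases "k = 0 \<or> k' = 0")
      case True
      have "k > 0 \<Longrightarrow> i < 3 \<and> k - 1 < t" "k' > 0 \<Longrightarrow> i' < 3 \<and> k' - 1 < t"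
        "k = 0 \<Longrightarrow> i = 0" "k' = 0 \<Longrightarrow> i' = 0" using pq by (auto simp: claw_dom_def)
      then show ?thesis using True pq(3) cen[of i "k - 1"] cen[of i' "k' - 1"]
        by (cases "k = 0"; cases "k' = 0") (auto simp: f_def)
    next
      case False
      then have "i < 3" "i' < 3" "k - 1 < t" "k' - 1 < t" "L i (k - 1) = L i' (k' - 1)"
        using pq by (auto simp: claw_dom_def f_def)
      moreover from this have "i = i'" using cross'[of i i' "k - 1" "k' - 1"] by blast
      ultimately have "k - 1 = k' - 1" using inj[of i "k - 1" "k' - 1"] by simp
      then have "k = k'" using False by arith
      then show ?thesis using \<open>i = i'\<close> by simp
    qed
  qed
  moreover have "insert c (\<Union>i<3. L i ` {..<t}) = f ` claw_dom t"
  proof -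
    have "f ` ({..<3} \<times> {1..t}) = (\<Union>i<3. L i ` {..<t})"
    proof (intro equalityI subsetI)
      fix x assume "x \<in> (\<Union>i<3. L i ` {..<t})"
      then obtain i k where "i < 3" "k < t" "x = L i k" by auto
      then show "x \<in> f ` ({..<3} \<times> {1..t})"
        by (intro image_eqI[of _ _ "(i, Suc k)"]) (auto simp: f_def)
    qed (force simp: f_def)
    then show ?thesis by (simp add: claw_dom_def f_def)
  qed
  moreover have "(f p, f q) \<in> E \<longleftrightarrow> claw_adj p q" if "p \<in> claw_dom t" "q \<in> claw_dom t" for p q
  proof -
    obtain i k i' k' where [simp]: "p = (i, k)" "q = (i', k')" by (cases p, cases q)
    consider "k = 0" "k' = 0" | "k = 0" "k' > 0" | "k > 0" "k' = 0" | "k > 0" "k' > 0" by blast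
    then show ?thesis
    proof cases
      case 1 then show ?thesis using cc that by (auto simp: f_def claw_adj_def)
    next
      case 2 
      then have "i' < 3" "k' - 1 < t" using that by (auto simp: claw_dom_def)
      then show ?thesis using 2 cen[of i' "k' - 1"] by (auto simp: f_def claw_adj_def)
    next
      case 3
      then have "i < 3" "k - 1 < t" using that by (auto simp: claw_dom_def)
      then show ?thesis using 3 cen'[of i "k - 1"] by (auto simp: f_def claw_adj_def)
    next
      case 4
      then have "i < 3" "k - 1 < t" "i' < 3" "k' - 1 < t" using that by (auto simp: claw_dom_def)
      then show ?thesis using 4 leg[of i "k - 1" "k' - 1"] cross'[of i i' "k - 1" "k' - 1"]
        by (cases "i = i'") (auto simp: f_def claw_adj_def)
    qed
  qed
  ultimately show ?thesis unfolding claw_set_def by blast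
qed

lemma tri_setI:
  fixes L :: "nat \<Rightarrow> nat \<Rightarrow> 'a"
  assumes E: "sym E" "irrefl E"
    and leg: "\<And>i k l. i < 3 \<Longrightarrow> k < t \<Longrightarrow> l < t \<Longrightarrow> (L i k, L i l) \<in> E \<longleftrightarrow> k = Suc l \<or> l = Suc k"
    and inj: "\<And>i k l. i < 3 \<Longrightarrow> k < t \<Longrightarrow> l < t \<Longrightarrow> L i k = L i l \<Longrightarrow> k = l"
    and cross: "\<And>i i' k l. i < i' \<Longrightarrow> i' < 3 \<Longrightarrow> k < t \<Longrightarrow> l < t \<Longrightarrow>
      ((L i k, L i' l) \<in> E \<longleftrightarrow> k = 0 \<and> l = 0) \<and> L i k \<noteq> L i' l"
  shows "tri_set E t (\<Union>i<3. L i ` {..<t})"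
proof -
  define f where "f p = L (fst p) (snd p - 1)" for p :: "nat \<times> nat"
  have cross': "((L i k, L i' l) \<in> E \<longleftrightarrow> k = 0 \<and> l = 0) \<and> L i k \<noteq> L i' l"
    if "i \<noteq> i'" "i < 3" "i' < 3" "k < t" "l < t" for i i' k l
  proof (cases "i < i'")
    case True then show ?thesis using cross that by blast
  next
    case False
    then show ?thesis using cross[of i' i l k] that E(1) by (auto dest: symD)
  qed
  have "inj_on f (tri_dom t)"
  proof (rule inj_onI)
    fix p q assume pq: "p \<in> tri_dom t" "q \<in> tri_dom t" "f p = f q"
    obtain i k i' k' where [simp]: "p = (i, k)" "q = (i', k')" by (cases p, cases q)
    have "i < 3" "i' < 3" "k - 1 < t" "k' - 1 < t" "k > 0" "k' > 0" "L i (k - 1) = L i' (k' - 1)"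
      using pq by (auto simp: tri_dom_def f_def)
    moreover from this have "i = i'" using cross'[of i i' "k - 1" "k' - 1"] by blast
    ultimately have "k - 1 = k' - 1" using inj[of i "k - 1" "k' - 1"] by simp
    then have "k = k'" using \<open>k > 0\<close> \<open>k' > 0\<close> by arith
    then show "p = q" using \<open>i = i'\<close> by simp
  qed
  moreover have "(\<Union>i<3. L i ` {..<t}) = f ` tri_dom t"
  proof (intro equalityI subsetI)
    fix x assume "x \<in> (\<Union>i<3. L i ` {..<t})"
    then obtain i k where "i < 3" "k < t" "x = L i k" by auto
    then show "x \<in> f ` tri_dom t"
      by (intro image_eqI[of _ _ "(i, Suc k)"]) (auto simp: f_def tri_dom_def)
  qed (force simp: f_def tri_dom_def)
  moreover have "(f p, f q) \<in> E \<longleftrightarrow> tri_adj p q" if "p \<in> tri_dom t" "q \<in> tri_dom t" for p q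
  proof -
    obtain i k i' k' where [simp]: "p = (i, k)" "q = (i', k')" by (cases p, cases q)
    have "i < 3" "k - 1 < t" "i' < 3" "k' - 1 < t" "k > 0" "k' > 0" using that by (auto simp: tri_dom_def)
    then show ?thesis using leg[of i "k - 1" "k' - 1"] cross'[of i i' "k - 1" "k' - 1"]
      by (cases "i = i'") (auto simp: f_def tri_adj_def)
  qed
  ultimately show ?thesis unfolding tri_set_def by blast
qed

lemma less_3_cases: "(i::nat) < 3 \<Longrightarrow> i = 0 \<or> i = 1 \<or> i = 2"
  by auto

text \<open>Let a and b be the first and the last position on \<pi> of a neighbour of
  \<open>\<rho> ! 0\<close>. If a = b, then \<open>\<pi> ! a\<close> is the centre of a claw; if b =
  a + 1, the vertices at a and b form a triangle with \<open>\<rho> ! 0\<close>; otherwise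
  \<open>\<rho> ! 0\<close> is the centre of a claw with two legs starting at a and b. In each case
  \<pi> is followed outwards, where \<open>\<rho> ! 0\<close> has no further neighbours.\<close>

lemma fork_claw_or_tri:
  assumes E: "sym E" "irrefl E" and \<pi>: "ipath E \<pi>" and \<rho>: "ipath E \<rho>" "length \<rho> \<ge> Suc t"
    and disj: "set \<pi> \<inter> set \<rho> = {}"
    and far: "\<And>k x. 0 < k \<Longrightarrow> k < length \<rho> \<Longrightarrow> x \<in> set \<pi> \<Longrightarrow> (\<rho> ! k, x) \<notin> E"
    and ex: "\<exists>j<length \<pi>. (\<rho> ! 0, \<pi> ! j) \<in> E"
    and mid: "\<And>j. j < length \<pi> \<Longrightarrow> (\<rho> ! 0, \<pi> ! j) \<in> E \<Longrightarrow> t \<le> j \<and> j + t < length \<pi>"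
    and t: "t \<ge> 1"
  shows "\<exists>R\<subseteq>set \<pi> \<union> set \<rho>. claw_set E t R \<or> tri_set E t R"
proof -
  define A where "A = {j. j < length \<pi> \<and> (\<rho> ! 0, \<pi> ! j) \<in> E}"
  have fA: "finite A" "A \<noteq> {}" using ex by (auto simp: A_def)
  define a where "a = Min A"
  define b where "b = Max A"
  have ab: "a \<in> A" "b \<in> A" "a \<le> b" using fA by (auto simp: a_def b_def)
  have Aab: "a \<le> j \<and> j \<le> b" if "j \<in> A" for j using fA that by (auto simp: a_def b_def)
  have rng: "t \<le> a" "b + t < length \<pi>" "a < length \<pi>" "b < length \<pi>" using ab mid by (auto simp: A_def)
  have dp: "distinct \<pi>" "distinct \<rho>" using \<pi> \<rho> by (auto simp: ipath_def)
  have pp: "(\<pi> ! i, \<pi> ! j) \<in> E \<longleftrightarrow> j = Suc i \<or> i = Suc j" if "i < length \<pi>" "j < length \<pi>" for i j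
    using \<pi> that by (auto simp: ipath_def)
  have rr: "(\<rho> ! i, \<rho> ! j) \<in> E \<longleftrightarrow> j = Suc i \<or> i = Suc j" if "i < length \<rho>" "j < length \<rho>" for i j
    using \<rho> that by (auto simp: ipath_def)
  have pe: "\<pi> ! i = \<pi> ! j \<longleftrightarrow> i = j" if "i < length \<pi>" "j < length \<pi>" for i j
    using nth_eq_iff_index_eq[OF dp(1)] that by blast
  have re: "\<rho> ! i = \<rho> ! j \<longleftrightarrow> i = j" if "i < length \<rho>" "j < length \<rho>" for i j
    using nth_eq_iff_index_eq[OF dp(2)] that by blast
  have prn: "\<pi> ! i \<noteq> \<rho> ! j" if "i < length \<pi>" "j < length \<rho>" for i j
    using disj that by (metis IntI empty_iff nth_mem)
  have rp: "(\<rho> ! k, \<pi> ! j) \<in> E \<longleftrightarrow> k = 0 \<and> j \<in> A" if "k < length \<rho>" "j < length \<pi>" for k j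
    using far[of k "\<pi> ! j"] that by (cases "k = 0") (auto simp: A_def)
  have pr: "(\<pi> ! j, \<rho> ! k) \<in> E \<longleftrightarrow> k = 0 \<and> j \<in> A" if "k < length \<rho>" "j < length \<pi>" for k j
    using rp[OF that] E(1) by (auto dest: symD)
  have lessT: "k < t \<Longrightarrow> k < length \<rho>" "k < t \<Longrightarrow> Suc k < length \<rho>" for k using \<rho>(2) by auto
  consider "b = a" | "b = Suc a" | "b \<ge> a + 2" using ab(3) by linarith
  then show ?thesis
  proof cases
    case 1
    then have Aa: "j \<in> A \<longleftrightarrow> j = a" for j using Aab ab by (auto intro: antisym)
    \<comment> \<open>No subtraction is truncated, because a is at least t; the same holds for
      \<open>a - k\<close> in the other two cases.\<close>
    define L where "L i k = (if i = 0 then \<pi> ! (a - 1 - k) else if i = 1 then \<pi> ! (a + 1 + k) else \<rho> ! k)"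
      for i k :: nat
    have "claw_set E t (insert (\<pi> ! a) (\<Union>i<3. L i ` {..<t}))"
    proof (rule claw_setI[OF E])
      fix i k l :: nat assume "i < 3" "k < t" "l < t"
      then show "(L i k, L i l) \<in> E \<longleftrightarrow> k = Suc l \<or> l = Suc k"
        using less_3_cases[of i] rng 1 lessT[of k] lessT[of l] by (auto simp: L_def pp rr)
    next
      fix i k l :: nat assume "i < 3" "k < t" "l < t" "L i k = L i l"
      then show "k = l"
        using less_3_cases[of i] rng 1 lessT[of k] lessT[of l] by (auto simp: L_def pe re)
    next
      fix i i' k l :: nat assume as: "i < i'" "i' < 3" "k < t" "l < t"
      then have "(i = 0 \<and> i' = 1) \<or> (i = 0 \<and> i' = 2) \<or> (i = 1 \<and> i' = 2)" by linarith
      then show "(L i k, L i' l) \<notin> E \<and> L i k \<noteq> L i' l"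
        using as rng 1 lessT[of k] lessT[of l] by (auto simp: L_def pe pp pr prn Aa)
    next
      fix i k :: nat assume "i < 3" "k < t"
      then show "\<pi> ! a \<noteq> L i k \<and> ((\<pi> ! a, L i k) \<in> E \<longleftrightarrow> k = 0)"
        using less_3_cases[of i] rng 1 lessT[of k] by (auto simp: L_def pe pp pr prn Aa)
    qed
    moreover have "insert (\<pi> ! a) (\<Union>i<3. L i ` {..<t}) \<subseteq> set \<pi> \<union> set \<rho>"
      using rng 1 lessT by (auto simp: L_def intro!: nth_mem)
    ultimately show ?thesis by blast
  next
    case 2
    define L where "L i k = (if i = 0 then \<pi> ! (a - k) else if i = 1 then \<pi> ! (b + k) else \<rho> ! k)"
      for i k :: nat
    have "tri_set E t (\<Union>i<3. L i ` {..<t})"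
    proof (rule tri_setI[OF E])
      fix i k l :: nat assume "i < 3" "k < t" "l < t"
      then show "(L i k, L i l) \<in> E \<longleftrightarrow> k = Suc l \<or> l = Suc k"
        using less_3_cases[of i] rng 2 lessT[of k] lessT[of l] by (auto simp: L_def pp rr)
    next
      fix i k l :: nat assume "i < 3" "k < t" "l < t" "L i k = L i l"
      then show "k = l"
        using less_3_cases[of i] rng 2 lessT[of k] lessT[of l] by (auto simp: L_def pe re)
    next
      fix i i' k l :: nat assume as: "i < i'" "i' < 3" "k < t" "l < t"
      then have c: "(i = 0 \<and> i' = 1) \<or> (i = 0 \<and> i' = 2) \<or> (i = 1 \<and> i' = 2)" by linarith
      have "a - k \<in> A \<longleftrightarrow> k = 0" "b + k \<in> A \<longleftrightarrow> k = 0"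
        using Aab[of "a - k"] Aab[of "b + k"] ab rng as by auto
      then show "((L i k, L i' l) \<in> E \<longleftrightarrow> k = 0 \<and> l = 0) \<and> L i k \<noteq> L i' l"
        using c as rng 2 lessT[of k] lessT[of l] by (auto simp: L_def pe pp pr prn)
    qed
    moreover have "(\<Union>i<3. L i ` {..<t}) \<subseteq> set \<pi> \<union> set \<rho>"
      using rng 2 lessT by (auto simp: L_def intro!: nth_mem)
    ultimately show ?thesis by blast
  next
    case 3
    \<comment> \<open>The stretch of \<pi> strictly between a and b is dropped, as
      \<open>\<rho> ! 0\<close> may have any neighbours there. It is nonempty, so the two legs are
      not adjacent. The third leg starts at \<open>\<rho> ! 1\<close>, which is why \<rho> must have
      t + 1 vertices.\<close>
    define L where "L i k = (if i = 0 then \<pi> ! (a - k) else if i = 1 then \<pi> ! (b + k) else \<rho> ! Suc k)"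
      for i k :: nat
    have r0: "0 < length \<rho>" using \<rho>(2) by linarith
    have "claw_set E t (insert (\<rho> ! 0) (\<Union>i<3. L i ` {..<t}))"
    proof (rule claw_setI[OF E])
      fix i k l :: nat assume "i < 3" "k < t" "l < t"
      then show "(L i k, L i l) \<in> E \<longleftrightarrow> k = Suc l \<or> l = Suc k"
        using less_3_cases[of i] rng 3 lessT[of k] lessT[of l] by (auto simp: L_def pp rr)
    next
      fix i k l :: nat assume "i < 3" "k < t" "l < t" "L i k = L i l"
      then show "k = l"
        using less_3_cases[of i] rng 3 lessT[of k] lessT[of l] by (auto simp: L_def pe re)
    next
      fix i i' k l :: nat assume as: "i < i'" "i' < 3" "k < t" "l < t"
      then have c: "(i = 0 \<and> i' = 1) \<or> (i = 0 \<and> i' = 2) \<or> (i = 1 \<and> i' = 2)" by linarith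
      then show "(L i k, L i' l) \<notin> E \<and> L i k \<noteq> L i' l"
        using as rng 3 lessT[of k] lessT[of l] by (auto simp: L_def pe pp pr prn)
    next
      fix i k :: nat assume as: "i < 3" "k < t"
      have "a - k \<in> A \<longleftrightarrow> k = 0" "b + k \<in> A \<longleftrightarrow> k = 0"
        using Aab[of "a - k"] Aab[of "b + k"] ab rng as by auto
      moreover have "a - k < length \<pi>" "b + k < length \<pi>" using rng as by auto
      ultimately show "\<rho> ! 0 \<noteq> L i k \<and> ((\<rho> ! 0, L i k) \<in> E \<longleftrightarrow> k = 0)"
        using as less_3_cases[of i] rng 3 lessT[of k] r0 prn[of "a - k" 0] prn[of "b + k" 0]
        by (auto simp: L_def re rr rp)
    qed
    moreover have "insert (\<rho> ! 0) (\<Union>i<3. L i ` {..<t}) \<subseteq> set \<pi> \<union> set \<rho>"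
      using rng 3 lessT r0 by (auto simp: L_def intro!: nth_mem)
    ultimately show ?thesis by blast
  qed
qed

section \<open>Legs at a connected set\<close>

text \<open>There are t + 1 vertices: the head, the only one with neighbours in X, may be used up by
  the connection through X, and t vertices remain for a leg of a claw.\<close>

definition leg :: "'a rel \<Rightarrow> 'a set \<Rightarrow> nat \<Rightarrow> 'a list \<Rightarrow> bool" where
  "leg E X t p \<longleftrightarrow> ipath E p \<and> length p = Suc t \<and> set p \<inter> X = {} \<and> (\<exists>x\<in>X. (hd p, x) \<in> E) \<and>
     (\<forall>y\<in>set (tl p). \<forall>x\<in>X. (y, x) \<notin> E)"

lemma ipath_adj: "ipath E xs \<Longrightarrow> Suc i < length xs \<Longrightarrow> (xs ! i, xs ! Suc i) \<in> E \<and> (xs ! Suc i, xs ! i) \<in> E"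
  by (simp add: ipath_def)

lemma ipath_hd_tl:
  assumes "ipath E p" "p \<noteq> []" "tl p \<noteq> []" "y \<in> set (tl p)"
  shows "(hd p, y) \<in> E \<longleftrightarrow> y = hd (tl p)" "(y, hd p) \<in> E \<longleftrightarrow> y = hd (tl p)" "y \<noteq> hd p"
proof -
  have d: "distinct p" using assms by (simp add: ipath_def)
  obtain k where k: "k < length p - 1" "y = p ! Suc k" using assms(4) by (auto simp: in_set_conv_nth nth_tl)
  have h: "hd p = p ! 0" "hd (tl p) = p ! 1" using assms by (cases p; cases "tl p"; simp)+
  have l: "Suc k < length p" "1 < length p" using k by auto
  have e: "y = hd (tl p) \<longleftrightarrow> k = 0" using nth_eq_iff_index_eq[OF d l] k h by simp
  have "(p ! i, p ! j) \<in> E \<longleftrightarrow> j = Suc i \<or> i = Suc j" if "i < length p" "j < length p" for i j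
    using assms(1) that by (simp add: ipath_def)
  from this[of 0 "Suc k"] this[of "Suc k" 0] l assms(2)
  have "(p ! 0, p ! Suc k) \<in> E \<longleftrightarrow> k = 0" "(p ! Suc k, p ! 0) \<in> E \<longleftrightarrow> k = 0"
    by auto
  then show "(hd p, y) \<in> E \<longleftrightarrow> y = hd (tl p)" "(y, hd p) \<in> E \<longleftrightarrow> y = hd (tl p)" using e k h by auto
  have "p ! Suc k \<noteq> p ! 0" using nth_eq_iff_index_eq[OF d l(1), of 0] assms(2) by simp
  then show "y \<noteq> hd p" using k h by simp
qed

text \<open>A shortest path from \<open>hd p1\<close> to \<open>hd p2\<close> through X, prolonged
  by both tails, is an induced path \<pi>. A shortest path \<sigma> from \<open>hd p3\<close>
  through X to a vertex with a neighbour on \<pi>, read backwards and prolonged by the third tail,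
  is the path \<rho> of \<open>fork_claw_or_tri\<close>. The last vertex of \<sigma> sees nothing of
  the first two tails, so its neighbours on \<pi> have distance at least t from both ends of the
  list.\<close>

lemma three_legs:
  assumes E: "sym E" "irrefl E" and X: "conn E X" and t: "t \<ge> 1"
    and l1: "leg E X t p1" and l2: "leg E X t p2" and l3: "leg E X t p3"
    and a12: "anticomplete E (set p1) (set p2)" and a13: "anticomplete E (set p1) (set p3)"
    and a23: "anticomplete E (set p2) (set p3)"
  shows "\<exists>R\<subseteq>X \<union> set p1 \<union> set p2 \<union> set p3. claw_set E t R \<or> tri_set E t R"
proof -
  have symE: "(y, x) \<in> E" if "(x, y) \<in> E" for x y using symD[OF E(1) that] .
  have ne: "p \<noteq> []" "tl p \<noteq> []" "hd p \<in> set p" "set (tl p) \<subseteq> set p" "set p = insert (hd p) (set (tl p))"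
    "length (tl p) = t" if "leg E X t p" for p
    using that t by (cases p; auto simp: leg_def)+
  note n1 = ne[OF l1] and n2 = ne[OF l2] and n3 = ne[OF l3]
  have i1: "ipath E p1" and i2: "ipath E p2" and i3: "ipath E p3" using l1 l2 l3 by (auto simp: leg_def)
  obtain x1 x2 x3 where x: "x1 \<in> X" "(hd p1, x1) \<in> E" "x2 \<in> X" "(hd p2, x2) \<in> E" "x3 \<in> X" "(hd p3, x3) \<in> E"
    using l1 l2 l3 by (auto simp: leg_def)
  have nX: "set p1 \<inter> X = {}" "set p2 \<inter> X = {}" "set p3 \<inter> X = {}" using l1 l2 l3 by (auto simp: leg_def)
  have tX: "(y, z) \<notin> E" "(z, y) \<notin> E" if "z \<in> X" "y \<in> set (tl p1) \<union> set (tl p2) \<union> set (tl p3)" for y z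
    using that l1 l2 l3 symE[of z y] by (auto simp: leg_def)
  have d12: "set p1 \<inter> set p2 = {}" "\<And>y z. y \<in> set p1 \<Longrightarrow> z \<in> set p2 \<Longrightarrow> (y, z) \<notin> E \<and> (z, y) \<notin> E"
    and d13: "set p1 \<inter> set p3 = {}" "\<And>y z. y \<in> set p1 \<Longrightarrow> z \<in> set p3 \<Longrightarrow> (y, z) \<notin> E \<and> (z, y) \<notin> E"
    and d23: "set p2 \<inter> set p3 = {}" "\<And>y z. y \<in> set p2 \<Longrightarrow> z \<in> set p3 \<Longrightarrow> (y, z) \<notin> E \<and> (z, y) \<notin> E"
    using a12 a13 a23 symE unfolding anticomplete_def by blast+
  have reach: "(y, z) \<in> (E \<inter> U \<times> U)\<^sup>*" if "x \<in> X" "(y, x) \<in> E" "z \<in> X" "X \<subseteq> U" "y \<in> U" for x y z U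
  proof -
    have "(y, x) \<in> E \<inter> U \<times> U" using that by auto
    moreover have "(x, z) \<in> (E \<inter> U \<times> U)\<^sup>*" using rtrancl_restrict_mono[OF connD[OF X that(1,3)] that(4)] .
    ultimately show ?thesis by (rule converse_rtrancl_into_rtrancl)
  qed
  define U where "U = insert (hd p1) (insert (hd p2) X)"
  have "(hd p1, x2) \<in> (E \<inter> U \<times> U)\<^sup>*" by (rule reach[OF x(1,2,3)]) (auto simp: U_def)
  moreover have "(x2, hd p2) \<in> E \<inter> U \<times> U" using x symE by (auto simp: U_def)
  ultimately have rU: "(hd p1, hd p2) \<in> (E \<inter> U \<times> U)\<^sup>*" by (rule rtrancl_into_rtrancl)
  have "hd p1 \<in> U" by (simp add: U_def)
  note sp = shortest_ipath[OF E this rU, of "\<lambda>z. z = hd p2"]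
  then obtain xs where xs: "ipath E xs" "xs \<noteq> []" "hd xs = hd p1" "set xs \<subseteq> U" "last xs = hd p2"
    by (rule sp) auto
  define \<pi> where "\<pi> = (rev (tl p1) @ xs) @ tl p2"
  have "hd p1 \<notin> set (tl p1)" "hd p2 \<notin> set (tl p2)"
    using ipath_hd_tl(3)[OF i1 n1(1,2)] ipath_hd_tl(3)[OF i2 n2(1,2)] by blast+
  then have tl1: "set (tl p1) \<inter> U = {}" and tl2: "set (tl p2) \<inter> U = {}"
    using nX d12 n1 n2 by (auto simp: U_def)
  have ip1: "ipath E (rev (tl p1) @ xs)"
  proof (rule ipath_append[OF E(1) _ _ xs(1,2)])
    show "ipath E (rev (tl p1))" using i1 by (simp add: ipath_rev ipath_tl)
    show "rev (tl p1) \<noteq> []" using n1 by simp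
    show "set (rev (tl p1)) \<inter> set xs = {}" using tl1 xs by auto
    fix y z assume y: "y \<in> set (rev (tl p1))" and z: "z \<in> set xs"
    then have "z = hd p1 \<or> z = hd p2 \<or> z \<in> X" using xs(4) by (auto simp: U_def)
    moreover have "last (rev (tl p1)) = hd (tl p1)" using n1 by (simp add: last_rev)
    moreover have "hd p1 \<noteq> hd p2" "hd p1 \<notin> X" using d12 n1 n2 nX by auto
    ultimately show "(y, z) \<in> E \<longleftrightarrow> y = last (rev (tl p1)) \<and> z = hd xs"
      using y ipath_hd_tl(2)[OF i1 n1(1,2), of y] tX[of z y] d12(2)[of y "hd p2"] n1 n2 xs(3) by auto
  qed
  have ipi: "ipath E \<pi>" unfolding \<pi>_def
  proof (rule ipath_append[OF E(1) ip1 _ ipath_tl[OF i2] n2(2)])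
    show "rev (tl p1) @ xs \<noteq> []" using xs by simp
    show "set (rev (tl p1) @ xs) \<inter> set (tl p2) = {}" using tl2 xs d12 n1 n2 by auto
    fix y z assume y: "y \<in> set (rev (tl p1) @ xs)" and z: "z \<in> set (tl p2)"
    then have "y \<in> set (tl p1) \<or> y = hd p1 \<or> y = hd p2 \<or> y \<in> X" using xs(4) by (auto simp: U_def)
    then have c: "y \<in> set p1 \<or> y = hd p2 \<or> y \<in> X" using n1 by auto
    have l: "last (rev (tl p1) @ xs) = hd p2" using xs by simp
    have "hd p2 \<notin> X" "hd p2 \<notin> set p1" using d12 n2 nX by auto
    then show "(y, z) \<in> E \<longleftrightarrow> y = last (rev (tl p1) @ xs) \<and> z = hd (tl p2)"
      using c l ipath_hd_tl(1)[OF i2 n2(1,2) z] tX[of y z] d12(2)[of y z] z n2 by auto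
  qed
  have set_pi: "set \<pi> \<subseteq> set p1 \<union> set p2 \<union> X" using xs(4) n1 n2 by (auto simp: \<pi>_def U_def)
  have len_pi: "length \<pi> = 2 * t + length xs" using n1 n2 by (simp add: \<pi>_def)
  have hd1: "hd p1 \<in> set \<pi>" using xs by (metis UnCI \<pi>_def hd_in_set set_append)
  define P where "P z \<longleftrightarrow> (\<exists>y\<in>set \<pi>. (z, y) \<in> E)" for z
  have "P x1" using x symE hd1 by (auto simp: P_def)
  moreover have "(hd p3, x1) \<in> (E \<inter> insert (hd p3) X \<times> insert (hd p3) X)\<^sup>*"
    by (rule reach[OF x(5,6,1)]) auto
  ultimately obtain \<sigma> where \<sigma>: "ipath E \<sigma>" "\<sigma> \<noteq> []" "hd \<sigma> = hd p3" "set \<sigma> \<subseteq> insert (hd p3) X" "P (last \<sigma>)"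
    "\<And>z. z \<in> set (butlast \<sigma>) \<Longrightarrow> \<not> P z"
    using shortest_ipath[OF E, of "hd p3" "insert (hd p3) X" x1 P] by blast
  define \<rho> where "\<rho> = rev \<sigma> @ tl p3"
  have "hd p3 \<notin> set (tl p3)" using ipath_hd_tl(3)[OF i3 n3(1,2)] by blast
  then have tl3: "set (tl p3) \<inter> insert (hd p3) X = {}" using nX n3 by auto
  have irho: "ipath E \<rho>" unfolding \<rho>_def
  proof (rule ipath_append[OF E(1) _ _ ipath_tl[OF i3] n3(2)])
    show "ipath E (rev \<sigma>)" using \<sigma> by (simp add: ipath_rev)
    show "rev \<sigma> \<noteq> []" using \<sigma> by simp
    show "set (rev \<sigma>) \<inter> set (tl p3) = {}" using tl3 \<sigma> by auto
    fix y z assume y: "y \<in> set (rev \<sigma>)" and z: "z \<in> set (tl p3)"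
    then have "y = hd p3 \<or> y \<in> X" using \<sigma> by auto
    moreover have "last (rev \<sigma>) = hd p3" using \<sigma> by (simp add: last_rev)
    moreover have "hd p3 \<notin> X" using nX n3 by auto
    ultimately show "(y, z) \<in> E \<longleftrightarrow> y = last (rev \<sigma>) \<and> z = hd (tl p3)"
      using ipath_hd_tl(1)[OF i3 n3(1,2) z] tX[of y z] z by auto
  qed
  \<comment> \<open>\<pi> has at least two vertices, so each of them has a neighbour on \<pi> and
    satisfies P; hence \<sigma> stops before it could enter \<pi>.\<close>
  have Ppi: "P z" if "z \<in> set \<pi>" for z
  proof -
    have "\<exists>i<length \<pi>. \<pi> ! i = z" using that by (simp only: in_set_conv_nth)
    then obtain i where i: "i < length \<pi>" "z = \<pi> ! i" by blast
    have "2 \<le> length \<pi>" using len_pi t by linarith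
    then have "Suc i < length \<pi> \<or> i > 0 \<and> Suc (i - 1) < length \<pi>" using i by auto
    then have "\<exists>j<length \<pi>. (\<pi> ! i, \<pi> ! j) \<in> E"
    proof
      assume "Suc i < length \<pi>"
      then show ?thesis using ipath_adj[OF ipi, of i] by blast
    next
      assume a: "i > 0 \<and> Suc (i - 1) < length \<pi>"
      then have "(\<pi> ! i, \<pi> ! (i - 1)) \<in> E" using ipath_adj[OF ipi, of "i - 1"] i(1) by simp
      then show ?thesis using a by (intro exI[of _ "i - 1"]) simp
    qed
    then show ?thesis using i by (auto simp: P_def)
  qed
  have h3: "hd p3 \<notin> set \<pi>" using set_pi d13 d23 nX n3 by auto
  have disj_sigma: "set \<sigma> \<inter> set \<pi> = {}"
  proof (rule ccontr)
    assume "set \<sigma> \<inter> set \<pi> \<noteq> {}"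
    then obtain z where z: "z \<in> set \<sigma>" "z \<in> set \<pi>" by auto
    have sb: "set \<sigma> = insert (last \<sigma>) (set (butlast \<sigma>))"
      using \<sigma>(2) by (metis append_butlast_last_id list.simps(15) rotate1.simps(2) set_rotate1)
    have zl: "z = last \<sigma>" using z sb \<sigma>(6) Ppi by blast
    have "length \<sigma> \<noteq> 1"
    proof
      assume "length \<sigma> = 1"
      then have "last \<sigma> = hd \<sigma>" by (cases \<sigma>) auto
      then show False using zl z h3 \<sigma>(3) by simp
    qed
    then obtain k where k: "length \<sigma> = Suc (Suc k)" using \<sigma>(2) by (cases \<sigma> rule: list.exhaust; cases "length \<sigma> - 2") (auto simp: Suc_le_eq neq_Nil_conv)
    have "(\<sigma> ! k, \<sigma> ! Suc k) \<in> E" using ipath_adj[OF \<sigma>(1), of k] k by simp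
    moreover have "\<sigma> ! Suc k = z" using zl \<sigma>(2) k by (simp add: last_conv_nth)
    moreover have "\<sigma> ! k \<in> set (butlast \<sigma>)" using k by (auto simp: in_set_conv_nth nth_butlast intro!: exI[of _ k])
    ultimately show False using \<sigma>(6) z unfolding P_def by blast
  qed
  have lenr: "length \<rho> = length \<sigma> + t" using n3 by (simp add: \<rho>_def)
  have r0: "\<rho> ! 0 = last \<sigma>" using \<sigma>(2) by (simp add: \<rho>_def nth_append rev_nth last_conv_nth)
  have tlr: "set (tl \<rho>) \<subseteq> set (butlast \<sigma>) \<union> set (tl p3)"
  proof -
    have "tl (rev \<sigma>) = rev (butlast \<sigma>)" by (metis butlast_rev rev_rev_ident)
    then show ?thesis using \<sigma>(2) by (simp add: \<rho>_def)
  qed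
  have "\<exists>R\<subseteq>set \<pi> \<union> set \<rho>. claw_set E t R \<or> tri_set E t R"
  proof (rule fork_claw_or_tri[OF E ipi irho _ _ _ _ _ t])
    show "Suc t \<le> length \<rho>" using lenr \<sigma>(2) by (cases \<sigma>) auto
    show "set \<pi> \<inter> set \<rho> = {}" using disj_sigma set_pi n3 nX d13 d23 by (auto simp: \<rho>_def)
    show "\<exists>j<length \<pi>. (\<rho> ! 0, \<pi> ! j) \<in> E" using \<sigma>(5) r0 by (auto simp: P_def in_set_conv_nth)
  next
    fix k z assume k: "0 < k" "k < length \<rho>" and z: "z \<in> set \<pi>"
    have "\<rho> ! k = tl \<rho> ! (k - 1)" "k - 1 < length (tl \<rho>)" using k by (auto simp: nth_tl)
    then have "\<rho> ! k \<in> set (tl \<rho>)" by simp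
    then consider "\<rho> ! k \<in> set (butlast \<sigma>)" | "\<rho> ! k \<in> set (tl p3)" using tlr by auto
    then show "(\<rho> ! k, z) \<notin> E"
    proof cases
      case 1 then show ?thesis using \<sigma>(6) z by (auto simp: P_def)
    next
      case 2
      then show ?thesis using z set_pi tX[of z "\<rho> ! k"] d13(2)[of z "\<rho> ! k"] d23(2)[of z "\<rho> ! k"] n3 by auto
    qed
  next
    fix j assume j: "j < length \<pi>" "(\<rho> ! 0, \<pi> ! j) \<in> E"
    have "last \<sigma> \<in> insert (hd p3) X" using last_in_set[OF \<sigma>(2)] \<sigma>(4) by blast
    then have no: "(\<rho> ! 0, y) \<notin> E" if "y \<in> set (tl p1) \<union> set (tl p2)" for y
      using that r0 tX[of "last \<sigma>" y] d13(2)[of y "hd p3"] d23(2)[of y "hd p3"] n1 n2 n3 by auto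
    show "t \<le> j \<and> j + t < length \<pi>"
    proof (rule ccontr)
      assume "\<not> ?thesis"
      then consider "j < t" | "t + length xs \<le> j" using len_pi by linarith
      then have "\<pi> ! j \<in> set (tl p1) \<union> set (tl p2)"
      proof cases
        case 1
        then have "\<pi> ! j = rev (tl p1) ! j" "j < length (rev (tl p1))" using n1 by (auto simp: \<pi>_def nth_append)
        then show ?thesis by (metis UnI1 nth_mem set_rev)
      next
        case 2
        then have "\<pi> ! j = tl p2 ! (j - (t + length xs))" "j - (t + length xs) < length (tl p2)"
          using n1 n2 j len_pi by (auto simp: \<pi>_def nth_append)
        then show ?thesis by (metis UnI2 nth_mem)
      qed
      then show False using no j by blast
    qed
  qed
  moreover have "set \<pi> \<union> set \<rho> \<subseteq> X \<union> set p1 \<union> set p2 \<union> set p3"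
    using set_pi \<sigma>(4) n3 by (auto simp: \<rho>_def)
  ultimately show ?thesis by (meson subset_trans)
qed

text \<open>By \<open>three_legs\<close> there are no three pairwise anticomplete legs, so packing
  fails already for N = 3. Legs avoid X, and therefore X can be removed from the hitting
  set.\<close>

lemma leg_hitting_setE:
  fixes t s :: nat
  assumes t: "t \<ge> 1"
  obtains C where "\<And>(V::'a set) E X. finite V \<Longrightarrow> sym E \<Longrightarrow> irrefl E \<Longrightarrow> biclique_free V E s \<Longrightarrow>
     (\<And>R. R \<subseteq> V \<Longrightarrow> \<not> claw_set E t R \<and> \<not> tri_set E t R) \<Longrightarrow> X \<subseteq> V \<Longrightarrow> conn E X \<Longrightarrow>
     \<exists>Z\<subseteq>V - X. alpha_le E Z C \<and> (\<forall>p. leg E X t p \<longrightarrow> set p \<subseteq> V \<longrightarrow> set p \<inter> Z \<noteq> {})"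
proof (rule packing_or_hitting_setE[where t = s and r = "Suc t" and N = 3, where 'a = 'a])
  fix C assume C: "\<And>(V::'a set) E \<R>. finite V \<Longrightarrow> sym E \<Longrightarrow> biclique_free V E s \<Longrightarrow>
     (\<And>R. R \<in> \<R> \<Longrightarrow> R \<subseteq> V \<and> R \<noteq> {} \<and> card R \<le> Suc t) \<Longrightarrow>
     (\<exists>\<S>\<subseteq>\<R>. finite \<S> \<and> card \<S> = 3 \<and> pairwise (anticomplete E) \<S>) \<or>
     (\<exists>Z\<subseteq>V. alpha_le E Z C \<and> (\<forall>R\<in>\<R>. R \<inter> Z \<noteq> {}))"
  show thesis
  proof (rule that[of C])
    fix V :: "'a set" and E X
    assume V: "finite V" and E: "sym E" "irrefl E" and bf: "biclique_free V E s"
      and no: "\<And>R. R \<subseteq> V \<Longrightarrow> \<not> claw_set E t R \<and> \<not> tri_set E t R" and X: "X \<subseteq> V" "conn E X"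
    define \<R> where "\<R> = {set p |p. leg E X t p \<and> set p \<subseteq> V}"
    have "(\<exists>\<S>\<subseteq>\<R>. finite \<S> \<and> card \<S> = 3 \<and> pairwise (anticomplete E) \<S>) \<or>
     (\<exists>Z\<subseteq>V. alpha_le E Z C \<and> (\<forall>R\<in>\<R>. R \<inter> Z \<noteq> {}))"
    proof (rule C[OF V E(1) bf])
      fix R assume "R \<in> \<R>"
      then obtain p where "leg E X t p" "set p \<subseteq> V" "R = set p" by (auto simp: \<R>_def)
      then show "R \<subseteq> V \<and> R \<noteq> {} \<and> card R \<le> Suc t"
        using card_length[of p] by (auto simp: leg_def)
    qed
    then show "\<exists>Z\<subseteq>V - X. alpha_le E Z C \<and> (\<forall>p. leg E X t p \<longrightarrow> set p \<subseteq> V \<longrightarrow> set p \<inter> Z \<noteq> {})"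
    proof
      assume "\<exists>\<S>\<subseteq>\<R>. finite \<S> \<and> card \<S> = 3 \<and> pairwise (anticomplete E) \<S>"
      then obtain \<S> where "\<S> \<subseteq> \<R>" "card \<S> = 3" and pw: "pairwise (anticomplete E) \<S>" by blast
      then obtain A B D where S: "{A, B, D} \<subseteq> \<R>" "\<S> = {A, B, D}" "A \<noteq> B" "A \<noteq> D" "B \<noteq> D"
        by (auto simp: card_3_iff)
      then obtain p1 p2 p3 where p: "A = set p1" "leg E X t p1" "set p1 \<subseteq> V" "B = set p2" "leg E X t p2" "set p2 \<subseteq> V"
        "D = set p3" "leg E X t p3" "set p3 \<subseteq> V" by (auto simp: \<R>_def)
      have ac: "anticomplete E (set p1) (set p2)" "anticomplete E (set p1) (set p3)"
        "anticomplete E (set p2) (set p3)"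
        using pw S p unfolding pairwise_def by auto
      obtain R where R: "R \<subseteq> X \<union> set p1 \<union> set p2 \<union> set p3" "claw_set E t R \<or> tri_set E t R"
        using three_legs[OF E X(2) t p(2,5,8) ac] by blast
      then have "R \<subseteq> V" using p X by blast
      then show ?thesis using no[of R] R(2) by simp
    next
      assume "\<exists>Z\<subseteq>V. alpha_le E Z C \<and> (\<forall>R\<in>\<R>. R \<inter> Z \<noteq> {})"
      then obtain Z where Z: "Z \<subseteq> V" "alpha_le E Z C" "\<And>R. R \<in> \<R> \<Longrightarrow> R \<inter> Z \<noteq> {}" by blast
      have "alpha_le E (Z - X) C" using Z(2) by (rule alpha_le_mono) auto
      moreover have "set p \<inter> (Z - X) \<noteq> {}" if p: "leg E X t p" "set p \<subseteq> V" for p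
      proof -
        have "set p \<inter> Z \<noteq> {}" using that by (intro Z(3)) (auto simp: \<R>_def)
        moreover have "set p \<inter> X = {}" using p by (simp add: leg_def)
        ultimately show ?thesis by blast
      qed
      ultimately show ?thesis using Z(1) by (intro exI[of _ "Z - X"]) auto
    qed
  qed
qed

subsection \<open>Havens\<close>

text \<open>The havens of Seymour and Thomas, except that the order refers to the independence number of the
  separators and not to their size.\<close>

definition haven :: "'a set \<Rightarrow> 'a rel \<Rightarrow> nat \<Rightarrow> ('a set \<Rightarrow> 'a set) \<Rightarrow> bool" where
  "haven V E k \<beta> \<longleftrightarrow>
     (\<forall>Y\<subseteq>V. alpha_le E Y k \<longrightarrow> \<beta> Y \<noteq> {} \<and> \<beta> Y \<subseteq> V - Y \<and> conn E (\<beta> Y) \<and>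
        (\<forall>x\<in>\<beta> Y. \<forall>y\<in>V - Y. (x, y) \<in> E \<longrightarrow> y \<in> \<beta> Y)) \<and>
     (\<forall>Y Y'. Y \<subseteq> Y' \<longrightarrow> Y' \<subseteq> V \<longrightarrow> alpha_le E Y' k \<longrightarrow> \<beta> Y' \<subseteq> \<beta> Y)"

lemma havenD:
  assumes "haven V E k \<beta>" "Y \<subseteq> V" "alpha_le E Y k"
  shows "\<beta> Y \<noteq> {}" "\<beta> Y \<subseteq> V - Y" "conn E (\<beta> Y)"
    "\<And>x y. x \<in> \<beta> Y \<Longrightarrow> y \<in> V \<Longrightarrow> y \<notin> Y \<Longrightarrow> (x, y) \<in> E \<Longrightarrow> y \<in> \<beta> Y"
  using assms unfolding haven_def by blast+

lemma haven_mono: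
  assumes "haven V E k \<beta>" "Y \<subseteq> Y'" "Y' \<subseteq> V" "alpha_le E Y' k"
  shows "\<beta> Y' \<subseteq> \<beta> Y"
  using assms unfolding haven_def by blast

text \<open>The deleted set L is added to every separator, which costs l of the order.\<close>

lemma haven_delete:
  assumes h: "haven V E (k + l) \<beta>" and L: "L \<subseteq> V" "alpha_le E L l"
  shows "haven (V - L) E k (\<lambda>Y. \<beta> (Y \<union> L))"
proof -
  have a: "Y \<union> L \<subseteq> V" "alpha_le E (Y \<union> L) (k + l)" if "Y \<subseteq> V - L" "alpha_le E Y k" for Y
    using that L alpha_le_Un by auto
  have 1: "\<beta> (Y \<union> L) \<noteq> {} \<and> \<beta> (Y \<union> L) \<subseteq> (V - L) - Y \<and> conn E (\<beta> (Y \<union> L)) \<and>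
        (\<forall>x\<in>\<beta> (Y \<union> L). \<forall>y\<in>(V - L) - Y. (x, y) \<in> E \<longrightarrow> y \<in> \<beta> (Y \<union> L))"
    if "Y \<subseteq> V - L" "alpha_le E Y k" for Y
    using havenD[OF h a[OF that]] by auto
  have 2: "\<beta> (Y' \<union> L) \<subseteq> \<beta> (Y \<union> L)" if "Y \<subseteq> Y'" "Y' \<subseteq> V - L" "alpha_le E Y' k" for Y Y'
    using that a[OF that(2,3)] by (intro haven_mono[OF h]) auto
  show ?thesis unfolding haven_def using 1 2 by auto
qed

text \<open>The component of x in the subgraph induced by U. For x outside U the value is the
  singleton of x.\<close>

definition comp :: "'a rel \<Rightarrow> 'a set \<Rightarrow> 'a \<Rightarrow> 'a set" where
  "comp E U x = {y. (x, y) \<in> (E \<inter> U \<times> U)\<^sup>*}"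

lemma comp_subset: "x \<in> U \<Longrightarrow> comp E U x \<subseteq> U"
proof
  fix y assume "x \<in> U" "y \<in> comp E U x"
  then have "(x, y) \<in> (E \<inter> U \<times> U)\<^sup>*" by (simp add: comp_def)
  then show "y \<in> U" using \<open>x \<in> U\<close> by (induction) auto
qed

lemma comp_self: "x \<in> comp E U x"
  by (simp add: comp_def)

lemma comp_closed: "x \<in> U \<Longrightarrow> y \<in> comp E U x \<Longrightarrow> z \<in> U \<Longrightarrow> (y, z) \<in> E \<Longrightarrow> z \<in> comp E U x"
  using comp_subset[of x U E] by (auto simp: comp_def intro: rtrancl_into_rtrancl)

lemma conn_comp:
  assumes "sym E" "x \<in> U"
  shows "conn E (comp E U x)"
proof -
  have a: "(x, y) \<in> (E \<inter> comp E U x \<times> comp E U x)\<^sup>*" if "y \<in> comp E U x" for y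
  proof -
    have "(x, y) \<in> (E \<inter> U \<times> U)\<^sup>*" using that by (simp add: comp_def)
    then show ?thesis
    proof (induction)
      case (step y z)
      then have "(x, z) \<in> (E \<inter> U \<times> U)\<^sup>*" by (auto intro: rtrancl_into_rtrancl)
      then have "(y, z) \<in> E \<inter> comp E U x \<times> comp E U x" using step by (auto simp: comp_def)
      then show ?case using step by (auto intro: rtrancl_into_rtrancl)
    qed simp
  qed
  show ?thesis unfolding conn_def
    using a rtrancl_restrict_sym[OF assms(1)] by (meson rtrancl_trans)
qed

lemma conn_subset_closed:
  assumes "conn E X" "X \<inter> C \<noteq> {}" "\<And>x y. x \<in> C \<Longrightarrow> y \<in> X \<Longrightarrow> (x, y) \<in> E \<Longrightarrow> y \<in> C"
  shows "X \<subseteq> C"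
proof
  obtain c where c: "c \<in> X" "c \<in> C" using assms by auto
  fix x assume "x \<in> X"
  then have "(c, x) \<in> (E \<inter> X \<times> X)\<^sup>*" using assms(1) c by (auto simp: conn_def)
  then show "x \<in> C" using c assms(3) by (induction) auto
qed

lemma conn_subset_comp: "conn E X \<Longrightarrow> X \<subseteq> U \<Longrightarrow> x \<in> X \<Longrightarrow> X \<subseteq> comp E U x"
  using rtrancl_restrict_mono[of x _ E X U] by (auto simp: conn_def comp_def)

text \<open>Otherwise the component of b in U would be closed under adjacency in W and thus equal to
  the connected set W.\<close>

lemma frontier:
  assumes W: "conn E W" and U: "U \<subseteq> W" "U \<noteq> W" and b: "b \<in> U"
  shows "\<exists>y\<in>W - U. \<exists>d\<in>comp E U b. (d, y) \<in> E"
proof (rule ccontr)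
  assume a: "\<not> ?thesis"
  have "W \<subseteq> comp E U b"
  proof (rule conn_subset_closed[OF W])
    show "W \<inter> comp E U b \<noteq> {}" using b U comp_self[of b E U] by auto
    fix x y assume "x \<in> comp E U b" "y \<in> W" "(x, y) \<in> E"
    then show "y \<in> comp E U b" using a comp_closed[OF b, of x E y] by blast
  qed
  then show False using comp_subset[OF b, of E] U by auto
qed

subsection \<open>Graphs all of whose vertices are separated from the haven\<close>

text \<open>X may meet the separator Y. Anticomplete includes disjoint, so \<beta> Y contains
  neither a vertex of X nor a neighbour of one.\<close>

definition light :: "'a set \<Rightarrow> 'a rel \<Rightarrow> ('a set \<Rightarrow> 'a set) \<Rightarrow> nat \<Rightarrow> 'a set \<Rightarrow> bool" where
  "light V E \<beta> j X \<longleftrightarrow> (\<exists>Y\<subseteq>V. alpha_le E Y j \<and> anticomplete E X (\<beta> Y))"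

text \<open>Gyarfas' path argument: a leg at \<open>X\<close> is grown towards the haven, one vertex at a time.\<close>

lemma gyarfas_leg:
  assumes V: "finite V" and E: "sym E" "irrefl E" and h: "haven V E k \<beta>" and X: "X \<noteq> {}"
    and W: "conn E W" "W \<subseteq> V" "X \<subseteq> W"
    and Y0: "Y0 \<subseteq> V" "alpha_le E Y0 k1" "\<beta> Y0 \<subseteq> W" "anticomplete E X (\<beta> Y0)"
    and li: "\<And>v. v \<in> V \<Longrightarrow> light V E \<beta> k0 {v}" and k: "k1 + Suc t * k0 \<le> k"
  shows "\<exists>p. leg E X t p \<and> set p \<subseteq> W"
proof -
  have symE: "(y, x) \<in> E" if "(x, y) \<in> E" for x y using symD[OF E(1) that] .
  \<comment> \<open>Invariant: D is connected, contains the side \<beta> Y of the haven, and is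
    attached to X and p only through the last vertex of p. Each prolongation of p adds one separator
    of independence number at most k0 to Y.\<close>
  have "\<exists>p Y D. leg E X n p \<and> set p \<subseteq> W \<and> Y \<subseteq> V \<and> alpha_le E Y (k1 + n * k0) \<and> conn E D \<and> D \<subseteq> W \<and>
      \<beta> Y \<subseteq> D \<and> (\<exists>d\<in>D. (last p, d) \<in> E) \<and> D \<inter> set p = {} \<and> anticomplete E D (X \<union> set (butlast p))"
    if "n \<le> t" for n
    using that
  proof (induction n)
    case 0
    define U where "U = {w \<in> W. w \<notin> X \<and> (\<forall>x\<in>X. (x, w) \<notin> E)}"
    have "alpha_le E Y0 k" using Y0(2) by (rule alpha_le_mono) (use k in auto)
    note hY = havenD[OF h Y0(1) this]
    have bU: "\<beta> Y0 \<subseteq> U" using Y0 by (auto simp: U_def anticomplete_def)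
    obtain b where b: "b \<in> \<beta> Y0" "b \<in> U" using hY(1) bU by blast
    obtain y d where y: "y \<in> W - U" "d \<in> comp E U b" "(d, y) \<in> E"
      using frontier[OF W(1), of U b] b X W(3) by (auto simp: U_def)
    have cU: "comp E U b \<subseteq> U" using comp_subset[OF b(2)] .
    have "y \<notin> X" using y cU symE by (auto simp: U_def)
    then obtain x where x: "x \<in> X" "(x, y) \<in> E" using y by (auto simp: U_def)
    have "leg E X 0 [y]" using \<open>y \<notin> X\<close> x symE E(2) by (auto simp: leg_def ipath_def irrefl_def)
    moreover have "\<beta> Y0 \<subseteq> comp E U b" using hY(3) bU b by (intro conn_subset_comp) auto
    moreover have "anticomplete E (comp E U b) X" using cU symE unfolding U_def anticomplete_def by blast
    moreover have "y \<notin> comp E U b" using y cU by auto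
    moreover have "conn E (comp E U b)" using conn_comp[OF E(1) b(2)] .
    moreover have "comp E U b \<subseteq> W" using cU by (auto simp: U_def)
    moreover have "\<exists>d\<in>comp E U b. (y, d) \<in> E" using y(2) symE[OF y(3)] by blast
    ultimately show ?case using y Y0
      by - (rule exI[of _ "[y]"], rule exI[of _ Y0], rule exI[of _ "comp E U b"], auto)
  next
    case (Suc n)
    then obtain p Y D where p: "leg E X n p" "set p \<subseteq> W" "Y \<subseteq> V" "alpha_le E Y (k1 + n * k0)" "conn E D" "D \<subseteq> W"
      "\<beta> Y \<subseteq> D" "\<exists>d\<in>D. (last p, d) \<in> E" "D \<inter> set p = {}" "anticomplete E D (X \<union> set (butlast p))" by auto
    define x where "x = last p"
    have pne: "p \<noteq> []" using p(1) by (auto simp: leg_def)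
    have xV: "x \<in> V" using last_in_set[OF pne] p(2) W(2) unfolding x_def by blast
    obtain Yx where Yx: "Yx \<subseteq> V" "alpha_le E Yx k0" "anticomplete E {x} (\<beta> Yx)"
      using li[OF xV] by (auto simp: light_def)
    have "alpha_le E (Y \<union> Yx) (k1 + n * k0 + k0)" using p(4) Yx(2) by (rule alpha_le_Un)
    then have al: "alpha_le E (Y \<union> Yx) (k1 + Suc n * k0)" by (simp add: add_ac)
    have "Suc n * k0 \<le> Suc t * k0" using Suc.prems by (intro mult_right_mono) auto
    then have "k1 + Suc n * k0 \<le> k" using k by linarith
    then have al': "alpha_le E (Y \<union> Yx) k" by (rule alpha_le_mono[OF al subset_refl])
    have YV: "Y \<union> Yx \<subseteq> V" using p Yx by auto
    note hY = havenD[OF h YV al']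
    have sub: "\<beta> (Y \<union> Yx) \<subseteq> \<beta> Y" "\<beta> (Y \<union> Yx) \<subseteq> \<beta> Yx" using haven_mono[OF h _ YV al'] by auto
    \<comment> \<open>Since x is separated from the haven, the new side of the haven lies among the
      nonneighbours U of x in D. The vertex y is in D but not in U, hence adjacent to x, and it
      touches the component of U that becomes the new D.\<close>
    define U where "U = {d \<in> D. (x, d) \<notin> E}"
    have bU: "\<beta> (Y \<union> Yx) \<subseteq> U" using sub p(7) Yx(3) by (auto simp: U_def anticomplete_def)
    obtain b where b: "b \<in> \<beta> (Y \<union> Yx)" "b \<in> U" using hY(1) bU by blast
    have "U \<noteq> D" using p(8) by (auto simp: U_def x_def)
    then obtain y d where y: "y \<in> D - U" "d \<in> comp E U b" "(d, y) \<in> E"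
      using frontier[OF p(5), of U b] b by (auto simp: U_def)
    have cU: "comp E U b \<subseteq> U" using comp_subset[OF b(2)] .
    have xy: "(x, y) \<in> E" "y \<in> D" using y by (auto simp: U_def)
    have setp: "set p = insert x (set (butlast p))"
      unfolding x_def using pne by (metis append_butlast_last_id list.simps(15) rotate1.simps(2) set_rotate1)
    have noy: "(y, z) \<notin> E" "(z, y) \<notin> E" if "z \<in> X \<union> set (butlast p)" for z
      using that p(10) xy(2) symE[of z y] unfolding anticomplete_def by blast+
    have xnb: "x \<notin> set (butlast p)"
    proof -
      have "distinct (butlast p @ [last p])" using p(1) pne by (simp add: leg_def ipath_def)
      then show ?thesis by (simp add: x_def)
    qed
    have ip: "ipath E (p @ [y])"
    proof (rule ipath_append[OF E(1) _ pne])
      show "ipath E p" using p(1) by (simp add: leg_def)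
      show "ipath E [y]" using E(2) by (auto simp: ipath_def irrefl_def)
      show "set p \<inter> set [y] = {}" using p(9) xy(2) by auto
      fix u z assume u: "u \<in> set p" and "z \<in> set [y]"
      then show "(u, z) \<in> E \<longleftrightarrow> u = last p \<and> z = hd [y]"
        using xy noy[of u] setp xnb x_def by auto
    qed simp
    have yX: "y \<notin> X" using p(10) xy by (auto simp: anticomplete_def)
    have l: "leg E X (Suc n) (p @ [y])"
      using p(1) pne ip noy yX by (auto simp: leg_def)
    have "\<beta> (Y \<union> Yx) \<subseteq> comp E U b" using hY(3) bU b by (intro conn_subset_comp) auto
    moreover have "conn E (comp E U b)" using conn_comp[OF E(1) b(2)] .
    moreover have cD: "comp E U b \<subseteq> D" using cU by (auto simp: U_def)
    moreover have "y \<notin> comp E U b" using y cU by auto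
    moreover have "anticomplete E (comp E U b) (X \<union> set p)"
    proof -
      have "anticomplete E (comp E U b) (X \<union> set (butlast p))"
        using p(10) cD by (rule anticomplete_subset) auto
      moreover have "anticomplete E (comp E U b) {x}"
        using cU p(9) setp symE unfolding U_def anticomplete_def by blast
      ultimately show ?thesis unfolding setp anticomplete_def by blast
    qed
    moreover have "set (p @ [y]) \<subseteq> W" "comp E U b \<inter> set (p @ [y]) = {}" 
      using p(2,6,9) xy cD \<open>y \<notin> comp E U b\<close> by auto
    moreover have "\<exists>d\<in>comp E U b. (y, d) \<in> E" using y(2) symE[OF y(3)] by blast
    ultimately show ?case using l YV al y p(6)
      by - (rule exI[of _ "p @ [y]"], rule exI[of _ "Y \<union> Yx"], rule exI[of _ "comp E U b"], auto simp: butlast_append)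
  qed
  then show ?thesis by blast
qed

text \<open>When a light connected set is enlarged vertex by vertex, the independence numbers of the
  separators would add up. Fact A resets the bound: a connected set that is light with
  \<open>C + k0\<close> is light with C, whatever its size.\<close>

lemma all_light_imp_False:
  assumes V: "finite V" and E: "sym E" "irrefl E" and h: "haven V E k \<beta>"
    and H: "\<And>X. X \<subseteq> V \<Longrightarrow> conn E X \<Longrightarrow>
      \<exists>Z\<subseteq>V - X. alpha_le E Z C \<and> (\<forall>p. leg E X t p \<longrightarrow> set p \<subseteq> V \<longrightarrow> set p \<inter> Z \<noteq> {})"
    and li: "\<And>v. v \<in> V \<Longrightarrow> light V E \<beta> k0 {v}"
    and k: "2 * C + k0 + Suc t * k0 \<le> k"
  shows False
proof -
  \<comment> \<open>If the leg-hitting set Z does not separate X from the haven, then X lies inside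
    \<beta> Z. Gyarfas' argument carried out within \<beta> Z produces a leg at X that Z does not
    meet.\<close>
  have A: "light V E \<beta> C X" if X: "X \<subseteq> V" "conn E X" "X \<noteq> {}" and l: "light V E \<beta> (C + k0) X" for X
  proof (rule ccontr)
    assume nl: "\<not> light V E \<beta> C X"
    obtain Z where Z: "Z \<subseteq> V - X" "alpha_le E Z C" "\<And>p. leg E X t p \<Longrightarrow> set p \<subseteq> V \<Longrightarrow> set p \<inter> Z \<noteq> {}"
      using H[OF X(1,2)] by blast
    have ZV: "Z \<subseteq> V" using Z by auto
    have alZ: "alpha_le E Z k" using Z(2) by (rule alpha_le_mono) (use k in auto)
    note hZ = havenD[OF h ZV alZ]
    have "\<not> anticomplete E X (\<beta> Z)" using nl ZV Z(2) by (auto simp: light_def)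
    then have "X \<inter> \<beta> Z \<noteq> {}"
      unfolding anticomplete_def using hZ(4) X(1) Z(1) symD[OF E(1)] by blast
    then have XZ: "X \<subseteq> \<beta> Z"
      by (rule conn_subset_closed[OF X(2)]) (use hZ(4) X(1) Z(1) in blast)
    obtain Y1 where Y1: "Y1 \<subseteq> V" "alpha_le E Y1 (C + k0)" "anticomplete E X (\<beta> Y1)"
      using l by (auto simp: light_def)
    have al: "alpha_le E (Z \<union> Y1) (C + (C + k0))" using Z(2) Y1(2) by (rule alpha_le_Un)
    have alk: "alpha_le E (Z \<union> Y1) k" using al by (rule alpha_le_mono) (use k in auto)
    have sub: "\<beta> (Z \<union> Y1) \<subseteq> \<beta> Z" "\<beta> (Z \<union> Y1) \<subseteq> \<beta> Y1"
      using haven_mono[OF h _ _ alk] ZV Y1(1) by auto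
    have "\<exists>p. leg E X t p \<and> set p \<subseteq> \<beta> Z"
    proof (rule gyarfas_leg[OF V E h X(3) hZ(3) _ XZ _ al sub(1) _ li])
      show "\<beta> Z \<subseteq> V" using hZ(2) by auto
      show "Z \<union> Y1 \<subseteq> V" using ZV Y1 by auto
      show "anticomplete E X (\<beta> (Z \<union> Y1))" using Y1(3) sub(2) by (auto intro: anticomplete_subset)
      show "C + (C + k0) + Suc t * k0 \<le> k" using k by simp
    qed
    then show False using Z(3) hZ(2) by blast
  qed
  have al0: "alpha_le E {} k" by (simp add: alpha_le_def)
  note h0 = havenD[OF h empty_subsetI al0]
  \<comment> \<open>A maximal element of G is all of \<open>\<beta> {}\<close>: adding an adjacent
    vertex raises the bound by k0, and A takes it back to C.\<close>
  define G where "G = {X. X \<subseteq> \<beta> {} \<and> X \<noteq> {} \<and> conn E X \<and> light V E \<beta> C X}"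
  have finb: "finite (\<beta> {})" using h0(2) V finite_subset by blast
  have finG: "finite G" unfolding G_def using finb by simp
  have mono: "light V E \<beta> (C + k0) X" if "light V E \<beta> k0 X" for X
    using that alpha_le_mono[of E _ k0 _ "C + k0"] unfolding light_def by (meson order_refl le_add2)
  obtain x0 where x0: "x0 \<in> \<beta> {}" using h0(1) by blast
  then have "{x0} \<in> G"
    using A[of "{x0}"] mono li[of x0] h0(2) by (auto simp: G_def conn_def)
  then obtain X where X: "X \<in> G" "\<And>X'. X' \<in> G \<Longrightarrow> X \<subseteq> X' \<Longrightarrow> X' = X"
    using finite_has_maximal2[OF finG] by metis
  have "X = \<beta> {}"
  proof (rule ccontr)
    assume ne: "X \<noteq> \<beta> {}"
    obtain b where b: "b \<in> X" using X by (auto simp: G_def)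
    obtain y d where y: "y \<in> \<beta> {} - X" "d \<in> comp E X b" "(d, y) \<in> E"
      using frontier[OF h0(3), of X b] ne X(1) b by (auto simp: G_def)
    have d: "d \<in> X" using comp_subset[OF b] y by auto
    have cX: "conn E (insert y X)" using conn_insert[OF E(1) _ d y(3)] X(1) by (auto simp: G_def)
    have yV: "y \<in> V" using y h0(2) by auto
    obtain Y1 where Y1: "Y1 \<subseteq> V" "alpha_le E Y1 C" "anticomplete E X (\<beta> Y1)"
      using X(1) by (auto simp: light_def G_def)
    obtain Y2 where Y2: "Y2 \<subseteq> V" "alpha_le E Y2 k0" "anticomplete E {y} (\<beta> Y2)"
      using li[OF yV] by (auto simp: light_def)
    have al: "alpha_le E (Y1 \<union> Y2) (C + k0)" using Y1(2) Y2(2) by (rule alpha_le_Un)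
    have alk: "alpha_le E (Y1 \<union> Y2) k" using al by (rule alpha_le_mono) (use k in auto)
    have sub: "\<beta> (Y1 \<union> Y2) \<subseteq> \<beta> Y1" "\<beta> (Y1 \<union> Y2) \<subseteq> \<beta> Y2"
      using haven_mono[OF h _ _ alk] Y1(1) Y2(1) by auto
    have "anticomplete E (insert y X) (\<beta> (Y1 \<union> Y2))"
    proof -
      have "anticomplete E X (\<beta> (Y1 \<union> Y2))" "anticomplete E {y} (\<beta> (Y1 \<union> Y2))"
        using Y1(3) Y2(3) sub by (auto intro: anticomplete_subset)
      then show ?thesis by (auto simp: anticomplete_def)
    qed
    then have "light V E \<beta> (C + k0) (insert y X)"
      unfolding light_def using al Y1(1) Y2(1) by (intro exI[of _ "Y1 \<union> Y2"]) auto
    then have "light V E \<beta> C (insert y X)"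
      using A[of "insert y X"] cX yV X(1) h0(2) by (auto simp: G_def)
    then have "insert y X \<in> G" using cX y X(1) by (auto simp: G_def)
    then show False using X(2)[of "insert y X"] y by auto
  qed
  then obtain Y where Y: "Y \<subseteq> V" "alpha_le E Y C" "anticomplete E (\<beta> {}) (\<beta> Y)"
    using X(1) by (auto simp: light_def G_def)
  have alk: "alpha_le E Y k" using Y(2) by (rule alpha_le_mono) (use k in auto)
  have "\<beta> Y \<subseteq> \<beta> {}" "\<beta> Y \<noteq> {}" using haven_mono[OF h _ Y(1) alk] havenD[OF h Y(1) alk] by auto
  then show False using Y(3) by (auto simp: anticomplete_def)
qed

subsection \<open>Vertices not separated from the haven\<close>

lemma sorted_triple_eq:
  fixes x y z x' y' z' :: nat
  assumes "x < y" "y < z" "x' < y'" "y' < z'" "{x, y, z} = {x', y', z'}"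
  shows "x = x' \<and> y = y' \<and> z = z'"
proof -
  have "x \<in> {x', y', z'}" "z \<in> {x', y', z'}" "x' \<in> {x, y, z}" "z' \<in> {x, y, z}" "y \<in> {x', y', z'}"
    using assms(5) by auto
  then show ?thesis using assms(1-4) by auto
qed

text \<open>Ramsey's theorem for triples. A triple gets colour 1, 2 or 3, in this order of
  preference, if its largest, middle or smallest element lies in the set B of the other two, and
  colour 0 otherwise. A homogeneous set of k + 3 elements in colour 1, 2 or 3 would put k + 1
  elements into a single \<open>B x y\<close>: take for x and y its two smallest, its smallest and
  largest, or its two largest elements. So there is a homogeneous set of m elements in colour
  0.\<close>

lemma clean_subsetE:
  fixes k m :: nat
  obtains N where "\<And>B :: nat \<Rightarrow> nat \<Rightarrow> nat set.
    (\<And>i j. i < j \<Longrightarrow> j < N \<Longrightarrow> finite (B i j) \<and> card (B i j) \<le> k) \<Longrightarrow>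
    \<exists>I\<subseteq>{..<N}. card I = m \<and> (\<forall>i\<in>I. \<forall>j\<in>I. i < j \<longrightarrow> B i j \<inter> (I - {i, j}) = {})"
proof -
  obtain N :: nat where N: "partn_lst {..<N} [m, k + 3, k + 3, k + 3] 3"
    using ramsey_full by blast
  show thesis
  proof (rule that[of N])
    fix B :: "nat \<Rightarrow> nat \<Rightarrow> nat set"
    assume B: "\<And>i j. i < j \<Longrightarrow> j < N \<Longrightarrow> finite (B i j) \<and> card (B i j) \<le> k"
    define P1 where "P1 T \<longleftrightarrow> (\<exists>x y z. T = {x, y, z} \<and> x < y \<and> y < z \<and> z \<in> B x y)" for T
    define P2 where "P2 T \<longleftrightarrow> (\<exists>x y z. T = {x, y, z} \<and> x < y \<and> y < z \<and> y \<in> B x z)" for T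
    define P3 where "P3 T \<longleftrightarrow> (\<exists>x y z. T = {x, y, z} \<and> x < y \<and> y < z \<and> x \<in> B y z)" for T
    have P1: "P1 {x, y, z} \<longleftrightarrow> z \<in> B x y" and P2: "P2 {x, y, z} \<longleftrightarrow> y \<in> B x z"
      and P3: "P3 {x, y, z} \<longleftrightarrow> x \<in> B y z" if "x < y" "y < z" for x y z
      unfolding P1_def P2_def P3_def using that sorted_triple_eq[OF that] by metis+
    define f where "f T = (if P1 T then 1 else if P2 T then 2 else if P3 T then 3 else (0::nat))" for T
    have "f \<in> nsets {..<N} 3 \<rightarrow> {..<4}" by (auto simp: f_def)
    then obtain i H where i: "i < length [m, k + 3, k + 3, k + 3]"
      and H: "H \<in> nsets {..<N} ([m, k + 3, k + 3, k + 3] ! i)" "f ` (nsets H 3) \<subseteq> {i}"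
      by (rule partn_lstE[OF N]) auto
    have finH: "finite H" and HN: "H \<subseteq> {..<N}" using H(1) by (auto simp: nsets_def)
    have fi: "f {x, y, z} = i" if "x \<in> H" "y \<in> H" "z \<in> H" "x < y" "y < z" for x y z
    proof -
      have "{x, y, z} \<in> nsets H 3" using that by (auto simp: nsets_def)
      then show ?thesis using H(2) by blast
    qed
    have no: False if xy: "x < y" "x \<in> H" "y \<in> H" and c: "card H = k + 3" and sub: "H - {x, y} \<subseteq> B x y" for x y
    proof -
      have "card (H - {x, y}) = k + 1" using xy c finH by (simp add: card_Diff_subset)
      moreover have "finite (B x y)" "card (B x y) \<le> k" using B[of x y] xy HN by auto
      ultimately show False using card_mono[OF _ sub] by simp
    qed
    have "i = 0 \<or> i = 1 \<or> i = 2 \<or> i = 3" using i by auto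
    moreover have "i \<noteq> 1"
    proof
      assume i1: "i = 1"
      then have c: "card H = k + 3" using H(1) by (auto simp: nsets_def)
      define x where "x = Min H"
      define y where "y = Min (H - {x})"
      have "H \<noteq> {}" using c by auto
      then have x: "x \<in> H" "\<And>w. w \<in> H \<Longrightarrow> x \<le> w" using finH by (auto simp: x_def)
      have "H - {x} \<noteq> {}" using c x(1) finH by (metis card_Suc_Diff1 card.empty add_Suc_right diff_Suc_1 numeral_3_eq_3 nat.distinct(1))
      then have y: "y \<in> H - {x}" "\<And>w. w \<in> H - {x} \<Longrightarrow> y \<le> w"
        using finH unfolding y_def by (meson Min_in Min_le finite_Diff)+
      have xy: "x < y" using x y by (metis DiffE le_neq_implies_less singletonI)
      have "H - {x, y} \<subseteq> B x y"
      proof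
        fix z assume z: "z \<in> H - {x, y}"
        then have "y < z" using y(2)[of z] by auto
        moreover have "f {x, y, z} = 1" using fi[of x y z] x y z xy i1 calculation by blast
        then have "P1 {x, y, z}" by (simp add: f_def split: if_splits)
        ultimately show "z \<in> B x y" using P1[OF xy] by blast
      qed
      then show False using no[OF xy _ _ c] x y by auto
    qed
    moreover have "i \<noteq> 2"
    proof
      assume i2: "i = 2"
      then have c: "card H = k + 3" using H(1) by (auto simp: nsets_def)
      define x where "x = Min H"
      define y where "y = Max H"
      have "H \<noteq> {}" using c by auto
      then have x: "x \<in> H" "\<And>w. w \<in> H \<Longrightarrow> x \<le> w" and y: "y \<in> H" "\<And>w. w \<in> H \<Longrightarrow> w \<le> y"
        using finH by (auto simp: x_def y_def)
      have "x \<noteq> y"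
      proof
        assume "x = y"
        then have "H \<subseteq> {x}" using x(2) y(2) by (auto intro: antisym)
        then show False using c card_mono[of "{x}" H] by auto
      qed
      then have xy: "x < y" using x(2)[OF y(1)] by simp
      have "H - {x, y} \<subseteq> B x y"
      proof
        fix z assume z: "z \<in> H - {x, y}"
        then have "x < z" "z < y" using x(2)[of z] y(2)[of z] by auto
        moreover have "f {x, z, y} = 2" using fi[of x z y] x y z i2 calculation by blast
        then have "P2 {x, z, y}" by (simp add: f_def split: if_splits)
        ultimately show "z \<in> B x y" using P2[of x z y] by blast
      qed
      then show False using no[OF xy _ _ c] x y by auto
    qed
    moreover have "i \<noteq> 3"
    proof
      assume i3: "i = 3"
      then have c: "card H = k + 3" using H(1) by (auto simp: nsets_def)
      define y where "y = Max H"
      define x where "x = Max (H - {y})"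
      have "H \<noteq> {}" using c by auto
      then have y: "y \<in> H" "\<And>w. w \<in> H \<Longrightarrow> w \<le> y" using finH by (auto simp: y_def)
      have "H - {y} \<noteq> {}" using c y(1) finH by (metis card_Suc_Diff1 card.empty add_Suc_right diff_Suc_1 numeral_3_eq_3 nat.distinct(1))
      then have x: "x \<in> H - {y}" "\<And>w. w \<in> H - {y} \<Longrightarrow> w \<le> x"
        using finH unfolding x_def by (meson Max_in Max_ge finite_Diff)+
      have xy: "x < y" using x y by (metis DiffE le_neq_implies_less singletonI)
      have "H - {x, y} \<subseteq> B x y"
      proof
        fix z assume z: "z \<in> H - {x, y}"
        then have "z < x" using x(2)[of z] by auto
        moreover have "f {z, x, y} = 3" using fi[of z x y] x y z xy i3 calculation by blast
        then have "P3 {z, x, y}" by (simp add: f_def split: if_splits)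
        ultimately show "z \<in> B x y" using P3[of z x y] xy by blast
      qed
      then show False using no[OF xy _ _ c] x y by auto
    qed
    ultimately have i0: "i = 0" by blast
    have "card H = m" using H(1) i0 by (simp add: nsets_def)
    moreover have "B x y \<inter> (H - {x, y}) = {}" if xy: "x \<in> H" "y \<in> H" "x < y" for x y
    proof (rule ccontr)
      assume "B x y \<inter> (H - {x, y}) \<noteq> {}"
      then obtain z where z: "z \<in> B x y" "z \<in> H" "z \<noteq> x" "z \<noteq> y" by auto
      then consider "z < x" | "x < z" "z < y" | "y < z" by linarith
      then show False
      proof cases
        case 1
        then show False using fi[of z x y] P3[of z x y] z xy i0 by (auto simp: f_def split: if_splits)
      next
        case 2
        then show False using fi[of x z y] P2[of x z y] z xy i0 by (auto simp: f_def split: if_splits)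
      next
        case 3
        then show False using fi[of x y z] P1[of x y z] z xy i0 by (auto simp: f_def split: if_splits)
      qed
    qed
    ultimately show "\<exists>I\<subseteq>{..<N}. card I = m \<and> (\<forall>i\<in>I. \<forall>j\<in>I. i < j \<longrightarrow> B i j \<inter> (I - {i, j}) = {})"
      using HN by blast
  qed
qed

lemma ipath_take: "ipath E xs \<Longrightarrow> ipath E (take n xs)"
  by (simp add: ipath_def)

lemma conn_ipath:
  assumes "sym E" "ipath E xs"
  shows "conn E (set xs)"
proof -
  have a: "(xs ! 0, xs ! k) \<in> (E \<inter> set xs \<times> set xs)\<^sup>*" if "k < length xs" for k
    using that
  proof (induction k)
    case (Suc k)
    then have "(xs ! k, xs ! Suc k) \<in> E \<inter> set xs \<times> set xs" using ipath_adj[OF assms(2), of k] by auto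
    then show ?case using Suc by (auto intro: rtrancl_into_rtrancl)
  qed simp
  show ?thesis unfolding conn_def
  proof (intro ballI)
    fix x y assume "x \<in> set xs" "y \<in> set xs"
    then obtain i j where "x = xs ! i" "i < length xs" "y = xs ! j" "j < length xs" by (metis in_set_conv_nth)
    then show "(x, y) \<in> (E \<inter> set xs \<times> set xs)\<^sup>*"
      using a[of i] a[of j] rtrancl_restrict_sym[OF assms(1)] by (meson rtrancl_trans)
  qed
qed

text \<open>Three paths \<open>u i 0, u i 1, \<dots>\<close> of stable vertices with common start, consecutive ones being joined
  through \<open>Q i n\<close>, provide three anticomplete legs.\<close>

lemma spider_of_connectors:
  fixes u :: "nat \<Rightarrow> nat \<Rightarrow> 'a"
  assumes E: "sym E" "irrefl E" and t: "t \<ge> 1"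
    and c: "\<And>i. i < 3 \<Longrightarrow> u i 0 = c"
    and st: "\<And>i i' n n'. i < 3 \<Longrightarrow> i' < 3 \<Longrightarrow> n \<le> t \<Longrightarrow> n' \<le> t \<Longrightarrow> (u i n, u i' n') \<notin> E"
    and uu: "\<And>i i' n n'. i < 3 \<Longrightarrow> i' < 3 \<Longrightarrow> n \<le> t \<Longrightarrow> n' \<le> t \<Longrightarrow> u i n = u i' n' \<Longrightarrow> n = n' \<and> (n = 0 \<or> i = i')"
    and Q: "\<And>i n. i < 3 \<Longrightarrow> n < t \<Longrightarrow> conn E (Q i n) \<and> (\<exists>q\<in>Q i n. (u i n, q) \<in> E) \<and> (\<exists>q\<in>Q i n. (u i (Suc n), q) \<in> E)"
    and QQ: "\<And>i i' n n'. i < 3 \<Longrightarrow> i' < 3 \<Longrightarrow> n < t \<Longrightarrow> n' < t \<Longrightarrow> i \<noteq> i' \<or> n \<noteq> n' \<Longrightarrow> anticomplete E (Q i n) (Q i' n')"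
    and uQ: "\<And>i i' m n. i < 3 \<Longrightarrow> i' < 3 \<Longrightarrow> m \<le> t \<Longrightarrow> n < t \<Longrightarrow> u i m \<notin> Q i' n"
    and uQ': "\<And>i i' m n q. i < 3 \<Longrightarrow> i' < 3 \<Longrightarrow> m \<le> t \<Longrightarrow> n < t \<Longrightarrow> q \<in> Q i' n \<Longrightarrow> (u i m, q) \<in> E \<Longrightarrow>
       u i m = u i' n \<or> u i m = u i' (Suc n)"
  shows "\<exists>R\<subseteq>(\<Union>i<3. (\<Union>n\<le>t. {u i n}) \<union> (\<Union>n<t. Q i n)). claw_set E t R \<or> tri_set E t R"
proof -
  have symE: "(y, x) \<in> E" if "(x, y) \<in> E" for x y using symD[OF E(1) that] .
  define A where "A i = (\<Union>n<t. Q i n) \<union> u i ` {1..t}" for i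
  have "\<exists>p. leg E {c} t p \<and> set p \<subseteq> A i" if i: "i < 3" for i
  proof -
    define W where "W = insert c (A i)"
    have uW: "u i n \<in> W" if "n \<le> t" for n
      using that c[OF i] by (cases "n = 0") (auto simp: W_def A_def)
    have QW: "Q i n \<subseteq> W" if "n < t" for n using that by (auto simp: W_def A_def)
    have reach: "(c, u i n) \<in> (E \<inter> W \<times> W)\<^sup>*" if "n \<le> t" for n
      using that
    proof (induction n)
      case 0 then show ?case using c[OF i] by simp
    next
      case (Suc n)
      then have n: "n < t" by simp
      obtain q q' where q: "q \<in> Q i n" "(u i n, q) \<in> E" "q' \<in> Q i n" "(u i (Suc n), q') \<in> E"
        using Q[OF i n] by auto
      have "(u i n, q) \<in> (E \<inter> W \<times> W)\<^sup>*" using q QW[OF n] uW[of n] n by auto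
      moreover have "(q, q') \<in> (E \<inter> W \<times> W)\<^sup>*"
        using rtrancl_restrict_mono[OF connD[of E "Q i n" q q'] QW[OF n]] Q[OF i n] q by blast
      moreover have "(q', u i (Suc n)) \<in> (E \<inter> W \<times> W)\<^sup>*" using q QW[OF n] uW[of "Suc n"] n symE by auto
      moreover have "(c, u i n) \<in> (E \<inter> W \<times> W)\<^sup>*" using Suc by simp
      ultimately show ?case by (meson rtrancl_trans)
    qed
    have cW: "c \<in> W" by (simp add: W_def)
    note sp = shortest_ipath[OF E cW reach[OF order_refl], of "\<lambda>z. z = u i t"]
    obtain xs where xs: "ipath E xs" "xs \<noteq> []" "hd xs = c" "set xs \<subseteq> W" "last xs = u i t"
      by (rule sp) auto
    \<comment> \<open>The vertices \<open>u i n\<close> form the even layers 2 n and the connectors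
      \<open>Q i n\<close> the odd layers 2 n + 1. An edge leads at most one layer up, so the path
      xs from layer 0 to layer 2 t has at least 2 t + 1 >= t + 2 vertices.\<close>
    define Lv where "Lv a = (if even a then {u i (a div 2)} else Q i (a div 2))" for a
    have WL: "\<exists>a\<le>2*t. w \<in> Lv a" if "w \<in> W" for w
    proof -
      from that consider "w = u i 0" | n where "n < t" "w \<in> Q i n" | n where "n \<le> t" "w = u i n"
        using c[OF i] by (auto simp: W_def A_def)
      then show ?thesis
      proof cases
        case 1 then show ?thesis by (intro exI[of _ 0]) (auto simp: Lv_def)
      next
        case 2 then show ?thesis by (intro exI[of _ "Suc (2 * n)"]) (auto simp: Lv_def)
      next
        case 3 then show ?thesis by (intro exI[of _ "2 * n"]) (auto simp: Lv_def)
      qed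
    qed
    have step: "b \<le> Suc a" if ab: "a \<le> 2 * t" "b \<le> 2 * t" "x \<in> Lv a" "y \<in> Lv b" "(x, y) \<in> E" for a b x y
    proof (cases "even a"; cases "even b")
      assume "even a" "even b"
      then have "x = u i (a div 2)" "y = u i (b div 2)" using ab by (auto simp: Lv_def)
      then show ?thesis using st[OF i i, of "a div 2" "b div 2"] ab by auto
    next
      assume *: "even a" "odd b"
      then have "x = u i (a div 2)" "y \<in> Q i (b div 2)" "a div 2 \<le> t" "b div 2 < t"
        using ab by (auto simp: Lv_def elim!: oddE)
      then have "u i (a div 2) = u i (b div 2) \<or> u i (a div 2) = u i (Suc (b div 2))"
        using uQ'[OF i i, of "a div 2" "b div 2" y] ab(5) by blast
      then have "a div 2 = b div 2 \<or> a div 2 = Suc (b div 2)"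
        using uu[OF i i, of "a div 2" "b div 2"] uu[OF i i, of "a div 2" "Suc (b div 2)"]
          \<open>a div 2 \<le> t\<close> \<open>b div 2 < t\<close> by auto
      then show ?thesis using * by (auto elim!: evenE oddE)
    next
      assume *: "odd a" "even b"
      then have "y = u i (b div 2)" "x \<in> Q i (a div 2)" "b div 2 \<le> t" "a div 2 < t"
        using ab by (auto simp: Lv_def elim!: oddE)
      then have "u i (b div 2) = u i (a div 2) \<or> u i (b div 2) = u i (Suc (a div 2))"
        using uQ'[OF i i, of "b div 2" "a div 2" x] symE[OF ab(5)] by blast
      then have "b div 2 = a div 2 \<or> b div 2 = Suc (a div 2)"
        using uu[OF i i, of "b div 2" "a div 2"] uu[OF i i, of "b div 2" "Suc (a div 2)"]
          \<open>b div 2 \<le> t\<close> \<open>a div 2 < t\<close> by auto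
      then show ?thesis using * by (auto elim!: evenE oddE)
    next
      assume *: "odd a" "odd b"
      then have "x \<in> Q i (a div 2)" "y \<in> Q i (b div 2)" "a div 2 < t" "b div 2 < t"
        using ab by (auto simp: Lv_def elim!: oddE)
      then have "a div 2 = b div 2"
        using QQ[OF i i, of "a div 2" "b div 2"] ab(5) by (auto simp: anticomplete_def)
      then show ?thesis using * by (auto elim!: oddE)
    qed
    have lev: "\<exists>a\<le>k. a \<le> 2 * t \<and> xs ! k \<in> Lv a" if "k < length xs" for k
      using that
    proof (induction k)
      case 0
      then have "xs ! 0 = u i 0" using xs(2,3) c[OF i] by (simp add: hd_conv_nth)
      then show ?case by (auto simp: Lv_def)
    next
      case (Suc k)
      then obtain a where a: "a \<le> k" "a \<le> 2 * t" "xs ! k \<in> Lv a" by auto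
      have "xs ! Suc k \<in> W" using xs(4) Suc.prems by auto
      then obtain b where b: "b \<le> 2 * t" "xs ! Suc k \<in> Lv b" using WL by blast
      have "(xs ! k, xs ! Suc k) \<in> E" using ipath_adj[OF xs(1) Suc.prems] by simp
      then have "b \<le> Suc a" using step[OF a(2) b(1) a(3) b(2)] by simp
      then show ?case using a b by (intro exI[of _ b]) auto
    qed
    obtain a where a: "a \<le> length xs - 1" "a \<le> 2 * t" "u i t \<in> Lv a"
      using lev[of "length xs - 1"] xs(2,5) by (auto simp: last_conv_nth)
    have "a = 2 * t"
    proof (cases "even a")
      case True
      then have "u i t = u i (a div 2)" using a by (simp add: Lv_def)
      then have "t = a div 2" using uu[OF i i, of t "a div 2"] a by auto
      then show ?thesis using True by auto
    next
      case False
      then have "u i t \<in> Q i (a div 2)" "a div 2 < t" using a by (auto simp: Lv_def elim!: oddE)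
      then show ?thesis using uQ[OF i i, of t "a div 2"] by auto
    qed
    then have len: "length xs \<ge> Suc (Suc t)" using a xs(2) t by (cases xs) auto
    \<comment> \<open>The t + 1 vertices after c; as xs is induced, only the first of them is
      adjacent to c.\<close>
    define p where "p = take (Suc t) (tl xs)"
    have tne: "tl xs \<noteq> []" using len by (cases xs) auto
    have sp: "set p \<subseteq> set (tl xs)" unfolding p_def by (rule set_take_subset)
    have pne: "p \<noteq> []" "hd p = hd (tl xs)" using tne by (auto simp: p_def)
    have hp: "hd p \<in> set (tl xs)" using pne tne by simp
    have cn: "c \<notin> set p" using ipath_hd_tl(3)[OF xs(1,2) tne] xs(3) sp by blast
    have "leg E {c} t p"
      unfolding leg_def
    proof (intro conjI)
      show "ipath E p" unfolding p_def using xs(1) by (intro ipath_take ipath_tl)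
      show "length p = Suc t" using len by (simp add: p_def)
      show "set p \<inter> {c} = {}" using cn by simp
      show "\<exists>x\<in>{c}. (hd p, x) \<in> E" using ipath_hd_tl(2)[OF xs(1,2) tne hp] xs(3) pne by simp
      have "hd p \<notin> set (tl p)"
        using \<open>ipath E p\<close> pne(1) by (cases p) (auto simp: ipath_def)
      moreover have "set (tl p) \<subseteq> set p" using pne(1) by (cases p) auto
      ultimately have "y \<in> set (tl xs) \<and> y \<noteq> hd (tl xs)" if "y \<in> set (tl p)" for y
        using that sp pne(2) by auto
      then show "\<forall>y\<in>set (tl p). \<forall>x\<in>{c}. (y, x) \<notin> E"
        using ipath_hd_tl(2)[OF xs(1,2) tne] xs(3) by simp
    qed
    moreover have "set p \<subseteq> A i"
      using sp cn xs(4) by (cases xs) (auto simp: W_def)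
    ultimately show ?thesis by blast
  qed
  then obtain p where p: "\<And>i. i < 3 \<Longrightarrow> leg E {c} t (p i) \<and> set (p i) \<subseteq> A i" by metis
  have AA: "anticomplete E (A i) (A i')" if "i < 3" "i' < 3" "i \<noteq> i'" for i i'
    unfolding anticomplete_def
  proof (intro conjI ballI)
    have f: "x \<noteq> y \<and> (x, y) \<notin> E" if "x \<in> A i" "y \<in> A i'" for x y
    proof -
      consider n n' where "x = u i n" "y = u i' n'" "1 \<le> n" "n \<le> t" "1 \<le> n'" "n' \<le> t"
        | n n' where "x = u i n" "y \<in> Q i' n'" "1 \<le> n" "n \<le> t" "n' < t"
        | n n' where "x \<in> Q i n" "y = u i' n'" "n < t" "1 \<le> n'" "n' \<le> t"
        | n n' where "x \<in> Q i n" "y \<in> Q i' n'" "n < t" "n' < t"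
        using \<open>x \<in> A i\<close> \<open>y \<in> A i'\<close> unfolding A_def by auto
      then show ?thesis
      proof cases
        case 1
        then show ?thesis using st[OF \<open>i < 3\<close> \<open>i' < 3\<close>, of n n'] uu[OF \<open>i < 3\<close> \<open>i' < 3\<close>, of n n'] \<open>i \<noteq> i'\<close> by auto
      next
        case 2
        then have "x \<notin> Q i' n'" using uQ[OF \<open>i < 3\<close> \<open>i' < 3\<close>] by blast
        moreover have "(x, y) \<notin> E"
          using uQ'[OF \<open>i < 3\<close> \<open>i' < 3\<close>, of n n' y] uu[OF \<open>i < 3\<close> \<open>i' < 3\<close>, of n n'] uu[OF \<open>i < 3\<close> \<open>i' < 3\<close>, of n "Suc n'"]
            2 \<open>i \<noteq> i'\<close> by auto
        ultimately show ?thesis using 2 by auto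
      next
        case 3
        then have "y \<notin> Q i n" using uQ[OF \<open>i' < 3\<close> \<open>i < 3\<close>] by blast
        moreover have "(y, x) \<notin> E"
          using uQ'[OF \<open>i' < 3\<close> \<open>i < 3\<close>, of n' n x] uu[OF \<open>i' < 3\<close> \<open>i < 3\<close>, of n' n] uu[OF \<open>i' < 3\<close> \<open>i < 3\<close>, of n' "Suc n"]
            3 \<open>i \<noteq> i'\<close> by auto
        ultimately show ?thesis using 3 symE by auto
      next
        case 4
        then show ?thesis using QQ[OF \<open>i < 3\<close> \<open>i' < 3\<close>, of n n'] \<open>i \<noteq> i'\<close> unfolding anticomplete_def by blast
      qed
    qed
    then show "A i \<inter> A i' = {}" by blast
    show "(x, y) \<notin> E" if "x \<in> A i" "y \<in> A i'" for x y using f[OF that] by simp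
  qed
  have "anticomplete E (set (p i)) (set (p i'))" if "i < 3" "i' < 3" "i \<noteq> i'" for i i'
    using AA[OF that] p[OF that(1)] p[OF that(2)] by (auto intro: anticomplete_subset)
  then have ac: "anticomplete E (set (p 0)) (set (p 1))" "anticomplete E (set (p 0)) (set (p 2))"
    "anticomplete E (set (p 1)) (set (p 2))" by auto
  have "conn E {c}" by (simp add: conn_def)
  moreover have "leg E {c} t (p 0)" "leg E {c} t (p 1)" "leg E {c} t (p 2)" using p by auto
  ultimately have "\<exists>R\<subseteq>{c} \<union> set (p 0) \<union> set (p 1) \<union> set (p 2). claw_set E t R \<or> tri_set E t R"
    using three_legs[OF E _ t _ _ _ ac] by blast
  then obtain R where R: "R \<subseteq> {c} \<union> set (p 0) \<union> set (p 1) \<union> set (p 2)" "claw_set E t R \<or> tri_set E t R"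
    by blast
  define B where "B = (\<Union>i<3. (\<Union>n\<le>t. {u i n}) \<union> (\<Union>n<t. Q i n))"
  have pB: "set (p i) \<subseteq> B" if "i < 3" for i
  proof -
    have "set (p i) \<subseteq> A i" using p[OF that] by simp
    also have "A i \<subseteq> (\<Union>n\<le>t. {u i n}) \<union> (\<Union>n<t. Q i n)" by (auto simp: A_def)
    finally show ?thesis unfolding B_def by (rule order_trans[OF _ UN_upper[of i "{..<3}"]]) (use that in simp)
  qed
  moreover have "c \<in> B" unfolding B_def using c[of 0] by (intro UN_I[of 0]) auto
  ultimately have "R \<subseteq> B" by (intro order_trans[OF R(1)] Un_least pB) auto
  then show ?thesis using R(2) unfolding B_def by blast
qed

text \<open>A connector joins any two vertices of \<open>S\<close> by a short path, but each of its vertices sees few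
  vertices of \<open>S\<close>.\<close>

definition connector :: "'a set \<Rightarrow> 'a rel \<Rightarrow> 'a set \<Rightarrow> nat \<Rightarrow> nat \<Rightarrow> 'a set \<Rightarrow> bool" where
  "connector V E S s k R \<longleftrightarrow> R \<subseteq> V - S \<and> (\<forall>q\<in>R. card {v \<in> S. (q, v) \<in> E} < s) \<and>
     (\<forall>a\<in>S. \<forall>b\<in>S. \<exists>Q\<subseteq>R. conn E Q \<and> card Q \<le> k \<and> (\<exists>q\<in>Q. (a, q) \<in> E) \<and> (\<exists>q\<in>Q. (b, q) \<in> E))"

text \<open>Delete S, W and a leg-hitting set \<open>Z v\<close> for each v in S. As no v in S is
  light, each has a neighbour in the remaining side D of the haven, which is connected. A shortest
  path in D from a root r to a neighbour of v has at most t vertices, since otherwise its last t + 1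
  vertices, read backwards, would be a leg at v avoiding \<open>Z v\<close>. The connector is the
  union of these paths.\<close>

lemma unseparated_imp_connector:
  assumes V: "finite V" and E: "sym E" "irrefl E" and h: "haven V E k \<beta>"
    and S: "S \<subseteq> V" "finite S"
    and nl: "\<And>v. v \<in> S \<Longrightarrow> \<not> light V E \<beta> k0 {v}"
    and H: "\<And>X. X \<subseteq> V \<Longrightarrow> conn E X \<Longrightarrow>
      \<exists>Z\<subseteq>V - X. alpha_le E Z C \<and> (\<forall>p. leg E X t p \<longrightarrow> set p \<subseteq> V \<longrightarrow> set p \<inter> Z \<noteq> {})"
    and W: "W \<subseteq> V" "alpha_le E W w" "\<And>q. q \<in> V - W \<Longrightarrow> card {v \<in> S. (q, v) \<in> E} < s"
    and k: "card S + card S * C + w \<le> k0" "k0 \<le> k"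
  shows "\<exists>R. connector V E S s (2 * t) R \<and> R \<noteq> {} \<and> card R \<le> Suc (card S * t) \<and> R \<inter> W = {}"
proof -
  have symE: "(y, x) \<in> E" if "(x, y) \<in> E" for x y using symD[OF E(1) that] .
  have "\<exists>Z\<subseteq>V - {v}. alpha_le E Z C \<and> (\<forall>p. leg E {v} t p \<longrightarrow> set p \<subseteq> V \<longrightarrow> set p \<inter> Z \<noteq> {})" if "v \<in> S" for v
    using H[of "{v}"] that S(1) by (auto simp: conn_def)
  then obtain Z where Z: "\<And>v. v \<in> S \<Longrightarrow> Z v \<subseteq> V - {v}" "\<And>v. v \<in> S \<Longrightarrow> alpha_le E (Z v) C"
    "\<And>v p. v \<in> S \<Longrightarrow> leg E {v} t p \<Longrightarrow> set p \<subseteq> V \<Longrightarrow> set p \<inter> Z v \<noteq> {}" by metis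
  define Y where "Y = S \<union> (\<Union>v\<in>S. Z v) \<union> W"
  have YV: "Y \<subseteq> V" using S(1) Z(1) W(1) by (auto simp: Y_def)
  have "alpha_le E Y (card S + card S * C + w)"
    unfolding Y_def
    by (rule alpha_le_Un[OF alpha_le_Un[OF alpha_le_card[OF S(2) order_refl] alpha_le_UN[OF S(2) Z(2)]] W(2)])
  then have al0: "alpha_le E Y k0" by (rule alpha_le_mono) (use k in auto)
  then have alk: "alpha_le E Y k" by (rule alpha_le_mono) (use k in auto)
  define D where "D = \<beta> Y"
  have D: "D \<noteq> {}" "D \<subseteq> V - Y" "conn E D" unfolding D_def using havenD[OF h YV alk] by auto
  obtain r where r: "r \<in> D" using D(1) by blast
  have "\<exists>Q. Q \<subseteq> D \<and> r \<in> Q \<and> conn E Q \<and> card Q \<le> t \<and> (\<exists>q\<in>Q. (v, q) \<in> E)" if v: "v \<in> S" for v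
  proof -
    have "\<not> anticomplete E {v} D" using nl[OF v] YV al0 unfolding light_def D_def by blast
    moreover have vD: "v \<notin> D" using D(2) v by (auto simp: Y_def)
    ultimately obtain d where d: "d \<in> D" "(v, d) \<in> E" by (auto simp: anticomplete_def)
    note sp = shortest_ipath[OF E r connD[OF D(3) r d(1)], of "\<lambda>z. (v, z) \<in> E"]
    obtain xs where xs: "ipath E xs" "xs \<noteq> []" "hd xs = r" "set xs \<subseteq> D" "(v, last xs) \<in> E"
      "\<And>z. z \<in> set (butlast xs) \<Longrightarrow> (v, z) \<notin> E"
      by (rule sp) (use d in auto)
    have "length xs \<le> t"
    proof (rule ccontr)
      assume "\<not> ?thesis"
      then have len: "length xs \<ge> Suc t" by simp
      define p where "p = take (Suc t) (rev xs)"
      have sp: "set p \<subseteq> set xs" unfolding p_def using set_take_subset[of "Suc t" "rev xs"] by simp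
      have hp: "p \<noteq> []" "hd p = last xs" using xs(2) by (auto simp: p_def hd_rev)
      have "tl p = take t (tl (rev xs))" by (simp add: p_def take_tl)
      moreover have "tl (rev xs) = rev (butlast xs)" by (metis butlast_rev rev_rev_ident)
      ultimately have tp: "set (tl p) \<subseteq> set (butlast xs)" using set_take_subset[of t "tl (rev xs)"] by simp
      have "leg E {v} t p"
        unfolding leg_def
      proof (intro conjI)
        show "ipath E p" unfolding p_def using xs(1) by (intro ipath_take) (simp add: ipath_rev)
        show "length p = Suc t" using len by (simp add: p_def)
        show "set p \<inter> {v} = {}" using sp xs(4) vD by auto
        show "\<exists>x\<in>{v}. (hd p, x) \<in> E" using hp symE[OF xs(5)] by simp
        show "\<forall>y\<in>set (tl p). \<forall>x\<in>{v}. (y, x) \<notin> E"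
        proof (intro ballI)
          fix y x assume "y \<in> set (tl p)" "x \<in> {v}"
          then show "(y, x) \<notin> E" using xs(6)[of y] tp symE[of y v] by auto
        qed
      qed
      moreover have "set p \<subseteq> V" "set p \<inter> Z v = {}" using sp xs(4) D(2) v by (auto simp: Y_def)
      ultimately show False using Z(3)[OF v] by blast
    qed
    moreover have "r \<in> set xs" using xs(2,3) hd_in_set by metis
    moreover have "\<exists>q\<in>set xs. (v, q) \<in> E" using xs(2,5) last_in_set by metis
    ultimately show ?thesis using xs(4) conn_ipath[OF E(1) xs(1)] card_length[of xs]
      by (intro exI[of _ "set xs"]) auto
  qed
  then obtain Q where Q: "\<And>v. v \<in> S \<Longrightarrow> Q v \<subseteq> D \<and> r \<in> Q v \<and> conn E (Q v) \<and> card (Q v) \<le> t \<and> (\<exists>q\<in>Q v. (v, q) \<in> E)"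
    by metis
  \<comment> \<open>All paths contain r, so any two of them form a connected set of at most 2 t
    vertices. Inserting r keeps R nonempty even if S is empty.\<close>
  define R where "R = insert r (\<Union>v\<in>S. Q v)"
  have RD: "R \<subseteq> D" using Q r by (auto simp: R_def)
  have "connector V E S s (2 * t) R"
    unfolding connector_def
  proof (intro conjI ballI)
    show "R \<subseteq> V - S" using RD D(2) by (auto simp: Y_def)
    show "card {v \<in> S. (q, v) \<in> E} < s" if "q \<in> R" for q
      using that RD D(2) by (intro W(3)) (auto simp: Y_def)
    fix a b assume a: "a \<in> S" and b: "b \<in> S"
    have "conn E (Q a \<union> Q b)" using Q[OF a] Q[OF b] by (intro conn_Un[OF E(1), of _ _ r r]) auto
    moreover have "card (Q a \<union> Q b) \<le> 2 * t" using card_Un_le[of "Q a" "Q b"] Q[OF a] Q[OF b] by linarith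
    ultimately show "\<exists>Q\<subseteq>R. conn E Q \<and> card Q \<le> 2 * t \<and> (\<exists>q\<in>Q. (a, q) \<in> E) \<and> (\<exists>q\<in>Q. (b, q) \<in> E)"
      using Q[OF a] Q[OF b] a b by (intro exI[of _ "Q a \<union> Q b"]) (auto simp: R_def)
  qed
  moreover have "card R \<le> Suc (card S * t)"
  proof -
    have "card (\<Union>v\<in>S. Q v) \<le> (\<Sum>v\<in>S. card (Q v))" using S(2) by (rule card_UN_le)
    also have "\<dots> \<le> (\<Sum>v\<in>S. t)" using Q by (intro sum_mono) auto
    finally have "card (\<Union>v\<in>S. Q v) \<le> card S * t" by simp
    then show ?thesis using card_insert_le_m1[of "Suc (card S * t)" "\<Union>v\<in>S. Q v" r] by (simp add: R_def)
  qed
  moreover have "R \<inter> W = {}" using RD D(2) by (auto simp: Y_def)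
  ultimately show ?thesis by (intro exI[of _ R]) (auto simp: R_def)
qed

lemma index_inj:
  fixes i i' n n' t :: nat
  assumes "i * t + n = i' * t + n'" "1 \<le> n" "n \<le> t" "1 \<le> n'" "n' \<le> t"
  shows "i = i' \<and> n = n'"
proof -
  obtain a b where ab: "n = Suc a" "n' = Suc b" "a < t" "b < t"
    using assms by (metis Suc_le_D Suc_le_lessD One_nat_def)
  then have "(i * t + a) div t = (i' * t + b) div t" using assms(1) by simp
  then have "i = i'" using ab by simp
  then show ?thesis using assms(1) by simp
qed

text \<open>Every pair of vertices of S has its own connector, and different pairs have anticomplete
  ones. The connected set \<open>Qf i j\<close> chosen in it sees at most \<open>k * s\<close>
  vertices of S, recorded in \<open>B i j\<close>; for i < j in the clean index set I it sees none
  with index in I except the two that it joins. Three chains of t such sets with a common start form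
  the spider.\<close>

lemma many_connectors_imp_claw:
  fixes g :: "nat \<Rightarrow> 'a"
  assumes E: "sym E" "irrefl E" and t: "t \<ge> 1"
    and g: "bij_betw g {..<N} S" and S: "stab E S" "S \<subseteq> V" and V: "finite V"
    and N: "\<And>B :: nat \<Rightarrow> nat \<Rightarrow> nat set.
      (\<And>i j. i < j \<Longrightarrow> j < N \<Longrightarrow> finite (B i j) \<and> card (B i j) \<le> k * s) \<Longrightarrow>
      \<exists>I\<subseteq>{..<N}. card I = Suc (3 * t) \<and> (\<forall>i\<in>I. \<forall>j\<in>I. i < j \<longrightarrow> B i j \<inter> (I - {i, j}) = {})"
    and R: "\<And>i j. i < N \<Longrightarrow> j < N \<Longrightarrow> connector V E S s k (R i j)"
    and RR: "\<And>i j i' j'. i < N \<Longrightarrow> j < N \<Longrightarrow> i' < N \<Longrightarrow> j' < N \<Longrightarrow> (i, j) \<noteq> (i', j') \<Longrightarrow>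
      anticomplete E (R i j) (R i' j')"
  shows "\<exists>R\<subseteq>V. claw_set E t R \<or> tri_set E t R"
proof -
  have symE: "(y, x) \<in> E" if "(x, y) \<in> E" for x y using symD[OF E(1) that] .
  have gS: "g i \<in> S" if "i < N" for i using g that by (auto simp: bij_betw_def)
  have ginj: "g i = g j \<longleftrightarrow> i = j" if "i < N" "j < N" for i j
    using g that by (auto simp: bij_betw_def inj_on_def)
  have finS: "finite S" using S(2) V finite_subset by blast
  have "\<exists>Q\<subseteq>R i j. conn E Q \<and> card Q \<le> k \<and> (\<exists>q\<in>Q. (g i, q) \<in> E) \<and> (\<exists>q\<in>Q. (g j, q) \<in> E)"
    if "i < N" "j < N" for i j
    using R[OF that] gS[OF that(1)] gS[OF that(2)] unfolding connector_def by blast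
  then obtain Qf where Qf: "\<And>i j. i < N \<Longrightarrow> j < N \<Longrightarrow> Qf i j \<subseteq> R i j \<and> conn E (Qf i j) \<and> card (Qf i j) \<le> k \<and>
     (\<exists>q\<in>Qf i j. (g i, q) \<in> E) \<and> (\<exists>q\<in>Qf i j. (g j, q) \<in> E)" by metis
  define B where "B i j = {l. l < N \<and> (\<exists>q\<in>Qf i j. (q, g l) \<in> E)}" for i j
  have Bb: "finite (B i j) \<and> card (B i j) \<le> k * s" if ij: "i < j" "j < N" for i j
  proof
    show "finite (B i j)" by (simp add: B_def)
    have iN: "i < N" using ij by simp
    note q = Qf[OF iN ij(2)]
    have RV: "R i j \<subseteq> V" "\<And>q. q \<in> R i j \<Longrightarrow> card {v \<in> S. (q, v) \<in> E} < s"
      using R[OF iN ij(2)] by (auto simp: connector_def)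
    then have finQ: "finite (Qf i j)" using q V finite_subset by (meson subset_trans)
    have c: "card {l. l < N \<and> (q, g l) \<in> E} \<le> s" if "q \<in> Qf i j" for q
    proof -
      have "card {l. l < N \<and> (q, g l) \<in> E} = card (g ` {l. l < N \<and> (q, g l) \<in> E})"
        using g by (intro card_image[symmetric]) (auto simp: bij_betw_def inj_on_def)
      also have "\<dots> \<le> card {v \<in> S. (q, v) \<in> E}"
        using finS gS by (intro card_mono) auto
      also have "\<dots> \<le> s" using RV(2)[of q] q that by fastforce
      finally show ?thesis .
    qed
    have "B i j = (\<Union>q\<in>Qf i j. {l. l < N \<and> (q, g l) \<in> E})" by (auto simp: B_def)
    then have "card (B i j) \<le> (\<Sum>q\<in>Qf i j. card {l. l < N \<and> (q, g l) \<in> E})"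
      using finQ by (simp add: card_UN_le)
    also have "\<dots> \<le> (\<Sum>q\<in>Qf i j. s)" using c by (rule sum_mono)
    also have "\<dots> \<le> k * s" using q by simp
    finally show "card (B i j) \<le> k * s" .
  qed
  have "\<exists>I\<subseteq>{..<N}. card I = Suc (3 * t) \<and> (\<forall>i\<in>I. \<forall>j\<in>I. i < j \<longrightarrow> B i j \<inter> (I - {i, j}) = {})"
    by (rule N) (rule Bb)
  then obtain I where I: "I \<subseteq> {..<N}" "card I = Suc (3 * t)"
    and cl: "\<And>i j. i \<in> I \<Longrightarrow> j \<in> I \<Longrightarrow> i < j \<Longrightarrow> B i j \<inter> (I - {i, j}) = {}"
    by (elim exE conjE) simp
  have "finite I" using I(1) finite_subset by blast
  then obtain h where h: "bij_betw h {..<Suc (3 * t)} I"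
    using ex_bij_betw_nat_finite[of I] I(2) by (auto simp: atLeast0LessThan)
  have hI: "h a \<in> I" if "a \<le> 3 * t" for a using h that by (auto simp: bij_betw_def)
  then have hN: "h a < N" if "a \<le> 3 * t" for a using that I(1) by blast
  have hinj: "h a = h b \<longleftrightarrow> a = b" if "a \<le> 3 * t" "b \<le> 3 * t" for a b
    using h that by (auto simp: bij_betw_def inj_on_def)
  \<comment> \<open>Cleanness is available for i < j only, so the connector is chosen for the
    unordered pair.\<close>
  define Qs where "Qs a b = Qf (min (h a) (h b)) (max (h a) (h b))" for a b
  \<comment> \<open>Position n of chain i has number \<open>i * t + n\<close>, and all chains start
    at 0. This uses exactly 3 t + 1 indices.\<close>
  define x where "x i n = (if n = 0 then 0 else i * t + n)" for i n :: nat
  have xle: "x i n \<le> 3 * t" if "i < 3" "n \<le> t" for i n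
  proof -
    have "i * t \<le> 2 * t" using that by (intro mult_right_mono) auto
    then have "i * t + n \<le> 3 * t" using that by linarith
    then show ?thesis by (simp add: x_def)
  qed
  have xlt: "x i n < x i (Suc n)" for i n by (simp add: x_def)
  have xinj: "n = n' \<and> (n = 0 \<or> i = i')" if "x i n = x i' n'" "n \<le> t" "n' \<le> t" for i i' n n'
    using that index_inj[of i t n i' n'] by (auto simp: x_def Suc_le_eq split: if_splits)
  have min_max: "min (h a) (h b) < N" "max (h a) (h b) < N" if "a \<le> 3 * t" "b \<le> 3 * t" for a b
    using hN[OF that(1)] hN[OF that(2)] by (auto simp: min_def max_def)
  have "\<exists>R\<subseteq>(\<Union>i<3. (\<Union>n\<le>t. {g (h (x i n))}) \<union> (\<Union>n<t. Qs (x i n) (x i (Suc n)))). claw_set E t R \<or> tri_set E t R"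
  proof (rule spider_of_connectors[OF E t, of "\<lambda>i n. g (h (x i n))" "g (h 0)"])
    show "g (h (x i 0)) = g (h 0)" for i by (simp add: x_def)
    show "(g (h (x i n)), g (h (x i' n'))) \<notin> E" if "i < 3" "i' < 3" "n \<le> t" "n' \<le> t" for i i' n n'
      using S(1) gS hN xle that by (auto simp: stab_def)
    show "n = n' \<and> (n = 0 \<or> i = i')" if "i < 3" "i' < 3" "n \<le> t" "n' \<le> t" "g (h (x i n)) = g (h (x i' n'))" for i i' n n'
      using that xinj ginj hN xle hinj by metis
    show "conn E (Qs (x i n) (x i (Suc n))) \<and> (\<exists>q\<in>Qs (x i n) (x i (Suc n)). (g (h (x i n)), q) \<in> E) \<and>
      (\<exists>q\<in>Qs (x i n) (x i (Suc n)). (g (h (x i (Suc n))), q) \<in> E)" if "i < 3" "n < t" for i n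
    proof -
      have a: "x i n \<le> 3 * t" "x i (Suc n) \<le> 3 * t" using xle that by auto
      show ?thesis using Qf[OF min_max[OF a]] unfolding Qs_def by (auto simp: min_def max_def split: if_splits)
    qed
    show "anticomplete E (Qs (x i n) (x i (Suc n))) (Qs (x i' n') (x i' (Suc n')))"
      if as: "i < 3" "i' < 3" "n < t" "n' < t" "i \<noteq> i' \<or> n \<noteq> n'" for i i' n n'
    proof -
      have a: "x i n \<le> 3 * t" "x i (Suc n) \<le> 3 * t" and b: "x i' n' \<le> 3 * t" "x i' (Suc n') \<le> 3 * t"
        using xle as by auto
      have "(min (h (x i n)) (h (x i (Suc n))), max (h (x i n)) (h (x i (Suc n)))) \<noteq>
        (min (h (x i' n')) (h (x i' (Suc n'))), max (h (x i' n')) (h (x i' (Suc n'))))"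
      proof
        assume "(min (h (x i n)) (h (x i (Suc n))), max (h (x i n)) (h (x i (Suc n)))) =
        (min (h (x i' n')) (h (x i' (Suc n'))), max (h (x i' n')) (h (x i' (Suc n'))))"
        then have "(h (x i n) = h (x i' n') \<and> h (x i (Suc n)) = h (x i' (Suc n'))) \<or>
          (h (x i n) = h (x i' (Suc n')) \<and> h (x i (Suc n)) = h (x i' n'))"
          by (auto simp: min_def max_def split: if_splits)
        then have "(x i n = x i' n' \<and> x i (Suc n) = x i' (Suc n')) \<or> (x i n = x i' (Suc n') \<and> x i (Suc n) = x i' n')"
          using hinj a b by simp
        then have "x i (Suc n) = x i' (Suc n')" using xlt[of i n] xlt[of i' n'] by auto
        then show False using xinj[of i "Suc n" i' "Suc n'"] as by auto
      qed
      then have "anticomplete E (R (min (h (x i n)) (h (x i (Suc n)))) (max (h (x i n)) (h (x i (Suc n)))))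
        (R (min (h (x i' n')) (h (x i' (Suc n')))) (max (h (x i' n')) (h (x i' (Suc n')))))"
        by (intro RR min_max a b)
      then show ?thesis unfolding Qs_def
        using Qf[OF min_max[OF a]] Qf[OF min_max[OF b]] by (auto intro: anticomplete_subset)
    qed
    show "g (h (x i m)) \<notin> Qs (x i' n) (x i' (Suc n))" if as: "i < 3" "i' < 3" "m \<le> t" "n < t" for i i' m n
    proof -
      have a: "x i' n \<le> 3 * t" "x i' (Suc n) \<le> 3 * t" using xle as by auto
      have "g (h (x i m)) \<in> S" using gS hN xle as by auto
      moreover have "Qs (x i' n) (x i' (Suc n)) \<subseteq> V - S"
        using Qf[OF min_max[OF a]] R[OF min_max[OF a]] unfolding Qs_def connector_def by blast
      ultimately show ?thesis by blast
    qed
    show "g (h (x i m)) = g (h (x i' n)) \<or> g (h (x i m)) = g (h (x i' (Suc n)))"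
      if as: "i < 3" "i' < 3" "m \<le> t" "n < t" "q \<in> Qs (x i' n) (x i' (Suc n))" "(g (h (x i m)), q) \<in> E" for i i' m n q
    proof (rule ccontr)
      assume ne: "\<not> ?thesis"
      have a: "x i' n \<le> 3 * t" "x i' (Suc n) \<le> 3 * t" "x i m \<le> 3 * t" using xle as by auto
      let ?a = "min (h (x i' n)) (h (x i' (Suc n)))" and ?b = "max (h (x i' n)) (h (x i' (Suc n)))"
      have "h (x i' n) \<noteq> h (x i' (Suc n))" using hinj[OF a(1,2)] xlt[of i' n] by auto
      then have ab: "?a < ?b" "?a \<in> I" "?b \<in> I" using hI[OF a(1)] hI[OF a(2)] by (auto simp: min_def max_def)
      have "h (x i m) \<in> B ?a ?b"
        using as(5) symE[OF as(6)] hN[OF a(3)] by (auto simp: B_def Qs_def)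
      then have "h (x i m) \<in> {?a, ?b}" using cl[OF ab(2,3,1)] hI[OF a(3)] by blast
      then show False using ne by (auto simp: min_def max_def split: if_splits)
    qed
  qed
  then obtain T where T: "T \<subseteq> (\<Union>i<3. (\<Union>n\<le>t. {g (h (x i n))}) \<union> (\<Union>n<t. Qs (x i n) (x i (Suc n))))"
    "claw_set E t T \<or> tri_set E t T" by blast
  have "g (h (x i n)) \<in> V" if "i < 3" "n \<le> t" for i n
    using gS[OF hN[OF xle[OF that]]] S(2) by blast
  moreover have "Qs (x i n) (x i (Suc n)) \<subseteq> V" if "i < 3" "n < t" for i n
  proof -
    have a: "x i n \<le> 3 * t" "x i (Suc n) \<le> 3 * t" using xle that by auto
    show ?thesis using Qf[OF min_max[OF a]] R[OF min_max[OF a]] unfolding Qs_def connector_def by blast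
  qed
  ultimately have "(\<Union>i<3. (\<Union>n\<le>t. {g (h (x i n))}) \<union> (\<Union>n<t. Qs (x i n) (x i (Suc n)))) \<subseteq> V"
    by (intro UN_least Un_least) auto
  then show ?thesis using T by (meson subset_trans)
qed

text \<open>Let S be a stable set of N vertices that are not light. Excluding bicliques bounds the
  independence number of the set W of vertices with at least s neighbours in S. If a set Z of small
  independence number hit all connectors of bounded size, \<open>unseparated_imp_connector\<close>
  with W and Z deleted would give one that Z misses. So there are N^2 pairwise anticomplete
  connectors, one for each pair of indices, and they yield a claw or its line graph.\<close>

lemma few_unseparatedE:
  fixes s t C :: nat
  assumes t: "t \<ge> 1"
  obtains N k0 where "\<And>(V :: 'a set) E k \<beta>. finite V \<Longrightarrow> sym E \<Longrightarrow> irrefl E \<Longrightarrow> biclique_free V E s \<Longrightarrow>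
    (\<And>R. R \<subseteq> V \<Longrightarrow> \<not> claw_set E t R \<and> \<not> tri_set E t R) \<Longrightarrow> haven V E k \<beta> \<Longrightarrow> k0 \<le> k \<Longrightarrow>
    (\<And>X. X \<subseteq> V \<Longrightarrow> conn E X \<Longrightarrow>
      \<exists>Z\<subseteq>V - X. alpha_le E Z C \<and> (\<forall>p. leg E X t p \<longrightarrow> set p \<subseteq> V \<longrightarrow> set p \<inter> Z \<noteq> {})) \<Longrightarrow>
    alpha_le E {v \<in> V. \<not> light V E \<beta> k0 {v}} N"
proof (rule clean_subsetE[where k = "2 * t * s" and m = "Suc (3 * t)"])
  fix N assume N: "\<And>B :: nat \<Rightarrow> nat \<Rightarrow> nat set.
    (\<And>i j. i < j \<Longrightarrow> j < N \<Longrightarrow> finite (B i j) \<and> card (B i j) \<le> 2 * t * s) \<Longrightarrow>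
    \<exists>I\<subseteq>{..<N}. card I = Suc (3 * t) \<and> (\<forall>i\<in>I. \<forall>j\<in>I. i < j \<longrightarrow> B i j \<inter> (I - {i, j}) = {})"
  show thesis
  proof (rule packing_or_hitting_setE[where t = s and r = "Suc (N * t)" and N = "N * N", where 'a = 'a])
  fix C' assume C': "\<And>(V::'a set) E \<R>. finite V \<Longrightarrow> sym E \<Longrightarrow> biclique_free V E s \<Longrightarrow>
     (\<And>R. R \<in> \<R> \<Longrightarrow> R \<subseteq> V \<and> R \<noteq> {} \<and> card R \<le> Suc (N * t)) \<Longrightarrow>
     (\<exists>\<S>\<subseteq>\<R>. finite \<S> \<and> card \<S> = N * N \<and> pairwise (anticomplete E) \<S>) \<or>
     (\<exists>Z\<subseteq>V. alpha_le E Z C' \<and> (\<forall>R\<in>\<R>. R \<inter> Z \<noteq> {}))"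
  \<comment> \<open>The summands pay for S, for the leg-hitting sets of its vertices, for W and for
    the set hitting the connectors.\<close>
  define k0 where "k0 = N + N * C + (2 ^ N * s + C')"
  show thesis
  proof (rule that[of k0 N])
    fix V :: "'a set" and E k \<beta>
    assume V: "finite V" and E: "sym E" "irrefl E" and bf: "biclique_free V E s"
      and no: "\<And>R. R \<subseteq> V \<Longrightarrow> \<not> claw_set E t R \<and> \<not> tri_set E t R"
      and h: "haven V E k \<beta>" and k: "k0 \<le> k"
      and H: "\<And>X. X \<subseteq> V \<Longrightarrow> conn E X \<Longrightarrow>
      \<exists>Z\<subseteq>V - X. alpha_le E Z C \<and> (\<forall>p. leg E X t p \<longrightarrow> set p \<subseteq> V \<longrightarrow> set p \<inter> Z \<noteq> {})"
    show "alpha_le E {v \<in> V. \<not> light V E \<beta> k0 {v}} N"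
    proof (rule ccontr)
      assume "\<not> ?thesis"
      then obtain S where S: "S \<subseteq> {v \<in> V. \<not> light V E \<beta> k0 {v}}" "finite S" "stab E S" "card S = N"
        by (rule not_alpha_leE[of _ _ _ N]) auto
      have SV: "S \<subseteq> V" using S by auto
      define W where "W = {q \<in> V. s \<le> card {v \<in> S. (q, v) \<in> E}}"
      define TT where "TT = {T. T \<subseteq> S \<and> card T = s}"
      have finTT: "finite TT" "card TT \<le> 2 ^ N"
      proof -
        have "TT \<subseteq> Pow S" by (auto simp: TT_def)
        then show "finite TT" "card TT \<le> 2 ^ N"
          using S(2,4) card_mono[of "Pow S" TT] by (auto simp: finite_subset card_Pow)
      qed
      \<comment> \<open>The common neighbours of s vertices of S contain no stable set of s
        vertices, and S has at most 2^N subsets of size s.\<close>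
      have "alpha_le E (\<Union>T\<in>TT. {q \<in> V. \<forall>v\<in>T. (v, q) \<in> E}) (card TT * s)"
      proof (rule alpha_le_UN[OF finTT(1)])
        fix T assume T: "T \<in> TT"
        show "alpha_le E {q \<in> V. \<forall>v\<in>T. (v, q) \<in> E} s"
        proof (rule ccontr)
          assume "\<not> alpha_le E {q \<in> V. \<forall>v\<in>T. (v, q) \<in> E} s"
          then obtain B where B: "B \<subseteq> {q \<in> V. \<forall>v\<in>T. (v, q) \<in> E}" "finite B" "stab E B" "card B = s"
            by (rule not_alpha_leE[of _ _ _ s]) auto
          have "finite T" "stab E T" "T \<subseteq> V" "card T = s"
            using T S(2) SV stab_subset[OF S(3)] finite_subset[of T S] by (auto simp: TT_def)
          moreover have "T \<times> B \<subseteq> E" "B \<subseteq> V" using B by auto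
          ultimately show False using biclique_freeD[OF bf] B by blast
        qed
      qed
      moreover have "W \<subseteq> (\<Union>T\<in>TT. {q \<in> V. \<forall>v\<in>T. (v, q) \<in> E})"
      proof
        fix q assume q: "q \<in> W"
        then obtain T where "T \<subseteq> {v \<in> S. (q, v) \<in> E}" "card T = s"
          unfolding W_def by (metis (no_types, lifting) mem_Collect_eq obtain_subset_with_card_n)
        then show "q \<in> (\<Union>T\<in>TT. {q \<in> V. \<forall>v\<in>T. (v, q) \<in> E})"
          using q symD[OF E(1)] by (intro UN_I[of T]) (auto simp: TT_def W_def)
      qed
      ultimately have alW: "alpha_le E W (2 ^ N * s)"
        using finTT(2) by (elim alpha_le_mono) auto
      define \<R> where "\<R> = {R. connector V E S s (2 * t) R \<and> R \<noteq> {} \<and> card R \<le> Suc (N * t)}"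
      have "(\<exists>\<S>\<subseteq>\<R>. finite \<S> \<and> card \<S> = N * N \<and> pairwise (anticomplete E) \<S>) \<or>
        (\<exists>Z\<subseteq>V. alpha_le E Z C' \<and> (\<forall>R\<in>\<R>. R \<inter> Z \<noteq> {}))"
        by (rule C'[OF V E(1) bf]) (auto simp: \<R>_def connector_def)
      then show False
      proof
        assume "\<exists>Z\<subseteq>V. alpha_le E Z C' \<and> (\<forall>R\<in>\<R>. R \<inter> Z \<noteq> {})"
        then obtain Z where Z: "Z \<subseteq> V" "alpha_le E Z C'" "\<And>R. R \<in> \<R> \<Longrightarrow> R \<inter> Z \<noteq> {}" by blast
        have "\<exists>R. connector V E S s (2 * t) R \<and> R \<noteq> {} \<and> card R \<le> Suc (card S * t) \<and> R \<inter> (W \<union> Z) = {}"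
        proof (rule unseparated_imp_connector[OF V E h SV S(2) _ H _ alpha_le_Un[OF alW Z(2)] _ _ k])
          show "W \<union> Z \<subseteq> V" using Z(1) by (auto simp: W_def)
          show "card {v \<in> S. (q, v) \<in> E} < s" if "q \<in> V - (W \<union> Z)" for q using that by (auto simp: W_def)
          show "card S + card S * C + (2 ^ N * s + C') \<le> k0" by (simp add: k0_def S(4))
        qed (use S in auto)
        then show False using Z(3) S(4) by (auto simp: \<R>_def)
      next
        assume "\<exists>\<S>\<subseteq>\<R>. finite \<S> \<and> card \<S> = N * N \<and> pairwise (anticomplete E) \<S>"
        then obtain \<S> where SS: "\<S> \<subseteq> \<R>" "finite \<S>" "card \<S> = N * N" "pairwise (anticomplete E) \<S>" by blast
        obtain f where f: "bij_betw f {..<N * N} \<S>"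
          using ex_bij_betw_nat_finite[OF SS(2)] SS(3) by (auto simp: atLeast0LessThan)
        obtain g where g: "bij_betw g {..<N} S"
          using ex_bij_betw_nat_finite[OF S(2)] S(4) by (auto simp: atLeast0LessThan)
        have lt: "i * N + j < N * N" if "i < N" "j < N" for i j
        proof -
          have "Suc i * N \<le> N * N" using that by (intro mult_right_mono) auto
          then show ?thesis using that by simp
        qed
        have ne: "i * N + j \<noteq> i' * N + j'" if "j < N" "j' < N" "(i, j) \<noteq> (i', j')" for i j i' j'
        proof
          assume eq: "i * N + j = i' * N + j'"
          have "(i * N + j) div N = i" "(i' * N + j') div N = i'" using that by auto
          then show False using eq that by auto
        qed
        have "\<exists>R\<subseteq>V. claw_set E t R \<or> tri_set E t R"
        proof (rule many_connectors_imp_claw[OF E t g S(3) SV V N, where R = "\<lambda>i j. f (i * N + j)"])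
          show "connector V E S s (2 * t) (f (i * N + j))" if "i < N" "j < N" for i j
          proof -
            have "f (i * N + j) \<in> \<S>" using f lt[OF that] by (auto simp: bij_betw_def)
            then show ?thesis using SS(1) by (auto simp: \<R>_def)
          qed
          show "anticomplete E (f (i * N + j)) (f (i' * N + j'))"
            if "i < N" "j < N" "i' < N" "j' < N" "(i, j) \<noteq> (i', j')" for i j i' j'
          proof -
            have "f (i * N + j) \<in> \<S>" "f (i' * N + j') \<in> \<S>" using f lt that by (auto simp: bij_betw_def)
            moreover have "f (i * N + j) \<noteq> f (i' * N + j')"
              using f lt[OF that(1,2)] lt[OF that(3,4)] ne[OF that(2,4,5)] by (auto simp: bij_betw_def inj_on_def)
            ultimately show ?thesis using SS(4) by (auto simp: pairwise_def)
          qed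
        qed
        then show False using no by blast
      qed
    qed
  qed
qed
qed

lemma card_claw_tri:
  assumes "claw_set E t R \<or> tri_set E t R" "t \<ge> 1"
  shows "R \<noteq> {} \<and> finite R \<and> card R \<le> Suc (3 * t)"
  using assms(1)
proof
  assume "claw_set E t R"
  then obtain f where f: "R = f ` claw_dom t" by (auto simp: claw_set_def)
  have "finite (claw_dom t)" "card (claw_dom t) \<le> Suc (3 * t)"
    by (auto simp: claw_dom_def card_insert_if)
  then show ?thesis using f card_image_le[of "claw_dom t" f] by (auto simp: claw_dom_def)
next
  assume "tri_set E t R"
  then obtain f where f: "R = f ` tri_dom t" by (auto simp: tri_set_def)
  have "finite (tri_dom t)" "card (tri_dom t) \<le> Suc (3 * t)" by (auto simp: tri_dom_def)
  then show ?thesis using f card_image_le[of "tri_dom t" f] assms(2) by (auto simp: tri_dom_def lessThan_empty_iff)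
qed

text \<open>The order of the haven is spent in three portions: C0 on a set hitting all claws and
  their line graphs, N1 on the vertices that are not light, and k' on the contradiction in the
  remaining graph. A packing of N + N members contains N of the same kind.\<close>

lemma haven_imp_packingE:
  fixes s t N :: nat
  assumes t: "t \<ge> 1"
  obtains k where "\<And>(V :: 'a set) E \<beta>. finite V \<Longrightarrow> sym E \<Longrightarrow> irrefl E \<Longrightarrow> biclique_free V E s \<Longrightarrow>
    haven V E k \<beta> \<Longrightarrow>
    \<exists>\<S>. finite \<S> \<and> card \<S> = N \<and> pairwise (anticomplete E) \<S> \<and> (\<forall>R\<in>\<S>. R \<subseteq> V) \<and>
      ((\<forall>R\<in>\<S>. claw_set E t R) \<or> (\<forall>R\<in>\<S>. tri_set E t R))"
proof (rule packing_or_hitting_setE[where t = s and r = "Suc (3 * t)" and N = "N + N", where 'a = 'a])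
  fix C0 assume C0: "\<And>(V::'a set) E \<R>. finite V \<Longrightarrow> sym E \<Longrightarrow> biclique_free V E s \<Longrightarrow>
     (\<And>R. R \<in> \<R> \<Longrightarrow> R \<subseteq> V \<and> R \<noteq> {} \<and> card R \<le> Suc (3 * t)) \<Longrightarrow>
     (\<exists>\<S>\<subseteq>\<R>. finite \<S> \<and> card \<S> = N + N \<and> pairwise (anticomplete E) \<S>) \<or>
     (\<exists>Z\<subseteq>V. alpha_le E Z C0 \<and> (\<forall>R\<in>\<R>. R \<inter> Z \<noteq> {}))"
  show thesis
  proof (rule leg_hitting_setE[OF t, where s = s, where 'a = 'a])
    fix C assume C: "\<And>(V::'a set) E X. finite V \<Longrightarrow> sym E \<Longrightarrow> irrefl E \<Longrightarrow> biclique_free V E s \<Longrightarrow>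
     (\<And>R. R \<subseteq> V \<Longrightarrow> \<not> claw_set E t R \<and> \<not> tri_set E t R) \<Longrightarrow> X \<subseteq> V \<Longrightarrow> conn E X \<Longrightarrow>
     \<exists>Z\<subseteq>V - X. alpha_le E Z C \<and> (\<forall>p. leg E X t p \<longrightarrow> set p \<subseteq> V \<longrightarrow> set p \<inter> Z \<noteq> {})"
    show thesis
    proof (rule few_unseparatedE[OF t, where s = s and C = C, where 'a = 'a])
      fix N1 k0 assume F: "\<And>(V :: 'a set) E k \<beta>. finite V \<Longrightarrow> sym E \<Longrightarrow> irrefl E \<Longrightarrow> biclique_free V E s \<Longrightarrow>
        (\<And>R. R \<subseteq> V \<Longrightarrow> \<not> claw_set E t R \<and> \<not> tri_set E t R) \<Longrightarrow> haven V E k \<beta> \<Longrightarrow> k0 \<le> k \<Longrightarrow>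
        (\<And>X. X \<subseteq> V \<Longrightarrow> conn E X \<Longrightarrow>
          \<exists>Z\<subseteq>V - X. alpha_le E Z C \<and> (\<forall>p. leg E X t p \<longrightarrow> set p \<subseteq> V \<longrightarrow> set p \<inter> Z \<noteq> {})) \<Longrightarrow>
        alpha_le E {v \<in> V. \<not> light V E \<beta> k0 {v}} N1"
      define k' where "k' = 2 * C + k0 + Suc t * k0"
      have kk: "2 * C + k0 + Suc t * k0 \<le> k'" unfolding k'_def by (rule order_refl)
      show thesis
      proof (rule that[of "(k' + N1) + C0"])
        fix V :: "'a set" and E \<beta>
        assume V: "finite V" and E: "sym E" "irrefl E" and bf: "biclique_free V E s"
          and h: "haven V E ((k' + N1) + C0) \<beta>"
        define \<R> where "\<R> = {R. R \<subseteq> V \<and> (claw_set E t R \<or> tri_set E t R)}"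
        have "(\<exists>\<S>\<subseteq>\<R>. finite \<S> \<and> card \<S> = N + N \<and> pairwise (anticomplete E) \<S>) \<or>
          (\<exists>Z\<subseteq>V. alpha_le E Z C0 \<and> (\<forall>R\<in>\<R>. R \<inter> Z \<noteq> {}))"
          by (rule C0[OF V E(1) bf]) (use card_claw_tri t in \<open>force simp: \<R>_def\<close>)
        then show "\<exists>\<S>. finite \<S> \<and> card \<S> = N \<and> pairwise (anticomplete E) \<S> \<and> (\<forall>R\<in>\<S>. R \<subseteq> V) \<and>
          ((\<forall>R\<in>\<S>. claw_set E t R) \<or> (\<forall>R\<in>\<S>. tri_set E t R))"
        proof
          assume "\<exists>\<S>\<subseteq>\<R>. finite \<S> \<and> card \<S> = N + N \<and> pairwise (anticomplete E) \<S>"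
          then obtain \<S> where S: "\<S> \<subseteq> \<R>" "finite \<S>" "card \<S> = N + N" "pairwise (anticomplete E) \<S>" by blast
          define A where "A = {R \<in> \<S>. claw_set E t R}"
          have "card A + card (\<S> - A) = N + N"
            using S(2,3) card_Diff_subset[of A \<S>] card_mono[of \<S> A] by (auto simp: A_def)
          then consider "N \<le> card A" | "N \<le> card (\<S> - A)" by linarith
          then show ?thesis
          proof cases
            case 1
            then obtain T where T: "T \<subseteq> A" "card T = N" "finite T" by (rule obtain_subset_with_card_n)
            then have "T \<subseteq> \<S>" by (auto simp: A_def)
            then show ?thesis using T S(1) pairwise_subset[OF S(4), of T]
              by (intro exI[of _ T]) (auto simp: A_def \<R>_def)
          next
            case 2
            then obtain T where T: "T \<subseteq> \<S> - A" "card T = N" "finite T" by (rule obtain_subset_with_card_n)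
            then show ?thesis using S(1) pairwise_subset[OF S(4), of T]
              by (intro exI[of _ T]) (auto simp: A_def \<R>_def)
          qed
        next
          assume "\<exists>Z\<subseteq>V. alpha_le E Z C0 \<and> (\<forall>R\<in>\<R>. R \<inter> Z \<noteq> {})"
          then obtain Z where Z: "Z \<subseteq> V" "alpha_le E Z C0" "\<And>R. R \<in> \<R> \<Longrightarrow> R \<inter> Z \<noteq> {}" by blast
          define V1 where "V1 = V - Z"
          define \<beta>1 where "\<beta>1 Y = \<beta> (Y \<union> Z)" for Y
          have h1: "haven V1 E (k' + N1) \<beta>1" unfolding V1_def \<beta>1_def by (rule haven_delete[OF h Z(1,2)])
          have V1: "finite V1" "biclique_free V1 E s"
            using V biclique_free_subset[OF bf, of V1] by (auto simp: V1_def)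
          have no1: "\<not> claw_set E t R \<and> \<not> tri_set E t R" if "R \<subseteq> V1" for R
            using that Z(3)[of R] by (auto simp: \<R>_def V1_def)
          define L where "L = {v \<in> V1. \<not> light V1 E \<beta>1 k0 {v}}"
          have alL: "alpha_le E L N1" unfolding L_def
            by (rule F[OF V1(1) E V1(2) no1 h1 _ C[OF V1(1) E V1(2) no1]]) (simp_all add: k'_def)
          define V2 where "V2 = V1 - L"
          define \<beta>2 where "\<beta>2 Y = \<beta>1 (Y \<union> L)" for Y
          have LV: "L \<subseteq> V1" by (auto simp: L_def)
          have h2: "haven V2 E k' \<beta>2" unfolding V2_def \<beta>2_def by (rule haven_delete[OF h1 LV alL])
          have V2: "finite V2" "biclique_free V2 E s" "V2 \<subseteq> V1"
            using V1(1) biclique_free_subset[OF V1(2), of V2] by (auto simp: V2_def)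
          have no2: "\<not> claw_set E t R \<and> \<not> tri_set E t R" if "R \<subseteq> V2" for R
            using no1[of R] that V2(3) by blast
          \<comment> \<open>Deleting L keeps vertices light: \<open>\<beta>2 (Y - L)\<close> is
            \<open>\<beta>1 (Y \<union> L)\<close>, a subset of \<open>\<beta>1 Y\<close>.\<close>
          have li: "light V2 E \<beta>2 k0 {v}" if v: "v \<in> V2" for v
          proof -
            have "light V1 E \<beta>1 k0 {v}" using v by (auto simp: V2_def L_def)
            then obtain Y where Y: "Y \<subseteq> V1" "alpha_le E Y k0" "anticomplete E {v} (\<beta>1 Y)"
              by (auto simp: light_def)
            have "alpha_le E (Y \<union> L) (k0 + N1)" using Y(2) alL by (rule alpha_le_Un)
            then have "alpha_le E (Y \<union> L) (k' + N1)" by (rule alpha_le_mono) (auto simp: k'_def)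
            then have "\<beta>1 (Y \<union> L) \<subseteq> \<beta>1 Y" using Y(1) LV by (intro haven_mono[OF h1]) auto
            then have "anticomplete E {v} (\<beta>2 (Y - L))"
              using Y(3) unfolding \<beta>2_def by (auto intro: anticomplete_subset)
            moreover have "alpha_le E (Y - L) k0" using Y(2) by (rule alpha_le_mono) auto
            ultimately show ?thesis using Y(1) unfolding light_def V2_def by blast
          qed
          have False
            by (rule all_light_imp_False[OF V2(1) E h2 C[OF V2(1) E V2(2) no2] li kk])
          then show ?thesis ..
        qed
      qed
    qed
  qed
qed

subsection \<open>Tree decompositions from the absence of havens\<close>

lemma comp_eq:
  assumes "sym E" "x \<in> U" "y \<in> comp E U x"
  shows "comp E U y = comp E U x"
proof -
  have xy: "(x, y) \<in> (E \<inter> U \<times> U)\<^sup>*" using assms(3) by (simp add: comp_def)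
  then have yx: "(y, x) \<in> (E \<inter> U \<times> U)\<^sup>*" by (rule rtrancl_restrict_sym[OF assms(1)])
  show ?thesis unfolding comp_def using xy yx by (auto intro: rtrancl_trans)
qed

text \<open>If no separator is balanced, each Y leaves a component with more than 2 k stable
  vertices of W, and these components form a haven: if that of a larger separator were not contained
  in that of a smaller one, the two would be anticomplete and W would contain 4 k + 2 stable
  vertices, more than 3 k + 1.\<close>

lemma no_haven_imp_balanced_separator:
  assumes V: "finite U" and E: "sym E" and no: "\<not> (\<exists>\<beta>. haven U E k \<beta>)"
    and W: "W \<subseteq> U" "alpha_le E W (3 * k + 1)"
  shows "\<exists>Y\<subseteq>U. alpha_le E Y k \<and> (\<forall>x\<in>U - Y. alpha_le E (W \<inter> comp E (U - Y) x) (2 * k))"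
proof (rule ccontr)
  assume "\<not> ?thesis"
  then have "\<exists>x\<in>U - Y. \<not> alpha_le E (W \<inter> comp E (U - Y) x) (2 * k)" if "Y \<subseteq> U" "alpha_le E Y k" for Y
    using that by blast
  then obtain f where f: "\<And>Y. Y \<subseteq> U \<Longrightarrow> alpha_le E Y k \<Longrightarrow> f Y \<in> U - Y \<and>
    \<not> alpha_le E (W \<inter> comp E (U - Y) (f Y)) (2 * k)" by metis
  define \<beta> where "\<beta> Y = comp E (U - Y) (f Y)" for Y
  have "haven U E k \<beta>"
    unfolding haven_def
  proof (intro conjI allI impI)
    fix Y assume Y: "Y \<subseteq> U" "alpha_le E Y k"
    note fY = f[OF Y]
    show "\<beta> Y \<noteq> {}" using comp_self[of "f Y" E "U - Y"] by (auto simp: \<beta>_def)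
    show "\<beta> Y \<subseteq> U - Y" unfolding \<beta>_def using fY by (intro comp_subset) auto
    show "conn E (\<beta> Y)" unfolding \<beta>_def using fY by (intro conn_comp[OF E]) auto
    show "\<forall>x\<in>\<beta> Y. \<forall>y\<in>U - Y. (x, y) \<in> E \<longrightarrow> y \<in> \<beta> Y"
      unfolding \<beta>_def using fY comp_closed[of "f Y" "U - Y"] by blast
  next
    fix Y Y' assume Y: "Y \<subseteq> Y'" "Y' \<subseteq> U" "alpha_le E Y' k"
    then have Y0: "Y \<subseteq> U" "alpha_le E Y k" by (auto intro: alpha_le_mono)
    note fY = f[OF Y0] and fY' = f[OF Y(2,3)]
    have c: "conn E (\<beta> Y')" "\<beta> Y' \<subseteq> U - Y'"
      unfolding \<beta>_def using fY' by (auto intro!: conn_comp[OF E] comp_subset)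
    show "\<beta> Y' \<subseteq> \<beta> Y"
    proof (rule ccontr)
      assume ns: "\<not> \<beta> Y' \<subseteq> \<beta> Y"
      have cl: "y \<in> \<beta> Y" if "x \<in> \<beta> Y" "y \<in> \<beta> Y'" "(x, y) \<in> E" for x y
        using that c(2) Y(1) comp_closed[of "f Y" "U - Y" x E y] fY unfolding \<beta>_def by blast
      then have disj: "\<beta> Y' \<inter> \<beta> Y = {}" using conn_subset_closed[OF c(1), of "\<beta> Y"] ns by blast
      have ne: "(x, y) \<notin> E" "(y, x) \<notin> E" if "x \<in> \<beta> Y" "y \<in> \<beta> Y'" for x y
        using cl[OF that] disj that symD[OF E, of y x] by blast+
      obtain S where S: "S \<subseteq> W \<inter> \<beta> Y" "finite S" "stab E S" "card S = Suc (2 * k)"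
        using not_alpha_leE[of E "W \<inter> \<beta> Y" "2 * k" "Suc (2 * k)"] fY unfolding \<beta>_def by blast
      obtain S' where S': "S' \<subseteq> W \<inter> \<beta> Y'" "finite S'" "stab E S'" "card S' = Suc (2 * k)"
        using not_alpha_leE[of E "W \<inter> \<beta> Y'" "2 * k" "Suc (2 * k)"] fY' unfolding \<beta>_def by blast
      have "stab E (S \<union> S')"
        using S S' ne unfolding stab_def by blast
      moreover have "S \<union> S' \<subseteq> W" using S S' by auto
      ultimately have "card (S \<union> S') \<le> 3 * k + 1" using W(2) S(2) S'(2) by (auto simp: alpha_le_def)
      moreover have "card (S \<union> S') = card S + card S'"
        using S S' disj by (intro card_Un_disjoint) auto
      ultimately show False using S(4) S'(4) by simp
    qed
  qed
  then show False using no by blast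
qed

text \<open>Rooted tree decompositions of the subgraph induced by \<open>U\<close>; a node of the tree is the list of
  child indices on the path from the root \<open>[]\<close>.\<close>

definition ltd :: "'a set \<Rightarrow> 'a rel \<Rightarrow> nat list set \<Rightarrow> (nat list \<Rightarrow> 'a set) \<Rightarrow> bool" where
  "ltd U E P B \<longleftrightarrow> finite P \<and> [] \<in> P \<and> (\<forall>p n. p @ [n] \<in> P \<longrightarrow> p \<in> P) \<and> (\<forall>p\<in>P. B p \<subseteq> U) \<and>
     (\<forall>u\<in>U. \<forall>v\<in>U. (u, v) \<in> E \<longrightarrow> (\<exists>p\<in>P. u \<in> B p \<and> v \<in> B p)) \<and>
     (\<forall>v\<in>U. \<exists>r\<in>P. v \<in> B r \<and>
        (\<forall>p\<in>P. v \<in> B p \<longrightarrow> (\<exists>q. p = r @ q \<and> (\<forall>q1 q2. q = q1 @ q2 \<longrightarrow> v \<in> B (r @ q1)))))"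

text \<open>B0 becomes the root bag, and the decompositions of the pieces \<open>D i\<close> with
  their attachments \<open>W i\<close> become its subtrees. A vertex of B0 that occurs in subtree i
  belongs to \<open>W i\<close>, hence to the top bag of that subtree, so its occurrences remain
  connected.\<close>

lemma ltd_glue:
  assumes B0: "B0 \<subseteq> U" and U: "U = B0 \<union> (\<Union>i<m. D i)"
    and DB: "\<And>i. i < m \<Longrightarrow> D i \<inter> B0 = {}" and DD: "\<And>i j. i < m \<Longrightarrow> j < m \<Longrightarrow> i \<noteq> j \<Longrightarrow> anticomplete E (D i) (D j)"
    and W: "\<And>i. i < m \<Longrightarrow> W i \<subseteq> B0" "\<And>i d w. i < m \<Longrightarrow> d \<in> D i \<Longrightarrow> w \<in> B0 \<Longrightarrow> (d, w) \<in> E \<or> (w, d) \<in> E \<Longrightarrow> w \<in> W i"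
    and t: "\<And>i. i < m \<Longrightarrow> ltd (D i \<union> W i) E (P i) (B i)" "\<And>i. i < m \<Longrightarrow> W i \<subseteq> B i []"
  shows "ltd U E (insert [] (\<Union>i<m. (\<lambda>p. i # p) ` P i)) (\<lambda>p. case p of [] \<Rightarrow> B0 | i # p \<Rightarrow> B i p)"
    (is "ltd U E ?P ?B")
  unfolding ltd_def
proof (intro conjI)
  note tD = t(1)[unfolded ltd_def]
  show "finite ?P" using tD by auto
  show "[] \<in> ?P" by simp
  show "\<forall>p n. p @ [n] \<in> ?P \<longrightarrow> p \<in> ?P"
  proof (intro allI impI)
    fix p n assume "p @ [n] \<in> ?P"
    then obtain i p' where i: "i < m" "p' \<in> P i" "p @ [n] = i # p'" by auto
    then show "p \<in> ?P" using tD[OF i(1)] by (cases p) auto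
  qed
  show "\<forall>p\<in>?P. ?B p \<subseteq> U"
  proof
    fix p assume "p \<in> ?P"
    then consider "p = []" | i p' where "i < m" "p' \<in> P i" "p = i # p'" by auto
    then show "?B p \<subseteq> U"
    proof cases
      case 2
      have "B i p' \<subseteq> D i \<union> W i" using tD[OF 2(1)] 2(2) by simp
      also have "\<dots> \<subseteq> U" using W(1)[OF 2(1)] 2(1) U by auto
      finally show ?thesis using 2 by simp
    qed (use B0 in simp)
  qed
  show "\<forall>u\<in>U. \<forall>v\<in>U. (u, v) \<in> E \<longrightarrow> (\<exists>p\<in>?P. u \<in> ?B p \<and> v \<in> ?B p)"
  proof (intro ballI impI)
    fix u v assume uv: "u \<in> U" "v \<in> U" "(u, v) \<in> E"
    show "\<exists>p\<in>?P. u \<in> ?B p \<and> v \<in> ?B p"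
    proof (cases "u \<in> B0 \<and> v \<in> B0")
      case True
      then show ?thesis by (intro bexI[of _ "[]"]) auto
    next
      case False
      have "\<exists>i<m. u \<in> D i \<union> W i \<and> v \<in> D i \<union> W i"
      proof (cases "u \<in> B0")
        case True
        then obtain i where i: "i < m" "v \<in> D i" using False uv U by auto
        then show ?thesis using W(2)[OF i True] uv by blast
      next
        case f: False
        then obtain i where i: "i < m" "u \<in> D i" using uv U by auto
        show ?thesis
        proof (cases "v \<in> B0")
          case True
          then show ?thesis using i W(2)[OF i True] uv by blast
        next
          case False
          then obtain j where j: "j < m" "v \<in> D j" using uv U by auto
          then have "i = j" using DD[OF i(1) j(1)] uv i by (auto simp: anticomplete_def)
          then show ?thesis using i j by blast
        qed
      qed
      then obtain i where i: "i < m" "u \<in> D i \<union> W i" "v \<in> D i \<union> W i" by blast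
      then obtain p where "p \<in> P i" "u \<in> B i p" "v \<in> B i p" using tD[OF i(1)] uv(3) by meson
      then show ?thesis using i(1) by (intro bexI[of _ "i # p"]) auto
    qed
  qed
  show "\<forall>v\<in>U. \<exists>r\<in>?P. v \<in> ?B r \<and>
        (\<forall>p\<in>?P. v \<in> ?B p \<longrightarrow> (\<exists>q. p = r @ q \<and> (\<forall>q1 q2. q = q1 @ q2 \<longrightarrow> v \<in> ?B (r @ q1))))"
  proof
    fix v assume v: "v \<in> U"
    have top: "\<exists>r\<in>P i. v \<in> B i r \<and>
        (\<forall>p\<in>P i. v \<in> B i p \<longrightarrow> (\<exists>q. p = r @ q \<and> (\<forall>q1 q2. q = q1 @ q2 \<longrightarrow> v \<in> B i (r @ q1))))"
      if "i < m" "v \<in> D i \<union> W i" for i using tD[OF that(1)] that(2) by blast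
    have inD: "v \<in> D i \<union> W i" if "i < m" "p \<in> P i" "v \<in> B i p" for i p
      using tD[OF that(1)] that by blast
    show "\<exists>r\<in>?P. v \<in> ?B r \<and>
        (\<forall>p\<in>?P. v \<in> ?B p \<longrightarrow> (\<exists>q. p = r @ q \<and> (\<forall>q1 q2. q = q1 @ q2 \<longrightarrow> v \<in> ?B (r @ q1))))"
    proof (cases "v \<in> B0")
      case True
      show ?thesis
      proof (intro bexI[of _ "[]"] conjI ballI impI)
        fix p assume p: "p \<in> ?P" "v \<in> ?B p"
        show "\<exists>q. p = [] @ q \<and> (\<forall>q1 q2. q = q1 @ q2 \<longrightarrow> v \<in> ?B ([] @ q1))"
        proof (cases p)
          case Nil
          then show ?thesis using True by auto
        next
          case (Cons i p')
          then have i: "i < m" "p' \<in> P i" "v \<in> B i p'" using p by auto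
          have vW: "v \<in> W i" using inD[OF i] True DB[OF i(1)] by blast
          then have v0: "v \<in> B i []" using t(2)[OF i(1)] by blast
          obtain r where r: "r \<in> P i" "v \<in> B i r"
            "\<And>p. p \<in> P i \<Longrightarrow> v \<in> B i p \<Longrightarrow> (\<exists>q. p = r @ q \<and> (\<forall>q1 q2. q = q1 @ q2 \<longrightarrow> v \<in> B i (r @ q1)))"
            using top[OF i(1)] vW by blast
          \<comment> \<open>v is in the top bag of the subtree, so the topmost node containing it is
            the empty list.\<close>
          have "r = []" using r(3)[of "[]"] v0 tD[OF i(1)] by auto
          then have "\<And>q1 q2. p' = q1 @ q2 \<Longrightarrow> v \<in> B i q1" using r(3)[OF i(2,3)] by auto
          then have "\<forall>q1 q2. p = q1 @ q2 \<longrightarrow> v \<in> ?B q1"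
            using Cons True by (auto split: list.splits simp: Cons_eq_append_conv)
          then show ?thesis by auto
        qed
      qed (use True in auto)
    next
      case False
      then obtain i where i: "i < m" "v \<in> D i" using v U by auto
      obtain r where r: "r \<in> P i" "v \<in> B i r"
        "\<And>p. p \<in> P i \<Longrightarrow> v \<in> B i p \<Longrightarrow> (\<exists>q. p = r @ q \<and> (\<forall>q1 q2. q = q1 @ q2 \<longrightarrow> v \<in> B i (r @ q1)))"
        using top[OF i(1)] i(2) by blast
      show ?thesis
      proof (intro bexI[of _ "i # r"] conjI ballI impI)
        fix p assume p: "p \<in> ?P" "v \<in> ?B p"
        then have "p \<noteq> []" using False by auto
        then obtain j p' where j: "p = j # p'" "j < m" "p' \<in> P j" "v \<in> B j p'" using p by auto
        then have "v \<in> D j" using inD[OF j(2-4)] W(1)[OF j(2)] False by blast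
        then have "j = i" using DD[OF i(1) j(2)] i(2) by (auto simp: anticomplete_def)
        then show "\<exists>q. p = (i # r) @ q \<and> (\<forall>q1 q2. q = q1 @ q2 \<longrightarrow> v \<in> ?B ((i # r) @ q1))"
          using r(3)[of p'] j by auto
      qed (use i r in auto)
    qed
  qed
qed

text \<open>The root bag consists of W, a balanced separator Y and one vertex u, so its independence
  number is at most (3 k + 1) + k + 1. A component of the rest attaches only to Y, to u and to the
  vertices of W in a single component of U - Y. This gives 2 k + k + 1 for the next W, the same
  bound as before.\<close>

lemma no_haven_imp_ltd:
  assumes V: "finite V" and E: "sym E" and no: "\<And>U. U \<subseteq> V \<Longrightarrow> \<not> (\<exists>\<beta>. haven U E k \<beta>)"
  shows "U \<subseteq> V \<Longrightarrow> W \<subseteq> U \<Longrightarrow> alpha_le E W (3 * k + 1) \<Longrightarrow>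
    \<exists>P B. ltd U E P B \<and> W \<subseteq> B [] \<and> (\<forall>p\<in>P. alpha_le E (B p) (4 * k + 2))"
proof (induction "card (U - W)" arbitrary: U W rule: less_induct)
  case less
  have finU: "finite U" using less.prems V finite_subset by blast
  show ?case
  proof (cases "U = W")
    case True
    have "ltd U E {[]} (\<lambda>_. U)" by (auto simp: ltd_def)
    moreover have "alpha_le E U (4 * k + 2)" using less.prems(3) True by (auto intro: alpha_le_mono)
    ultimately show ?thesis using True by blast
  next
    case False
    \<comment> \<open>Putting a vertex outside W into the root bag makes \<open>card (U - W)\<close>
      decrease even if the separator is contained in W.\<close>
    then obtain u where u: "u \<in> U" "u \<notin> W" using less.prems by auto
    obtain Y where Y: "Y \<subseteq> U" "alpha_le E Y k"
      "\<And>x. x \<in> U - Y \<Longrightarrow> alpha_le E (W \<inter> comp E (U - Y) x) (2 * k)"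
      using no_haven_imp_balanced_separator[OF finU E no[OF less.prems(1)] less.prems(2,3)] by blast
    have alu: "alpha_le E {u} 1" by (rule alpha_le_card) auto
    define B0 where "B0 = W \<union> Y \<union> {u}"
    have B0U: "B0 \<subseteq> U" using less.prems Y u by (auto simp: B0_def)
    have "alpha_le E B0 ((3 * k + 1) + k + 1)"
      unfolding B0_def using less.prems(3) Y(2) alu by (intro alpha_le_Un)
    then have alB0: "alpha_le E B0 (4 * k + 2)" by (rule alpha_le_mono) auto
    define \<D> where "\<D> = comp E (U - B0) ` (U - B0)"
    have "finite \<D>" using finU by (simp add: \<D>_def)
    then obtain D where D: "bij_betw D {..<card \<D>} \<D>"
      using ex_bij_betw_nat_finite[of \<D>] by (auto simp: atLeast0LessThan)
    define m where "m = card \<D>"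
    have Dx: "\<exists>x\<in>U - B0. D i = comp E (U - B0) x" if "i < m" for i
    proof -
      have "D i \<in> \<D>" using D that by (auto simp: bij_betw_def m_def)
      then show ?thesis by (auto simp: \<D>_def)
    qed
    have Dsub: "D i \<subseteq> U - B0" if i: "i < m" for i
    proof -
      obtain x where "x \<in> U - B0" "D i = comp E (U - B0) x" using Dx[OF i] by blast
      then show ?thesis using comp_subset[of x "U - B0" E] by simp
    qed
    define W' where "W' i = {w \<in> B0. \<exists>d\<in>D i. (d, w) \<in> E}" for i
    have alW': "alpha_le E (W' i) (3 * k + 1)" if i: "i < m" for i
    proof -
      obtain x where x: "x \<in> U - B0" "D i = comp E (U - B0) x" using Dx[OF i] by blast
      have xY: "x \<in> U - Y" using x by (auto simp: B0_def)
      have "comp E (U - B0) x \<subseteq> comp E (U - Y) x"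
        by (rule conn_subset_comp[OF conn_comp[OF E x(1)]])
          (use comp_subset[OF x(1), of E] comp_self[of x E "U - B0"] in \<open>auto simp: B0_def\<close>)
      then have DY: "D i \<subseteq> comp E (U - Y) x" using x(2) by simp
      have "W' i \<subseteq> (W \<inter> comp E (U - Y) x) \<union> Y \<union> {u}"
      proof
        fix w assume "w \<in> W' i"
        then obtain d where d: "w \<in> B0" "d \<in> D i" "(d, w) \<in> E" by (auto simp: W'_def)
        then have "w \<in> comp E (U - Y) x" if "w \<notin> Y"
          using comp_closed[OF xY, of d E w] DY that B0U by blast
        then show "w \<in> (W \<inter> comp E (U - Y) x) \<union> Y \<union> {u}" using d(1) by (auto simp: B0_def)
      qed
      moreover have "alpha_le E ((W \<inter> comp E (U - Y) x) \<union> Y \<union> {u}) (2 * k + k + 1)"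
        using Y(2) Y(3)[OF xY] alu by (intro alpha_le_Un)
      ultimately show ?thesis by (elim alpha_le_mono[rotated]) auto
    qed
    have "\<exists>P B. ltd (D i \<union> W' i) E P B \<and> W' i \<subseteq> B [] \<and> (\<forall>p\<in>P. alpha_le E (B p) (4 * k + 2))" if i: "i < m" for i
    proof (rule less.hyps)
      have "(D i \<union> W' i) - W' i \<subseteq> U - W - {u}" using Dsub[OF i] by (auto simp: B0_def)
      then have "card ((D i \<union> W' i) - W' i) \<le> card (U - W - {u})" using finU by (intro card_mono) auto
      also have "\<dots> < card (U - W)" using u finU by (intro psubset_card_mono) auto
      finally show "card ((D i \<union> W' i) - W' i) < card (U - W)" .
      show "D i \<union> W' i \<subseteq> V" using Dsub[OF i] B0U less.prems(1) by (auto simp: W'_def)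
    qed (use alW' i in auto)
    then obtain P B where PB: "\<And>i. i < m \<Longrightarrow> ltd (D i \<union> W' i) E (P i) (B i)" "\<And>i. i < m \<Longrightarrow> W' i \<subseteq> B i []"
      "\<And>i p. i < m \<Longrightarrow> p \<in> P i \<Longrightarrow> alpha_le E (B i p) (4 * k + 2)" by metis
    have "ltd U E (insert [] (\<Union>i<m. (\<lambda>p. i # p) ` P i)) (\<lambda>p. case p of [] \<Rightarrow> B0 | i # p \<Rightarrow> B i p)"
    proof (rule ltd_glue[OF B0U, where D = D and W = W'])
      have "(\<Union>i<m. D i) = \<Union> \<D>" using D by (auto simp: bij_betw_def m_def)
      also have "\<dots> = U - B0"
      proof (intro equalityI subsetI)
        fix y assume "y \<in> \<Union> \<D>"
        then obtain x where "x \<in> U - B0" "y \<in> comp E (U - B0) x" by (auto simp: \<D>_def)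
        then show "y \<in> U - B0" using comp_subset[of x "U - B0" E] by blast
      next
        fix y assume "y \<in> U - B0"
        then show "y \<in> \<Union> \<D>" using comp_self[of y E "U - B0"] by (auto simp: \<D>_def)
      qed
      finally show "U = B0 \<union> (\<Union>i<m. D i)" using B0U by auto
      show "D i \<inter> B0 = {}" if "i < m" for i using Dsub[OF that] by auto
      show "anticomplete E (D i) (D j)" if ij: "i < m" "j < m" "i \<noteq> j" for i j
      proof -
        obtain x where x: "x \<in> U - B0" "D i = comp E (U - B0) x" using Dx[OF ij(1)] by blast
        obtain y where y: "y \<in> U - B0" "D j = comp E (U - B0) y" using Dx[OF ij(2)] by blast
        have ne: "D i \<noteq> D j" using D ij by (auto simp: bij_betw_def inj_on_def m_def)
        have disj: "D i \<inter> D j = {}"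
        proof (rule ccontr)
          assume "D i \<inter> D j \<noteq> {}"
          then obtain z where "z \<in> D i" "z \<in> D j" by auto
          then have "D i = D j" using comp_eq[OF E x(1), of z] comp_eq[OF E y(1), of z] x y by simp
          then show False using ne by simp
        qed
        moreover have "(a, b) \<notin> E" if "a \<in> D i" "b \<in> D j" for a b
          using comp_closed[OF x(1), of a E b] that disj x(2) Dsub[OF ij(2)] by blast
        ultimately show ?thesis by (auto simp: anticomplete_def)
      qed
      show "W' i \<subseteq> B0" for i by (auto simp: W'_def)
      show "w \<in> W' i" if "d \<in> D i" "w \<in> B0" "(d, w) \<in> E \<or> (w, d) \<in> E" for i d w
        using that symD[OF E] by (auto simp: W'_def)
    qed (use PB in auto)
    moreover have "W \<subseteq> B0" by (auto simp: B0_def)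
    ultimately show ?thesis using alB0 PB(3)
      by (intro exI[of _ "insert [] (\<Union>i<m. (\<lambda>p. i # p) ` P i)"] exI[of _ "\<lambda>p. case p of [] \<Rightarrow> B0 | i # p \<Rightarrow> B i p"]) auto
  qed
qed

subsection \<open>Graphs as pair digraphs\<close>

lemma pair_graph_iff_sgraph: "pair_graph G \<longleftrightarrow> sgraph (pverts G) (parcs G)"
proof
  assume "pair_graph G"
  then interpret pair_graph G .
  have "irrefl (parcs G)" using no_loops' by (auto simp: irrefl_def)
  moreover have "sym (parcs G)" using arcs_symmetric by (auto simp: sym_def)
  moreover have "parcs G \<subseteq> pverts G \<times> pverts G" using in_arcsD1 in_arcsD2 by auto
  ultimately show "sgraph (pverts G) (parcs G)" using pair_finite_verts by (simp add: sgraph_def)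
next
  assume s: "sgraph (pverts G) (parcs G)"
  have "finite (parcs G)" using s finite_subset[of "parcs G" "pverts G \<times> pverts G"] by (simp add: sgraph_def)
  then show "pair_graph G"
    using s by unfold_locales (auto simp: sgraph_def symmetric_def irrefl_def)
qed

lemma rtrancl_on_iff: "u \<in> S \<Longrightarrow> (u, v) \<in> rtrancl_on S A \<longleftrightarrow> (u, v) \<in> (A \<inter> S \<times> S)\<^sup>*"
proof
  assume "(u, v) \<in> rtrancl_on S A"
  then show "(u, v) \<in> (A \<inter> S \<times> S)\<^sup>*"
  proof (induction rule: rtrancl_on.induct)
    case (rtrancl_on_into_rtrancl_on a b c)
    then show ?case using in_rtrancl_on_in_F(2)[of a b S A] by (auto intro: rtrancl_into_rtrancl)
  qed simp
next
  assume u: "u \<in> S" and "(u, v) \<in> (A \<inter> S \<times> S)\<^sup>*"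
  from this(2) show "(u, v) \<in> rtrancl_on S A"
    by induction (use u in \<open>auto intro: rtrancl_on_into_rtrancl_on\<close>)
qed

lemma connected_iff_conn:
  assumes "verts H = S" "arcs H \<inter> S \<times> S = E \<inter> S \<times> S" "tail H = fst" "head H = snd" "sym E" "arcs H \<subseteq> S \<times> S"
  shows "connected H \<longleftrightarrow> S \<noteq> {} \<and> conn E S"
proof -
  have a: "arcs H = E \<inter> S \<times> S" using assms by auto
  have "arcs_ends (with_proj (mk_symmetric H)) = E \<inter> S \<times> S"
    using assms(3,4) a symD[OF assms(5)] by (auto simp: parcs_mk_symmetric)
  then show ?thesis
    using assms(1) by (auto simp: connected_def strongly_connected_def reachable_def rtrancl_on_iff conn_def)
qed

lemma connected_with_proj_iff:
  "pair_graph G \<Longrightarrow> connected (with_proj G) \<longleftrightarrow> pverts G \<noteq> {} \<and> conn (parcs G) (pverts G)"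
  by (rule connected_iff_conn) (auto simp: pair_graph_iff_sgraph sgraph_def)

lemma connected_restrict_iff:
  "pair_graph G \<Longrightarrow> connected (with_proj G \<restriction> S) \<longleftrightarrow> S \<noteq> {} \<and> conn (parcs G) S"
  by (rule connected_iff_conn) (auto simp: pair_graph_iff_sgraph sgraph_def induce_subgraph_def)

text \<open>On finite simple graphs this is equivalent to the absence of cycles of length at least
  3. It provides directly the vertex of degree at most 1 that inductions on forests remove.\<close>

definition acyc :: "'a set \<Rightarrow> 'a rel \<Rightarrow> bool" where
  "acyc V E \<longleftrightarrow> (\<forall>S\<subseteq>V. S \<noteq> {} \<longrightarrow> (\<exists>v\<in>S. \<forall>a\<in>S. \<forall>b\<in>S. (v, a) \<in> E \<longrightarrow> (v, b) \<in> E \<longrightarrow> a = b))"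

lemma pawalk_verts_eq: "pcas u p v \<Longrightarrow> pawalk_verts u p = u # map snd p"
  by (induction p arbitrary: u) auto

lemma pcas_append: "pcas u p v \<Longrightarrow> pcas v q w \<Longrightarrow> pcas u (p @ q) w"
  by (induction p arbitrary: u) auto

lemma pcas_nth:
  "pcas u p v \<Longrightarrow> i < length p \<Longrightarrow> fst (p ! i) = (if i = 0 then u else snd (p ! (i - 1)))"
  by (induction p arbitrary: u i) (auto simp: nth_Cons split: nat.splits)

lemma pcas_last: "pcas u p v \<Longrightarrow> p \<noteq> [] \<Longrightarrow> snd (last p) = v"
  by (induction p arbitrary: u) auto

text \<open>On a cycle of length at least 3 the predecessor and the successor of a vertex are
  distinct, so none of its vertices can be the one promised by \<open>acyc\<close>.\<close>

lemma acyc_imp_no_cycle: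
  assumes G: "sgraph V E" "pverts G = V" "parcs G = E" and a: "acyc V E"
    and c: "pre_digraph.cycle (with_proj G) p" "3 \<le> length p"
  shows False
proof -
  obtain u where u: "pre_digraph.awalk (with_proj G) u p u" "distinct (tl (pawalk_verts u p))"
    using c(1) unfolding pre_digraph.cycle_def awalk_verts_with_proj_eq by blast
  have p: "set p \<subseteq> E" "pcas u p u"
    using u(1) G by (auto simp: pre_digraph.awalk_def cas_with_proj_eq)
  have d: "distinct (map snd p)" using u(2) pawalk_verts_eq[OF p(2)] by simp
  define n where "n = length p"
  define w where "w i = snd (p ! i)" for i
  have n: "n \<ge> 3" using c(2) by (simp add: n_def)
  have winj: "w i = w j \<longleftrightarrow> i = j" if "i < n" "j < n" for i j
    using nth_eq_iff_index_eq[OF d, of i j] that by (simp add: w_def n_def)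
  define S where "S = w ` {..<n}"
  have edge: "(w (if i = 0 then n - 1 else i - 1), w i) \<in> E" if "i < n" for i
  proof -
    have "p ! i \<in> E" using p(1) that by (auto simp: n_def)
    moreover have "fst (p ! i) = w (if i = 0 then n - 1 else i - 1)"
      using pcas_nth[OF p(2), of i] pcas_last[OF p(2)] that by (auto simp: w_def n_def last_conv_nth)
    ultimately show ?thesis by (metis w_def prod.collapse)
  qed
  have "S \<subseteq> V" using edge sgraphD(2)[OF G(1)] by (auto simp: S_def)
  moreover have "S \<noteq> {}" using n by (auto simp: S_def lessThan_empty_iff)
  ultimately obtain v where v: "v \<in> S" "\<And>a b. a \<in> S \<Longrightarrow> b \<in> S \<Longrightarrow> (v, a) \<in> E \<Longrightarrow> (v, b) \<in> E \<Longrightarrow> a = b"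
    using a unfolding acyc_def by metis
  then obtain i where i: "i < n" "v = w i" by (auto simp: S_def)
  define j where "j = (if i = 0 then n - 1 else i - 1)"
  define k where "k = (if Suc i = n then 0 else Suc i)"
  have jk: "j < n" "k < n" "j \<noteq> k" using i n by (auto simp: j_def k_def)
  have "(v, w j) \<in> E" using edge[OF i(1)] i(2) sgraphD(5)[OF G(1)] by (simp add: j_def)
  moreover have "(if k = 0 then n - 1 else k - 1) = i" using i n by (auto simp: k_def)
  then have "(v, w k) \<in> E" using edge[OF jk(2)] i(2) by simp
  moreover have "w j \<in> S" "w k \<in> S" using jk by (auto simp: S_def)
  ultimately have "w j = w k" using v(2) by blast
  then show False using winj jk by simp
qed

text \<open>In a set S all of whose vertices have two neighbours in S, take a longest path. The
  neighbours in S of its first vertex lie on the path, and one of them is at position 2 or later,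
  which closes a cycle.\<close>

lemma no_cycle_imp_acyc:
  assumes G: "sgraph V E" "pverts G = V" "parcs G = E"
    and c: "\<not> (\<exists>p. pre_digraph.cycle (with_proj G) p \<and> 3 \<le> length p)"
  shows "acyc V E"
  unfolding acyc_def
proof (intro allI impI, rule ccontr)
  fix S assume S: "S \<subseteq> V" "S \<noteq> {}"
    and "\<not> (\<exists>v\<in>S. \<forall>a\<in>S. \<forall>b\<in>S. (v, a) \<in> E \<longrightarrow> (v, b) \<in> E \<longrightarrow> a = b)"
  then have two: "\<exists>a\<in>S. \<exists>b\<in>S. (v, a) \<in> E \<and> (v, b) \<in> E \<and> a \<noteq> b" if "v \<in> S" for v using that by blast
  define Ps where "Ps = {xs. xs \<noteq> [] \<and> distinct xs \<and> set xs \<subseteq> S \<and> (\<forall>i. Suc i < length xs \<longrightarrow> (xs ! i, xs ! Suc i) \<in> E)}"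
  have finS: "finite S" using S(1) sgraphD(1)[OF G(1)] finite_subset by blast
  obtain s where "s \<in> S" using S by auto
  then have "[s] \<in> Ps" by (simp add: Ps_def)
  moreover have "length xs \<le> card S" if "xs \<in> Ps" for xs
    using that distinct_card[of xs] card_mono[OF finS, of "set xs"] by (simp add: Ps_def)
  ultimately obtain xs where xs: "xs \<in> Ps" "\<And>ys. ys \<in> Ps \<Longrightarrow> length ys \<le> length xs"
    using ex_has_greatest_nat[of "\<lambda>xs. xs \<in> Ps" "[s]" length "Suc (card S)"] by (metis le_imp_less_Suc)
  have x: "xs \<noteq> []" "distinct xs" "set xs \<subseteq> S" "\<And>i. Suc i < length xs \<Longrightarrow> (xs ! i, xs ! Suc i) \<in> E"
    using xs(1) by (auto simp: Ps_def)
  define v where "v = xs ! 0"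
  have v: "v = hd xs" "v \<in> S" using x(1,3) by (auto simp: v_def hd_conv_nth)
  have inx: "a \<in> set xs" if "a \<in> S" "(v, a) \<in> E" for a
  proof (rule ccontr)
    assume "a \<notin> set xs"
    moreover have "(a, v) \<in> E" using that sgraphD(5)[OF G(1)] by blast
    ultimately have "a # xs \<in> Ps" using x that by (auto simp: Ps_def nth_Cons v_def split: nat.splits)
    then show False using xs(2) by fastforce
  qed
  obtain a b where ab: "a \<in> S" "b \<in> S" "(v, a) \<in> E" "(v, b) \<in> E" "a \<noteq> b" using two[OF v(2)] by blast
  obtain i j where ij: "i < length xs" "a = xs ! i" "j < length xs" "b = xs ! j"
    using inx ab by (metis in_set_conv_nth)
  have "i \<noteq> 0" "j \<noteq> 0" "i \<noteq> j" using ab ij sgraphD(6)[OF G(1)] by (intro notI; simp add: v_def)+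
  then have "\<exists>l. 2 \<le> l \<and> l < length xs \<and> (v, xs ! l) \<in> E"
    using ij ab by (cases "i < j") (auto intro: exI[of _ j] exI[of _ i])
  then obtain l where l: "2 \<le> l" "l < length xs" "(v, xs ! l) \<in> E" by blast
  define q where "q n = map (\<lambda>k. (xs ! k, xs ! Suc k)) [0..<n]" for n
  define p where "p = q l @ [(xs ! l, v)]"
  have pq: "pcas v (q n) (xs ! n)" for n
    by (induction n) (auto simp: q_def v_def intro: pcas_append)
  have pc: "pcas v p v" unfolding p_def by (rule pcas_append[OF pq]) simp
  have "set p \<subseteq> E" using x(4) l sgraphD(5)[OF G(1) l(3)] by (auto simp: p_def q_def)
  then have "pre_digraph.awalk (with_proj G) v p v"
    using pc v(2) S(1) G by (auto simp: pre_digraph.awalk_def cas_with_proj_eq)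
  moreover have "distinct (tl (pawalk_verts v p))"
  proof -
    have "map snd (q l) = map (\<lambda>k. xs ! Suc k) [0..<l]" by (simp add: q_def comp_def)
    moreover have "distinct (map (\<lambda>k. xs ! Suc k) [0..<l])"
      using x(2) l(2) by (auto simp: distinct_map inj_on_def nth_eq_iff_index_eq)
    moreover have "v \<notin> set (map (\<lambda>k. xs ! Suc k) [0..<l])"
    proof
      assume "v \<in> set (map (\<lambda>k. xs ! Suc k) [0..<l])"
      then obtain k where k: "k < l" "xs ! 0 = xs ! Suc k" by (auto simp: v_def)
      then show False using nth_eq_iff_index_eq[OF x(2), of 0 "Suc k"] l(2) x(1) by simp
    qed
    ultimately show ?thesis using pawalk_verts_eq[OF pc] by (simp add: p_def)
  qed
  moreover have "p \<noteq> []" "3 \<le> length p" using l by (auto simp: p_def q_def)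
  ultimately show False using c unfolding pre_digraph.cycle_def awalk_verts_with_proj_eq by blast
qed

lemma undirected_forest_iff:
  "undirected_forest G \<longleftrightarrow> sgraph (pverts G) (parcs G) \<and> acyc (pverts G) (parcs G)"
  unfolding undirected_forest_def pair_graph_iff_sgraph
  using acyc_imp_no_cycle no_cycle_imp_acyc by blast

lemma undirected_tree_iff:
  "undirected_tree G \<longleftrightarrow> sgraph (pverts G) (parcs G) \<and> acyc (pverts G) (parcs G) \<and>
     pverts G \<noteq> {} \<and> conn (parcs G) (pverts G)"
  unfolding undirected_tree_def undirected_forest_iff
  using connected_with_proj_iff[of G] by (auto simp: pair_graph_iff_sgraph)

subsection \<open>From lists of indices to tree decompositions\<close>

text \<open>\<open>list_encode\<close> turns the nodes into natural numbers; tree edges join a list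
  to its extensions by one entry. In any set of nodes, a longest list can only be adjacent to its
  \<open>butlast\<close>, which shows acyclicity.\<close>

lemma ltd_imp_tree_decomposition:
  assumes G: "pair_graph G" and t: "ltd (pverts G) (parcs G) P B"
  shows "\<exists>T. tree_decomposition G T (B \<circ> list_decode) \<and> list_decode ` pverts T = P"
proof -
  note t0 = t[unfolded ltd_def]
  have fin: "finite P"
    using t0 by (elim conjE)
  have nil: "[] \<in> P"
    using t0 by (elim conjE)
  have closed': "\<forall>p n. p @ [n] \<in> P \<longrightarrow> p \<in> P"
    using t0 by (elim conjE)
  have bag': "\<forall>p\<in>P. B p \<subseteq> pverts G"
    using t0 by (elim conjE)
  have edge': "\<forall>u\<in>pverts G. \<forall>v\<in>pverts G. (u, v) \<in> parcs G \<longrightarrow> (\<exists>p\<in>P. u \<in> B p \<and> v \<in> B p)"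
    using t0 by (elim conjE)
  have top': "\<forall>v\<in>pverts G. \<exists>r\<in>P. v \<in> B r \<and>
      (\<forall>p\<in>P. v \<in> B p \<longrightarrow> (\<exists>q. p = r @ q \<and> (\<forall>q1 q2. q = q1 @ q2 \<longrightarrow> v \<in> B (r @ q1))))"
    using t0 by (elim conjE)
  note closed = closed'[rule_format] and bag = bag'[rule_format] and edge = edge'[rule_format] and top = top'[rule_format]
  define F where "F = {(list_encode p, list_encode (p @ [n])) |p n. p @ [n] \<in> P} \<union>
    {(list_encode (p @ [n]), list_encode p) |p n. p @ [n] \<in> P}"
  define N where "N = list_encode ` P"
  define T where "T = \<lparr>pverts = N, parcs = F\<rparr>"
  have prefix: "p \<in> P" if "p @ q \<in> P" for p q
    using that
  proof (induction q rule: rev_induct)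
    case (snoc x q)
    then show ?case using closed by (metis append_assoc)
  qed simp
  have FE: "(list_encode p, list_encode q) \<in> F \<longleftrightarrow> (\<exists>n. q \<in> P \<and> q = p @ [n]) \<or> (\<exists>n. p \<in> P \<and> p = q @ [n])" for p q
    by (auto simp: F_def list_encode_eq)
  have FI: "\<exists>p q. x = list_encode p \<and> y = list_encode q \<and> p \<in> P \<and> q \<in> P" if "(x, y) \<in> F" for x y
    using that prefix by (auto simp: F_def)
  have sg: "sgraph N F"
    unfolding sgraph_def
  proof (intro conjI)
    show "finite N" using fin by (simp add: N_def)
    show "F \<subseteq> N \<times> N" using FI by (fastforce simp: N_def)
    show "sym F" by (auto simp: sym_def F_def)
    show "irrefl F" by (auto simp: irrefl_def F_def list_encode_eq)
  qed
  have ac: "acyc N F"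
    unfolding acyc_def
  proof (intro allI impI)
    fix S assume S: "S \<subseteq> N" "S \<noteq> {}"
    define m where "m = Max ((\<lambda>x. length (list_decode x)) ` S)"
    have finS: "finite S" using S(1) fin finite_subset unfolding N_def by blast
    have "m \<in> (\<lambda>x. length (list_decode x)) ` S" unfolding m_def using finS S(2) by (intro Max_in) auto
    then obtain v where v: "v \<in> S" "length (list_decode v) = m" by blast
    have le: "length (list_decode x) \<le> m" if "x \<in> S" for x using that finS by (simp add: m_def)
    have "list_decode a = butlast (list_decode v)" if "a \<in> S" "(v, a) \<in> F" for a
    proof -
      have "(list_encode (list_decode v), list_encode (list_decode a)) \<in> F" using that by simp
      then show ?thesis using le[OF that(1)] v(2) unfolding FE by auto
    qed
    then have "a = b" if "a \<in> S" "b \<in> S" "(v, a) \<in> F" "(v, b) \<in> F" for a b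
      using that by (metis list_decode_inverse)
    then show "\<exists>v\<in>S. \<forall>a\<in>S. \<forall>b\<in>S. (v, a) \<in> F \<longrightarrow> (v, b) \<in> F \<longrightarrow> a = b" using v(1) by blast
  qed
  \<comment> \<open>Used with r = [] for the whole tree, and with the topmost node for the nodes
    whose bags contain a given vertex.\<close>
  have con: "conn F (list_encode ` A)"
    if A: "A \<subseteq> P" "r \<in> A" "\<And>p. p \<in> A \<Longrightarrow> \<exists>q. p = r @ q \<and> (\<forall>q1 q2. q = q1 @ q2 \<longrightarrow> r @ q1 \<in> A)" for A r
  proof -
    let ?S = "list_encode ` A"
    have reach: "(list_encode r, list_encode (r @ q)) \<in> (F \<inter> ?S \<times> ?S)\<^sup>*"
      if "\<And>q1 q2. q = q1 @ q2 \<Longrightarrow> r @ q1 \<in> A" for q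
      using that
    proof (induction q rule: rev_induct)
      case (snoc x q)
      have "(list_encode r, list_encode (r @ q)) \<in> (F \<inter> ?S \<times> ?S)\<^sup>*"
        by (rule snoc.IH) (use snoc.prems in auto)
      moreover have a: "r @ q \<in> A" "r @ q @ [x] \<in> A" using snoc.prems[of q "[x]"] snoc.prems[of "q @ [x]" "[]"] by auto
      then have "(list_encode (r @ q), list_encode (r @ q @ [x])) \<in> F \<inter> ?S \<times> ?S"
        using A(1) by (auto simp: FE)
      ultimately show ?case by (rule rtrancl_into_rtrancl)
    qed simp
    have "(list_encode r, x) \<in> (F \<inter> ?S \<times> ?S)\<^sup>*" if x: "x \<in> ?S" for x
    proof -
      obtain p where p: "p \<in> A" "x = list_encode p" using x by auto
      then show ?thesis using A(3)[OF p(1)] reach by auto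
    qed
    then show ?thesis unfolding conn_def
      using rtrancl_restrict_sym[OF sgraphD(3)[OF sg]] by (meson rtrancl_trans)
  qed
  have "conn F N" unfolding N_def
  proof (rule con[of P "[]"])
    fix p assume "p \<in> P"
    then show "\<exists>q. p = [] @ q \<and> (\<forall>q1 q2. q = q1 @ q2 \<longrightarrow> [] @ q1 \<in> P)"
      using prefix by auto
  qed (use nil in simp_all)
  moreover have "N \<noteq> {}" using nil by (auto simp: N_def)
  ultimately have tree: "undirected_tree T" using sg ac by (simp add: undirected_tree_iff T_def)
  have pgT: "pair_graph T" using sg by (simp add: pair_graph_iff_sgraph T_def)
  have "tree_decomposition G T (B \<circ> list_decode)"
    unfolding tree_decomposition_def
  proof (intro conjI tree)
    show "\<forall>n\<in>pverts T. (B \<circ> list_decode) n \<subseteq> pverts G" using bag by (auto simp: T_def N_def)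
    show "\<forall>v\<in>pverts G. \<exists>n\<in>pverts T. v \<in> (B \<circ> list_decode) n"
    proof
      fix v assume "v \<in> pverts G"
      then obtain r where "r \<in> P" "v \<in> B r" using top by blast
      then show "\<exists>n\<in>pverts T. v \<in> (B \<circ> list_decode) n"
        by (intro bexI[of _ "list_encode r"]) (auto simp: T_def N_def)
    qed
    show "\<forall>(u, v)\<in>parcs G. \<exists>n\<in>pverts T. u \<in> (B \<circ> list_decode) n \<and> v \<in> (B \<circ> list_decode) n"
    proof (clarify)
      fix u v assume uv: "(u, v) \<in> parcs G"
      then have "u \<in> pverts G" "v \<in> pverts G" using G by (auto simp: pair_graph_iff_sgraph sgraph_def)
      then obtain p where "p \<in> P" "u \<in> B p" "v \<in> B p" using edge uv by blast
      then show "\<exists>n\<in>pverts T. u \<in> (B \<circ> list_decode) n \<and> v \<in> (B \<circ> list_decode) n"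
        by (intro bexI[of _ "list_encode p"]) (auto simp: T_def N_def)
    qed
    show "\<forall>v\<in>pverts G. connected (with_proj T \<restriction> {n \<in> pverts T. v \<in> (B \<circ> list_decode) n})"
    proof
      fix v assume v: "v \<in> pverts G"
      have eq: "{n \<in> pverts T. v \<in> (B \<circ> list_decode) n} = list_encode ` {p \<in> P. v \<in> B p}"
        by (auto simp: T_def N_def)
      obtain r where r: "r \<in> P" "v \<in> B r"
        "\<And>p. p \<in> P \<Longrightarrow> v \<in> B p \<Longrightarrow> \<exists>q. p = r @ q \<and> (\<forall>q1 q2. q = q1 @ q2 \<longrightarrow> v \<in> B (r @ q1))"
        using top[OF v] by blast
      have "conn F (list_encode ` {p \<in> P. v \<in> B p})"
      proof (rule con[of _ r])
        fix p assume p: "p \<in> {p \<in> P. v \<in> B p}"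
        then obtain q where q: "p = r @ q" "\<And>q1 q2. q = q1 @ q2 \<Longrightarrow> v \<in> B (r @ q1)" using r(3) by blast
        have "r @ q1 \<in> P" if "q = q1 @ q2" for q1 q2 using prefix[of "r @ q1" q2] that p q(1) by simp
        then show "\<exists>q. p = r @ q \<and> (\<forall>q1 q2. q = q1 @ q2 \<longrightarrow> r @ q1 \<in> {p \<in> P. v \<in> B p})"
          using q by (intro exI[of _ q]) auto
      qed (use r in auto)
      then show "connected (with_proj T \<restriction> {n \<in> pverts T. v \<in> (B \<circ> list_decode) n})"
        unfolding eq connected_restrict_iff[OF pgT] using r by (auto simp: T_def)
    qed
  qed
  moreover have "list_decode ` pverts T = P" by (auto simp: T_def N_def image_image)
  ultimately show ?thesis by blast
qed

subsection \<open>Brambles\<close>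

text \<open>An induced path passes through v only between two distinct neighbours of v, so induced
  paths between other vertices avoid v.\<close>

lemma conn_remove_leaf:
  assumes E: "sym E" "irrefl E" and S: "conn E S" and v: "\<And>a b. a \<in> S \<Longrightarrow> b \<in> S \<Longrightarrow> (v, a) \<in> E \<Longrightarrow> (v, b) \<in> E \<Longrightarrow> a = b"
  shows "conn E (S - {v})"
  unfolding conn_def
proof (intro ballI)
  fix x y assume x: "x \<in> S - {v}" and y: "y \<in> S - {v}"
  have xS: "x \<in> S" using x by simp
  note sp = shortest_ipath[OF E xS connD[OF S xS], of y "\<lambda>z. z = y"]
  obtain xs where xs: "ipath E xs" "xs \<noteq> []" "hd xs = x" "set xs \<subseteq> S" "last xs = y"
    by (rule sp) (use y in auto)
  have "v \<notin> set xs"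
  proof
    assume "v \<in> set xs"
    then obtain i where i: "i < length xs" "xs ! i = v" by (metis in_set_conv_nth)
    have "i \<noteq> 0" using i xs(2,3) x by (intro notI) (simp add: hd_conv_nth)
    moreover have "Suc i \<noteq> length xs"
    proof
      assume "Suc i = length xs"
      then have "xs ! i = last xs" using xs(2) by (metis diff_Suc_1 last_conv_nth)
      then show False using i xs(5) y by simp
    qed
    ultimately have i': "Suc (i - 1) = i" "Suc i < length xs" using i by auto
    have "(v, xs ! (i - 1)) \<in> E" "(v, xs ! Suc i) \<in> E"
      using ipath_adj[OF xs(1), of i] ipath_adj[OF xs(1), of "i - 1"] i i' by auto
    then have "xs ! (i - 1) = xs ! Suc i" using v xs(4) i i' by (meson Suc_lessD less_imp_diff_less nth_mem subsetD)
    moreover have "distinct xs" using xs(1) by (simp add: ipath_def)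
    ultimately show False using nth_eq_iff_index_eq[of xs "i - 1" "Suc i"] i i' by auto
  qed
  then have "set xs \<subseteq> S - {v}" using xs(4) by auto
  moreover have "(x, y) \<in> (E \<inter> set xs \<times> set xs)\<^sup>*"
    using connD[OF conn_ipath[OF E(1) xs(1)]] xs(2,3,5) by (metis hd_in_set last_in_set)
  ultimately show "(x, y) \<in> (E \<inter> (S - {v}) \<times> (S - {v}))\<^sup>*" by (rule rtrancl_restrict_mono[rotated])
qed

lemma conn_neighbour:
  assumes "conn E S" "v \<in> S" "S \<noteq> {v}"
  shows "\<exists>a\<in>S. (v, a) \<in> E"
proof -
  obtain y where y: "y \<in> S" "y \<noteq> v" using assms by auto
  have "(v, y) \<in> (E \<inter> S \<times> S)\<^sup>*" using connD[OF assms(1,2) y(1)] .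
  then show ?thesis using y(2) by (cases rule: converse_rtranclE) auto
qed

text \<open>The Helly property of subtrees, by removal of a leaf v. If {v} is a member, v is common
  to all. Otherwise every member through v contains the only neighbour of v, so the members still
  meet pairwise after v is removed.\<close>

lemma subtrees_helly:
  assumes "finite N" "N \<noteq> {}" "sym F" "irrefl F" "acyc N F"
    and "\<And>S. S \<in> \<S> \<Longrightarrow> S \<subseteq> N \<and> S \<noteq> {} \<and> conn F S" "\<And>S S'. S \<in> \<S> \<Longrightarrow> S' \<in> \<S> \<Longrightarrow> S \<inter> S' \<noteq> {}"
  shows "\<exists>n\<in>N. \<forall>S\<in>\<S>. n \<in> S"
  using assms
proof (induction "card N" arbitrary: N \<S> rule: less_induct)
  case less
  note S = less.prems(6) and SS = less.prems(7)
  obtain v where v: "v \<in> N" "\<And>a b. a \<in> N \<Longrightarrow> b \<in> N \<Longrightarrow> (v, a) \<in> F \<Longrightarrow> (v, b) \<in> F \<Longrightarrow> a = b"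
    using less.prems(5)[unfolded acyc_def, rule_format, OF subset_refl less.prems(2)] by blast
  show ?case
  proof (cases "\<exists>S\<in>\<S>. S = {v}")
    case True
    then show ?thesis using SS v(1) by blast
  next
    case False
    show ?thesis
    proof (cases "\<S> = {}")
      case True
      then show ?thesis using v by auto
    next
      case ne: False
      define \<S>' where "\<S>' = (\<lambda>S. S - {v}) ` \<S>"
      have "\<exists>n\<in>N - {v}. \<forall>S\<in>\<S>'. n \<in> S"
      proof (rule less.hyps)
        show "card (N - {v}) < card N" using v(1) less.prems(1) by (meson card_Diff1_less)
        show "acyc (N - {v}) F" using less.prems(5) unfolding acyc_def by (meson Diff_subset subset_trans)
        have ns: "S - {v} \<noteq> {}" if "S \<in> \<S>" for S using S[OF that] False that by blast
        show "S \<subseteq> N - {v} \<and> S \<noteq> {} \<and> conn F S" if "S \<in> \<S>'" for S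
        proof -
          obtain S0 where S0: "S0 \<in> \<S>" "S = S0 - {v}" using \<open>S \<in> \<S>'\<close> by (auto simp: \<S>'_def)
          have "conn F (S0 - {v})"
          proof (rule conn_remove_leaf[OF less.prems(3,4)])
            show "conn F S0" using S[OF S0(1)] by simp
            show "a = b" if "a \<in> S0" "b \<in> S0" "(v, a) \<in> F" "(v, b) \<in> F" for a b
              using v(2) that S[OF S0(1)] by blast
          qed
          then show ?thesis using S0 S[OF S0(1)] ns[OF S0(1)] by auto
        qed
        then show "N - {v} \<noteq> {}" using ne by (auto simp: \<S>'_def)
        show "S \<inter> S' \<noteq> {}" if SS': "S \<in> \<S>'" "S' \<in> \<S>'" for S S'
        proof -
          obtain S0 S0' where S0: "S0 \<in> \<S>" "S = S0 - {v}" "S0' \<in> \<S>" "S' = S0' - {v}"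
            using SS' by (auto simp: \<S>'_def)
          obtain x where x: "x \<in> S0" "x \<in> S0'" using SS[OF S0(1,3)] by blast
          show ?thesis
          proof (cases "x = v")
            case True
            then obtain a b where ab: "a \<in> S0" "(v, a) \<in> F" "b \<in> S0'" "(v, b) \<in> F"
              using conn_neighbour[of F S0 v] conn_neighbour[of F S0' v] S[OF S0(1)] S[OF S0(3)] S0 False x by blast
            then have "a = b" using v(2) S[OF S0(1)] S[OF S0(3)] by blast
            moreover have "a \<noteq> v" using ab less.prems(4) by (auto simp: irrefl_def)
            ultimately show ?thesis using ab S0 by blast
          next
            case False
            then show ?thesis using x S0 by blast
          qed
        qed
      qed (use less.prems in auto)
      then show ?thesis by (auto simp: \<S>'_def)
    qed
  qed
qed

text \<open>The index set is a connected set of another graph, and a path in it leads through a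
  chain of overlapping sets. It serves for subtrees of a decomposition, for subdivisions and for
  line graphs.\<close>

lemma conn_UN:
  assumes F: "sym F" and A: "conn E A" and S: "\<And>a. a \<in> A \<Longrightarrow> conn F (S a) \<and> S a \<noteq> {}"
    and SS: "\<And>a b. a \<in> A \<Longrightarrow> b \<in> A \<Longrightarrow> (a, b) \<in> E \<Longrightarrow> S a \<inter> S b \<noteq> {}"
  shows "conn F (\<Union>a\<in>A. S a)"
  unfolding conn_def
proof (intro ballI)
  let ?U = "\<Union>a\<in>A. S a"
  fix x y assume "x \<in> ?U" "y \<in> ?U"
  then obtain a b where ab: "a \<in> A" "x \<in> S a" "b \<in> A" "y \<in> S b" by auto
  have inner: "(z, w) \<in> (F \<inter> ?U \<times> ?U)\<^sup>*" if "c \<in> A" "z \<in> S c" "w \<in> S c" for c z w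
  proof (rule rtrancl_restrict_mono[of z w F "S c"])
    show "(z, w) \<in> (F \<inter> S c \<times> S c)\<^sup>*" using connD[of F "S c" z w] S[OF that(1)] that by blast
  qed (use that in auto)
  have "(a, b) \<in> (E \<inter> A \<times> A)\<^sup>*" using connD[OF A ab(1,3)] .
  then have "\<forall>w\<in>S b. (x, w) \<in> (F \<inter> ?U \<times> ?U)\<^sup>*"
  proof (induction)
    case base
    then show ?case using inner[OF ab(1,2)] by blast
  next
    case (step b c)
    then obtain z where z: "z \<in> S b" "z \<in> S c" using SS[of b c] by auto
    show ?case
    proof
      fix w assume "w \<in> S c"
      then have "(z, w) \<in> (F \<inter> ?U \<times> ?U)\<^sup>*" using inner[of c z w] z step by auto
      moreover have "(x, z) \<in> (F \<inter> ?U \<times> ?U)\<^sup>*" using step z by blast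
      ultimately show "(x, w) \<in> (F \<inter> ?U \<times> ?U)\<^sup>*" by (rule rtrancl_trans[rotated])
    qed
  qed
  then show "(x, y) \<in> (F \<inter> ?U \<times> ?U)\<^sup>*" using ab by blast
qed

text \<open>The nodes whose bags meet a connected set form a subtree, the union of the subtrees of
  its vertices. Sets that touch have intersecting subtrees, so the Helly property gives a common
  node.\<close>

lemma bramble_hit_by_bag:
  assumes G: "pair_graph G" and td: "tree_decomposition G T B"
    and A: "\<And>A. A \<in> \<A> \<Longrightarrow> A \<subseteq> pverts G \<and> A \<noteq> {} \<and> conn (parcs G) A"
    and AA: "\<And>A A'. A \<in> \<A> \<Longrightarrow> A' \<in> \<A> \<Longrightarrow> A \<inter> A' \<noteq> {} \<or> (\<exists>a\<in>A. \<exists>b\<in>A'. (a, b) \<in> parcs G)"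
  shows "\<exists>n\<in>pverts T. \<forall>A\<in>\<A>. B n \<inter> A \<noteq> {}"
proof -
  have tree: "undirected_tree T" using td by (simp add: tree_decomposition_def)
  then have T: "sgraph (pverts T) (parcs T)" "acyc (pverts T) (parcs T)" "pverts T \<noteq> {}"
    by (auto simp: undirected_tree_iff)
  have pgT: "pair_graph T" using T by (simp add: pair_graph_iff_sgraph)
  define N where "N v = {n \<in> pverts T. v \<in> B n}" for v
  have Nv: "N v \<noteq> {}" "conn (parcs T) (N v)" if "v \<in> pverts G" for v
    using td that connected_restrict_iff[OF pgT, of "N v"] by (auto simp: tree_decomposition_def N_def)
  have Nuv: "N u \<inter> N v \<noteq> {}" if "(u, v) \<in> parcs G" for u v
    using td that by (fastforce simp: tree_decomposition_def N_def)
  have "\<exists>n\<in>pverts T. \<forall>S\<in>(\<lambda>A. \<Union>v\<in>A. N v) ` \<A>. n \<in> S"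
  proof (rule subtrees_helly[OF sgraphD(1)[OF T(1)] T(3) sgraphD(3,4)[OF T(1)] T(2)])
    fix S assume "S \<in> (\<lambda>A. \<Union>v\<in>A. N v) ` \<A>"
    then obtain A0 where A0: "A0 \<in> \<A>" "S = (\<Union>v\<in>A0. N v)" by auto
    have "conn (parcs T) (\<Union>v\<in>A0. N v)"
      by (rule conn_UN[OF sgraphD(3)[OF T(1)], of "parcs G"]) (use A[OF A0(1)] Nv Nuv in auto)
    then show "S \<subseteq> pverts T \<and> S \<noteq> {} \<and> conn (parcs T) S"
      using A0 A[OF A0(1)] Nv by (fastforce simp: N_def)
  next
    fix S S' assume "S \<in> (\<lambda>A. \<Union>v\<in>A. N v) ` \<A>" "S' \<in> (\<lambda>A. \<Union>v\<in>A. N v) ` \<A>"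
    then obtain A0 A1 where A0: "A0 \<in> \<A>" "S = (\<Union>v\<in>A0. N v)" "A1 \<in> \<A>" "S' = (\<Union>v\<in>A1. N v)" by auto
    from AA[OF A0(1,3)] show "S \<inter> S' \<noteq> {}"
    proof
      assume "A0 \<inter> A1 \<noteq> {}"
      then obtain v where v: "v \<in> A0" "v \<in> A1" by auto
      then obtain n where "n \<in> N v" using Nv(1)[of v] A[OF A0(1)] by blast
      then show ?thesis using v A0 by blast
    next
      assume "\<exists>a\<in>A0. \<exists>b\<in>A1. (a, b) \<in> parcs G"
      then obtain a b n where "a \<in> A0" "b \<in> A1" "n \<in> N a" "n \<in> N b" using Nuv by blast
      then show ?thesis using A0 by blast
    qed
  qed
  then obtain n where "n \<in> pverts T" "\<And>A. A \<in> \<A> \<Longrightarrow> n \<in> (\<Union>v\<in>A. N v)" by auto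
  then show ?thesis by (intro bexI[of _ n]) (auto simp: N_def)
qed

lemma treewidth_witness:
  assumes "pair_graph G"
  shows "\<exists>T B. tree_decomposition G T B \<and> decomposition_width T B = treewidth G"
proof -
  have "\<exists>w T B. tree_decomposition G T B \<and> decomposition_width T B = w"
    using tree_decomposition_trivial[OF assms] by blast
  then show ?thesis unfolding treewidth_def
    by (rule LeastI_ex[of "\<lambda>w. \<exists>T B. tree_decomposition G T B \<and> decomposition_width T B = w"])
qed

text \<open>The sets \<open>R i \<union> C j\<close> form a bramble that no set of fewer than \<open>n\<close> vertices hits.\<close>

lemma treewidth_ge:
  assumes G: "pair_graph G"
    and R: "\<And>i. i < n \<Longrightarrow> R i \<subseteq> pverts G \<and> R i \<noteq> {} \<and> conn (parcs G) (R i)"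
    and C: "\<And>j. j < n \<Longrightarrow> C j \<subseteq> pverts G \<and> C j \<noteq> {} \<and> conn (parcs G) (C j)"
    and RR: "\<And>i j. i < n \<Longrightarrow> j < n \<Longrightarrow> i \<noteq> j \<Longrightarrow> R i \<inter> R j = {}"
    and CC: "\<And>i j. i < n \<Longrightarrow> j < n \<Longrightarrow> i \<noteq> j \<Longrightarrow> C i \<inter> C j = {}"
    and RC: "\<And>i j. i < n \<Longrightarrow> j < n \<Longrightarrow> \<exists>a\<in>R i. \<exists>b\<in>C j. (a, b) \<in> parcs G \<or> a = b"
  shows "n \<le> Suc (treewidth G)"
proof -
  obtain T B where td: "tree_decomposition G T B" and w: "decomposition_width T B = treewidth G"
    using treewidth_witness[OF G] by blast
  have E: "sym (parcs G)" and finG: "finite (pverts G)" using G by (auto simp: pair_graph_iff_sgraph sgraph_def)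
  define \<A> where "\<A> = {R i \<union> C j |i j. i < n \<and> j < n}"
  have "\<exists>m\<in>pverts T. \<forall>A\<in>\<A>. B m \<inter> A \<noteq> {}"
  proof (rule bramble_hit_by_bag[OF G td])
    fix A assume "A \<in> \<A>"
    then obtain i j where ij: "i < n" "j < n" "A = R i \<union> C j" by (auto simp: \<A>_def)
    obtain a b where "a \<in> R i" "b \<in> C j" "(a, b) \<in> parcs G \<or> a = b" using RC[OF ij(1,2)] by blast
    then have "conn (parcs G) A" using conn_Un[OF E, of "R i" "C j" a b] R[OF ij(1)] C[OF ij(2)] ij by auto
    then show "A \<subseteq> pverts G \<and> A \<noteq> {} \<and> conn (parcs G) A" using R[OF ij(1)] C[OF ij(2)] ij by auto
  next
    fix A A' assume "A \<in> \<A>" "A' \<in> \<A>"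
    then obtain i j i' j' where ij: "i < n" "A = R i \<union> C j" "j' < n" "A' = R i' \<union> C j'" by (auto simp: \<A>_def)
    then show "A \<inter> A' \<noteq> {} \<or> (\<exists>a\<in>A. \<exists>b\<in>A'. (a, b) \<in> parcs G)" using RC[OF ij(1,3)] by blast
  qed
  then obtain m where m0: "m \<in> pverts T" "\<forall>A\<in>\<A>. B m \<inter> A \<noteq> {}" by blast
  have "B m \<inter> (R i \<union> C j) \<noteq> {}" if "i < n" "j < n" for i j using m0(2) that unfolding \<A>_def by blast
  note m = m0(1) this
  have finB: "finite (B m)" using td m(1) finG finite_subset by (auto simp: tree_decomposition_def)
  have disj: "n \<le> card (B m)" if X: "\<And>i. i < n \<Longrightarrow> B m \<inter> X i \<noteq> {}" "\<And>i j. i < n \<Longrightarrow> j < n \<Longrightarrow> i \<noteq> j \<Longrightarrow> X i \<inter> X j = {}" for X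
  proof -
    have "\<exists>f. \<forall>i<n. f i \<in> B m \<inter> X i" using X(1) by (meson ex_in_conv)
    then obtain f where f: "\<And>i. i < n \<Longrightarrow> f i \<in> B m \<inter> X i" by blast
    have "inj_on f {..<n}"
    proof (rule inj_onI, rule ccontr)
      fix i j assume "i \<in> {..<n}" "j \<in> {..<n}" "f i = f j" "i \<noteq> j"
      then show False using f[of i] f[of j] X(2)[of i j] by auto
    qed
    moreover have "f ` {..<n} \<subseteq> B m" using f by auto
    ultimately show ?thesis using card_inj_on_le[of f "{..<n}" "B m"] finB by simp
  qed
  \<comment> \<open>If the bag misses some \<open>R i\<close>, it hits every \<open>C j\<close>,
    because the union of the two is in the bramble. Either way it hits n disjoint sets.\<close>
  have "n \<le> card (B m)"
  proof (cases "\<forall>i<n. B m \<inter> R i \<noteq> {}")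
    case True
    then show ?thesis using disj[of R] RR by auto
  next
    case False
    then obtain i where "i < n" "B m \<inter> R i = {}" by auto
    then have "B m \<inter> C j \<noteq> {}" if "j < n" for j using m(2)[of i j] that by blast
    then show ?thesis using disj[of C] CC by auto
  qed
  also have "card (B m) \<le> (MAX t\<in>pverts T. card (B t))"
    using m(1) td by (intro Max_ge) (auto simp: tree_decomposition_def undirected_tree_iff sgraph_def)
  finally show ?thesis using w by (simp add: decomposition_width_def)
qed

subsection \<open>Induced embeddings\<close>

definition emb :: "'a pair_pre_digraph \<Rightarrow> 'b pair_pre_digraph \<Rightarrow> ('a \<Rightarrow> 'b) \<Rightarrow> bool" where
  "emb H G f \<longleftrightarrow> inj_on f (pverts H) \<and> f ` pverts H \<subseteq> pverts G \<and>
     (\<forall>u\<in>pverts H. \<forall>v\<in>pverts H. (u, v) \<in> parcs H \<longleftrightarrow> (f u, f v) \<in> parcs G)"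

lemma emb_comp: "emb H G f \<Longrightarrow> emb G K g \<Longrightarrow> emb H K (g \<circ> f)"
  unfolding emb_def using comp_inj_on[of f "pverts H" g] inj_on_subset[of g "pverts G" "f ` pverts H"]
  by (simp add: image_comp[symmetric] image_subset_iff)

lemma wf_with_proj: "pair_graph G \<Longrightarrow> wf_digraph (with_proj G)"
  by (auto simp: pair_graph_iff_sgraph sgraph_def wf_digraph_def)

text \<open>A subgraph of \<open>with_proj G\<close> has the projections as tail and head. Hence an
  isomorphism onto it acts on arcs as it does on their ends, and only the map on vertices
  matters.\<close>

lemma induced_free_iff:
  assumes H: "pair_graph H" and G: "pair_graph G"
  shows "induced_free H G \<longleftrightarrow> \<not> (\<exists>f. emb H G f)"
proof -
  have wH: "parcs H \<subseteq> pverts H \<times> pverts H" using H by (auto simp: pair_graph_iff_sgraph sgraph_def)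
  have "\<exists>f. emb H G f" if K: "induced_subgraph K (with_proj G)" "digraph_iso (with_proj H) K" for K
  proof -
    obtain hom where hom: "pre_digraph.digraph_isomorphism (with_proj H) hom" "K = app_iso hom (with_proj H)"
      using K(2) by (auto simp: digraph_iso_def)
    define f where "f = iso_verts hom"
    have inj: "inj_on f (pverts H)" using hom(1) by (auto simp: pre_digraph.digraph_isomorphism_def f_def)
    have c: "iso_tail hom = fst" "iso_head hom = snd"
      using K(1) hom(2) by (auto simp: induced_subgraph_def subgraph_def compatible_def)
    have arc: "iso_arcs hom (u, v) = (f u, f v)" if "(u, v) \<in> parcs H" for u v
      using hom(1) that c by (auto simp: pre_digraph.digraph_isomorphism_def f_def prod_eq_iff)
    have vK: "verts K = f ` pverts H" and aK: "arcs K = iso_arcs hom ` parcs H"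
      using hom(2) by (auto simp: f_def)
    have iK: "arcs K = {e \<in> parcs G. fst e \<in> verts K \<and> snd e \<in> verts K}" and sub: "verts K \<subseteq> pverts G"
      using K(1) by (auto simp: induced_subgraph_def subgraph_def)
    have "(u, v) \<in> parcs H \<longleftrightarrow> (f u, f v) \<in> parcs G" if uv: "u \<in> pverts H" "v \<in> pverts H" for u v
    proof
      assume "(u, v) \<in> parcs H"
      then have "(f u, f v) \<in> arcs K" using arc aK by force
      then show "(f u, f v) \<in> parcs G" using iK by auto
    next
      assume "(f u, f v) \<in> parcs G"
      then have "(f u, f v) \<in> arcs K" using iK vK uv by auto
      then obtain u' v' where "(u', v') \<in> parcs H" "iso_arcs hom (u', v') = (f u, f v)" using aK by auto
      then show "(u, v) \<in> parcs H" using arc[of u' v'] wH uv inj by (auto dest: inj_onD)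
    qed
    then show ?thesis using inj sub vK unfolding emb_def by blast
  qed
  moreover have "\<exists>K. induced_subgraph K (with_proj G) \<and> digraph_iso (with_proj H) K" if f: "emb H G f" for f
  proof -
    define K where "K = \<lparr>verts = f ` pverts H, arcs = map_prod f f ` parcs H, tail = fst, head = snd\<rparr>"
    define hom where "hom = \<lparr>iso_verts = f, iso_arcs = map_prod f f, iso_head = snd, iso_tail = fst\<rparr>"
    have inj: "inj_on f (pverts H)" using f by (simp add: emb_def)
    have "inj_on (map_prod f f) (parcs H)"
      using map_prod_inj_on[OF inj inj] wH by (rule inj_on_subset)
    then have "pre_digraph.digraph_isomorphism (with_proj H) hom"
      using wf_with_proj[OF H] inj by (auto simp: pre_digraph.digraph_isomorphism_def hom_def)
    moreover have "K = app_iso hom (with_proj H)" by (simp add: K_def hom_def app_iso_def)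
    ultimately have iso: "digraph_iso (with_proj H) K" by (auto simp: digraph_iso_def)
    have "wf_digraph K" using wH by (auto simp: wf_digraph_def K_def)
    moreover have "arcs K = {e \<in> parcs G. fst e \<in> verts K \<and> snd e \<in> verts K}"
    proof (intro equalityI subsetI)
      fix e assume "e \<in> arcs K"
      then obtain u v where "(u, v) \<in> parcs H" "e = (f u, f v)" by (auto simp: K_def)
      then show "e \<in> {e \<in> parcs G. fst e \<in> verts K \<and> snd e \<in> verts K}"
        using f wH by (auto simp: emb_def K_def)
    next
      fix e assume "e \<in> {e \<in> parcs G. fst e \<in> verts K \<and> snd e \<in> verts K}"
      then obtain u v where "u \<in> pverts H" "v \<in> pverts H" "e = (f u, f v)" "e \<in> parcs G"
        by (cases e) (auto simp: K_def)
      then show "e \<in> arcs K" using f by (force simp: emb_def K_def)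
    qed
    ultimately have "induced_subgraph K (with_proj G)"
      using wf_with_proj[OF G] f by (auto simp: induced_subgraph_def subgraph_def compatible_def K_def emb_def)
    then show ?thesis using iso by blast
  qed
  ultimately show ?thesis unfolding induced_free_def by blast
qed

text \<open>Line graphs have sets as vertices, whereas the classes consist of graphs on natural
  numbers.\<close>

definition relabel :: "('a \<Rightarrow> 'b) \<Rightarrow> 'a pair_pre_digraph \<Rightarrow> 'b pair_pre_digraph" where
  "relabel f G = \<lparr>pverts = f ` pverts G, parcs = map_prod f f ` parcs G\<rparr>"

lemma relabel_parcs_iff:
  assumes "pair_graph G" "inj_on f (pverts G)" "u \<in> pverts G" "v \<in> pverts G"
  shows "(f u, f v) \<in> parcs (relabel f G) \<longleftrightarrow> (u, v) \<in> parcs G"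
proof
  assume "(f u, f v) \<in> parcs (relabel f G)"
  then obtain a b where ab: "(a, b) \<in> parcs G" "f a = f u" "f b = f v" by (auto simp: relabel_def)
  then have "a \<in> pverts G" "b \<in> pverts G" using assms(1) by (auto simp: pair_graph_iff_sgraph sgraph_def)
  then have "a = u" "b = v" using ab assms by (auto dest: inj_onD)
  then show "(u, v) \<in> parcs G" using ab by simp
qed (force simp: relabel_def)

lemma pair_graph_relabel:
  assumes G: "pair_graph G" and f: "inj_on f (pverts G)"
  shows "pair_graph (relabel f G)"
proof -
  have s: "sgraph (pverts G) (parcs G)" using G by (simp add: pair_graph_iff_sgraph)
  have 1: "parcs (relabel f G) \<subseteq> pverts (relabel f G) \<times> pverts (relabel f G)"
    using sgraphD(2)[OF s] by (auto simp: relabel_def)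
  have "sym (parcs (relabel f G))"
    using sgraphD(5)[OF s] by (force simp: sym_def relabel_def)
  moreover have "irrefl (parcs (relabel f G))"
    unfolding irrefl_def
  proof (intro allI notI)
    fix x assume x: "(x, x) \<in> parcs (relabel f G)"
    then obtain u where "u \<in> pverts G" "x = f u" using 1 by (auto simp: relabel_def)
    then show False using x relabel_parcs_iff[OF G f, of u u] sgraphD(6)[OF s] by simp
  qed
  ultimately show ?thesis using 1 sgraphD(1)[OF s] by (simp add: pair_graph_iff_sgraph sgraph_def relabel_def)
qed

lemma emb_relabel_inv:
  assumes G: "pair_graph G" and f: "inj_on f (pverts G)" and e: "emb H (relabel f G) h"
  shows "emb H G (the_inv_into (pverts G) f \<circ> h)"
proof -
  have "emb (relabel f G) G (the_inv_into (pverts G) f)"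
    unfolding emb_def
  proof (intro conjI ballI)
    show "inj_on (the_inv_into (pverts G) f) (pverts (relabel f G))"
      using inj_on_the_inv_into[OF f] by (simp add: relabel_def)
    show "the_inv_into (pverts G) f ` pverts (relabel f G) \<subseteq> pverts G"
      using the_inv_into_onto[OF f] by (simp add: relabel_def)
    fix x y assume "x \<in> pverts (relabel f G)" "y \<in> pverts (relabel f G)"
    then obtain u v where "u \<in> pverts G" "x = f u" "v \<in> pverts G" "y = f v" by (auto simp: relabel_def)
    then show "(x, y) \<in> parcs (relabel f G) \<longleftrightarrow> (the_inv_into (pverts G) f x, the_inv_into (pverts G) f y) \<in> parcs G"
      using relabel_parcs_iff[OF G f, of u v] the_inv_into_f_f[OF f] by simp
  qed
  then show ?thesis using emb_comp[OF e] by blast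
qed

lemma conn_image:
  assumes "conn E X"
  shows "conn (map_prod f f ` E) (f ` X)"
  unfolding conn_def
proof (intro ballI)
  fix x y assume "x \<in> f ` X" "y \<in> f ` X"
  then obtain u v where uv: "u \<in> X" "v \<in> X" "x = f u" "y = f v" by auto
  have "(u, v) \<in> (E \<inter> X \<times> X)\<^sup>*" using connD[OF assms uv(1,2)] .
  then have "(f u, f v) \<in> (map_prod f f ` E \<inter> f ` X \<times> f ` X)\<^sup>*"
  proof (induction)
    case (step b c)
    then have "(f b, f c) \<in> map_prod f f ` E \<inter> f ` X \<times> f ` X" by force
    then show ?case using step by (auto intro: rtrancl_into_rtrancl)
  qed simp
  then show "(x, y) \<in> (map_prod f f ` E \<inter> f ` X \<times> f ` X)\<^sup>*" using uv by simp
qed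

lemma treewidth_relabel_ge:
  assumes G: "pair_graph G" and f: "inj_on f (pverts G)"
    and R: "\<And>i. i < n \<Longrightarrow> R i \<subseteq> pverts G \<and> R i \<noteq> {} \<and> conn (parcs G) (R i)"
    and C: "\<And>j. j < n \<Longrightarrow> C j \<subseteq> pverts G \<and> C j \<noteq> {} \<and> conn (parcs G) (C j)"
    and RR: "\<And>i j. i < n \<Longrightarrow> j < n \<Longrightarrow> i \<noteq> j \<Longrightarrow> R i \<inter> R j = {}"
    and CC: "\<And>i j. i < n \<Longrightarrow> j < n \<Longrightarrow> i \<noteq> j \<Longrightarrow> C i \<inter> C j = {}"
    and RC: "\<And>i j. i < n \<Longrightarrow> j < n \<Longrightarrow> \<exists>a\<in>R i. \<exists>b\<in>C j. (a, b) \<in> parcs G \<or> a = b"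
  shows "n \<le> Suc (treewidth (relabel f G))"
proof (rule treewidth_ge[OF pair_graph_relabel[OF G f], of n "\<lambda>i. f ` R i" "\<lambda>j. f ` C j"])
  show "f ` R i \<subseteq> pverts (relabel f G) \<and> f ` R i \<noteq> {} \<and> conn (parcs (relabel f G)) (f ` R i)" if "i < n" for i
    using R[OF that] conn_image[of "parcs G" "R i" f] by (auto simp: relabel_def)
  show "f ` C j \<subseteq> pverts (relabel f G) \<and> f ` C j \<noteq> {} \<and> conn (parcs (relabel f G)) (f ` C j)" if "j < n" for j
    using C[OF that] conn_image[of "parcs G" "C j" f] by (auto simp: relabel_def)
  show "f ` R i \<inter> f ` R j = {}" if "i < n" "j < n" "i \<noteq> j" for i j
    using RR[OF that] R[OF that(1)] R[OF that(2)] inj_on_image_Int[OF f, of "R i" "R j"] by auto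
  show "f ` C i \<inter> f ` C j = {}" if "i < n" "j < n" "i \<noteq> j" for i j
    using CC[OF that] C[OF that(1)] C[OF that(2)] inj_on_image_Int[OF f, of "C i" "C j"] by auto
  show "\<exists>a\<in>f ` R i. \<exists>b\<in>f ` C j. (a, b) \<in> parcs (relabel f G) \<or> a = b" if ij: "i < n" "j < n" for i j
  proof -
    obtain a b where "a \<in> R i" "b \<in> C j" "(a, b) \<in> parcs G \<or> a = b" using RC[OF ij] by blast
    then show ?thesis by (intro bexI[of _ "f a"] bexI[of _ "f b"]) (auto simp: relabel_def)
  qed
qed

subsection \<open>Bounded tree independence number bounds treewidth by the clique number\<close>

lemma tree_independence_number_witness:
  assumes G: "pair_graph G"
  shows "\<exists>T B. tree_decomposition G T B \<and> (\<forall>n\<in>pverts T. alpha_le (parcs G) (B n) (tree_independence_number G))"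
proof -
  define P where "P c \<longleftrightarrow> 1 \<le> c \<and> (\<exists>T B. tree_decomposition G T B \<and>
      (\<forall>t\<in>pverts T. \<not> (\<exists>S\<subseteq>B t. stable_set G S \<and> card S = c + 1)))" for c
  have s: "sgraph (pverts G) (parcs G)" using G by (simp add: pair_graph_iff_sgraph)
  have "card S \<noteq> Suc (card (pverts G)) + 1" if "S \<subseteq> pverts G" for S
    using card_mono[OF sgraphD(1)[OF s] that] by simp
  then have "P (Suc (card (pverts G)))"
    unfolding P_def
    by - (rule conjI, simp, rule exI[of _ "\<lparr>pverts = {0}, parcs = {}\<rparr>"], rule exI[of _ "\<lambda>_. pverts G"],
        use tree_decomposition_trivial[OF G] in simp)
  then have "P (LEAST c. P c)" by (rule LeastI[of P])
  moreover have "tree_independence_number G = (LEAST c. P c)"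
    unfolding tree_independence_number_def P_def ..
  ultimately have "P (tree_independence_number G)" by simp
  then obtain T B where td: "tree_decomposition G T B"
    and no: "\<And>t. t \<in> pverts T \<Longrightarrow> \<not> (\<exists>S\<subseteq>B t. stable_set G S \<and> card S = tree_independence_number G + 1)"
    unfolding P_def by blast
  have "alpha_le (parcs G) (B t) (tree_independence_number G)" if t: "t \<in> pverts T" for t
  proof (rule ccontr)
    assume "\<not> ?thesis"
    then obtain S where "S \<subseteq> B t" "stab (parcs G) S" "card S = Suc (tree_independence_number G)"
      by (rule not_alpha_leE[OF _ order_refl])
    moreover have "B t \<subseteq> pverts G" using td t by (simp add: tree_decomposition_def)
    moreover from calculation have "stable_set G S" unfolding stable_set_def stab_def by blast
    ultimately show False using no[OF t] by (metis Suc_eq_plus1)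
  qed
  then show ?thesis using td by blast
qed

lemma card_le_clique_number:
  assumes G: "pair_graph G" and K: "Defs.clique G K"
  shows "card K \<le> clique_number G"
proof -
  have "finite (pverts G)" using G by (simp add: pair_graph_iff_sgraph sgraph_def)
  then have "finite {K. Defs.clique G K}"
    using finite_subset[of "{K. Defs.clique G K}" "Pow (pverts G)"] by (auto simp: Defs.clique_def)
  then show ?thesis unfolding clique_number_def using K Max_ge[of "card ` {K. Defs.clique G K}" "card K"] by blast
qed

lemma clique_number_le:
  assumes G: "pair_graph G" and K: "\<And>K. Defs.clique G K \<Longrightarrow> card K \<le> m"
  shows "clique_number G \<le> m"
proof -
  have "finite (pverts G)" using G by (simp add: pair_graph_iff_sgraph sgraph_def)
  then have "finite {K. Defs.clique G K}"
    using finite_subset[of "{K. Defs.clique G K}" "Pow (pverts G)"] by (auto simp: Defs.clique_def)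
  moreover have "{} \<in> {K. Defs.clique G K}" by (simp add: Defs.clique_def)
  ultimately show ?thesis unfolding clique_number_def
    using K by (subst Max_le_iff) auto
qed

text \<open>A bag larger than the Ramsey number would contain a clique exceeding the clique number
  or c + 1 stable vertices. Ramsey numbers of at least 1 make the bounding function positive, as its
  definition demands.\<close>

lemma bounded_tree_independence_imp_tw_omega_bounded:
  assumes G: "\<And>G. G \<in> \<G> \<Longrightarrow> pair_graph G" and b: "bounded_tree_independence_number \<G>"
  shows "tw_omega_bounded \<G>"
proof -
  obtain c where c: "\<And>G. G \<in> \<G> \<Longrightarrow> tree_independence_number G \<le> c"
    using b by (auto simp: bounded_tree_independence_number_def)
  have "\<forall>w. \<exists>r\<ge>1. \<forall>(V::nat set) (E::nat set set). finite V \<and> card V \<ge> r \<longrightarrow>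
    (\<exists>R\<subseteq>V. card R = Suc w \<and> Ramsey.clique R E \<or> card R = Suc c \<and> Ramsey.indep R E)"
    using ramsey2 by blast
  then obtain r where r1: "\<And>w. r w \<ge> 1" and r: "\<And>w (V::nat set) (E::nat set set). finite V \<Longrightarrow> card V \<ge> r w \<Longrightarrow>
    (\<exists>R\<subseteq>V. card R = Suc w \<and> Ramsey.clique R E \<or> card R = Suc c \<and> Ramsey.indep R E)"
    by metis
  have "treewidth G \<le> r (clique_number G)" if GG: "G \<in> \<G>" for G
  proof -
    have pg: "pair_graph G" using G[OF GG] .
    have s: "sgraph (pverts G) (parcs G)" using pg by (simp add: pair_graph_iff_sgraph)
    obtain T B where td: "tree_decomposition G T B"
      and al0: "\<And>n. n \<in> pverts T \<Longrightarrow> alpha_le (parcs G) (B n) (tree_independence_number G)"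
      using tree_independence_number_witness[OF pg] by blast
    have al: "alpha_le (parcs G) (B n) c" if "n \<in> pverts T" for n
      using al0[OF that] c[OF GG] by (auto intro: alpha_le_mono)
    have small: "card (B n) \<le> r (clique_number G)" if n: "n \<in> pverts T" for n
    proof (rule ccontr)
      assume "\<not> ?thesis"
      then have big: "card (B n) \<ge> r (clique_number G)" by simp
      have BV: "B n \<subseteq> pverts G" using td n by (simp add: tree_decomposition_def)
      then have fin: "finite (B n)" using sgraphD(1)[OF s] finite_subset by blast
      define E where "E = {{u, v} |u v. (u, v) \<in> parcs G}"
      have E: "{u, v} \<in> E \<longleftrightarrow> (u, v) \<in> parcs G" for u v
        using sgraphD(5)[OF s] by (auto simp: E_def doubleton_eq_iff)
      obtain R where R: "R \<subseteq> B n" "card R = Suc (clique_number G) \<and> Ramsey.clique R E \<or> card R = Suc c \<and> Ramsey.indep R E"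
        using r[OF fin big, of E] by blast
      from R(2) show False
      proof
        assume a: "card R = Suc (clique_number G) \<and> Ramsey.clique R E"
        then have "Defs.clique G R" using R(1) BV E by (auto simp: Defs.clique_def Ramsey.clique_def)
        then show False using card_le_clique_number[OF pg] a by fastforce
      next
        assume a: "card R = Suc c \<and> Ramsey.indep R E"
        then have "stab (parcs G) R" using E sgraphD(6)[OF s] by (fastforce simp: stab_def Ramsey.indep_def)
        then have "card R \<le> c" using al[OF n] R(1) fin finite_subset by (auto simp: alpha_le_def)
        then show False using a by simp
      qed
    qed
    have fT: "finite (pverts T)" "pverts T \<noteq> {}"
      using td by (auto simp: tree_decomposition_def undirected_tree_iff sgraph_def)
    have "treewidth G \<le> decomposition_width T B"
      unfolding treewidth_def by (rule Least_le) (use td in blast)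
    also have "\<dots> \<le> (MAX t\<in>pverts T. card (B t))" by (simp add: decomposition_width_def)
    also have "\<dots> \<le> r (clique_number G)" using fT small by (subst Max_le_iff) auto
    finally show ?thesis .
  qed
  then show ?thesis unfolding tw_omega_bounded_def using r1 by blast
qed

subsection \<open>Trees with at most three leaves are spiders\<close>

definition deg :: "'a rel \<Rightarrow> 'a set \<Rightarrow> 'a \<Rightarrow> nat" where
  "deg E X v = card {a \<in> X. (v, a) \<in> E}"

lemma acyc_subset: "acyc V E \<Longrightarrow> X \<subseteq> V \<Longrightarrow> acyc X E"
  unfolding acyc_def by (meson subset_trans)

lemma acyc_leaf:
  assumes "finite X" "X \<noteq> {}" "acyc X E"
  shows "\<exists>v\<in>X. deg E X v \<le> 1"
proof -
  obtain v where v: "v \<in> X" "\<And>a b. a \<in> X \<Longrightarrow> b \<in> X \<Longrightarrow> (v, a) \<in> E \<Longrightarrow> (v, b) \<in> E \<Longrightarrow> a = b"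
    using assms(3)[unfolded acyc_def, THEN spec, THEN mp, OF subset_refl, THEN mp, OF assms(2)] by metis
  have "deg E X v \<le> 1"
    unfolding deg_def One_nat_def using assms(1) v(2) card_le_Suc0_iff_eq[of "{a \<in> X. (v, a) \<in> E}"] by simp
  then show ?thesis using v(1) by blast
qed

lemma deg_le_oneD:
  assumes "finite X" "deg E X v \<le> 1" "a \<in> X" "b \<in> X" "(v, a) \<in> E" "(v, b) \<in> E"
  shows "a = b"
proof (rule ccontr)
  assume "a \<noteq> b"
  then have "card {a, b} \<le> deg E X v"
    unfolding deg_def using assms by (intro card_mono) auto
  then show False using assms(2) \<open>a \<noteq> b\<close> by simp
qed

lemma deg_pos:
  assumes "finite X" "conn E X" "v \<in> X" "X \<noteq> {v}"
  shows "deg E X v \<ge> 1"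
proof -
  obtain a where "a \<in> X" "(v, a) \<in> E" using conn_neighbour[OF assms(2-4)] by blast
  then have "{a \<in> X. (v, a) \<in> E} \<noteq> {}" by blast
  then show ?thesis unfolding deg_def using assms(1) by (simp add: Suc_le_eq card_gt_0_iff)
qed

lemma deg_remove:
  assumes "finite X" "v \<in> X"
  shows "deg E X u = deg E (X - {v}) u + of_bool ((u, v) \<in> E)"
proof (cases "(u, v) \<in> E")
  case True
  then have "{a \<in> X. (u, a) \<in> E} = insert v {a \<in> X - {v}. (u, a) \<in> E}" using assms by auto
  then show ?thesis using assms True by (simp add: deg_def)
next
  case False
  then have "{a \<in> X. (u, a) \<in> E} = {a \<in> X - {v}. (u, a) \<in> E}" by auto
  then show ?thesis using False by (simp add: deg_def)
qed

lemma conn_remove_deg_le_one: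
  assumes "sym E" "irrefl E" "finite X" "conn E X" "deg E X v \<le> 1"
  shows "conn E (X - {v})"
  by (rule conn_remove_leaf[OF assms(1,2,4)]) (rule deg_le_oneD[OF assms(3,5)])

text \<open>Removing a leaf lowers the degree sum by 2. The number 2 stands on the left to avoid
  truncated subtraction.\<close>

lemma tree_degree_sum:
  assumes E: "sym E" "irrefl E" and X: "finite X" "X \<noteq> {}" "conn E X" "acyc X E"
  shows "(\<Sum>v\<in>X. deg E X v) + 2 = 2 * card X"
  using X
proof (induction "card X" arbitrary: X)
  case 0
  then show ?case by simp
next
  case (Suc n)
  obtain v where v: "v \<in> X" "deg E X v \<le> 1" using acyc_leaf[of X E] Suc.prems by blast
  have irr: "(u, u) \<notin> E" for u using E(2) by (simp add: irrefl_def)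
  show ?case
  proof (cases "X = {v}")
    case True
    have "{a \<in> X. (v, a) \<in> E} = {}" using irr True by auto
    then have "deg E X v = 0" unfolding deg_def by (metis card.empty)
    then show ?thesis using True by simp
  next
    case False
    let ?Y = "X - {v}"
    have c: "card ?Y = n" using Suc v by simp
    have d1: "deg E X v = 1" using deg_pos[OF Suc.prems(1,3) v(1) False] v(2) by simp
    have "n = card ?Y" "finite ?Y" "?Y \<noteq> {}" using c Suc.prems v(1) False by auto
    then have IH: "(\<Sum>u\<in>?Y. deg E ?Y u) + 2 = 2 * card ?Y"
      using Suc.hyps(1)[of ?Y] conn_remove_deg_le_one[OF E Suc.prems(1,3) v(2)] acyc_subset[OF Suc.prems(4), of ?Y] by blast
    have "{u \<in> ?Y. (u, v) \<in> E} = {a \<in> X. (v, a) \<in> E}" using E(1) irr by (auto dest: symD)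
    then have one: "card {u \<in> ?Y. (u, v) \<in> E} = 1" using d1 by (simp add: deg_def)
    have "(\<Sum>u\<in>?Y. deg E X u) = (\<Sum>u\<in>?Y. deg E ?Y u) + (\<Sum>u\<in>?Y. of_bool ((u, v) \<in> E))"
      unfolding sum.distrib[symmetric] using deg_remove[OF Suc.prems(1) v(1)] by (intro sum.cong) auto
    also have "(\<Sum>u\<in>?Y. of_bool ((u, v) \<in> E)) = card {u \<in> ?Y. (u, v) \<in> E}"
      using Suc.prems(1) by (simp add: Int_def)
    finally have "(\<Sum>u\<in>?Y. deg E X u) = (\<Sum>u\<in>?Y. deg E ?Y u) + 1" using one by simp
    moreover have "(\<Sum>u\<in>X. deg E X u) = deg E X v + (\<Sum>u\<in>?Y. deg E X u)"
      using sum.remove[OF Suc.prems(1) v(1), of "deg E X"] .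
    moreover have "card X = Suc (card ?Y)" using card.remove[OF Suc.prems(1) v(1)] .
    ultimately show ?thesis using IH d1 by simp
  qed
qed

text \<open>Degree plus 1 for leaves is at most 2 at every vertex other than c and at most 3 at c.
  The sum is at most 2 |X| + 1, while the degrees alone contribute 2 |X| - 2.\<close>

lemma card_leaves_le_three:
  assumes E: "sym E" "irrefl E" and X: "finite X" "X \<noteq> {}" "conn E X" "acyc X E"
    and c: "\<And>v. v \<in> X \<Longrightarrow> v \<noteq> c \<Longrightarrow> deg E X v \<le> 2" "deg E X c \<le> 3"
  shows "card {v \<in> X. deg E X v = 1} \<le> 3"
proof -
  have "(\<Sum>v\<in>X. of_bool (deg E X v = 1) + deg E X v) \<le> (\<Sum>v\<in>X. 2 + of_bool (v = c))"
  proof (rule sum_mono)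
    fix v assume "v \<in> X"
    then show "of_bool (deg E X v = 1) + deg E X v \<le> 2 + of_bool (v = c)"
      using c(1)[of v] c(2) by (cases "v = c") (auto simp: of_bool_def)
  qed
  also have "\<dots> = 2 * card X + card {v \<in> X. v = c}"
    unfolding sum.distrib using X(1) by (simp add: Int_def)
  also have "\<dots> \<le> 2 * card X + 1"
    using card_mono[of "{c}" "{v \<in> X. v = c}"] by auto
  finally have "(\<Sum>v\<in>X. of_bool (deg E X v = 1)) + (\<Sum>v\<in>X. deg E X v) \<le> 2 * card X + 1"
    by (simp add: sum.distrib)
  moreover have "(\<Sum>v\<in>X. of_bool (deg E X v = 1)) = card {v \<in> X. deg E X v = 1}"
    using X(1) by (simp add: Int_def)
  ultimately show ?thesis using tree_degree_sum[OF E X] by simp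
qed

text \<open>In a tree with at least two vertices, the number of leaves is 2 plus the sum of
  \<open>deg - 2\<close>, where truncation discards the leaves. With at most three leaves this
  excess is at most 1, so at most one vertex has degree above 2, and that degree is 3.\<close>

lemma three_leaf_tree_centre:
  assumes E: "sym E" "irrefl E" and X: "finite X" "X \<noteq> {}" "conn E X" "acyc X E"
    and l: "card {v \<in> X. deg E X v = 1} \<le> 3"
  shows "\<exists>c\<in>X. deg E X c \<le> 3 \<and> (\<forall>v\<in>X. v \<noteq> c \<longrightarrow> deg E X v \<le> 2)"
proof -
  have L: "(\<Sum>v\<in>X. of_bool (deg E X v = 1)) = card {v \<in> X. deg E X v = 1}"
    using X(1) by (simp add: Int_def)
  have excess: "(\<Sum>v\<in>X. deg E X v - 2) \<le> 1"
  proof (cases "\<exists>v. X = {v}")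
    case True
    then obtain v where v: "X = {v}" by blast
    then have "{a \<in> X. (v, a) \<in> E} = {}" using E(2) by (auto simp: irrefl_def)
    then have "deg E X v = 0" unfolding deg_def by (metis card.empty)
    then show ?thesis using v by simp
  next
    case False
    have "(\<Sum>v\<in>X. (deg E X v - 2) + 2) \<le> (\<Sum>v\<in>X. deg E X v + of_bool (deg E X v = 1))"
    proof (rule sum_mono)
      fix v assume "v \<in> X"
      then have "deg E X v \<ge> 1" using deg_pos[OF X(1,3)] False by blast
      then show "(deg E X v - 2) + 2 \<le> deg E X v + of_bool (deg E X v = 1)" by (auto simp: of_bool_def)
    qed
    then have "(\<Sum>v\<in>X. deg E X v - 2) + 2 * card X \<le> (\<Sum>v\<in>X. deg E X v) + card {v \<in> X. deg E X v = 1}"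
      unfolding sum.distrib L by simp
    then show ?thesis using tree_degree_sum[OF E X] l by simp
  qed
  show ?thesis
  proof (cases "\<exists>c\<in>X. deg E X c \<ge> 3")
    case True
    then obtain c where c: "c \<in> X" "deg E X c \<ge> 3" by blast
    have s: "(\<Sum>v\<in>X. deg E X v - 2) = (deg E X c - 2) + (\<Sum>v\<in>X-{c}. deg E X v - 2)"
      using sum.remove[OF X(1) c(1)] .
    have "deg E X v \<le> 2" if "v \<in> X" "v \<noteq> c" for v
    proof -
      have "deg E X v - 2 \<le> (\<Sum>v\<in>X-{c}. deg E X v - 2)"
        using that X(1) by (intro member_le_sum) auto
      then show ?thesis using s excess c(2) by linarith
    qed
    then show ?thesis using c s excess by (intro bexI[of _ c]) auto
  next
    case False
    then have "\<forall>v\<in>X. deg E X v \<le> 2" by (simp add: not_le numeral_3_eq_3 numeral_2_eq_2 less_Suc_eq_le)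
    then show ?thesis using X(2) by fastforce
  qed
qed

text \<open>The subdivided claw with legs of lengths \<open>l 0\<close>, \<open>l 1\<close> and
  \<open>l 2\<close>, any of which may be 0. It lies in \<open>claw_dom t\<close> if t is at least
  these lengths.\<close>

definition spider :: "(nat \<Rightarrow> nat) \<Rightarrow> (nat \<times> nat) set" where
  "spider l = {(i, j). (i = 0 \<and> j = 0) \<or> (i < 3 \<and> 1 \<le> j \<and> j \<le> l i)}"

text \<open>Remove a leaf v other than c, embed the rest and put v at the end of a leg. Its
  neighbour u is the last vertex of a leg, because otherwise u would have two more neighbours
  besides v; if u = c, some leg is still empty, because otherwise c would have degree 4.\<close>

lemma spider_embedding:
  assumes E: "sym E" "irrefl E" and X: "finite X" "c \<in> X" "conn E X" "acyc X E"
    and c: "deg E X c \<le> 3" "\<And>v. v \<in> X \<Longrightarrow> v \<noteq> c \<Longrightarrow> deg E X v \<le> 2"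
  shows "\<exists>l g. g c = (0, 0) \<and> bij_betw g X (spider l) \<and>
    (\<forall>u\<in>X. \<forall>v\<in>X. (u, v) \<in> E \<longleftrightarrow> claw_adj (g u) (g v))"
  using X c
proof (induction "card X" arbitrary: X)
  case 0
  then show ?case by auto
next
  case (Suc n)
  have irr: "(u, u) \<notin> E" for u using E(2) by (simp add: irrefl_def)
  have sy: "(u, v) \<in> E \<longleftrightarrow> (v, u) \<in> E" for u v using E(1) by (auto dest: symD)
  show ?case
  proof (cases "X = {c}")
    case True
    have "spider (\<lambda>_. 0) = {(0, 0)}" by (auto simp: spider_def)
    then have "bij_betw (\<lambda>_. (0, 0)) X (spider (\<lambda>_. 0))" using True by (simp add: bij_betw_def)
    moreover have "\<forall>u\<in>X. \<forall>v\<in>X. (u, v) \<in> E \<longleftrightarrow> claw_adj (0, 0) (0, 0)"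
      using True irr by (simp add: claw_adj_def)
    ultimately show ?thesis
      by - (rule exI[of _ "\<lambda>_. 0"], rule exI[of _ "\<lambda>_. (0, 0)"], simp)
  next
    case False
    \<comment> \<open>If all vertices other than c had degree at least 2, the degree sum would be
      too large for a tree.\<close>
    have "\<exists>v\<in>X. v \<noteq> c \<and> deg E X v \<le> 1"
    proof (rule ccontr)
      assume "\<not> ?thesis"
      then have "(\<Sum>v\<in>X-{c}. 2) \<le> (\<Sum>v\<in>X-{c}. deg E X v)" by (intro sum_mono) force
      moreover have "deg E X c \<ge> 1" using deg_pos[OF Suc.prems(1,3,2) False] .
      moreover have "(\<Sum>v\<in>X. deg E X v) = deg E X c + (\<Sum>v\<in>X-{c}. deg E X v)"
        using sum.remove[OF Suc.prems(1,2)] .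
      moreover have "card X = Suc (card (X - {c}))" using card.remove[OF Suc.prems(1,2)] .
      moreover have "(\<Sum>v\<in>X. deg E X v) + 2 = 2 * card X"
        using tree_degree_sum[OF E Suc.prems(1) _ Suc.prems(3,4)] Suc.prems(2) by blast
      ultimately show False by simp
    qed
    then obtain v where v: "v \<in> X" "v \<noteq> c" "deg E X v \<le> 1" by blast
    have "X \<noteq> {v}" using v Suc.prems(2) by blast
    then obtain u where u: "u \<in> X" "(v, u) \<in> E" using conn_neighbour[OF Suc.prems(3) v(1)] by blast
    have only: "(v, w) \<in> E \<longleftrightarrow> w = u" if "w \<in> X" for w
      using deg_le_oneD[OF Suc.prems(1) v(3) that u(1)] u(2) by blast
    define Y where "Y = X - {v}"
    have XY: "X = insert v Y" "v \<notin> Y" using v(1) by (auto simp: Y_def)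
    have uY: "u \<in> Y" using u irr by (auto simp: Y_def)
    have Y: "finite Y" "c \<in> Y" "conn E Y" "acyc Y E" "n = card Y"
      using Suc v conn_remove_deg_le_one[OF E Suc.prems(1,3) v(3)] acyc_subset[OF Suc.prems(4), of Y]
      by (auto simp: Y_def)
    have dY: "deg E X w = deg E Y w + of_bool (w = u)" if "w \<in> X" for w
      using deg_remove[OF Suc.prems(1) v(1), of E w] only[OF that] sy[of w v] by (simp add: Y_def)
    have dY': "deg E Y w \<le> deg E X w" if "w \<in> Y" for w using dY[of w] that XY by simp
    have "\<exists>l g. g c = (0, 0) \<and> bij_betw g Y (spider l) \<and>
      (\<forall>u\<in>Y. \<forall>v\<in>Y. (u, v) \<in> E \<longleftrightarrow> claw_adj (g u) (g v))"
    proof (rule Suc.hyps(1)[OF Y(5) Y(1-4)])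
      show "deg E Y c \<le> 3" using dY'[OF Y(2)] Suc.prems(5) by simp
      show "deg E Y w \<le> 2" if "w \<in> Y" "w \<noteq> c" for w
        using dY'[OF that(1)] Suc.prems(6)[of w] that XY by simp
    qed
    then obtain l g where g: "g c = (0, 0)" "bij_betw g Y (spider l)"
      and adj: "\<And>u v. u \<in> Y \<Longrightarrow> v \<in> Y \<Longrightarrow> (u, v) \<in> E \<longleftrightarrow> claw_adj (g u) (g v)" by blast
    have inj: "inj_on g Y" and im: "g ` Y = spider l" using g(2) by (auto simp: bij_betw_def)
    have degY: "card A \<le> deg E Y w" if "A \<subseteq> spider l" "w \<in> Y" "\<And>q. q \<in> A \<Longrightarrow> claw_adj (g w) q" for A w
    proof -
      have "A \<subseteq> g ` {a \<in> Y. (w, a) \<in> E}"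
      proof
        fix q assume q: "q \<in> A"
        then have "q \<in> g ` Y" using that(1) im by auto
        then obtain a where "a \<in> Y" "q = g a" by (rule imageE)
        then show "q \<in> g ` {a \<in> Y. (w, a) \<in> E}" using adj[of w a] that(2) that(3)[OF q] by blast
      qed
      then have "card A \<le> card (g ` {a \<in> Y. (w, a) \<in> E})" using Y(1) by (intro card_mono) auto
      also have "\<dots> \<le> deg E Y w" unfolding deg_def using Y(1) by (intro card_image_le) auto
      finally show ?thesis .
    qed
    have "\<exists>i<3. (\<forall>q\<in>spider l. claw_adj (i, Suc (l i)) q \<longleftrightarrow> q = g u)"
    proof (cases "u = c")
      case True
      have "\<exists>i<3. l i = 0"
      proof (rule ccontr)
        assume "\<not> ?thesis"
        then have pos: "\<And>i. i < 3 \<Longrightarrow> l i \<ge> 1" by (metis less_one not_le)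
        have "card ((\<lambda>i. (i, 1::nat)) ` {..<3::nat}) \<le> deg E Y c"
        proof (rule degY)
          show "(\<lambda>i. (i, 1::nat)) ` {..<3::nat} \<subseteq> spider l" using pos by (auto simp: spider_def)
          show "claw_adj (g c) q" if "q \<in> (\<lambda>i. (i, 1::nat)) ` {..<3::nat}" for q
            using that g(1) by (auto simp: claw_adj_def)
        qed (rule Y(2))
        moreover have "card ((\<lambda>i. (i, 1::nat)) ` {..<3::nat}) = 3"
          by (subst card_image) (auto simp: inj_on_def)
        ultimately show False using dY[of c] Suc.prems(2,5) True by simp
      qed
      then obtain i where i: "i < 3" "l i = 0" by blast
      have "\<forall>q\<in>spider l. claw_adj (i, Suc (l i)) q \<longleftrightarrow> q = g u"
        using i g(1) True by (auto simp: spider_def claw_adj_def)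
      then show ?thesis using i(1) by blast
    next
      case ne: False
      obtain i j where gu: "g u = (i, j)" by fastforce
      have "g u \<noteq> (0, 0)" using ne inj uY Y(2) g(1) by (metis inj_onD)
      moreover have "(i, j) \<in> spider l" using gu im uY by (metis imageI)
      ultimately have ij: "i < 3" "1 \<le> j" "j \<le> l i" using gu by (auto simp: spider_def)
      have "j = l i"
      proof (rule ccontr)
        assume "j \<noteq> l i"
        let ?A = "{(i, Suc j), (if j = 1 then (0, 0) else (i, j - 1))}"
        have "card ?A \<le> deg E Y u"
        proof (rule degY)
          show "?A \<subseteq> spider l" using ij \<open>j \<noteq> l i\<close> by (auto simp: spider_def)
          show "claw_adj (g u) q" if "q \<in> ?A" for q using that gu ij by (auto simp: claw_adj_def split: if_splits)
        qed (rule uY)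
        moreover have "card ?A = 2" by auto
        ultimately show False using dY[OF u(1)] Suc.prems(6)[OF u(1) ne] by simp
      qed
      then have "\<forall>q\<in>spider l. claw_adj (i, Suc (l i)) q \<longleftrightarrow> q = g u"
        using ij gu by (auto simp: spider_def claw_adj_def)
      then show ?thesis using ij by blast
    qed
    then obtain i where i: "i < 3" "\<And>q. q \<in> spider l \<Longrightarrow> claw_adj (i, Suc (l i)) q \<longleftrightarrow> q = g u" by blast
    define g' where "g' = g(v := (i, Suc (l i)))"
    define l' where "l' = l(i := Suc (l i))"
    have gY: "g' w = g w" if "w \<in> Y" for w using that XY by (auto simp: g'_def)
    have sp: "spider l' = insert (i, Suc (l i)) (spider l)" "(i, Suc (l i)) \<notin> spider l"
      using i(1) by (auto simp: spider_def l'_def split: if_splits)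
    have "inj_on g' Y" using inj gY by (simp add: inj_on_def)
    moreover have "g' ` Y = spider l" using im gY by simp
    ultimately have bij: "bij_betw g' X (spider l')"
      using XY sp by (auto simp: bij_betw_def g'_def)
    have cs: "claw_adj p q \<longleftrightarrow> claw_adj q p" for p q by (auto simp: claw_adj_def)
    have vY: "(v, w) \<in> E \<longleftrightarrow> claw_adj (g' v) (g' w)" if w: "w \<in> Y" for w
    proof -
      have "g w \<in> spider l" using im w by blast
      then have "claw_adj (g' v) (g' w) \<longleftrightarrow> g w = g u" using i(2)[of "g w"] gY[OF w] by (simp add: g'_def)
      also have "\<dots> \<longleftrightarrow> w = u" using inj w uY by (auto dest: inj_onD)
      finally show ?thesis using only[of w] w XY by simp
    qed
    have "(a, b) \<in> E \<longleftrightarrow> claw_adj (g' a) (g' b)" if ab: "a \<in> X" "b \<in> X" for a b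
    proof (cases "a = v")
      case True
      show ?thesis
      proof (cases "b = v")
        case bv: True
        have "\<not> claw_adj (g' v) (g' v)" by (simp add: g'_def claw_adj_def)
        then show ?thesis using True bv irr by simp
      next
        case False
        then show ?thesis using True vY[of b] ab XY by blast
      qed
    next
      case av: False
      then have aY: "a \<in> Y" using ab XY by blast
      show ?thesis
      proof (cases "b = v")
        case True
        then show ?thesis using vY[OF aY] sy[of a v] cs[of "g' a" "g' v"] by simp
      next
        case False
        then have "b \<in> Y" using ab XY by blast
        then show ?thesis using adj[OF aY] gY[OF aY] gY[of b] by simp
      qed
    qed
    moreover have "g' c = (0, 0)" using g(1) v(2) by (simp add: g'_def)
    ultimately show ?thesis using bij by blast
  qed
qed

section \<open>Three-leaf forests as disjoint unions of spiders\<close>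

lemma sccs_eq_comps:
  assumes G: "pair_graph G"
  shows "pre_digraph.sccs (with_proj G) = (\<lambda>x. with_proj G \<restriction> comp (parcs G) (pverts G) x) ` pverts G"
proof -
  interpret pair_graph G by (rule G)
  let ?E = "parcs G" and ?V = "pverts G"
  have s: "sgraph ?V ?E" using G by (simp add: pair_graph_iff_sgraph)
  have reach: "reachable (with_proj G) u v \<longleftrightarrow> u \<in> ?V \<and> v \<in> comp ?E ?V u" for u v
  proof (cases "u \<in> ?V")
    case True
    then show ?thesis by (simp add: reachable_def comp_def rtrancl_on_iff)
  next
    case False
    then show ?thesis using reachable_in_verts(1)[of u v] by auto
  qed
  have cs: "v \<in> comp ?E ?V u \<longleftrightarrow> u \<in> comp ?E ?V v" for u v
    unfolding comp_def using rtrancl_restrict_sym[OF sgraphD(3)[OF s], of _ _ ?V] by blast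
  have "sccs_verts = comp ?E ?V ` ?V"
  proof (intro equalityI subsetI)
    fix S assume "S \<in> sccs_verts"
    then have S: "S \<noteq> {}" "\<And>u v. u \<in> S \<Longrightarrow> v \<in> S \<Longrightarrow> u \<in> ?V \<and> v \<in> comp ?E ?V u"
      "\<And>u v. u \<in> S \<Longrightarrow> v \<notin> S \<Longrightarrow> \<not> (u \<in> ?V \<and> v \<in> comp ?E ?V u) \<or> \<not> (v \<in> ?V \<and> u \<in> comp ?E ?V v)"
      unfolding in_sccs_verts_conv_reachable reach by blast+
    obtain u where u: "u \<in> S" using S(1) by blast
    have uV: "u \<in> ?V" using S(2)[OF u u] by blast
    have "S = comp ?E ?V u"
    proof (intro equalityI subsetI)
      fix v assume "v \<in> S" then show "v \<in> comp ?E ?V u" using S(2)[OF u] by blast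
    next
      fix v assume v: "v \<in> comp ?E ?V u"
      then have "v \<in> ?V" using comp_subset[OF uV] by blast
      then show "v \<in> S" using S(3)[OF u, of v] v cs[of v u] uV by blast
    qed
    then show "S \<in> comp ?E ?V ` ?V" using uV by blast
  next
    fix S assume "S \<in> comp ?E ?V ` ?V"
    then obtain u where u: "u \<in> ?V" "S = comp ?E ?V u" by blast
    have eq: "comp ?E ?V v = S" if "v \<in> S" for v
      using comp_eq[OF sgraphD(3)[OF s]] that u by blast
    have sub: "S \<subseteq> ?V" using comp_subset[OF u(1)] u(2) by blast
    show "S \<in> sccs_verts"
      unfolding in_sccs_verts_conv_reachable reach
    proof (intro conjI ballI allI impI)
      show "S \<noteq> {}" using comp_self[of u ?E ?V] u(2) by blast
      fix a assume a: "a \<in> S"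
      then show "a \<in> ?V" using sub by blast
      show "v \<in> comp ?E ?V a" if "v \<in> S" for v using eq[OF a] that by blast
      show "\<not> (a \<in> ?V \<and> v \<in> comp ?E ?V a) \<or> \<not> (v \<in> ?V \<and> a \<in> comp ?E ?V v)" if "v \<notin> S" for v
        using eq[OF a] that by blast
    qed
  qed
  then show ?thesis using sccs_conv_sccs_verts by (simp add: image_image)
qed

lemma leaves_comp_eq:
  assumes G: "pair_graph G" and x: "x \<in> pverts G"
  shows "leaves (with_proj G \<restriction> comp (parcs G) (pverts G) x) =
    {v \<in> comp (parcs G) (pverts G) x. deg (parcs G) (comp (parcs G) (pverts G) x) v = 1}"
proof -
  let ?C = "comp (parcs G) (pverts G) x"
  have "out_degree (with_proj G \<restriction> ?C) v = deg (parcs G) ?C v" if v: "v \<in> ?C" for v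
  proof -
    have "out_arcs (with_proj G \<restriction> ?C) v = Pair v ` {a \<in> ?C. (v, a) \<in> parcs G}"
      using v by (auto simp: out_arcs_def)
    then show ?thesis by (simp add: out_degree_def deg_def card_image inj_on_def)
  qed
  then show ?thesis by (auto simp: leaves_def)
qed

lemma three_leaf_forest_iff:
  "forest_with_three_leaf_components G \<longleftrightarrow> sgraph (pverts G) (parcs G) \<and> acyc (pverts G) (parcs G) \<and>
     (\<forall>x\<in>pverts G. card {v \<in> comp (parcs G) (pverts G) x. deg (parcs G) (comp (parcs G) (pverts G) x) v = 1} \<le> 3)"
proof (cases "pair_graph G")
  case True
  then show ?thesis
    unfolding forest_with_three_leaf_components_def undirected_forest_iff sccs_eq_comps[OF True]
    using leaves_comp_eq[OF True] by auto
next
  case False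
  then show ?thesis
    unfolding forest_with_three_leaf_components_def undirected_forest_def by (simp add: pair_graph_iff_sgraph)
qed

text \<open>H is an induced subgraph of N disjoint copies of the graph \<open>adj\<close> on D;
  \<open>h v\<close> gives the number of a copy and a point in it.\<close>

definition copies_coding :: "'a pair_pre_digraph \<Rightarrow> nat \<Rightarrow> 'p set \<Rightarrow> ('p \<Rightarrow> 'p \<Rightarrow> bool) \<Rightarrow> ('a \<Rightarrow> nat \<times> 'p) \<Rightarrow> bool" where
  "copies_coding H N D adj h \<longleftrightarrow> inj_on h (pverts H) \<and> h ` pverts H \<subseteq> {..<N} \<times> D \<and>
     (\<forall>u\<in>pverts H. \<forall>v\<in>pverts H. (u, v) \<in> parcs H \<longleftrightarrow> fst (h u) = fst (h v) \<and> adj (snd (h u)) (snd (h v)))"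

lemma copies_codingD:
  assumes "copies_coding H N D adj h"
  shows "inj_on h (pverts H)" "h ` pverts H \<subseteq> {..<N} \<times> D"
    "u \<in> pverts H \<Longrightarrow> v \<in> pverts H \<Longrightarrow> (u, v) \<in> parcs H \<longleftrightarrow> fst (h u) = fst (h v) \<and> adj (snd (h u)) (snd (h v))"
  using assms unfolding copies_coding_def by auto

lemma copies_coding_mono:
  "copies_coding H N D adj h \<Longrightarrow> N \<le> N' \<Longrightarrow> D \<subseteq> D' \<Longrightarrow> copies_coding H N' D' adj h"
  unfolding copies_coding_def by (meson Sigma_mono lessThan_subset_iff subset_trans)

text \<open>Each component has a centre and is embedded as a spider; \<open>e\<close> numbers the
  components. N and t are maxima, with 0 inserted in case H is the null graph.\<close>

lemma three_leaf_forest_embedding: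
  assumes H: "forest_with_three_leaf_components H"
  shows "\<exists>N t g. copies_coding H N (claw_dom t) claw_adj g"
proof -
  let ?V = "pverts H" and ?E = "parcs H"
  let ?C = "comp ?E ?V"
  have s: "sgraph ?V ?E" and ac: "acyc ?V ?E"
    and lf: "\<And>x. x \<in> ?V \<Longrightarrow> card {v \<in> ?C x. deg ?E (?C x) v = 1} \<le> 3"
    using H by (auto simp: three_leaf_forest_iff)
  have E: "sym ?E" "irrefl ?E" and V: "finite ?V" using s by (auto simp: sgraph_def)
  have "\<exists>g. inj_on g X \<and> (\<exists>l. g ` X \<subseteq> spider l) \<and> (\<forall>u\<in>X. \<forall>v\<in>X. (u, v) \<in> ?E \<longleftrightarrow> claw_adj (g u) (g v))"
    if XC: "X \<in> ?C ` ?V" for X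
  proof -
    obtain x where x: "x \<in> ?V" "X = ?C x" using XC by blast
    have X: "finite X" "X \<noteq> {}" "conn ?E X" "acyc X ?E"
      using comp_subset[OF x(1), of ?E] finite_subset[OF _ V] comp_self[of x ?E ?V] conn_comp[OF E(1) x(1)]
        acyc_subset[OF ac] x(2) by auto
    obtain c where c: "c \<in> X" "deg ?E X c \<le> 3" "\<And>v. v \<in> X \<Longrightarrow> v \<noteq> c \<Longrightarrow> deg ?E X v \<le> 2"
      using three_leaf_tree_centre[OF E X] lf[OF x(1)] x(2) by blast
    show ?thesis
      using spider_embedding[OF E X(1) c(1) X(3,4) c(2,3)] by (auto simp: bij_betw_def)
  qed
  then obtain h where h: "\<And>X. X \<in> ?C ` ?V \<Longrightarrow> inj_on (h X) X"
    "\<And>X. X \<in> ?C ` ?V \<Longrightarrow> \<exists>l. h X ` X \<subseteq> spider l"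
    "\<And>X u v. X \<in> ?C ` ?V \<Longrightarrow> u \<in> X \<Longrightarrow> v \<in> X \<Longrightarrow> (u, v) \<in> ?E \<longleftrightarrow> claw_adj (h X u) (h X v)"
    by metis
  obtain e :: "'a set \<Rightarrow> nat" where e: "inj_on e (?C ` ?V)"
    using V finite_imp_inj_to_nat_seg[of "?C ` ?V"] by auto
  define g where "g v = (e (?C v), h (?C v) v)" for v
  define N where "N = Suc (Max (insert 0 (e ` ?C ` ?V)))"
  define t where "t = Max (insert 0 ((\<lambda>v. snd (h (?C v) v)) ` ?V))"
  have self: "v \<in> ?C v" for v by (rule comp_self)
  have same: "?C u = ?C v" if "e (?C u) = e (?C v)" "u \<in> ?V" "v \<in> ?V" for u v
    using e that by (auto dest: inj_onD)
  have "inj_on g ?V"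
  proof (rule inj_onI)
    fix u v assume uv: "u \<in> ?V" "v \<in> ?V" "g u = g v"
    then have c: "?C u = ?C v" using same by (simp add: g_def)
    have "h (?C u) u = h (?C u) v" using uv(3) c by (simp add: g_def)
    then show "u = v" using h(1)[of "?C u"] uv self[of u] self[of v] c by (auto dest: inj_onD)
  qed
  moreover have "g ` ?V \<subseteq> {..<N} \<times> claw_dom t"
  proof
    fix p assume "p \<in> g ` ?V"
    then obtain v where v: "v \<in> ?V" "p = g v" by blast
    have "e (?C v) < N" unfolding N_def less_Suc_eq_le using v V by (intro Max_ge) auto
    moreover have "snd (h (?C v) v) \<le> t" unfolding t_def using v V by (intro Max_ge) auto
    moreover have "\<exists>l. h (?C v) v \<in> spider l" using h(2)[of "?C v"] v(1) self[of v] by blast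
    ultimately show "p \<in> {..<N} \<times> claw_dom t"
      by (auto simp: v(2) g_def spider_def claw_dom_def)
  qed
  moreover have "(u, v) \<in> ?E \<longleftrightarrow> fst (g u) = fst (g v) \<and> claw_adj (snd (g u)) (snd (g v))"
    if uv: "u \<in> ?V" "v \<in> ?V" for u v
  proof (cases "?C u = ?C v")
    case True
    then show ?thesis using h(3)[of "?C u" u v] uv self[of u] self[of v] by (auto simp: g_def)
  next
    case False
    have "(u, v) \<notin> ?E"
    proof
      assume "(u, v) \<in> ?E"
      then have "v \<in> ?C u" using comp_closed[OF uv(1) self uv(2)] by blast
      then show False using comp_eq[OF E(1), of u ?V v] False uv by blast
    qed
    then show ?thesis using same[OF _ uv] False by (auto simp: g_def)
  qed
  ultimately have "copies_coding H N (claw_dom t) claw_adj g" by (simp add: copies_coding_def)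
  then show ?thesis by blast
qed

subsection \<open>Excluding the three obstructions bounds the tree independence number\<close>

text \<open>Pairwise anticomplete copies of a pattern induce a disjoint union of copies, into which
  H was coded.\<close>

lemma emb_into_packing:
  assumes \<S>: "finite \<S>" "card \<S> = N" "pairwise (anticomplete (parcs G)) \<S>" "\<And>R. R \<in> \<S> \<Longrightarrow> R \<subseteq> pverts G"
    and f: "\<And>R. R \<in> \<S> \<Longrightarrow> \<exists>f. inj_on f D \<and> R = f ` D \<and> (\<forall>p\<in>D. \<forall>q\<in>D. (f p, f q) \<in> parcs G \<longleftrightarrow> adj p q)"
    and cc: "copies_coding H N D adj h"
  shows "\<exists>f. emb H G f"
proof -
  note h = copies_codingD(1,2)[OF cc] and adj = copies_codingD(3)[OF cc]
  obtain b where b: "bij_betw b {..<N} \<S>"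
    using ex_bij_betw_nat_finite[OF \<S>(1)] \<S>(2) by (auto simp: atLeast0LessThan)
  obtain F where F: "\<And>R. R \<in> \<S> \<Longrightarrow> inj_on (F R) D" "\<And>R. R \<in> \<S> \<Longrightarrow> R = F R ` D"
    "\<And>R p q. R \<in> \<S> \<Longrightarrow> p \<in> D \<Longrightarrow> q \<in> D \<Longrightarrow> (F R p, F R q) \<in> parcs G \<longleftrightarrow> adj p q"
    using f by metis
  define k where "k u = F (b (fst (h u))) (snd (h u))" for u
  have bS: "b (fst (h u)) \<in> \<S>" and D: "snd (h u) \<in> D" if "u \<in> pverts H" for u
    using that h(2) b by (force simp: bij_betw_def)+
  have kR: "k u \<in> b (fst (h u))" if "u \<in> pverts H" for u
    unfolding k_def using F(2)[OF bS[OF that]] D[OF that] by blast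
  have bne: "b (fst (h u)) \<noteq> b (fst (h v))" if "u \<in> pverts H" "v \<in> pverts H" "fst (h u) \<noteq> fst (h v)" for u v
  proof -
    have "fst (h u) \<in> {..<N}" "fst (h v) \<in> {..<N}" using that h(2) by force+
    then show ?thesis using b that(3) by (auto simp: bij_betw_def dest: inj_onD)
  qed
  have anti: "anticomplete (parcs G) (b (fst (h u))) (b (fst (h v)))"
    if "u \<in> pverts H" "v \<in> pverts H" "fst (h u) \<noteq> fst (h v)" for u v
    using \<S>(3) bS[OF that(1)] bS[OF that(2)] bne[OF that] by (auto simp: pairwise_def)
  have "inj_on k (pverts H)"
  proof (rule inj_onI)
    fix u v assume uv: "u \<in> pverts H" "v \<in> pverts H" "k u = k v"
    have c: "fst (h u) = fst (h v)"
    proof (rule ccontr)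
      assume "\<not> ?thesis"
      then show False using anti[OF uv(1,2)] kR[OF uv(1)] kR[OF uv(2)] uv(3) by (auto simp: anticomplete_def)
    qed
    then have "snd (h u) = snd (h v)"
      using uv(3) F(1)[OF bS[OF uv(1)]] D[OF uv(1)] D[OF uv(2)] by (auto simp: k_def dest: inj_onD)
    then have "h u = h v" using c by (simp add: prod_eq_iff)
    then show "u = v" using h(1) uv by (auto dest: inj_onD)
  qed
  moreover have "k ` pverts H \<subseteq> pverts G" using kR bS \<S>(4) by blast
  moreover have "(u, v) \<in> parcs H \<longleftrightarrow> (k u, k v) \<in> parcs G" if uv: "u \<in> pverts H" "v \<in> pverts H" for u v
  proof (cases "fst (h u) = fst (h v)")
    case True
    then show ?thesis using adj[OF uv] F(3)[OF bS[OF uv(1)] D[OF uv(1)] D[OF uv(2)]] by (simp add: k_def)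
  next
    case False
    then show ?thesis using adj[OF uv] anti[OF uv] kR[OF uv(1)] kR[OF uv(2)] by (auto simp: anticomplete_def)
  qed
  ultimately show ?thesis unfolding emb_def by blast
qed

text \<open>An edge of a subdivided claw is represented by its end \<open>p\<close> farther from the centre; \<open>par p\<close> is the other end.\<close>

definition par :: "nat \<times> nat \<Rightarrow> nat \<times> nat" where
  "par p = (if snd p = 1 then (0, 0) else (fst p, snd p - 1))"

lemma tri_adj_iff_share_end:
  assumes "p \<in> tri_dom t" "q \<in> tri_dom t" "p \<noteq> q"
  shows "{p, par p} \<inter> {q, par q} \<noteq> {} \<longleftrightarrow> tri_adj p q"
  using assms by (cases p; cases q) (auto simp: tri_dom_def par_def tri_adj_def)

lemma claw_adj_par:
  assumes "p \<in> claw_dom t" "q \<in> claw_dom t" "claw_adj p q"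
  shows "(p \<in> tri_dom t \<and> q = par p) \<or> (q \<in> tri_dom t \<and> p = par q)"
  using assms by (cases p; cases q) (auto simp: claw_dom_def tri_dom_def par_def claw_adj_def)

text \<open>The coding of H sends each edge of H to an edge of a subdivided claw, which is named by
  its farther end p. Two edges of H meet exactly if their images do, and for different edges in the
  same copy this is \<open>tri_adj\<close>.\<close>

lemma line_graph_three_leaf_forest_embedding:
  assumes H: "forest_with_three_leaf_components H"
  shows "\<exists>N t h. copies_coding (line_graph H) N (tri_dom t) tri_adj h"
proof -
  have s: "sgraph (pverts H) (parcs H)" using H by (simp add: three_leaf_forest_iff)
  obtain N t g where cc: "copies_coding H N (claw_dom t) claw_adj g"
    using three_leaf_forest_embedding[OF H] by blast
  note g = copies_codingD(1,2)[OF cc] and adj = copies_codingD(3)[OF cc]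
  let ?L = "pverts (line_graph H)"
  have L: "e \<in> ?L \<longleftrightarrow> (\<exists>u v. (u, v) \<in> parcs H \<and> e = {u, v})" for e
    by (auto simp: line_graph_def Let_def)
  have LE: "(e, f) \<in> parcs (line_graph H) \<longleftrightarrow> e \<in> ?L \<and> f \<in> ?L \<and> e \<noteq> f \<and> e \<inter> f \<noteq> {}" for e f
    by (auto simp: line_graph_def Let_def)
  have "\<exists>c p. c < N \<and> p \<in> tri_dom t \<and> g ` e = {(c, p), (c, par p)}" if e: "e \<in> ?L" for e
  proof -
    obtain u v where uv: "(u, v) \<in> parcs H" "e = {u, v}" using e L by blast
    then have V: "u \<in> pverts H" "v \<in> pverts H" using sgraphD(7)[OF s] by blast+
    obtain c p where p: "g u = (c, p)" by (rule prod.exhaust)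
    obtain d q where q: "g v = (d, q)" by (rule prod.exhaust)
    have a: "c = d" "claw_adj p q" using adj[OF V] uv(1) p q by auto
    have "g u \<in> {..<N} \<times> claw_dom t" "g v \<in> {..<N} \<times> claw_dom t" using g(2) V by blast+
    then have "c < N" "p \<in> claw_dom t" "q \<in> claw_dom t" using p q by auto
    then have "(p \<in> tri_dom t \<and> q = par p) \<or> (q \<in> tri_dom t \<and> p = par q)"
      using claw_adj_par a(2) by blast
    moreover have "g ` e = {(c, p), (c, q)}" using p q uv(2) a(1) by simp
    ultimately show ?thesis using \<open>c < N\<close> by (metis insert_commute)
  qed
  then have "\<forall>e\<in>?L. \<exists>q. fst q < N \<and> snd q \<in> tri_dom t \<and> g ` e = {(fst q, snd q), (fst q, par (snd q))}"
    by simp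
  from bchoice[OF this] obtain h where h: "\<And>e. e \<in> ?L \<Longrightarrow> fst (h e) < N \<and> snd (h e) \<in> tri_dom t \<and>
      g ` e = {(fst (h e), snd (h e)), (fst (h e), par (snd (h e)))}" by blast
  define c p where "c e = fst (h e)" and "p e = snd (h e)" for e
  have cp: "c e < N \<and> p e \<in> tri_dom t \<and> g ` e = {(c e, p e), (c e, par (p e))}" if "e \<in> ?L" for e
    using h[OF that] by (simp add: c_def p_def)
  have h_def: "h e = (c e, p e)" for e by (simp add: c_def p_def)
  have sub: "e \<subseteq> pverts H" if e: "e \<in> ?L" for e
  proof -
    obtain u v where "(u, v) \<in> parcs H" "e = {u, v}" using e[unfolded L] by blast
    then show ?thesis using sgraphD(7)[OF s, of u v] by simp
  qed
  have inj: "inj_on h ?L"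
  proof (rule inj_onI)
    fix e f assume ef: "e \<in> ?L" "f \<in> ?L" "h e = h f"
    then have "g ` e = g ` f" using cp[OF ef(1)] cp[OF ef(2)] by (simp add: h_def)
    then show "e = f" using inj_on_image_eq_iff[OF g(1) sub[OF ef(1)] sub[OF ef(2)]] by simp
  qed
  moreover have "h ` ?L \<subseteq> {..<N} \<times> tri_dom t" using cp by (auto simp: h_def)
  moreover have "(e, f) \<in> parcs (line_graph H) \<longleftrightarrow> fst (h e) = fst (h f) \<and> tri_adj (snd (h e)) (snd (h f))"
    if ef: "e \<in> ?L" "f \<in> ?L" for e f
  proof (cases "e = f")
    case True
    then show ?thesis unfolding LE by (simp add: tri_adj_def)
  next
    case False
    have "e \<inter> f \<noteq> {} \<longleftrightarrow> g ` e \<inter> g ` f \<noteq> {}"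
      using inj_on_image_Int[OF g(1) sub[OF ef(1)] sub[OF ef(2)]] by (metis image_is_empty)
    also have "\<dots> \<longleftrightarrow> c e = c f \<and> {p e, par (p e)} \<inter> {p f, par (p f)} \<noteq> {}"
      using cp[OF ef(1)] cp[OF ef(2)] by auto
    also have "\<dots> \<longleftrightarrow> c e = c f \<and> tri_adj (p e) (p f)"
    proof -
      have "p e \<noteq> p f" if "c e = c f" using inj_onD[OF inj, of e f] ef False that h_def by metis
      then show ?thesis using tri_adj_iff_share_end[of "p e" t "p f"] cp[OF ef(1)] cp[OF ef(2)] by blast
    qed
    finally show ?thesis using LE ef False by (simp add: h_def)
  qed
  ultimately have "copies_coding (line_graph H) N (tri_dom t) tri_adj h" by (simp add: copies_coding_def)
  then show ?thesis by blast
qed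

text \<open>Neither side of H has more than \<open>max m n\<close> vertices, so an induced biclique
  with sides of that size contains H.\<close>

lemma biclique_free_if_bipartite_free:
  assumes G: "pair_graph G" and H: "pair_graph H" and K: "complete_bipartite_digraph m n (with_proj H)"
    and free: "\<not> (\<exists>f. emb H G f)"
  shows "biclique_free (pverts G) (parcs G) (max m n)"
proof (rule ccontr)
  have s: "sgraph (pverts G) (parcs G)" using G by (simp add: pair_graph_iff_sgraph)
  assume "\<not> ?thesis"
  then obtain A B where AB: "A \<subseteq> pverts G" "B \<subseteq> pverts G" "finite A" "finite B" "card A = max m n" "card B = max m n"
    "stab (parcs G) A" "stab (parcs G) B" "A \<times> B \<subseteq> parcs G"
    unfolding biclique_free_def by blast
  obtain U V where UV: "finite (pverts H)" "pverts H = U \<union> V" "U \<inter> V = {}" "card U = m" "card V = n" "parcs H = U \<times> V \<union> V \<times> U"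
    using K unfolding complete_bipartite_digraph_pair_def by blast
  have "A \<inter> B = {}" using AB(9) sgraphD(6)[OF s] by blast
  obtain a where a: "a ` U \<subseteq> A" "inj_on a U"
    using card_le_inj[of U A] UV AB(3,5) by auto
  obtain b where b: "b ` V \<subseteq> B" "inj_on b V"
    using card_le_inj[of V B] UV AB(4,6) by auto
  define f where "f x = (if x \<in> U then a x else b x)" for x
  have fU: "f x = a x" "f x \<in> A" if "x \<in> U" for x using that a by (auto simp: f_def)
  have fV: "f x = b x" "f x \<in> B" if "x \<in> V" for x using that b UV(3) by (auto simp: f_def)
  have "inj_on f (pverts H)"
  proof (rule inj_onI)
    fix x y assume "x \<in> pverts H" "y \<in> pverts H" "f x = f y"
    then show "x = y" using fU fV a(2) b(2) \<open>A \<inter> B = {}\<close> unfolding UV(2) by (metis Un_iff disjoint_iff inj_onD)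
  qed
  moreover have "f ` pverts H \<subseteq> pverts G" using fU(2) fV(2) AB(1,2) UV(2) by blast
  moreover have "(x, y) \<in> parcs H \<longleftrightarrow> (f x, f y) \<in> parcs G" if xy: "x \<in> pverts H" "y \<in> pverts H" for x y
  proof -
    have BA: "(v, u) \<in> parcs G" if "u \<in> A" "v \<in> B" for u v using AB(9) that sgraphD(5)[OF s] by blast
    consider "x \<in> U" "y \<in> U" | "x \<in> U" "y \<in> V" | "x \<in> V" "y \<in> U" | "x \<in> V" "y \<in> V" using xy UV(2) by blast
    then show ?thesis
    proof cases
      case 1
      then have "(f x, f y) \<notin> parcs G" using fU(2) AB(7) by (simp add: stab_def)
      then show ?thesis using 1 UV(3) unfolding UV(6) by blast
    next
      case 2
      then have "(f x, f y) \<in> parcs G" using fU(2) fV(2) AB(9) by blast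
      then show ?thesis using 2 unfolding UV(6) by blast
    next
      case 3
      then have "(f x, f y) \<in> parcs G" using fU(2) fV(2) BA by blast
      then show ?thesis using 3 unfolding UV(6) by blast
    next
      case 4
      then have "(f x, f y) \<notin> parcs G" using fV(2) AB(8) by (simp add: stab_def)
      then show ?thesis using 4 UV(3) unfolding UV(6) by blast
    qed
  qed
  ultimately show False using free unfolding emb_def by blast
qed

lemma excluding_imp_bounded_tree_independence:
  fixes \<G> :: "nat pair_pre_digraph set" and H1 :: "'b pair_pre_digraph" and H2 :: "'c pair_pre_digraph"
    and H3 :: "'d pair_pre_digraph"
  assumes G: "\<And>G. G \<in> \<G> \<Longrightarrow> pair_graph G"
    and H1: "complete_bipartite H1" and H2: "forest_with_three_leaf_components H2"
    and H3: "forest_with_three_leaf_components H3"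
    and ex: "class_excludes \<G> H1" "class_excludes \<G> H2" "class_excludes \<G> (line_graph H3)"
  shows "bounded_tree_independence_number \<G>"
proof -
  obtain m n where pH1: "pair_graph H1" and mn: "complete_bipartite_digraph m n (with_proj H1)"
    using H1 by (auto simp: complete_bipartite_def)
  have pH: "pair_graph H2" "pair_graph (line_graph H3)"
    using H2 H3 pair_graph_line_graph by (auto simp: three_leaf_forest_iff pair_graph_iff_sgraph)
  obtain N2 t2 h2 where h2: "copies_coding H2 N2 (claw_dom t2) claw_adj h2"
    using three_leaf_forest_embedding[OF H2] by blast
  obtain N3 t3 h3 where h3: "copies_coding (line_graph H3) N3 (tri_dom t3) tri_adj h3"
    using line_graph_three_leaf_forest_embedding[OF H3] by blast
  \<comment> \<open>One packing size and one leg length serve for both obstructions; the successor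
    makes t positive.\<close>
  define N where "N = N2 + N3"
  define t where "t = Suc (t2 + t3)"
  have c2: "copies_coding H2 N (claw_dom t) claw_adj h2"
    by (rule copies_coding_mono[OF h2]) (auto simp: N_def t_def claw_dom_def)
  have c3: "copies_coding (line_graph H3) N (tri_dom t) tri_adj h3"
    by (rule copies_coding_mono[OF h3]) (auto simp: N_def t_def tri_dom_def)
  show ?thesis
  proof (rule haven_imp_packingE[of t "max m n" N, where 'a = nat])
    show "1 \<le> t" by (simp add: t_def)
    fix k assume k: "\<And>(V :: nat set) E \<beta>. finite V \<Longrightarrow> sym E \<Longrightarrow> irrefl E \<Longrightarrow> biclique_free V E (max m n) \<Longrightarrow>
      haven V E k \<beta> \<Longrightarrow>
      \<exists>\<S>. finite \<S> \<and> card \<S> = N \<and> pairwise (anticomplete E) \<S> \<and> (\<forall>R\<in>\<S>. R \<subseteq> V) \<and>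
        ((\<forall>R\<in>\<S>. claw_set E t R) \<or> (\<forall>R\<in>\<S>. tri_set E t R))"
    \<comment> \<open>The value \<open>4 * k + 2\<close> is the bound on the bags in
      \<open>no_haven_imp_ltd\<close>, started with the empty set W.\<close>
    have "tree_independence_number G \<le> 4 * k + 2" if GG: "G \<in> \<G>" for G
    proof -
      let ?V = "pverts G" and ?E = "parcs G"
      have pg: "pair_graph G" using G[OF GG] .
      have s: "sgraph ?V ?E" using pg by (simp add: pair_graph_iff_sgraph)
      have free: "\<not> (\<exists>f. emb H1 G f)" "\<not> (\<exists>f. emb H2 G f)" "\<not> (\<exists>f. emb (line_graph H3) G f)"
        using ex GG induced_free_iff[OF pH1 pg] induced_free_iff[OF pH(1) pg] induced_free_iff[OF pH(2) pg]
        unfolding class_excludes_def by blast+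
      have bf: "biclique_free ?V ?E (max m n)"
        by (rule biclique_free_if_bipartite_free[OF pg pH1 mn free(1)])
      have no: "\<not> (\<exists>\<beta>. haven U ?E k \<beta>)" if U: "U \<subseteq> ?V" for U
      proof
        assume "\<exists>\<beta>. haven U ?E k \<beta>"
        then obtain \<beta> where "haven U ?E k \<beta>" by blast
        then obtain \<S> where \<S>: "finite \<S>" "card \<S> = N" "pairwise (anticomplete ?E) \<S>" "\<And>R. R \<in> \<S> \<Longrightarrow> R \<subseteq> U"
          "(\<forall>R\<in>\<S>. claw_set ?E t R) \<or> (\<forall>R\<in>\<S>. tri_set ?E t R)"
          using k[of U ?E \<beta>] finite_subset[OF U sgraphD(1)[OF s]] sgraphD(3,4)[OF s] biclique_free_subset[OF bf U] by metis
        have sub: "\<And>R. R \<in> \<S> \<Longrightarrow> R \<subseteq> ?V" using \<S>(4) U by blast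
        from \<S>(5) show False
        proof
          assume "\<forall>R\<in>\<S>. claw_set ?E t R"
          then show False
            using emb_into_packing[OF \<S>(1-3) sub _ c2] free(2) unfolding claw_set_def by blast
        next
          assume "\<forall>R\<in>\<S>. tri_set ?E t R"
          then show False
            using emb_into_packing[OF \<S>(1-3) sub _ c3] free(3) unfolding tri_set_def by blast
        qed
      qed
      have "alpha_le ?E {} (3 * k + 1)" by (simp add: alpha_le_def)
      then obtain P B where PB: "ltd ?V ?E P B" "\<And>p. p \<in> P \<Longrightarrow> alpha_le ?E (B p) (4 * k + 2)"
        using no_haven_imp_ltd[OF sgraphD(1)[OF s] sgraphD(3)[OF s] no order_refl empty_subsetI] by blast
      obtain T where T: "tree_decomposition G T (B \<circ> list_decode)" "list_decode ` pverts T = P"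
        using ltd_imp_tree_decomposition[OF pg PB(1)] by blast
      have "\<not> (\<exists>S\<subseteq>(B \<circ> list_decode) n. stable_set G S \<and> card S = 4 * k + 2 + 1)" if n: "n \<in> pverts T" for n
      proof (intro notI, elim exE conjE)
        fix S assume S: "S \<subseteq> (B \<circ> list_decode) n" "stable_set G S" "card S = 4 * k + 2 + 1"
        have "finite S" using S(3) by (metis card.infinite add_is_0 one_neq_zero)
        moreover have "stab ?E S" using S(2) by (auto simp: stable_set_def stab_def)
        moreover have "alpha_le ?E (B (list_decode n)) (4 * k + 2)" using PB(2) T(2) n by blast
        ultimately have "card S \<le> 4 * k + 2" using S(1) by (simp add: alpha_le_def)
        then show False using S(3) by simp
      qed
      then show ?thesis
        unfolding tree_independence_number_def
        by - (rule Least_le, rule conjI, simp, rule exI[of _ T], rule exI[of _ "B \<circ> list_decode"], use T(1) in simp)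
    qed
    then show ?thesis unfolding bounded_tree_independence_number_def by (intro exI[of _ "4 * k + 2"]) auto
  qed
qed

subsection \<open>Subdivisions of graphs of maximum degree three\<close>

text \<open>
  \<open>pt k e p\<close> is the \<open>p\<close>-th point of the arc \<open>e\<close> subdivided by \<open>k\<close> vertices, for \<open>p \<le> k + 1\<close>. The
  branch vertex \<open>u\<close> is encoded like the \<open>0\<close>-th point of a loop at \<open>u\<close>, so that it does not depend
  on the arc.
\<close>

definition pt :: "nat \<Rightarrow> nat \<times> nat \<Rightarrow> nat \<Rightarrow> nat" where
  "pt k e p = (if p = 0 then prod_encode (prod_encode (fst e, fst e), 0)
     else if p \<le> k then prod_encode (prod_encode e, p)
     else prod_encode (prod_encode (snd e, snd e), 0))"

definition branch :: "nat \<Rightarrow> bool" where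
  "branch x \<longleftrightarrow> snd (prod_decode x) = 0"

text \<open>An arc of A only fixes the direction in which the points of the subdivided edge are
  counted; the result is symmetric.\<close>

definition subdiv :: "(nat \<times> nat) set \<Rightarrow> nat \<Rightarrow> nat pair_pre_digraph" where
  "subdiv A k = \<lparr>pverts = {pt k e p |e p. e \<in> A \<and> p \<le> Suc k},
     parcs = {(x, y). \<exists>e\<in>A. \<exists>p\<le>k. (x = pt k e p \<and> y = pt k e (Suc p)) \<or> (y = pt k e p \<and> x = pt k e (Suc p))}\<rparr>"

lemma branch_pt: "branch (pt k e p) \<longleftrightarrow> p = 0 \<or> p > k"
  by (simp add: branch_def pt_def)

lemma pt_interior_eq_iff: "p \<noteq> 0 \<Longrightarrow> p \<le> k \<Longrightarrow> pt k e p = pt k e' q \<longleftrightarrow> e = e' \<and> p = q"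
  by (auto simp: pt_def)

lemma pt_inj: "fst e \<noteq> snd e \<Longrightarrow> inj_on (pt k e) {..Suc k}"
  by (auto simp: inj_on_def pt_def split: if_splits)

lemma subdiv_arcE:
  assumes "(x, y) \<in> parcs (subdiv A k)"
  obtains e p where "e \<in> A" "p \<le> k" "x = pt k e p" "y = pt k e (Suc p)"
    | e p where "e \<in> A" "p \<le> k" "y = pt k e p" "x = pt k e (Suc p)"
  using assms unfolding subdiv_def by auto

lemma subdiv_arcI:
  assumes "e \<in> A" "p \<le> k"
  shows "(pt k e p, pt k e (Suc p)) \<in> parcs (subdiv A k)" "(pt k e (Suc p), pt k e p) \<in> parcs (subdiv A k)"
  unfolding subdiv_def using assms by auto

lemma pair_graph_subdiv:
  assumes "finite A" and A: "\<And>u. (u, u) \<notin> A"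
  shows "pair_graph (subdiv A k)"
proof -
  have "pverts (subdiv A k) = (\<lambda>(e, p). pt k e p) ` (A \<times> {..Suc k})"
    by (auto simp: subdiv_def)
  then have "finite (pverts (subdiv A k))" using assms(1) by simp
  moreover have "parcs (subdiv A k) \<subseteq> pverts (subdiv A k) \<times> pverts (subdiv A k)"
    unfolding subdiv_def by fastforce
  moreover have "sym (parcs (subdiv A k))"
    unfolding subdiv_def sym_def by auto
  moreover have "(x, x) \<notin> parcs (subdiv A k)" for x
  proof
    have "pt k e p \<noteq> pt k e (Suc p)" if "e \<in> A" "p \<le> k" for e p
    proof -
      have "fst e \<noteq> snd e" using A that(1) by (metis prod.collapse)
      then show ?thesis using inj_onD[OF pt_inj[of e k], of p "Suc p"] that(2) by auto
    qed
    moreover assume "(x, x) \<in> parcs (subdiv A k)"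
    ultimately show False by (elim subdiv_arcE) metis+
  qed
  ultimately show ?thesis by (simp add: pair_graph_iff_sgraph sgraph_def irrefl_def)
qed

lemma subdiv_interior_nbr:
  assumes "(pt k e p, y) \<in> parcs (subdiv A k)" "p \<noteq> 0" "p \<le> k"
  shows "y = pt k e (p - 1) \<or> y = pt k e (Suc p)"
  using assms(1)
proof (cases rule: subdiv_arcE)
  case (1 e' q)
  then show ?thesis using pt_interior_eq_iff[OF assms(2,3), of e e' q] by simp
next
  case (2 e' q)
  then show ?thesis using pt_interior_eq_iff[OF assms(2,3), of e e' "Suc q"] by auto
qed

lemma subdiv_branch_nbr:
  assumes xy: "(x, y) \<in> parcs (subdiv A k)" and "branch x"
  shows "\<exists>e\<in>A. (x = pt k e 0 \<and> y = pt k e 1) \<or> (x = pt k e (Suc k) \<and> y = pt k e k)"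
  using xy
proof (cases rule: subdiv_arcE)
  case (1 e p)
  then have "p = 0" using assms(2) branch_pt[of k e p] by simp
  then show ?thesis using 1 by auto
next
  case (2 e p)
  then have "p = k" using assms(2) branch_pt[of k e "Suc p"] by simp
  then show ?thesis using 2 by auto
qed

lemma subdiv_vertex_cases:
  assumes "(x, y) \<in> parcs (subdiv A k)"
  obtains "branch x" | e p where "e \<in> A" "p \<noteq> 0" "p \<le> k" "x = pt k e p"
  using assms
proof (cases rule: subdiv_arcE)
  case (1 e p)
  then show ?thesis using that branch_pt[of k e p] by (cases "p = 0") auto
next
  case (2 e p)
  then show ?thesis using that(1) that(2)[of e "Suc p"] branch_pt[of k e "Suc p"] by (cases "Suc p \<le> k") auto
qed

lemma subdiv_degree_interior:
  assumes "\<not> branch x"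
  shows "finite {y. (x, y) \<in> parcs (subdiv A k)} \<and> card {y. (x, y) \<in> parcs (subdiv A k)} \<le> 2"
proof (cases "{y. (x, y) \<in> parcs (subdiv A k)} = {}")
  case True
  then show ?thesis by (metis card.empty finite.emptyI zero_le)
next
  case False
  then obtain y where "(x, y) \<in> parcs (subdiv A k)" by blast
  then obtain e p where ep: "p \<noteq> 0" "p \<le> k" "x = pt k e p"
    using assms by (elim subdiv_vertex_cases) auto
  let ?S = "{pt k e (p - 1), pt k e (Suc p)}"
  have sub: "{y. (x, y) \<in> parcs (subdiv A k)} \<subseteq> ?S"
    using subdiv_interior_nbr[of k e p _ A] ep by blast
  have "card ?S \<le> 2" by (simp add: card_insert_if)
  then show ?thesis using finite_subset[OF sub] card_mono[OF _ sub] by fastforce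
qed

lemma subdiv_degree:
  assumes "finite A" and A: "\<And>u. (u, u) \<notin> A" and d: "\<And>u. card {e \<in> A. fst e = u \<or> snd e = u} \<le> 3"
  shows "finite {y. (x, y) \<in> parcs (subdiv A k)} \<and> card {y. (x, y) \<in> parcs (subdiv A k)} \<le> 3"
proof (cases "branch x")
  case True
  define u where "u = fst (prod_decode (fst (prod_decode x)))"
  let ?A = "{e \<in> A. fst e = u \<or> snd e = u}"
  define h where "h e = (if fst e = u then pt k e 1 else pt k e k)" for e
  have sub: "{y. (x, y) \<in> parcs (subdiv A k)} \<subseteq> h ` ?A"
  proof
    fix y assume "y \<in> {y. (x, y) \<in> parcs (subdiv A k)}"
    then obtain e where e: "e \<in> A" "(x = pt k e 0 \<and> y = pt k e 1) \<or> (x = pt k e (Suc k) \<and> y = pt k e k)"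
      using subdiv_branch_nbr[OF _ True] by blast
    have ne: "fst e \<noteq> snd e" using A e(1) by (metis prod.collapse)
    from e(2) have "e \<in> ?A \<and> y = h e"
    proof
      assume a: "x = pt k e 0 \<and> y = pt k e 1"
      then have "fst e = u" by (simp add: u_def pt_def)
      then show ?thesis using a e(1) by (simp add: h_def)
    next
      assume a: "x = pt k e (Suc k) \<and> y = pt k e k"
      then have "snd e = u" by (simp add: u_def pt_def)
      then show ?thesis using a e(1) ne by (simp add: h_def)
    qed
    then show "y \<in> h ` ?A" by blast
  qed
  have fin: "finite ?A" using assms(1) by simp
  have "card {y. (x, y) \<in> parcs (subdiv A k)} \<le> card (h ` ?A)" using card_mono[OF _ sub] fin by simp
  also have "\<dots> \<le> card ?A" by (rule card_image_le[OF fin])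
  also have "\<dots> \<le> 3" by (rule d)
  finally show ?thesis using finite_subset[OF sub] fin by simp
next
  case False
  then show ?thesis using subdiv_degree_interior[of x A k] by auto
qed

text \<open>As k is positive, T contains an interior point of some subdivided arc. Such a point has
  only two neighbours, so both are in T; continuing in both directions, T contains all k + 2 points
  of the arc.\<close>

lemma subdiv_small_core:
  assumes k: "k \<ge> 1" and A: "\<And>u. (u, u) \<notin> A" and T: "finite T" "x \<in> T"
    and deg2: "\<And>x. x \<in> T \<Longrightarrow> \<exists>y\<in>T. \<exists>z\<in>T. y \<noteq> z \<and> (x, y) \<in> parcs (subdiv A k) \<and> (x, z) \<in> parcs (subdiv A k)"
  shows "card T > k"
proof -
  have "\<exists>e\<in>A. \<exists>p. p \<noteq> 0 \<and> p \<le> k \<and> pt k e p \<in> T"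
  proof (cases "branch x")
    case True
    obtain y where y: "y \<in> T" "(x, y) \<in> parcs (subdiv A k)" using deg2[OF T(2)] by blast
    show ?thesis using subdiv_branch_nbr[OF y(2) True] y(1) k by (metis One_nat_def le_refl not_one_le_zero)
  next
    case False
    obtain y where y: "y \<in> T" "(x, y) \<in> parcs (subdiv A k)" using deg2[OF T(2)] by blast
    show ?thesis using y(2) False T(2) by (elim subdiv_vertex_cases) auto
  qed
  then obtain e p where ep: "e \<in> A" "p \<noteq> 0" "p \<le> k" "pt k e p \<in> T" by blast
  have both: "pt k e (q - 1) \<in> T \<and> pt k e (Suc q) \<in> T" if q: "q \<noteq> 0" "q \<le> k" "pt k e q \<in> T" for q
  proof -
    obtain y z where yz: "y \<in> T" "z \<in> T" "y \<noteq> z" "(pt k e q, y) \<in> parcs (subdiv A k)" "(pt k e q, z) \<in> parcs (subdiv A k)"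
      using deg2[OF q(3)] by blast
    then show ?thesis using subdiv_interior_nbr[OF yz(4) q(1,2)] subdiv_interior_nbr[OF yz(5) q(1,2)] by blast
  qed
  have up: "pt k e (p + m) \<in> T" if "p + m \<le> Suc k" for m
    using that
  proof (induction m)
    case (Suc m)
    then show ?case using both[of "p + m"] ep by simp
  qed (use ep in simp)
  have down: "pt k e (p - m) \<in> T" for m
  proof (induction m)
    case (Suc m)
    then show ?case using both[of "p - m"] ep by (cases "p - m = 0") auto
  qed (use ep in simp)
  have "pt k e q \<in> T" if "q \<le> Suc k" for q
    using up[of "q - p"] down[of "p - q"] that by (cases "p \<le> q") auto
  then have sub: "pt k e ` {..Suc k} \<subseteq> T" by blast
  have "fst e \<noteq> snd e" using A ep(1) by (metis prod.collapse)
  then have "card (pt k e ` {..Suc k}) = Suc (Suc k)" by (simp add: card_image pt_inj)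
  then show ?thesis using card_mono[OF T(1) sub] by simp
qed

text \<open>A path that leaves a branch vertex along a subdivided arc cannot turn back, and the next
  branch vertex comes only after the k interior points.\<close>

lemma subdiv_branch_path:
  assumes xs: "distinct xs" "length xs \<ge> 2" "\<And>i. Suc i < length xs \<Longrightarrow> (xs ! i, xs ! Suc i) \<in> parcs (subdiv A k)"
    and b: "branch (xs ! 0)" "branch (xs ! (length xs - 1))"
  shows "length xs > k"
proof (rule ccontr)
  assume "\<not> ?thesis"
  then have len: "length xs \<le> k" by simp
  have "(xs ! 0, xs ! 1) \<in> parcs (subdiv A k)" using xs(2) xs(3)[of 0] by simp
  then obtain e where e: "(xs ! 0 = pt k e 0 \<and> xs ! 1 = pt k e 1) \<or> (xs ! 0 = pt k e (Suc k) \<and> xs ! 1 = pt k e k)"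
    using subdiv_branch_nbr[OF _ b(1)] by blast
  \<comment> \<open>The points of the arc counted from the end at which the path starts.\<close>
  define f where "f m = (if xs ! 0 = pt k e 0 \<and> xs ! 1 = pt k e 1 then pt k e m else pt k e (Suc k - m))" for m
  have f01: "xs ! 0 = f 0" "xs ! 1 = f 1" using e by (auto simp: f_def)
  have nbr: "y = f (m - 1) \<or> y = f (Suc m)" if "(f m, y) \<in> parcs (subdiv A k)" "m \<noteq> 0" "m \<le> k" for m y
  proof (cases "xs ! 0 = pt k e 0 \<and> xs ! 1 = pt k e 1")
    case True
    then show ?thesis using subdiv_interior_nbr[of k e m y A] that by (simp add: f_def)
  next
    case False
    have "Suc k - m - 1 = Suc k - Suc m" "Suc (Suc k - m) = Suc k - (m - 1)" using that by auto
    then show ?thesis using subdiv_interior_nbr[of k e "Suc k - m" y A] that False by (auto simp: f_def)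
  qed
  have walk: "Suc m < length xs \<Longrightarrow> xs ! m = f m \<and> xs ! Suc m = f (Suc m)" for m
  proof (induction m)
    case 0
    then show ?case using f01 by simp
  next
    case (Suc m)
    then have IH: "xs ! m = f m" "xs ! Suc m = f (Suc m)" by auto
    have "(f (Suc m), xs ! Suc (Suc m)) \<in> parcs (subdiv A k)" using xs(3)[OF Suc.prems] IH by simp
    then have "xs ! Suc (Suc m) = f m \<or> xs ! Suc (Suc m) = f (Suc (Suc m))"
      using nbr[of "Suc m"] Suc.prems len by simp
    moreover have "xs ! Suc (Suc m) \<noteq> xs ! m"
      using nth_eq_iff_index_eq[OF xs(1), of "Suc (Suc m)" m] Suc.prems by simp
    ultimately show ?case using IH by auto
  qed
  obtain m where m: "length xs = Suc (Suc m)" using xs(2) by (metis Suc_le_D numeral_2_eq_2 Suc_le_mono)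
  then have "branch (f (Suc m))" using walk[of m] b(2) by simp
  then show False using m len by (auto simp: f_def branch_pt split: if_splits)
qed

text \<open>H is acyclic by \<open>subdiv_small_core\<close>, and each component contains at most
  one branch vertex by \<open>subdiv_branch_path\<close>. All other vertices have degree at most 2,
  which leaves at most three leaves. The map f is just an injective homomorphism, so that the lemma
  covers arbitrary sets of edges of the wall as well as induced subgraphs.\<close>

lemma small_hom_into_subdiv:
  assumes k: "k \<ge> 1" and A: "finite A" "\<And>u. (u, u) \<notin> A" "\<And>u. card {e \<in> A. fst e = u \<or> snd e = u} \<le> 3"
    and H: "pair_graph H" "card (pverts H) \<le> k"
    and f: "inj_on f (pverts H)" "\<And>u v. (u, v) \<in> parcs H \<Longrightarrow> (f u, f v) \<in> parcs (subdiv A k)"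
  shows "forest_with_three_leaf_components H"
proof -
  let ?V = "pverts H" and ?E = "parcs H" and ?W = "parcs (subdiv A k)"
  have s: "sgraph ?V ?E" using H(1) by (simp add: pair_graph_iff_sgraph)
  have E: "sym ?E" "irrefl ?E" and V: "finite ?V" using s by (auto simp: sgraph_def)
  have ac: "acyc ?V ?E"
    unfolding acyc_def
  proof (intro allI impI)
    fix S assume S: "S \<subseteq> ?V" "S \<noteq> {}"
    show "\<exists>v\<in>S. \<forall>a\<in>S. \<forall>b\<in>S. (v, a) \<in> ?E \<longrightarrow> (v, b) \<in> ?E \<longrightarrow> a = b"
    proof (rule ccontr)
      assume no: "\<not> ?thesis"
      obtain s where s: "s \<in> S" using S(2) by blast
      have "card (f ` S) > k"
      proof (rule subdiv_small_core[OF k A(2)])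
        show "finite (f ` S)" using S(1) V finite_subset by blast
        show "f s \<in> f ` S" using s by blast
        fix x assume "x \<in> f ` S"
        then obtain v where v: "v \<in> S" "x = f v" by blast
        then obtain a b where ab: "a \<in> S" "b \<in> S" "(v, a) \<in> ?E" "(v, b) \<in> ?E" "a \<noteq> b" using no by blast
        have "f a \<noteq> f b" using f(1) ab S(1) by (meson inj_onD subsetD)
        then show "\<exists>y\<in>f ` S. \<exists>z\<in>f ` S. y \<noteq> z \<and> (x, y) \<in> ?W \<and> (x, z) \<in> ?W"
          using f(2)[OF ab(3)] f(2)[OF ab(4)] ab(1,2) v(2) by blast
      qed
      moreover have "card (f ` S) \<le> card ?V"
        using card_image_le[of S f] card_mono[OF V S(1)] finite_subset[OF S(1) V] by linarith
      ultimately show False using H(2) by simp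
    qed
  qed
  have degW: "deg ?E X v \<le> card {y. (f v, y) \<in> ?W}" if X: "X \<subseteq> ?V" for X v
  proof -
    have "deg ?E X v = card (f ` {a \<in> X. (v, a) \<in> ?E})"
      unfolding deg_def using f(1) X by (subst card_image) (auto intro: inj_on_subset)
    also have "\<dots> \<le> card {y. (f v, y) \<in> ?W}"
      using subdiv_degree[OF A, of "f v" k] f(2) by (intro card_mono) auto
    finally show ?thesis .
  qed
  have "card {v \<in> X. deg ?E X v = 1} \<le> 3" if x: "x \<in> ?V" and Xd: "X = comp ?E ?V x" for x X
  proof -
    have XV: "X \<subseteq> ?V" using comp_subset[OF x] Xd by blast
    have X: "finite X" "X \<noteq> {}" "conn ?E X" "acyc X ?E"
      using finite_subset[OF XV V] comp_self[of x ?E ?V] conn_comp[OF E(1) x] acyc_subset[OF ac XV] Xd by auto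
    have uniq: "u = v" if uv: "u \<in> X" "v \<in> X" "branch (f u)" "branch (f v)" for u v
    proof (rule ccontr)
      assume ne: "u \<noteq> v"
      obtain xs where xs: "ipath ?E xs" "xs \<noteq> []" "hd xs = u" "set xs \<subseteq> X" "last xs = v"
        using shortest_ipath[OF E uv(1) connD[OF X(3) uv(1,2)], of "\<lambda>z. z = v"] by blast
      have l2: "length xs \<ge> 2" using xs(2,3,5) ne by (cases xs rule: list.exhaust; cases "tl xs") auto
      have "length (map f xs) > k"
      proof (rule subdiv_branch_path)
        show "distinct (map f xs)"
          using xs(1,4) f(1) XV by (auto simp: ipath_def distinct_map intro: inj_on_subset)
        show "2 \<le> length (map f xs)" using l2 by simp
        show "branch (map f xs ! 0)" using xs(2,3) uv(3) by (simp add: hd_conv_nth)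
        show "branch (map f xs ! (length (map f xs) - 1))" using xs(2,5) uv(4) by (simp add: last_conv_nth)
        fix i assume i: "Suc i < length (map f xs)"
        then have "(xs ! i, xs ! Suc i) \<in> ?E" using xs(1) by (simp add: ipath_def)
        then show "(map f xs ! i, map f xs ! Suc i) \<in> ?W" using f(2) i by simp
      qed
      moreover have "length xs = card (set xs)" using xs(1) by (simp add: ipath_def distinct_card)
      moreover have "card (set xs) \<le> card ?V" using card_mono[OF V] xs(4) XV by blast
      ultimately show False using H(2) by simp
    qed
    have d3: "deg ?E X v \<le> 3" for v
      using degW[OF XV, of v] subdiv_degree[OF A, of "f v" k] by linarith
    have d2: "deg ?E X v \<le> 2" if "\<not> branch (f v)" for v
      using degW[OF XV, of v] subdiv_degree_interior[OF that, of A k] by linarith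
    show ?thesis
    proof (cases "\<exists>c\<in>X. branch (f c)")
      case True
      then obtain c where c: "c \<in> X" "branch (f c)" by blast
      show ?thesis by (rule card_leaves_le_three[OF E X, of c]) (use uniq c d2 d3 in blast)+
    next
      case False
      then show ?thesis using card_leaves_le_three[OF E X, of undefined] d2 d3 by blast
    qed
  qed
  then show ?thesis unfolding three_leaf_forest_iff using s ac by blast
qed

text \<open>What the subgraph induced by S becomes in the subdivision. Arcs leaving S are dropped,
  and so are vertices of S that lie on no arc inside S.\<close>

definition lift :: "(nat \<times> nat) set \<Rightarrow> nat \<Rightarrow> nat set \<Rightarrow> nat set" where
  "lift A k S = (\<Union>e\<in>{e \<in> A. fst e \<in> S \<and> snd e \<in> S}. pt k e ` {..Suc k})"

lemma conn_path_image:
  assumes "sym E" "\<And>p. p < m \<Longrightarrow> (f p, f (Suc p)) \<in> E"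
  shows "conn E (f ` {..m})"
  using assms(2)
proof (induction m)
  case 0
  then show ?case by (simp add: conn_def)
next
  case (Suc m)
  then have "conn E (insert (f (Suc m)) (f ` {..m}))"
    by (intro conn_insert[OF assms(1), of _ "f m"]) auto
  then show ?case by (simp add: atMost_Suc)
qed

lemma conn_UN_common:
  assumes "sym F" "\<And>a. a \<in> A \<Longrightarrow> conn F (S a) \<and> x \<in> S a"
  shows "conn F (\<Union>a\<in>A. S a)"
proof (rule conn_UN[of F UNIV])
  show "conn UNIV A" unfolding conn_def by auto
qed (use assms in blast)+

text \<open>\<open>T a\<close> consists of the subdivided arcs inside S at a, which share the branch
  vertex of a; adjacent vertices of S share an arc. Having two vertices in S guarantees that no
  \<open>T a\<close> is empty.\<close>

lemma conn_lift:
  assumes pg: "pair_graph (subdiv A k)" and S: "conn (A \<union> A\<inverse>) S" "u \<in> S" "v \<in> S" "u \<noteq> v"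
  shows "conn (parcs (subdiv A k)) (lift A k S)"
proof -
  have sy: "sym (parcs (subdiv A k))" using pg by (simp add: pair_graph_iff_sgraph sgraph_def)
  define J where "J a = {e \<in> A. fst e \<in> S \<and> snd e \<in> S \<and> (fst e = a \<or> snd e = a)}" for a
  define T where "T a = (\<Union>e\<in>J a. pt k e ` {..Suc k})" for a
  define b where "b a = prod_encode (prod_encode (a, a), 0)" for a
  have bT: "b a \<in> pt k e ` {..Suc k}" if e: "e \<in> J a" for a e
  proof (cases "fst e = a")
    case True
    then have "b a = pt k e 0" by (simp add: b_def pt_def)
    then show ?thesis by blast
  next
    case False
    then have "b a = pt k e (Suc k)" using e by (simp add: J_def b_def pt_def)
    then show ?thesis by blast
  qed
  have cT: "conn (parcs (subdiv A k)) (T a)" for a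
    unfolding T_def
  proof (rule conn_UN_common[OF sy])
    fix e assume e: "e \<in> J a"
    then have "e \<in> A" by (simp add: J_def)
    then show "conn (parcs (subdiv A k)) (pt k e ` {..Suc k}) \<and> b a \<in> pt k e ` {..Suc k}"
      using bT[OF e] by (intro conjI conn_path_image[OF sy] subdiv_arcI) auto
  qed
  have "conn (parcs (subdiv A k)) (\<Union>a\<in>S. T a)"
  proof (rule conn_UN[OF sy S(1)])
    fix a assume a: "a \<in> S"
    have "S \<noteq> {a}" using S(2-4) by blast
    then obtain c where c: "c \<in> S" "(a, c) \<in> A \<union> A\<inverse>" using conn_neighbour[OF S(1) a] by blast
    then have "J a \<noteq> {}" using a by (force simp: J_def)
    then show "conn (parcs (subdiv A k)) (T a) \<and> T a \<noteq> {}" using cT by (auto simp: T_def)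
  next
    fix a c assume ac: "a \<in> S" "c \<in> S" "(a, c) \<in> A \<union> A\<inverse>"
    then obtain e where "e \<in> J a" "e \<in> J c" by (force simp: J_def)
    then have "pt k e 0 \<in> T a \<inter> T c" by (auto simp: T_def)
    then show "T a \<inter> T c \<noteq> {}" by blast
  qed
  moreover have "(\<Union>a\<in>S. T a) = lift A k S" by (auto simp: T_def J_def lift_def)
  ultimately show ?thesis by simp
qed

lemma lift_subset: "lift A k S \<subseteq> pverts (subdiv A k)"
  by (auto simp: lift_def subdiv_def)

lemma end_in_lift:
  assumes "conn (A \<union> A\<inverse>) S" "a \<in> S" "S \<noteq> {a}"
  shows "prod_encode (prod_encode (a, a), 0) \<in> lift A k S"
proof -
  obtain c where c: "c \<in> S" "(a, c) \<in> A \<or> (c, a) \<in> A" using conn_neighbour[OF assms] by blast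
  from c(2) show ?thesis
  proof
    assume "(a, c) \<in> A"
    moreover have "prod_encode (prod_encode (a, a), 0) = pt k (a, c) 0" by (simp add: pt_def)
    ultimately show ?thesis using c(1) assms(2) unfolding lift_def by force
  next
    assume "(c, a) \<in> A"
    moreover have "prod_encode (prod_encode (a, a), 0) = pt k (c, a) (Suc k)" by (simp add: pt_def)
    ultimately show ?thesis using c(1) assms(2) unfolding lift_def by force
  qed
qed

text \<open>A point encodes its arc, or a loop if it is a branch vertex. The first component r is an
  end of every subdivided arc through the point, so r maps the lift of S into S.\<close>

lemma lift_disjoint: 
  assumes "S \<inter> S' = {}"
  shows "lift A k S \<inter> lift A k S' = {}"
proof -
  define r where "r x = fst (prod_decode (fst (prod_decode x)))" for x
  have r: "r (pt k e p) \<in> {fst e, snd e}" for e p by (simp add: r_def pt_def)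
  have "r x \<in> S" if x: "x \<in> lift A k S" for x S
  proof -
    obtain e p where "fst e \<in> S" "snd e \<in> S" "x = pt k e p" using x by (auto simp: lift_def)
    then show ?thesis using r[of e p] by auto
  qed
  then show ?thesis using assms by blast
qed

definition edges_in :: "'a pair_pre_digraph \<Rightarrow> 'a set \<Rightarrow> 'a set set" where
  "edges_in G X = {{u, v} |u v. (u, v) \<in> parcs G \<and> u \<in> X \<and> v \<in> X}"

text \<open>The edges inside X at a fixed vertex form a clique of the line graph, and the cliques of
  adjacent vertices share an edge.\<close>

lemma conn_edges_in:
  assumes G: "pair_graph G" and X: "conn (parcs G) X" "u \<in> X" "v \<in> X" "u \<noteq> v"
  shows "conn (parcs (line_graph G)) (edges_in G X)"
proof -
  let ?L = "parcs (line_graph G)"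
  have sG: "(b, a) \<in> parcs G" if "(a, b) \<in> parcs G" for a b
    using G that by (auto simp: pair_graph_iff_sgraph sgraph_def dest: symD)
  have sL: "sym ?L" using pair_graph_line_graph[OF G] by (simp add: pair_graph_iff_sgraph sgraph_def)
  define T where "T a = {{a, b} |b. (a, b) \<in> parcs G \<and> b \<in> X}" for a
  have adj: "(e, f) \<in> ?L" if "e \<in> T a" "f \<in> T a" "e \<noteq> f" for a e f
    using that unfolding T_def line_graph_def Let_def by auto
  have cT: "conn ?L (T a)" for a
    unfolding conn_def
  proof (intro ballI)
    fix e f assume "e \<in> T a" "f \<in> T a"
    then show "(e, f) \<in> (?L \<inter> T a \<times> T a)\<^sup>*" using adj[of e a f] by (cases "e = f") auto
  qed
  have "conn ?L (\<Union>a\<in>X. T a)"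
  proof (rule conn_UN[OF sL X(1)])
    fix a assume a: "a \<in> X"
    have "X \<noteq> {a}" using X(2-4) by blast
    then have "T a \<noteq> {}" using conn_neighbour[OF X(1) a] by (auto simp: T_def)
    then show "conn ?L (T a) \<and> T a \<noteq> {}" using cT by simp
  next
    fix a b assume ab: "a \<in> X" "b \<in> X" "(a, b) \<in> parcs G"
    then have "{a, b} \<in> T a" "{b, a} \<in> T b" using sG by (auto simp: T_def)
    then show "T a \<inter> T b \<noteq> {}" by (metis IntI empty_iff insert_commute)
  qed
  moreover have "(\<Union>a\<in>X. T a) = edges_in G X" by (auto simp: T_def edges_in_def)
  ultimately show ?thesis by simp
qed

text \<open>In the line graph each set is replaced by the edges inside it. If \<open>R i\<close> and
  \<open>C j\<close> share x, both contain an edge at x, since they are connected with at least two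
  vertices, and these edges are equal or adjacent. So the same families bound both
  treewidths.\<close>

lemma treewidth_ge_of_crossing_families:
  fixes G :: "nat pair_pre_digraph"
  assumes G: "pair_graph G"
    and R: "\<And>i. i < n \<Longrightarrow> R i \<subseteq> pverts G \<and> conn (parcs G) (R i) \<and> (\<exists>u\<in>R i. \<exists>v\<in>R i. u \<noteq> v)"
    and C: "\<And>j. j < n \<Longrightarrow> C j \<subseteq> pverts G \<and> conn (parcs G) (C j) \<and> (\<exists>u\<in>C j. \<exists>v\<in>C j. u \<noteq> v)"
    and RR: "\<And>i j. i < n \<Longrightarrow> j < n \<Longrightarrow> i \<noteq> j \<Longrightarrow> R i \<inter> R j = {}"
    and CC: "\<And>i j. i < n \<Longrightarrow> j < n \<Longrightarrow> i \<noteq> j \<Longrightarrow> C i \<inter> C j = {}"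
    and RC: "\<And>i j. i < n \<Longrightarrow> j < n \<Longrightarrow> R i \<inter> C j \<noteq> {}"
  shows "n \<le> Suc (treewidth G)" "n \<le> Suc (treewidth (relabel set_encode (line_graph G)))"
proof -
  show "n \<le> Suc (treewidth G)"
  proof (rule treewidth_ge[OF G, of n R C])
    show "R i \<subseteq> pverts G \<and> R i \<noteq> {} \<and> conn (parcs G) (R i)" if "i < n" for i using R[OF that] by blast
    show "C i \<subseteq> pverts G \<and> C i \<noteq> {} \<and> conn (parcs G) (C i)" if "i < n" for i using C[OF that] by blast
    show "\<exists>a\<in>R i. \<exists>b\<in>C j. (a, b) \<in> parcs G \<or> a = b" if "i < n" "j < n" for i j using RC[OF that] by blast
  qed (use RR CC in blast)+
  let ?L = "line_graph G"
  have s: "sgraph (pverts G) (parcs G)" using G by (simp add: pair_graph_iff_sgraph)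
  have fin: "finite e" if "e \<in> pverts ?L" for e using that by (auto simp: line_graph_def Let_def)
  have inj: "inj_on set_encode (pverts ?L)"
    by (rule inj_on_subset[OF inj_on_set_encode]) (use fin in blast)
  have fam: "edges_in G X \<subseteq> pverts ?L \<and> edges_in G X \<noteq> {} \<and> conn (parcs ?L) (edges_in G X)"
    if X: "X \<subseteq> pverts G \<and> conn (parcs G) X \<and> (\<exists>u\<in>X. \<exists>v\<in>X. u \<noteq> v)" for X
  proof -
    obtain u v where uv: "u \<in> X" "v \<in> X" "u \<noteq> v" using X by blast
    then obtain a where "a \<in> X" "(u, a) \<in> parcs G" using conn_neighbour[of "parcs G" X u] X by blast
    then have "edges_in G X \<noteq> {}" using uv(1) unfolding edges_in_def by blast
    moreover have "edges_in G X \<subseteq> pverts ?L" by (auto simp: edges_in_def line_graph_def Let_def)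
    ultimately show ?thesis using conn_edges_in[OF G _ uv] X by blast
  qed
  have dis: "edges_in G X \<inter> edges_in G Y = {}" if "X \<inter> Y = {}" for X Y
    using that unfolding edges_in_def by (auto simp: doubleton_eq_iff)
  show "n \<le> Suc (treewidth (relabel set_encode ?L))"
  proof (rule treewidth_relabel_ge[OF pair_graph_line_graph[OF G] inj, of n "\<lambda>i. edges_in G (R i)" "\<lambda>i. edges_in G (C i)"])
    show "edges_in G (R i) \<subseteq> pverts ?L \<and> edges_in G (R i) \<noteq> {} \<and> conn (parcs ?L) (edges_in G (R i))" if "i < n" for i
      by (rule fam[OF R[OF that]])
    show "edges_in G (C i) \<subseteq> pverts ?L \<and> edges_in G (C i) \<noteq> {} \<and> conn (parcs ?L) (edges_in G (C i))" if "i < n" for i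
      by (rule fam[OF C[OF that]])
    show "edges_in G (R i) \<inter> edges_in G (R j) = {}" if "i < n" "j < n" "i \<noteq> j" for i j
      by (rule dis[OF RR[OF that]])
    show "edges_in G (C i) \<inter> edges_in G (C j) = {}" if "i < n" "j < n" "i \<noteq> j" for i j
      by (rule dis[OF CC[OF that]])
    fix i j assume ij: "i < n" "j < n"
    obtain x where x: "x \<in> R i" "x \<in> C j" using RC[OF ij] by blast
    have "R i \<noteq> {x}" using R[OF ij(1)] by (metis singletonD)
    then obtain a where a: "a \<in> R i" "(x, a) \<in> parcs G"
      using conn_neighbour[of "parcs G" "R i" x] R[OF ij(1)] x(1) by blast
    have "C j \<noteq> {x}" using C[OF ij(2)] by (metis singletonD)
    then obtain b where b: "b \<in> C j" "(x, b) \<in> parcs G"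
      using conn_neighbour[of "parcs G" "C j" x] C[OF ij(2)] x(2) by blast
    note ab = a b
    have "{x, a} \<in> edges_in G (R i)" "{x, b} \<in> edges_in G (C j)" using ab x unfolding edges_in_def by blast+
    moreover have "({x, a}, {x, b}) \<in> parcs ?L \<or> {x, a} = {x, b}"
      using ab(2,4) by (auto simp: line_graph_def Let_def)
    ultimately show "\<exists>e\<in>edges_in G (R i). \<exists>f\<in>edges_in G (C j). (e, f) \<in> parcs ?L \<or> e = f" by blast
  qed
qed

subsection \<open>Walls\<close>

definition wv :: "nat \<Rightarrow> nat \<Rightarrow> nat \<Rightarrow> nat" where
  "wv c i j = prod_encode (c, prod_encode (i, j))"

text \<open>
  \<open>n\<close> disjoint paths \<open>wv 0 i\<close> (the rows) and \<open>n\<close> disjoint paths \<open>wv 1 j\<close> (the columns), with an edge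
  joining the \<open>j\<close>-th vertex of row \<open>i\<close> to the \<open>i\<close>-th vertex of column \<open>j\<close>.
\<close>

definition wall :: "nat \<Rightarrow> (nat \<times> nat) set" where
  "wall n = {(wv c i j, wv c i (Suc j)) |c i j. c < 2 \<and> i < n \<and> Suc j < n} \<union>
     {(wv 0 i j, wv 1 j i) |i j. i < n \<and> j < n}"

lemma wv_eq_iff: "wv c i j = wv c' i' j' \<longleftrightarrow> c = c' \<and> i = i' \<and> j = j'"
  by (simp add: wv_def)

lemma wv_cases: obtains c i j where "u = wv c i j"
  unfolding wv_def by (metis prod.exhaust prod_decode_inverse)

lemma finite_wall: "finite (wall n)"
proof (rule finite_subset)
  show "wall n \<subseteq> (\<lambda>(c, i, j). (wv c i j, wv c i (Suc j))) ` ({..<2} \<times> {..<n} \<times> {..<n}) \<union>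
      (\<lambda>(i, j). (wv 0 i j, wv 1 j i)) ` ({..<n} \<times> {..<n})"
    by (force simp: wall_def)
qed simp

lemma wall_irrefl: "(u, u) \<notin> wall n"
  by (auto simp: wall_def wv_eq_iff)

text \<open>A vertex has at most a predecessor and a successor on its path and one edge between rows
  and columns.\<close>

lemma wall_degree: "card {e \<in> wall n. fst e = u \<or> snd e = u} \<le> 3"
proof -
  obtain c i j where u: "u = wv c i j" by (rule wv_cases)
  let ?S = "{(u, wv c i (Suc j)), (wv c i (j - 1), u), (if c = 0 then (u, wv 1 j i) else (wv 0 j i, u))}"
  have "{e \<in> wall n. fst e = u \<or> snd e = u} \<subseteq> ?S"
    by (auto simp: wall_def u wv_eq_iff)
  then have "card {e \<in> wall n. fst e = u \<or> snd e = u} \<le> card ?S" by (rule card_mono[rotated]) simp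
  also have "\<dots> \<le> 3" by (simp add: card_insert_if)
  finally show ?thesis .
qed

lemma ex_wall:
  assumes n: "n \<ge> 2" and k: "k \<ge> 1"
  shows "\<exists>W :: nat pair_pre_digraph. pair_graph W \<and>
    (\<forall>x. finite {y. (x, y) \<in> parcs W} \<and> card {y. (x, y) \<in> parcs W} \<le> 3) \<and>
    (\<forall>(H :: nat pair_pre_digraph) f. pair_graph H \<longrightarrow> card (pverts H) \<le> k \<longrightarrow> inj_on f (pverts H) \<longrightarrow>
       (\<forall>u v. (u, v) \<in> parcs H \<longrightarrow> (f u, f v) \<in> parcs W) \<longrightarrow> forest_with_three_leaf_components H) \<and>
    n \<le> Suc (treewidth W) \<and> n \<le> Suc (treewidth (relabel set_encode (line_graph W)))"
proof -
  let ?A = "wall n" and ?W = "subdiv (wall n) k"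
  let ?B = "?A \<union> ?A\<inverse>"
  note A = finite_wall[of n] wall_irrefl[of _ n] wall_degree[of n]
  have pg: "pair_graph ?W" by (rule pair_graph_subdiv[OF A(1,2)])
  \<comment> \<open>Row i is extended by its neighbours in the columns. Then \<open>R i\<close> and
    the column \<open>C j\<close> share the vertex \<open>wv 1 j i\<close>, while different
    \<open>R i\<close> remain disjoint.\<close>
  define R where "R i = wv 0 i ` {..n - 1} \<union> (\<lambda>j. wv 1 j i) ` {..<n}" for i
  define C where "C j = wv 1 j ` {..n - 1}" for j
  have sy: "sym ?B" by (auto simp: sym_def)
  have row: "conn ?B (wv c i ` {..n - 1})" if "c < 2" "i < n" for c i
  proof (rule conn_path_image[OF sy])
    fix p assume "p < n - 1"
    then have "Suc p < n" by simp
    then show "(wv c i p, wv c i (Suc p)) \<in> ?B" unfolding wall_def using that by blast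
  qed
  have cR: "conn ?B (R i)" if i: "i < n" for i
  proof -
    have "conn ?B (wv 0 i ` {..n - 1} \<union> (\<lambda>j. wv 1 j i) ` {..<m})" if "m \<le> n" for m
      using that
    proof (induction m)
      case 0
      then show ?case using row[of 0 i] i by simp
    next
      case (Suc m)
      have "conn ?B (insert (wv 1 m i) (wv 0 i ` {..n - 1} \<union> (\<lambda>j. wv 1 j i) ` {..<m}))"
      proof (rule conn_insert[OF sy, of _ "wv 0 i m"])
        show "conn ?B (wv 0 i ` {..n - 1} \<union> (\<lambda>j. wv 1 j i) ` {..<m})" using Suc by simp
        show "wv 0 i m \<in> wv 0 i ` {..n - 1} \<union> (\<lambda>j. wv 1 j i) ` {..<m}" using Suc.prems by auto
        show "(wv 0 i m, wv 1 m i) \<in> ?B" 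
          using Suc.prems i less_eq_Suc_le unfolding wall_def by blast
      qed
      then show ?case by (simp add: lessThan_Suc)
    qed
    then show ?thesis unfolding R_def by blast
  qed
  have cC: "conn ?B (C j)" if "j < n" for j unfolding C_def using row[of 1 j] that by simp
  have R2: "wv 0 i 0 \<in> R i" "wv 0 i 1 \<in> R i" "wv 0 i 0 \<noteq> wv 0 i 1" for i
    using n by (auto simp: R_def wv_eq_iff)
  have C2: "wv 1 j 0 \<in> C j" "wv 1 j 1 \<in> C j" "wv 1 j 0 \<noteq> wv 1 j 1" for j
    using n by (auto simp: C_def wv_eq_iff)
  define b where "b a = prod_encode (prod_encode (a, a), 0)" for a :: nat
  have two: "\<exists>x\<in>lift ?A k S. \<exists>y\<in>lift ?A k S. x \<noteq> y" if "conn ?B S" "u \<in> S" "v \<in> S" "u \<noteq> v" for S u v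
  proof -
    have "b u \<in> lift ?A k S" "b v \<in> lift ?A k S"
      unfolding b_def using end_in_lift[OF that(1)] that(2-4) by blast+
    moreover have "b u \<noteq> b v" using that(4) by (simp add: b_def)
    ultimately show ?thesis by blast
  qed
  have fam: "lift ?A k S \<subseteq> pverts ?W \<and> conn (parcs ?W) (lift ?A k S) \<and> (\<exists>x\<in>lift ?A k S. \<exists>y\<in>lift ?A k S. x \<noteq> y)"
    if "conn ?B S" "u \<in> S" "v \<in> S" "u \<noteq> v" for S u v
    using lift_subset conn_lift[OF pg that] two[OF that] by blast
  have fR: "lift ?A k (R i) \<subseteq> pverts ?W \<and> conn (parcs ?W) (lift ?A k (R i)) \<and>
      (\<exists>x\<in>lift ?A k (R i). \<exists>y\<in>lift ?A k (R i). x \<noteq> y)" if "i < n" for i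
    by (rule fam[OF cR[OF that] R2])
  have fC: "lift ?A k (C j) \<subseteq> pverts ?W \<and> conn (parcs ?W) (lift ?A k (C j)) \<and>
      (\<exists>x\<in>lift ?A k (C j). \<exists>y\<in>lift ?A k (C j). x \<noteq> y)" if "j < n" for j
    by (rule fam[OF cC[OF that] C2])
  have dR: "lift ?A k (R i) \<inter> lift ?A k (R j) = {}" if "i < n" "j < n" "i \<noteq> j" for i j
    by (rule lift_disjoint) (use that(3) in \<open>auto simp: R_def wv_eq_iff\<close>)
  have dC: "lift ?A k (C i) \<inter> lift ?A k (C j) = {}" if "i < n" "j < n" "i \<noteq> j" for i j
    by (rule lift_disjoint) (use that(3) in \<open>auto simp: C_def wv_eq_iff\<close>)
  have RC: "lift ?A k (R i) \<inter> lift ?A k (C j) \<noteq> {}" if ij: "i < n" "j < n" for i j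
  proof -
    have "wv 1 j i \<in> R i" "wv 1 j i \<in> C j" using ij by (auto simp: R_def C_def)
    moreover have "R i \<noteq> {wv 1 j i}" using R2[of i] by (metis singletonD)
    moreover have "C j \<noteq> {wv 1 j i}" using C2[of j] by (metis singletonD)
    ultimately have "b (wv 1 j i) \<in> lift ?A k (R i)" "b (wv 1 j i) \<in> lift ?A k (C j)"
      unfolding b_def using end_in_lift[OF cR[OF ij(1)]] end_in_lift[OF cC[OF ij(2)]] by blast+
    then show ?thesis by blast
  qed
  note tw = treewidth_ge_of_crossing_families[OF pg fR fC dR dC RC]
  show ?thesis
    using pg subdiv_degree[OF A] small_hom_into_subdiv[OF k A] tw
    by (intro exI[of _ ?W] conjI allI impI) blast+
qed

subsection \<open>A treewidth bound excludes the three obstructions\<close>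

lemma clique_number_le_degree:
  assumes G: "pair_graph G" and d: "\<And>x. finite {y. (x, y) \<in> parcs G} \<and> card {y. (x, y) \<in> parcs G} \<le> d"
  shows "clique_number G \<le> Suc d"
proof (rule clique_number_le[OF G])
  fix K assume K: "Defs.clique G K"
  show "card K \<le> Suc d"
  proof (cases "K = {}")
    case False
    then obtain x where x: "x \<in> K" by blast
    then have sub: "K \<subseteq> insert x {y. (x, y) \<in> parcs G}" using K by (auto simp: Defs.clique_def)
    have "card K \<le> card (insert x {y. (x, y) \<in> parcs G})" using card_mono[OF _ sub] d[of x] by simp
    also have "\<dots> \<le> Suc (card {y. (x, y) \<in> parcs G})" using d[of x] by (simp add: card_insert_if)
    finally show ?thesis using d[of x] by linarith
  qed simp
qed

text \<open>All edges in a clique of the line graph meet a fixed one of them, and at most d edges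
  pass through each of its two ends.\<close>

lemma clique_number_relabel_line_graph_le:
  assumes G: "pair_graph G" and d: "\<And>x. finite {y. (x, y) \<in> parcs G} \<and> card {y. (x, y) \<in> parcs G} \<le> d"
    and f: "inj_on f (pverts (line_graph G))"
  shows "clique_number (relabel f (line_graph G)) \<le> d + d"
proof (rule clique_number_le[OF pair_graph_relabel[OF pair_graph_line_graph[OF G] f]])
  let ?L = "line_graph G"
  fix K assume K: "Defs.clique (relabel f ?L) K"
  show "card K \<le> d + d"
  proof (cases "K = {}")
    case False
    have KV: "K \<subseteq> f ` pverts ?L" using K by (auto simp: Defs.clique_def relabel_def)
    define K' where "K' = {e \<in> pverts ?L. f e \<in> K}"
    have im: "f ` K' = K" using KV by (auto simp: K'_def)
    then obtain e where e: "e \<in> K'" using False by blast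
    obtain u v where uv: "(u, v) \<in> parcs G" "e = {u, v}"
      using e by (auto simp: K'_def line_graph_def Let_def)
    have sG: "(b, a) \<in> parcs G" if "(a, b) \<in> parcs G" for a b
      using G that by (auto simp: pair_graph_iff_sgraph sgraph_def dest: symD)
    define N where "N x = (\<lambda>y. {x, y}) ` {y. (x, y) \<in> parcs G}" for x
    have N: "finite (N x)" "card (N x) \<le> d" for x
      using d[of x] card_image_le[of "{y. (x, y) \<in> parcs G}" "\<lambda>y. {x, y}"] by (auto simp: N_def)
    have "K' \<subseteq> N u \<union> N v"
    proof
      fix e' assume e': "e' \<in> K'"
      have "e' \<inter> e \<noteq> {}"
      proof (cases "e' = e")
        case True
        then show ?thesis using uv by simp
      next
        case False
        have V: "e' \<in> pverts ?L" "e \<in> pverts ?L" using e e' by (auto simp: K'_def)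
        then have "f e' \<noteq> f e" using False f by (auto dest: inj_onD)
        then have "(f e', f e) \<in> parcs (relabel f ?L)"
          using K e e' by (auto simp: Defs.clique_def K'_def)
        then have "(e', e) \<in> parcs ?L" using relabel_parcs_iff[OF pair_graph_line_graph[OF G] f V] by simp
        then show ?thesis by (auto simp: line_graph_def Let_def)
      qed
      moreover obtain a b where ab: "(a, b) \<in> parcs G" "e' = {a, b}"
        using e' by (auto simp: K'_def line_graph_def Let_def)
      moreover have "{a, b} \<in> N a" "{a, b} \<in> N b"
        using ab(1) sG[OF ab(1)] unfolding N_def by (blast, metis (mono_tags) image_eqI insert_commute mem_Collect_eq)
      ultimately show "e' \<in> N u \<union> N v" using uv(2) by auto
    qed
    then have "card K' \<le> card (N u \<union> N v)" using N(1) by (intro card_mono) auto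
    also have "\<dots> \<le> card (N u) + card (N v)" by (rule card_Un_le)
    also have "\<dots> \<le> d + d" using N(2)[of u] N(2)[of v] by linarith
    finally have "card K' \<le> d + d" .
    moreover have "finite K'" using \<open>K' \<subseteq> N u \<union> N v\<close> N(1) finite_subset by blast
    ultimately show ?thesis using card_image_le[of K' f] im by simp
  qed simp
qed

definition biclique :: "nat \<Rightarrow> nat pair_pre_digraph" where
  "biclique n = \<lparr>pverts = {..<n} \<union> {n..<n + n}, parcs = {..<n} \<times> {n..<n + n} \<union> {n..<n + n} \<times> {..<n}\<rparr>"

lemma complete_bipartite_biclique:
  assumes "n \<ge> 1"
  shows "complete_bipartite (biclique n)"
proof -
  have pg: "pair_graph (biclique n)"
    by (auto simp: pair_graph_iff_sgraph sgraph_def biclique_def sym_def irrefl_def)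
  have "\<exists>U V. pverts (biclique n) = U \<union> V \<and> U \<inter> V = {} \<and> card U = n \<and> card V = n \<and> parcs (biclique n) = U \<times> V \<union> V \<times> U"
    by (rule exI[of _ "{..<n}"], rule exI[of _ "{n..<n + n}"]) (auto simp: biclique_def)
  moreover have "finite (pverts (biclique n))" by (simp add: biclique_def)
  ultimately have "complete_bipartite_digraph n n (with_proj (biclique n))"
    unfolding complete_bipartite_digraph_pair_def by blast
  then show ?thesis unfolding complete_bipartite_def using pg assms by blast
qed

lemma clique_number_biclique: "n \<ge> 1 \<Longrightarrow> clique_number (biclique n) \<le> 2"
proof (rule clique_number_le)
  show "pair_graph (biclique n)" if "n \<ge> 1"
    using complete_bipartite_biclique[OF that] by (simp add: complete_bipartite_def)
  fix K assume K: "Defs.clique (biclique n) K"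
  have 1: "u = v" if "u \<in> K" "v \<in> K" "u < n \<longleftrightarrow> v < n" for u v
  proof (rule ccontr)
    assume "u \<noteq> v"
    then have "(u, v) \<in> parcs (biclique n)" using K that by (simp add: Defs.clique_def)
    then show False using that(3) by (auto simp: biclique_def)
  qed
  have fin: "finite K" using K by (auto simp: Defs.clique_def biclique_def intro: finite_subset)
  have "card (K \<inter> {..<n}) \<le> 1"
    unfolding One_nat_def using fin 1 by (subst card_le_Suc0_iff_eq) auto
  moreover have "card (K - {..<n}) \<le> 1"
    unfolding One_nat_def using fin 1 by (subst card_le_Suc0_iff_eq) auto
  moreover have "card K \<le> card (K \<inter> {..<n}) + card (K - {..<n})"
    using card_Un_le[of "K \<inter> {..<n}" "K - {..<n}"] by (simp add: Int_Diff_Un)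
  ultimately show "card K \<le> 2" by linarith
qed

lemma treewidth_biclique:
  assumes "n \<ge> 1"
  shows "n \<le> Suc (treewidth (biclique n))"
proof (rule treewidth_ge[of _ n "\<lambda>i. {i}" "\<lambda>j. {n + j}"])
  show "pair_graph (biclique n)"
    using complete_bipartite_biclique[OF assms] by (simp add: complete_bipartite_def)
qed (auto simp: biclique_def conn_def)

text \<open>For clique number at most 6 the class has treewidth at most M, so a graph beyond this
  bound is outside the class.\<close>

lemma emb_of_large_treewidth:
  fixes G :: "nat pair_pre_digraph"
  assumes F: "\<forall>F\<in>\<F>. pair_graph F" and f: "\<forall>G\<in>free_class \<F>. treewidth G \<le> f (clique_number G)"
    and M: "\<And>i. i \<le> 6 \<Longrightarrow> f i \<le> M"
    and G: "pair_graph G" "clique_number G \<le> 6" "M + 2 \<le> Suc (treewidth G)"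
  shows "\<exists>F\<in>\<F>. \<exists>h. emb F G h"
proof (rule ccontr)
  assume "\<not> ?thesis"
  then have "induced_free F G" if "F \<in> \<F>" for F
    using induced_free_iff[of F G] F G(1) that by blast
  then have "G \<in> free_class \<F>" using G(1) by (simp add: free_class_def)
  then have "treewidth G \<le> f (clique_number G)" using f by blast
  then show False using M[OF G(2)] G(3) by linarith
qed

lemma class_excludes_of_emb:
  assumes F: "\<forall>F\<in>\<F>. pair_graph F" "F \<in> \<F>" and H: "pair_graph H" "emb F H h"
  shows "class_excludes (free_class \<F>) H"
  unfolding class_excludes_def
proof
  fix G assume G: "G \<in> free_class \<F>"
  then have pg: "pair_graph G" and "induced_free F G" using F(2) by (auto simp: free_class_def)
  then have no: "\<not> (\<exists>f. emb F G f)" using induced_free_iff[of F G] F by blast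
  have "\<not> (\<exists>f. emb H G f)" using no emb_comp[OF H(2)] by blast
  then show "induced_free H G" using induced_free_iff[OF H(1) pg] by blast
qed

text \<open>An induced subgraph of a line graph is the line graph of the subgraph formed by the
  selected edges. Each of them contributes at most two vertices, whence the factor 2.\<close>

lemma edge_subgraph_of_line_graph_emb:
  fixes F :: "'b pair_pre_digraph"
  assumes W: "pair_graph W" and F: "pair_graph F" and h: "emb F (line_graph W) h"
  shows "\<exists>H. pair_graph H \<and> card (pverts H) \<le> 2 * card (pverts F) \<and> parcs H \<subseteq> parcs W \<and> emb F (line_graph H) h"
proof -
  define X where "X = h ` pverts F"
  define H where "H = \<lparr>pverts = \<Union>X, parcs = {(u, v). {u, v} \<in> X}\<rparr>"
  have s: "sgraph (pverts W) (parcs W)" using W by (simp add: pair_graph_iff_sgraph)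
  have finF: "finite (pverts F)" using F by (simp add: pair_graph_iff_sgraph sgraph_def)
  have XL: "X \<subseteq> pverts (line_graph W)" using h by (auto simp: emb_def X_def)
  have Xe: "\<exists>u v. (u, v) \<in> parcs W \<and> e = {u, v}" if "e \<in> X" for e
  proof -
    have "e \<in> pverts (line_graph W)" using XL that by blast
    then show ?thesis by (auto simp: line_graph_def Let_def)
  qed
  have sub: "(u, v) \<in> parcs W" if uv: "{u, v} \<in> X" for u v
  proof -
    obtain a b where "(a, b) \<in> parcs W" "{u, v} = {a, b}" using Xe[OF uv] by blast
    then show ?thesis using sgraphD(5)[OF s] by (auto simp: doubleton_eq_iff)
  qed
  have fin2: "finite e \<and> card e \<le> 2" if e: "e \<in> X" for e
  proof -
    obtain a b where "e = {a, b}" using Xe[OF e] by blast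
    then show ?thesis by (simp add: card_insert_if)
  qed
  have "finite X" using finF by (simp add: X_def)
  have "card (\<Union>X) \<le> (\<Sum>e\<in>X. card e)" by (rule card_Union_le_sum_card)
  also have "\<dots> \<le> (\<Sum>e\<in>X. 2)" using fin2 by (intro sum_mono) blast
  also have "\<dots> \<le> 2 * card (pverts F)" using card_image_le[OF finF, of h] by (simp add: X_def)
  finally have c: "card (pverts H) \<le> 2 * card (pverts F)" by (simp add: H_def)
  have "finite (pverts H)" using \<open>finite X\<close> fin2 by (simp add: H_def)
  moreover have "parcs H \<subseteq> pverts H \<times> pverts H" by (auto simp: H_def)
  moreover have "sym (parcs H)" by (auto simp: H_def sym_def insert_commute)
  moreover have "irrefl (parcs H)"
  proof -
    have "(u, u) \<notin> parcs H" for u using sub[of u u] sgraphD(6)[OF s, of u] by (auto simp: H_def)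
    then show ?thesis by (simp add: irrefl_def)
  qed
  ultimately have pH: "pair_graph H" by (simp add: pair_graph_iff_sgraph sgraph_def)
  have "pverts (line_graph H) = X" using Xe by (fastforce simp: H_def line_graph_def Let_def)
  then have "emb F (line_graph H) h"
    using h XL unfolding emb_def X_def by (auto simp: line_graph_def Let_def)
  moreover have "parcs H \<subseteq> parcs W" using sub by (auto simp: H_def)
  ultimately show ?thesis using pH c by blast
qed

text \<open>A large biclique, a wall and its line graph each contain a member of the family. The
  biclique itself serves as \<open>H1\<close>, the member found in the wall as \<open>H2\<close>,
  and the edges of the wall selected by the member found in the line graph as
  \<open>H3\<close>.\<close>

lemma tw_omega_bounded_imp_excluding:
  assumes fin: "finite \<F>" and F: "\<forall>F\<in>\<F>. pair_graph F" and b: "tw_omega_bounded (free_class \<F>)"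
  shows "\<exists>(H1 :: nat pair_pre_digraph) (H2 :: nat pair_pre_digraph) (H3 :: nat pair_pre_digraph).
    complete_bipartite H1 \<and> forest_with_three_leaf_components H2 \<and> forest_with_three_leaf_components H3 \<and>
    class_excludes (free_class \<F>) H1 \<and> class_excludes (free_class \<F>) H2 \<and>
    class_excludes (free_class \<F>) (line_graph H3)"
proof -
  obtain f where f: "\<forall>G\<in>free_class \<F>. treewidth G \<le> f (clique_number G)"
    using b by (auto simp: tw_omega_bounded_def)
  \<comment> \<open>6 bounds the clique numbers of the three test graphs: 2 for the biclique, 4 for
    the wall and 3 + 3 for its line graph.\<close>
  define M where "M = (\<Sum>i\<le>6. f i)"
  have M: "f i \<le> M" if "i \<le> 6" for i unfolding M_def using that by (intro member_le_sum) auto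
  \<comment> \<open>The subdivision length must be at least the size of every member of the finite
    family, and twice that size for the subgraph whose line graph contains the member. The successor
    makes k positive.\<close>
  define k where "k = Suc (2 * (\<Sum>F\<in>\<F>. card (pverts F)))"
  have k: "2 * card (pverts F) \<le> k" if "F \<in> \<F>" for F
    using member_le_sum[OF that, of "\<lambda>F. card (pverts F)"] fin by (simp add: k_def)
  have large: "\<exists>F\<in>\<F>. \<exists>h. emb F G h"
    if "pair_graph G" "clique_number G \<le> 6" "M + 2 \<le> Suc (treewidth G)"
    for G :: "nat pair_pre_digraph"
    using emb_of_large_treewidth[OF F f, of M G] that M by blast

  let ?K = "biclique (M + 2)"
  have K: "complete_bipartite ?K" by (rule complete_bipartite_biclique) simp
  then have pK: "pair_graph ?K" by (simp add: complete_bipartite_def)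
  have "clique_number ?K \<le> 6" using clique_number_biclique[of "M + 2"] by simp
  then obtain F1 h1 where F1: "F1 \<in> \<F>" "emb F1 ?K h1"
    using large[OF pK] treewidth_biclique[of "M + 2"] by auto

  obtain W :: "nat pair_pre_digraph" where W: "pair_graph W"
    "\<And>x. finite {y. (x, y) \<in> parcs W} \<and> card {y. (x, y) \<in> parcs W} \<le> 3"
    "\<And>(H :: nat pair_pre_digraph) f. pair_graph H \<Longrightarrow> card (pverts H) \<le> k \<Longrightarrow> inj_on f (pverts H) \<Longrightarrow>
       (\<And>u v. (u, v) \<in> parcs H \<Longrightarrow> (f u, f v) \<in> parcs W) \<Longrightarrow> forest_with_three_leaf_components H"
    "M + 2 \<le> Suc (treewidth W)" "M + 2 \<le> Suc (treewidth (relabel set_encode (line_graph W)))"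
    using ex_wall[of "M + 2" k] by (auto simp: k_def)
  have "clique_number W \<le> 6" using clique_number_le_degree[OF W(1,2)] by simp
  then obtain F2 h2 where F2: "F2 \<in> \<F>" "emb F2 W h2" using large[OF W(1)] W(4) by blast
  have pF2: "pair_graph F2" using F F2 by blast
  have H2: "forest_with_three_leaf_components F2"
  proof (rule W(3)[OF pF2])
    show "card (pverts F2) \<le> k" using k[OF F2(1)] by simp
    show "inj_on h2 (pverts F2)" using F2(2) by (simp add: emb_def)
    show "(h2 u, h2 v) \<in> parcs W" if "(u, v) \<in> parcs F2" for u v
    proof -
      have "u \<in> pverts F2" "v \<in> pverts F2" using pF2 that by (auto simp: pair_graph_iff_sgraph sgraph_def)
      then show ?thesis using F2(2) that by (simp add: emb_def)
    qed
  qed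

  let ?L = "line_graph W"
  have inj: "inj_on set_encode (pverts ?L)"
    by (rule inj_on_subset[OF inj_on_set_encode]) (auto simp: line_graph_def Let_def)
  have pL: "pair_graph (relabel set_encode ?L)"
    by (rule pair_graph_relabel[OF pair_graph_line_graph[OF W(1)] inj])
  have "clique_number (relabel set_encode ?L) \<le> 6"
    using clique_number_relabel_line_graph_le[OF W(1,2) inj] by simp
  then obtain F3 h3 where F3: "F3 \<in> \<F>" "emb F3 (relabel set_encode ?L) h3"
    using large[OF pL] W(5) by blast
  have pF3: "pair_graph F3" using F F3 by blast
  obtain h where h: "emb F3 ?L h"
    using emb_relabel_inv[OF pair_graph_line_graph[OF W(1)] inj F3(2)] by blast
  obtain H3 where H3: "pair_graph H3" "card (pverts H3) \<le> 2 * card (pverts F3)" "parcs H3 \<subseteq> parcs W"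
    "emb F3 (line_graph H3) h"
    using edge_subgraph_of_line_graph_emb[OF W(1) pF3 h] by blast
  have "forest_with_three_leaf_components H3"
    by (rule W(3)[OF H3(1), of id]) (use H3(2,3) k[OF F3(1)] in auto)
  moreover have "class_excludes (free_class \<F>) (line_graph H3)"
    by (rule class_excludes_of_emb[OF F F3(1) pair_graph_line_graph[OF H3(1)] H3(4)])
  moreover have "class_excludes (free_class \<F>) F2"
    by (rule class_excludes_of_emb[OF F F2(1) pF2, of id]) (simp add: emb_def)
  moreover have "class_excludes (free_class \<F>) ?K" by (rule class_excludes_of_emb[OF F F1(1) pK F1(2)])
  ultimately show ?thesis using K H2 by blast
qed

theorem mainTheorem2:
  fixes \<F> \<G> :: "nat pair_pre_digraph set"
  assumes "finite \<F>"
    and "\<forall>F\<in>\<F>. pair_graph F"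
    and "\<G> = free_class \<F>"
  shows "(bounded_tree_independence_number \<G> \<longleftrightarrow> tw_omega_bounded \<G>) \<and>
    (tw_omega_bounded \<G> \<longleftrightarrow>
      (\<exists>(H\<^sub>1 :: nat pair_pre_digraph) (H\<^sub>2 :: nat pair_pre_digraph) (H\<^sub>3 :: nat pair_pre_digraph).
        complete_bipartite H\<^sub>1 \<and>
        forest_with_three_leaf_components H\<^sub>2 \<and>
        forest_with_three_leaf_components H\<^sub>3 \<and>
        class_excludes \<G> H\<^sub>1 \<and>
        class_excludes \<G> H\<^sub>2 \<and>
        class_excludes \<G> (line_graph H\<^sub>3)))"
proof -
  have pg: "\<And>G. G \<in> \<G> \<Longrightarrow> pair_graph G" using assms(3) by (simp add: free_class_def)
  show ?thesis
    using bounded_tree_independence_imp_tw_omega_bounded[OF pg]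
      tw_omega_bounded_imp_excluding[OF assms(1,2)]
      excluding_imp_bounded_tree_independence[OF pg]
    unfolding assms(3) by blast
qed

end
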